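(* Let $F$ be either a finite extension of $\mathbf{Q}_p$ or $F=\mathbf{F}_q((T))$ with $q$ a power of $p$, let $o$ be the ring of integers of a finite extension of $\mathbf{Q}_p$, and let $B$ be the upper triangular subgroup of $G=GL(2,F)$. Let $V\in\mathcal{M}_o(B)$ be of finite presentation, and let $V_0\subset V|_{B_0Z}$ be a subrepresentation of finite type generating $V$ such that the natural presentation $\mathrm{ind}_{B_0Z}^B(V_0)\to V$ is finite. Then, modulo $\mathcal{M}_o^{tf}(B_0Z)$: a) $\langle B^+V_0\rangle$ does not depend on the choice of $V_0$; b) $\Delta_V(V_0):=\langle B^+V_0\rangle\cap\langle (B-B^+)V_0\rangle\equiv 0$; c) $D_V(V_0):=\langle B^+V_0\rangle/\Delta_V(V_0)$ belongs to $\mathcal{M}_o^{et}((B^+)^{-1})$; d) if $0\to V'\to V\to V''\to 0$ is an exact sequence in $\mathcal{M}_o(B)$ of representations of finite presentation, and $V'_0,V_0,V''_0$ are subrepresentations of finite type of the restrictions to $B_0Z$ of $V',V,V''$ respectively, forming an exact sequence $0\to V'_0\to V_0\to V''_0\to 0$ and inducing finite presentations of $V',V,V''$, then $$0\to\langle B^+V'_0\rangle\to\langle B^+V_0\rangle\to\langle B^+V''_0\rangle\to0$$ is an exact sequence; e) if $V$ extends to an admissible representation of $G$, then $\langle B^+V_0\rangle^{U_0}\equiv 0$.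
   Context: $O_F$ is the ring of integers of $F$, $p_F$ a uniformizer, $\mathbf{F}_q$ the residue field, $Z$ the centre of $G$, $B=TU$ ($T$ diagonal, $U$ upper unipotent), $B_0=T_0U_0$ the subgroup of $O_F$-points of $B$, $U_0=U(O_F)$, $t=\begin{pmatrix}p_F&0\\0&1\end{pmatrix}$, $B^+=\bigcup_{n\ge0}B_0Zt^n$ (a monoid), $(B^+)^{-1}$ the inverse monoid. $U(q)$ is the system of representatives of $U_0/tU_0t^{-1}$ in $U_0$ given by Teichmüller representatives of $\mathbf{F}_q$. For a topological group or monoid $H$, $\mathcal{M}_o(H)$ is the category of smooth representations of $H$ on $o$-modules, $\mathcal{M}_o^{tf}(H)$ the subcategory of those of finite type (finitely generated over $o[H]$). $\mathrm{ind}$ is compact induction. A presentation $\mathrm{ind}_{B_0Z}^B(V_0)\to V$ (a surjection) is finite if $V_0\in\mathcal{M}_o(B_0Z)$ is of finite type and its kernel is of finite type in $\mathcal{M}_o(B)$; $V$ is of finite presentation if it has a finite presentation. For $X\subset B$ and $W\subset V$, $\langle XW\rangle$ is the $o$-submodule of $V$ generated by the $xw$, $x\in X,w\in W$. A representation of $G$ is admissible if its invariants under every compact open subgroup form a finitely generated $o$-module. $D_V(V_0)\simeq V/\langle (B-B^+)V_0\rangle$ carries the action of $(B^+)^{-1}$ induced from $V$. $D\in\mathcal{M}_o((B^+)^{-1})$ is étale if $d\mapsto((ut)^{-1}d)_{u\in U(q)}:D\to\bigoplus_{u\in U(q)}D$ is bijective; $\mathcal{M}_o^{et}((B^+)^{-1})$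 is the category of étale objects. "Modulo $\mathcal{M}_o^{tf}(B_0Z)$" means in the quotient category $\mathcal{M}_o(B_0Z)/\mathcal{M}_o^{tf}(B_0Z)$ by the Serre subcategory $\mathcal{M}_o^{tf}(B_0Z)$: two representations are equivalent ($\equiv$) if they become isomorphic there; $X\equiv 0$ means $X\in\mathcal{M}_o^{tf}(B_0Z)$; a sequence is exact if it is exact there; "independent of $V_0$" means that different choices give representations isomorphic there; and $D$ is étale modulo $\mathcal{M}_o^{tf}(B_0Z)$ if the kernel and cokernel of the map $d\mapsto((ut)^{-1}d)_{u\in U(q)}:D\to\bigoplus_{u\in U(q)}D$ are in $\mathcal{M}_o^{tf}(B_0Z)$, where $b\in B_0$ acts on the target by $(b\cdot x)_u=b'^{-1}x_{u'}$ with $b^{-1}ut=u'tb'$, $u'\in U(q)$, $b'\in B_0$, and $Z$ acts diagonally (making the map $B_0Z$-equivariant). *)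

theory Defs
  imports
    "HOL-Analysis.Analysis"
    "HOL-Algebra.Algebra"
    "HOL-Algebra.Algebraic_Closure_Type"
    "HOL-Computational_Algebra.Formal_Laurent_Series"
begin

(* HOL-Algebra reserves the letter X for the polynomial variable. *)
no_notation var (\<open>X\<index>\<close>)

section \<open>Coefficient rings and base fields\<close>

abbreviation subset_ring :: "'a::field set \<Rightarrow> 'a ring" where
  "subset_ring A \<equiv> ring_of_type_algebra\<lparr>carrier := A\<rparr>"

text \<open>The ring of \<open>p\<close>-adic integers as the inverse limit of the rings of integers
  modulo \<open>p ^ n\<close>.\<close>

definition padic_int_ring :: "nat \<Rightarrow> (nat \<Rightarrow> int) ring" where
  "padic_int_ring p =
    \<lparr>carrier = {x. \<forall>n. 0 \<le> x n \<and> x n < int p ^ n \<and> x (Suc n) mod int p ^ n = x n},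
     monoid.mult = (\<lambda>x y n. (x n * y n) mod int p ^ n),
     one = (\<lambda>n. 1 mod int p ^ n),
     ring.zero = (\<lambda>n. 0),
     add = (\<lambda>x y n. (x n + y n) mod int p ^ n)\<rparr>"

definition integral_closure :: "'a::field set \<Rightarrow> 'a set" where
  "integral_closure A =
    {x. \<exists>f. Polynomial.lead_coeff f = 1 \<and> set (coeffs f) \<subseteq> A \<and> poly f x = 0}"

text \<open>The field \<open>'a\<close> is a finite extension of the field of \<open>p\<close>-adic numbers, with ring of
  integers \<open>A\<close>. The subfield generated by the image of the \<open>p\<close>-adic integers is (a copy of) their
  field of fractions, that is, of the field of \<open>p\<close>-adic numbers.\<close>

definition padic_field_integers :: "nat \<Rightarrow> 'a::field set \<Rightarrow> bool" where
  "padic_field_integers p A \<longleftrightarrow>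
    (\<exists>\<iota> \<in> ring_hom (padic_int_ring p) ring_of_type_algebra.
       inj_on \<iota> (carrier (padic_int_ring p)) \<and>
       ring.finite_dimension ring_of_type_algebra
         (generate_field ring_of_type_algebra (\<iota> ` carrier (padic_int_ring p))) UNIV \<and>
       A = integral_closure (\<iota> ` carrier (padic_int_ring p)))"

text \<open>The field \<open>'a\<close> is the field of Laurent series over the finite field \<open>'k\<close>, with ring of
  integers \<open>A\<close>.\<close>

definition laurent_field_integers :: "'k::{field,finite} itself \<Rightarrow> 'a::field set \<Rightarrow> bool" where
  "laurent_field_integers _ A \<longleftrightarrow>
    (\<exists>\<phi> \<in> ring_hom (ring_of_type_algebra :: 'k fls ring) ring_of_type_algebra.
       bij \<phi> \<and> A = \<phi> ` range fps_to_fls)"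

definition uniformizer :: "'a::field set \<Rightarrow> 'a \<Rightarrow> bool" where
  "uniformizer A \<pi> \<longleftrightarrow> \<pi> \<in> A \<and> maximalideal (PIdl\<^bsub>subset_ring A\<^esub> \<pi>) (subset_ring A)"

definition residue_card :: "'a::field set \<Rightarrow> 'a \<Rightarrow> nat" where
  "residue_card A \<pi> = card (carrier (subset_ring A Quot (PIdl\<^bsub>subset_ring A\<^esub> \<pi>)))"

text \<open>The Teichmueller representative of an element of the residue field with \<open>q\<close> elements is
  its unique lift \<open>x\<close> satisfying \<open>x ^ q = x\<close>.\<close>

definition teichmueller :: "'a::field set \<Rightarrow> 'a \<Rightarrow> 'a set" where
  "teichmueller A \<pi> = {x \<in> A. x ^ residue_card A \<pi> = x}"

definition field_topology :: "'a::field set \<Rightarrow> 'a topology" where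
  "field_topology A = topology_generated_by {(\<lambda>y. x + a * y) ` A | x a. a \<noteq> 0}"


section \<open>Smooth representations\<close>

text \<open>An \<open>R\<close>-module with an action of elements of type \<open>'g\<close>. As usual for modules in HOL-Algebra,
  the record fields \<open>mult\<close> and \<open>one\<close> carry no meaning. The monoid \<open>H\<close> through which the action is
  considered is a separate parameter throughout, so that restriction to a submonoid does not change
  the record.\<close>

record ('r, 'v, 'g) rep = "('r, 'v) module" +
  act :: "'g \<Rightarrow> 'v \<Rightarrow> 'v"

abbreviation on_carrier :: "('r, 'v, 'g) rep \<Rightarrow> 'v set \<Rightarrow> ('r, 'v, 'g) rep"
    (infixl \<open>\<downharpoonright>\<close> 72) where
  "V \<downharpoonright> N \<equiv> V\<lparr>carrier := N\<rparr>"

text \<open>\<open>T\<close> is a topology on a set containing the monoid \<open>H\<close>, which gets the subspace topology.\<close>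

locale smooth_rep = Module.module R V + H: monoid H
  for R :: "'r ring" and H :: "'g monoid" and T :: "'g topology" and V :: "('r, 'v, 'g) rep" +
  assumes act_closed: "\<lbrakk>h \<in> carrier H; v \<in> carrier V\<rbrakk> \<Longrightarrow> act V h v \<in> carrier V"
    and act_add: "\<lbrakk>h \<in> carrier H; v \<in> carrier V; w \<in> carrier V\<rbrakk> \<Longrightarrow>
      act V h (v \<oplus>\<^bsub>V\<^esub> w) = act V h v \<oplus>\<^bsub>V\<^esub> act V h w"
    and act_smult: "\<lbrakk>h \<in> carrier H; r \<in> carrier R; v \<in> carrier V\<rbrakk> \<Longrightarrow>
      act V h (r \<odot>\<^bsub>V\<^esub> v) = r \<odot>\<^bsub>V\<^esub> act V h v"
    and act_one: "v \<in> carrier V \<Longrightarrow> act V \<one>\<^bsub>H\<^esub> v = v"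
    and act_mult: "\<lbrakk>g \<in> carrier H; h \<in> carrier H; v \<in> carrier V\<rbrakk> \<Longrightarrow>
      act V (g \<otimes>\<^bsub>H\<^esub> h) v = act V g (act V h v)"
    and smooth: "v \<in> carrier V \<Longrightarrow>
      openin (subtopology T (carrier H)) {h \<in> carrier H. act V h v = v}"

definition subrep :: "'r ring \<Rightarrow> 'g monoid \<Rightarrow> ('r, 'v, 'g) rep \<Rightarrow> 'v set \<Rightarrow> bool" where
  "subrep R H V N \<longleftrightarrow> submodule N R V \<and> (\<forall>h\<in>carrier H. \<forall>v\<in>N. act V h v \<in> N)"

text \<open>The \<open>R\<close>-submodule generated by the products \<open>x w\<close>.\<close>

definition act_span :: "'r ring \<Rightarrow> ('r, 'v, 'g) rep \<Rightarrow> 'g set \<Rightarrow> 'v set \<Rightarrow> 'v set" where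
  "act_span R V X W = (\<lambda>N. submodule N R V) hull {act V x w | x w. x \<in> X \<and> w \<in> W}"

definition finite_type :: "'r ring \<Rightarrow> 'g monoid \<Rightarrow> ('r, 'v, 'g) rep \<Rightarrow> bool" where
  "finite_type R H V \<longleftrightarrow>
    (\<exists>S. finite S \<and> S \<subseteq> carrier V \<and> act_span R V (carrier H) S = carrier V)"

definition smooth_tf :: "'r ring \<Rightarrow> 'g monoid \<Rightarrow> 'g topology \<Rightarrow> ('r, 'v, 'g) rep \<Rightarrow> bool" where
  "smooth_tf R H T V \<longleftrightarrow> smooth_rep R H T V \<and> finite_type R H V"

definition quot_rep :: "('r, 'v, 'g) rep \<Rightarrow> 'v set \<Rightarrow> ('r, 'v set, 'g) rep" where
  "quot_rep V N =
    \<lparr>carrier = a_rcosets\<^bsub>V\<^esub> N, monoid.mult = undefined, one = undefined,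
     ring.zero = N, add = set_add V,
     module.smult = (\<lambda>r X. N <+>\<^bsub>V\<^esub> module.smult V r ` X),
     act = (\<lambda>h X. N <+>\<^bsub>V\<^esub> act V h ` X)\<rparr>"

definition prod_rep ::
    "('r, 'v, 'g) rep \<Rightarrow> ('r, 'w, 'g) rep \<Rightarrow> ('r, 'v \<times> 'w, 'g) rep" where
  "prod_rep V W =
    \<lparr>carrier = carrier V \<times> carrier W, monoid.mult = undefined, one = undefined,
     ring.zero = (\<zero>\<^bsub>V\<^esub>, \<zero>\<^bsub>W\<^esub>),
     add = (\<lambda>(v, w) (v', w'). (v \<oplus>\<^bsub>V\<^esub> v', w \<oplus>\<^bsub>W\<^esub> w')),
     module.smult = (\<lambda>r (v, w). (r \<odot>\<^bsub>V\<^esub> v, r \<odot>\<^bsub>W\<^esub> w)),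
     act = (\<lambda>h (v, w). (act V h v, act W h w))\<rparr>"

definition rep_hom ::
    "'r ring \<Rightarrow> 'g monoid \<Rightarrow> ('r, 'v, 'g) rep \<Rightarrow> ('r, 'w, 'g) rep \<Rightarrow> ('v \<Rightarrow> 'w) set" where
  "rep_hom R H V W = {f \<in> carrier V \<rightarrow> carrier W.
     (\<forall>x\<in>carrier V. \<forall>y\<in>carrier V. f (x \<oplus>\<^bsub>V\<^esub> y) = f x \<oplus>\<^bsub>W\<^esub> f y) \<and>
     (\<forall>r\<in>carrier R. \<forall>x\<in>carrier V. f (r \<odot>\<^bsub>V\<^esub> x) = r \<odot>\<^bsub>W\<^esub> f x) \<and>
     (\<forall>h\<in>carrier H. \<forall>x\<in>carrier V. f (act V h x) = act W h (f x))}"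

definition ker_rep :: "('r, 'v, 'g) rep \<Rightarrow> ('r, 'w, 'g) rep \<Rightarrow> ('v \<Rightarrow> 'w) \<Rightarrow> 'v set" where
  "ker_rep V W f = {x \<in> carrier V. f x = \<zero>\<^bsub>W\<^esub>}"

definition short_exact :: "'r ring \<Rightarrow> 'g monoid \<Rightarrow> ('r, 'u, 'g) rep \<Rightarrow> ('u \<Rightarrow> 'v) \<Rightarrow>
    ('r, 'v, 'g) rep \<Rightarrow> ('v \<Rightarrow> 'w) \<Rightarrow> ('r, 'w, 'g) rep \<Rightarrow> bool" where
  "short_exact R H X f Y g Z \<longleftrightarrow>
    f \<in> rep_hom R H X Y \<and> g \<in> rep_hom R H Y Z \<and>
    inj_on f (carrier X) \<and> f ` carrier X = ker_rep Y Z g \<and> g ` carrier Y = carrier Z"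

definition fixed_vectors :: "('r, 'v, 'g) rep \<Rightarrow> 'g set \<Rightarrow> 'v set" where
  "fixed_vectors V K = {v \<in> carrier V. \<forall>k\<in>K. act V k v = v}"

definition admissible :: "'r ring \<Rightarrow> 'g monoid \<Rightarrow> 'g topology \<Rightarrow> ('r, 'v, 'g) rep \<Rightarrow> bool" where
  "admissible R G T V \<longleftrightarrow> smooth_rep R G T V \<and>
    (\<forall>K. subgroup K G \<and> compactin (subtopology T (carrier G)) K \<and>
         openin (subtopology T (carrier G)) K \<longrightarrow>
       (\<exists>S. finite S \<and> S \<subseteq> fixed_vectors V K \<and>
         (\<lambda>N. submodule N R V) hull S = fixed_vectors V K))"


section \<open>Compact induction and finite presentations\<close>

text \<open>Functions on \<open>G\<close> with values in \<open>W\<close>, left equivariant under the subgroup \<open>H\<close>, with compact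
  support modulo \<open>H\<close>, right invariant under some open subgroup; \<open>G\<close> acts by right translation.\<close>

definition compact_ind :: "'g monoid \<Rightarrow> 'g topology \<Rightarrow> 'g set \<Rightarrow> ('r, 'w, 'g) rep \<Rightarrow>
    ('r, 'g \<Rightarrow> 'w, 'g) rep" where
  "compact_ind G T H W =
    \<lparr>carrier = {f \<in> carrier G \<rightarrow>\<^sub>E carrier W.
       (\<forall>h\<in>H. \<forall>g\<in>carrier G. f (h \<otimes>\<^bsub>G\<^esub> g) = act W h (f g)) \<and>
       (\<exists>C. compactin (subtopology T (carrier G)) C \<and>
            {g \<in> carrier G. f g \<noteq> \<zero>\<^bsub>W\<^esub>} \<subseteq> H <#>\<^bsub>G\<^esub> C) \<and>
       (\<exists>K. subgroup K G \<and> openin (subtopology T (carrier G)) K \<and>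
            (\<forall>g\<in>carrier G. \<forall>k\<in>K. f (g \<otimes>\<^bsub>G\<^esub> k) = f g))},
     monoid.mult = undefined, one = undefined,
     ring.zero = (\<lambda>g\<in>carrier G. \<zero>\<^bsub>W\<^esub>),
     add = (\<lambda>f f'. \<lambda>g\<in>carrier G. f g \<oplus>\<^bsub>W\<^esub> f' g),
     module.smult = (\<lambda>r f. \<lambda>g\<in>carrier G. r \<odot>\<^bsub>W\<^esub> f g),
     act = (\<lambda>x f. \<lambda>g\<in>carrier G. f (g \<otimes>\<^bsub>G\<^esub> x))\<rparr>"

text \<open>The map \<open>compact_ind G T H (V \<downharpoonright> V0) \<rightarrow> V\<close> extending the inclusion of the \<open>H\<close>-stable \<open>V0\<close> by
  Frobenius reciprocity: \<open>f\<close> goes to the sum of \<open>x\<inverse> f(x)\<close> over representatives \<open>x\<close> of the right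
  cosets \<open>H x\<close> in the support of \<open>f\<close>.\<close>

definition natural_map :: "'g monoid \<Rightarrow> 'g set \<Rightarrow> ('r, 'v, 'g) rep \<Rightarrow> ('g \<Rightarrow> 'v) \<Rightarrow> 'v" where
  "natural_map G H V f =
    (\<Oplus>\<^bsub>V\<^esub>c\<in>{c \<in> rcosets\<^bsub>G\<^esub> H. \<exists>x\<in>c. f x \<noteq> \<zero>\<^bsub>V\<^esub>}.
       (let x = (SOME x. x \<in> c) in act V (inv\<^bsub>G\<^esub> x) (f x)))"

definition finite_presentation :: "'r ring \<Rightarrow> 'g monoid \<Rightarrow> 'g topology \<Rightarrow> 'g set \<Rightarrow>
    ('r, 'w, 'g) rep \<Rightarrow> (('g \<Rightarrow> 'w) \<Rightarrow> 'v) \<Rightarrow> ('r, 'v, 'g) rep \<Rightarrow> bool" where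
  "finite_presentation R G T H W \<pi> V \<longleftrightarrow>
    smooth_tf R (G\<lparr>carrier := H\<rparr>) T W \<and>
    \<pi> \<in> rep_hom R G (compact_ind G T H W) V \<and>
    \<pi> ` carrier (compact_ind G T H W) = carrier V \<and>
    smooth_tf R G T (compact_ind G T H W \<downharpoonright> ker_rep (compact_ind G T H W) V \<pi>)"

text \<open>Letting \<open>W\<close> range only over representations with elements in the type \<open>'v\<close> is no
  restriction: in a finite presentation \<open>W\<close> may be replaced by its image in \<open>V\<close>.\<close>

definition finitely_presented :: "'r ring \<Rightarrow> 'g monoid \<Rightarrow> 'g topology \<Rightarrow> 'g set \<Rightarrow>
    ('r, 'v, 'g) rep \<Rightarrow> bool" where
  "finitely_presented R G T H V \<longleftrightarrow> smooth_rep R G T V \<and>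
    (\<exists>(W :: ('r, 'v, 'g) rep) \<pi>. finite_presentation R G T H W \<pi> V)"

definition presenting_subrep :: "'r ring \<Rightarrow> 'g monoid \<Rightarrow> 'g topology \<Rightarrow> 'g set \<Rightarrow>
    ('r, 'v, 'g) rep \<Rightarrow> 'v set \<Rightarrow> bool" where
  "presenting_subrep R G T H V V0 \<longleftrightarrow>
    subrep R (G\<lparr>carrier := H\<rparr>) V V0 \<and>
    finite_type R (G\<lparr>carrier := H\<rparr>) (V \<downharpoonright> V0) \<and>
    act_span R V (carrier G) V0 = carrier V \<and>
    finite_presentation R G T H (V \<downharpoonright> V0) (natural_map G H V) V"


section \<open>The quotient category modulo representations of finite type\<close>

text \<open>By Gabriel's construction, a morphism \<open>X \<rightarrow> Y\<close> of the quotient category is represented by a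
  morphism \<open>X' \<rightarrow> Y / Y'\<close> where \<open>X'\<close> is a subobject of \<open>X\<close> with \<open>X / X'\<close> of finite type and \<open>Y'\<close> is
  a subobject of \<open>Y\<close> of finite type. We encode it by its graph
  \<open>{(x, y). x \<in> X' \<and> y \<in> f x} \<subseteq> X \<times> Y\<close>, a subobject of \<open>X \<times> Y\<close> from which \<open>X'\<close> is recovered as the
  domain and \<open>Y'\<close> as the image of \<open>0\<close>. The composition of the quotient category is then the
  composition of relations. Two representatives define the same morphism if they agree as maps
  \<open>X1 \<rightarrow> Y / Y1\<close> for some smaller \<open>X1\<close> and larger \<open>Y1\<close> of the same kind.\<close>

definition qmor :: "'r ring \<Rightarrow> 'g monoid \<Rightarrow> 'g topology \<Rightarrow> ('r, 'v, 'g) rep \<Rightarrow>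
    ('r, 'w, 'g) rep \<Rightarrow> ('v \<times> 'w) set set" where
  "qmor R H T X Y = {\<Gamma>. subrep R H (prod_rep X Y) \<Gamma> \<and>
     smooth_tf R H T (quot_rep X (Domain \<Gamma>)) \<and>
     smooth_tf R H T (Y \<downharpoonright> (\<Gamma> `` {\<zero>\<^bsub>X\<^esub>}))}"

definition qmor_eq :: "'r ring \<Rightarrow> 'g monoid \<Rightarrow> 'g topology \<Rightarrow> ('r, 'v, 'g) rep \<Rightarrow>
    ('r, 'w, 'g) rep \<Rightarrow> ('v \<times> 'w) set \<Rightarrow> ('v \<times> 'w) set \<Rightarrow> bool" where
  "qmor_eq R H T X Y \<Gamma> \<Gamma>' \<longleftrightarrow>
    (\<exists>X1 Y1. subrep R H X X1 \<and> X1 \<subseteq> Domain \<Gamma> \<inter> Domain \<Gamma>' \<and> smooth_tf R H T (quot_rep X X1) \<and>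
       subrep R H Y Y1 \<and> smooth_tf R H T (Y \<downharpoonright> Y1) \<and>
       (\<forall>x\<in>X1. \<forall>y\<in>\<Gamma> `` {x}. \<forall>y'\<in>\<Gamma>' `` {x}. y \<ominus>\<^bsub>Y\<^esub> y' \<in> Y1))"

definition iso_mod_tf :: "'r ring \<Rightarrow> 'g monoid \<Rightarrow> 'g topology \<Rightarrow> ('r, 'v, 'g) rep \<Rightarrow>
    ('r, 'w, 'g) rep \<Rightarrow> bool" where
  "iso_mod_tf R H T X Y \<longleftrightarrow> smooth_rep R H T X \<and> smooth_rep R H T Y \<and>
    (\<exists>\<Gamma>\<in>qmor R H T X Y. \<exists>\<Gamma>'\<in>qmor R H T Y X.
       qmor_eq R H T X X (\<Gamma> O \<Gamma>') (Id_on (carrier X)) \<and>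
       qmor_eq R H T Y Y (\<Gamma>' O \<Gamma>) (Id_on (carrier Y)))"

text \<open>The functor to the quotient category is exact, so a complex becomes exact there if and only if
  its homology is of finite type.\<close>

definition short_exact_mod_tf :: "'r ring \<Rightarrow> 'g monoid \<Rightarrow> 'g topology \<Rightarrow>
    ('r, 'u, 'g) rep \<Rightarrow> ('u \<Rightarrow> 'v) \<Rightarrow> ('r, 'v, 'g) rep \<Rightarrow> ('v \<Rightarrow> 'w) \<Rightarrow> ('r, 'w, 'g) rep \<Rightarrow> bool" where
  "short_exact_mod_tf R H T X f Y g Z \<longleftrightarrow>
    smooth_rep R H T X \<and> smooth_rep R H T Y \<and> smooth_rep R H T Z \<and>
    f \<in> rep_hom R H X Y \<and> g \<in> rep_hom R H Y Z \<and> f ` carrier X \<subseteq> ker_rep Y Z g \<and>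
    smooth_tf R H T (X \<downharpoonright> ker_rep X Y f) \<and>
    smooth_tf R H T (quot_rep (Y \<downharpoonright> ker_rep Y Z g) (f ` carrier X)) \<and>
    smooth_tf R H T (quot_rep Z (g ` carrier Y))"


section \<open>The group GL(2) and its submonoids\<close>

definition mat2 :: "'a \<Rightarrow> 'a \<Rightarrow> 'a \<Rightarrow> 'a \<Rightarrow> 'a::field^2^2" where
  "mat2 a b c d = vector [vector [a, b], vector [c, d]]"

definition GL2 :: "('a::field^2^2) monoid" where
  "GL2 = \<lparr>carrier = {A. invertible A}, monoid.mult = (**), one = mat 1\<rparr>"

definition matrix_topology :: "'a::field set \<Rightarrow> ('a^2^2) topology" where
  "matrix_topology A =
    pullback_topology UNIV (\<lambda>M (i, j). M $ i $ j) (product_topology (\<lambda>_. field_topology A) UNIV)"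

definition centre :: "('a::field^2^2) set" where
  "centre = {z \<in> carrier GL2. \<forall>g\<in>carrier GL2. z \<otimes>\<^bsub>GL2\<^esub> g = g \<otimes>\<^bsub>GL2\<^esub> z}"

definition borel_set :: "('a::field^2^2) set" where
  "borel_set = {M \<in> carrier GL2. M $ 2 $ 1 = 0}"

definition T0 :: "'a::field set \<Rightarrow> ('a^2^2) set" where
  "T0 A = {mat2 a 0 0 d | a d. a \<in> Units (subset_ring A) \<and> d \<in> Units (subset_ring A)}"

definition U0 :: "'a::field set \<Rightarrow> ('a^2^2) set" where
  "U0 A = {mat2 1 x 0 1 | x. x \<in> A}"

definition Uq :: "'a::field set \<Rightarrow> 'a \<Rightarrow> ('a^2^2) set" where
  "Uq A \<pi> = {mat2 1 x 0 1 | x. x \<in> teichmueller A \<pi>}"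

definition B0 :: "'a::field set \<Rightarrow> ('a^2^2) set" where
  "B0 A = T0 A <#>\<^bsub>GL2\<^esub> U0 A"

definition B0Z :: "'a::field set \<Rightarrow> ('a^2^2) set" where
  "B0Z A = B0 A <#>\<^bsub>GL2\<^esub> centre"

definition tmat :: "'a::field \<Rightarrow> 'a^2^2" where
  "tmat \<pi> = mat2 \<pi> 0 0 1"

definition Bplus :: "'a::field set \<Rightarrow> 'a \<Rightarrow> ('a^2^2) set" where
  "Bplus A \<pi> = (\<Union>n::nat. B0Z A #>\<^bsub>GL2\<^esub> (tmat \<pi> [^]\<^bsub>GL2\<^esub> n))"

definition Bplus_inv :: "'a::field set \<Rightarrow> 'a \<Rightarrow> ('a^2^2) set" where
  "Bplus_inv A \<pi> = (\<lambda>b. inv\<^bsub>GL2\<^esub> b) ` Bplus A \<pi>"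

abbreviation GL2_on :: "('a::field^2^2) set \<Rightarrow> ('a^2^2) monoid" where
  "GL2_on S \<equiv> GL2\<lparr>carrier := S\<rparr>"


section \<open>The functors of the theorem\<close>

definition Vplus :: "'r ring \<Rightarrow> 'a::field set \<Rightarrow> 'a \<Rightarrow> ('r, 'v, 'a^2^2) rep \<Rightarrow> 'v set \<Rightarrow> 'v set"
  where "Vplus R A \<pi> V V0 = act_span R V (Bplus A \<pi>) V0"

definition Vminus :: "'r ring \<Rightarrow> 'a::field set \<Rightarrow> 'a \<Rightarrow> ('r, 'v, 'a^2^2) rep \<Rightarrow> 'v set \<Rightarrow> 'v set"
  where "Vminus R A \<pi> V V0 = act_span R V (borel_set - Bplus A \<pi>) V0"

definition Delta :: "'r ring \<Rightarrow> 'a::field set \<Rightarrow> 'a \<Rightarrow> ('r, 'v, 'a^2^2) rep \<Rightarrow> 'v set \<Rightarrow> 'v set"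
  where "Delta R A \<pi> V V0 = Vplus R A \<pi> V V0 \<inter> Vminus R A \<pi> V V0"

text \<open>\<open>D_V(V0)\<close> is the quotient of \<open>Vplus\<close> by \<open>Delta\<close>. An element \<open>h\<close> of the inverse of \<open>B\<^sup>+\<close> need not
  preserve \<open>Vplus\<close>; it acts on \<open>V / Vminus\<close>, and this action is transported along the isomorphism
  \<open>Vplus / Delta \<rightarrow> V / Vminus\<close>, whose inverse sends a coset of \<open>Vminus\<close> to its intersection with
  \<open>Vplus\<close>.\<close>

definition D_rep :: "'r ring \<Rightarrow> 'a::field set \<Rightarrow> 'a \<Rightarrow> ('r, 'v, 'a^2^2) rep \<Rightarrow> 'v set \<Rightarrow>
    ('r, 'v set, 'a^2^2) rep" where
  "D_rep R A \<pi> V V0 =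
    (quot_rep (V \<downharpoonright> Vplus R A \<pi> V V0) (Delta R A \<pi> V V0))
      \<lparr>act := (\<lambda>h X. (Vminus R A \<pi> V V0 <+>\<^bsub>V\<^esub> act V h ` X) \<inter> Vplus R A \<pi> V V0)\<rparr>"

text \<open>The direct sum of copies of \<open>D\<close> indexed by \<open>U(q)\<close>. Given \<open>b \<in> B0 Z\<close> and \<open>u \<in> U(q)\<close>, write
  \<open>b\<inverse> u t = u' t b'\<close> with \<open>u' \<in> U(q)\<close> and \<open>b' \<in> B0 Z\<close>; then \<open>(b x)\<^sub>u = b'\<inverse> x\<^sub>u'\<close>, where
  \<open>b'\<inverse> = (u t)\<inverse> b u' t\<close>. For \<open>b \<in> Z\<close> this gives \<open>u' = u\<close> and \<open>b' = b\<inverse>\<close>, the diagonal action.\<close>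

definition etale_index :: "'a::field set \<Rightarrow> 'a \<Rightarrow> 'a^2^2 \<Rightarrow> 'a^2^2 \<Rightarrow> 'a^2^2" where
  "etale_index A \<pi> b u = (THE u'. u' \<in> Uq A \<pi> \<and>
     (\<exists>b'\<in>B0Z A. inv\<^bsub>GL2\<^esub> b \<otimes>\<^bsub>GL2\<^esub> u \<otimes>\<^bsub>GL2\<^esub> tmat \<pi> = u' \<otimes>\<^bsub>GL2\<^esub> tmat \<pi> \<otimes>\<^bsub>GL2\<^esub> b'))"

definition etale_target :: "'a::field set \<Rightarrow> 'a \<Rightarrow> ('r, 'd, 'a^2^2) rep \<Rightarrow>
    ('r, 'a^2^2 \<Rightarrow> 'd, 'a^2^2) rep" where
  "etale_target A \<pi> D =
    \<lparr>carrier = Uq A \<pi> \<rightarrow>\<^sub>E carrier D, monoid.mult = undefined, one = undefined,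
     ring.zero = (\<lambda>u\<in>Uq A \<pi>. \<zero>\<^bsub>D\<^esub>),
     add = (\<lambda>x y. \<lambda>u\<in>Uq A \<pi>. x u \<oplus>\<^bsub>D\<^esub> y u),
     module.smult = (\<lambda>r x. \<lambda>u\<in>Uq A \<pi>. r \<odot>\<^bsub>D\<^esub> x u),
     act = (\<lambda>b x. \<lambda>u\<in>Uq A \<pi>. let u' = etale_index A \<pi> b u in
       act D (inv\<^bsub>GL2\<^esub> (u \<otimes>\<^bsub>GL2\<^esub> tmat \<pi>) \<otimes>\<^bsub>GL2\<^esub> b \<otimes>\<^bsub>GL2\<^esub> u' \<otimes>\<^bsub>GL2\<^esub> tmat \<pi>) (x u'))\<rparr>"

definition etale_map :: "'a::field set \<Rightarrow> 'a \<Rightarrow> ('r, 'd, 'a^2^2) rep \<Rightarrow> 'd \<Rightarrow> 'a^2^2 \<Rightarrow> 'd" where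
  "etale_map A \<pi> D d = (\<lambda>u\<in>Uq A \<pi>. act D (inv\<^bsub>GL2\<^esub> (u \<otimes>\<^bsub>GL2\<^esub> tmat \<pi>)) d)"

definition etale_mod_tf :: "'r ring \<Rightarrow> 'a::field set \<Rightarrow> 'a \<Rightarrow> ('r, 'd, 'a^2^2) rep \<Rightarrow> bool" where
  "etale_mod_tf R A \<pi> D \<longleftrightarrow>
    smooth_rep R (GL2_on (Bplus_inv A \<pi>)) (matrix_topology A) D \<and>
    etale_map A \<pi> D \<in> rep_hom R (GL2_on (B0Z A)) D (etale_target A \<pi> D) \<and>
    smooth_tf R (GL2_on (B0Z A)) (matrix_topology A)
      (D \<downharpoonright> ker_rep D (etale_target A \<pi> D) (etale_map A \<pi> D)) \<and>
    smooth_tf R (GL2_on (B0Z A)) (matrix_topology A)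
      (quot_rep (etale_target A \<pi> D) (etale_map A \<pi> D ` carrier D))"

end

theory Submission
  imports Defs
begin

text \<open>Write \<open>V\<^sup>+\<close>, \<open>V\<^sup>-\<close> for \<open>\<langle>B\<^sup>+ V0\<rangle>\<close>, \<open>\<langle>(B - B\<^sup>+) V0\<rangle>\<close> and \<open>H = B0 Z\<close>. Then \<open>V = V\<^sup>+ + V\<^sup>-\<close>, and every
  element of \<open>B\<close> is moved into \<open>B\<^sup>+\<close> by high powers of \<open>t\<close>; hence all but finitely many translates
  \<open>t\<^sup>n s\<close> of a generator of another \<open>V1\<close> lie in \<open>V\<^sup>+\<close>, which gives a).

  b) The elements of \<open>\<Delta> = V\<^sup>+ \<inter> V\<^sup>-\<close> arise by truncating to \<open>B\<^sup>+\<close> the elements of the kernel of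
  \<open>ind V0 \<rightarrow> V\<close>. For the translates of a generator of the kernel, the truncation maps to \<open>0\<close> unless
  the translate meets both \<open>B\<^sup>+\<close> and its complement; up to \<open>H\<close> this happens for finitely many of them.

  c) As \<open>V\<^sup>+ = V0 + \<Sum> u t V\<^sup>+\<close> and \<open>(u t)\<inverse>\<close> maps \<open>V0\<close> and the other summands into \<open>V\<^sup>-\<close>, the etale map
  is surjective, and its kernel is the image of \<open>V0 + \<Sum> u t \<Delta>\<close>.

  d) Decomposing in \<open>V' = V'\<^sup>+ + V'\<^sup>-\<close> a preimage of an element of \<open>V\<^sup>+\<close> that vanishes in \<open>V''\<close> shows
  that the homology in the middle is a subquotient of \<open>\<Delta>\<close>. Subrepresentations of representations of
  finite type of \<open>H\<close> are of finite type by Hilbert's basis theorem for the central element \<open>\<pi>\<close>.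

  e) Let \<open>F\<close> be the sum of the \<open>u t\<close>. A vector \<open>v \<in> V\<^sup>+\<close> fixed by \<open>U0\<close> unwinds as \<open>v = d\<^sub>0\<close>,
  \<open>d\<^sub>k = q\<^sub>k + F d\<^sub>k\<^sub>+\<^sub>1\<close>, with \<open>q\<^sub>k \<in> V0 + \<Sum> u t \<Delta>\<close> and \<open>d\<^sub>k\<close> fixed by \<open>U0\<close> modulo \<open>\<Delta>\<close>. Since the kernels of
  \<open>F\<^sup>j\<close> on \<open>\<Delta>\<close> stabilise, some \<open>F\<^sup>e d\<^sub>k\<close> are all fixed by a common subgroup of \<open>U0\<close> and then, by
  descending induction on \<open>k\<close>, by a congruence subgroup that does not depend on \<open>v\<close>.\<close>

section \<open>Finitely generated submodules\<close>

text \<open>Modulo the centre, B is the affine group of the line; H and B^+ are given by integral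
  coefficients, for H with a unit as slope. Questions about cosets thus become arithmetic in the
  ring of integers, and the two kinds of base field enter only through the axioms of
  \<open>cdvr\<close>. The centre is not compact, so finite type over H is weaker than finite
  generation over o. But up to powers of the scalar pi the group H is compact and has finite orbits;
  this is why one endomorphism suffices in Hilbert's theorem. In c), (B^+)^-1 preserves V^- but not
  V^+, so the computations with D take place in V modulo V^-. In e), vectors of a fixed level are
  finitely generated over o, but F raises the level by one and a vector may need arbitrarily many F.
  The level stays bounded because t enlarges only the unipotent part of a congruence subgroup, and
  the unipotent defects lie in Delta, where F^e already kills whatever some power of F kills. If V0
  and Delta have level m, the common level is m + e + 2.\<close>

abbreviation mspan :: "('r, 'b) ring_scheme \<Rightarrow> ('r, 'v, 'm) module_scheme \<Rightarrow> 'v set \<Rightarrow> 'v set" where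
  "mspan R M S \<equiv> (\<lambda>N. submodule N R M) hull S"

definition fg :: "('r, 'b) ring_scheme \<Rightarrow> ('r, 'v, 'm) module_scheme \<Rightarrow> 'v set \<Rightarrow> bool" where
  "fg R M N \<longleftrightarrow> (\<exists>S. finite S \<and> S \<subseteq> N \<and> mspan R M S = N)"

context Module.module
begin

text \<open>Negatives are multiples by - 1, so closure under them need not be checked
  separately.\<close>

lemma submoduleI':
  assumes "N \<subseteq> carrier M" "\<zero>\<^bsub>M\<^esub> \<in> N"
    and add: "\<And>a b. \<lbrakk>a \<in> N; b \<in> N\<rbrakk> \<Longrightarrow> a \<oplus>\<^bsub>M\<^esub> b \<in> N"
    and smult: "\<And>r a. \<lbrakk>r \<in> carrier R; a \<in> N\<rbrakk> \<Longrightarrow> r \<odot>\<^bsub>M\<^esub> a \<in> N"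
  shows "submodule N R M"
proof (rule submoduleI[OF assms(1,2) _ add smult])
  fix a assume a: "a \<in> N"
  then have "\<ominus>\<^bsub>M\<^esub> a = (\<ominus>\<^bsub>R\<^esub> \<one>\<^bsub>R\<^esub>) \<odot>\<^bsub>M\<^esub> a" using assms(1) smult_l_minus[of "\<one>\<^bsub>R\<^esub>" a] by auto
  then show "\<ominus>\<^bsub>M\<^esub> a \<in> N" using smult[OF _ a, of "\<ominus>\<^bsub>R\<^esub> \<one>\<^bsub>R\<^esub>"] by simp
qed

lemma submodule_subset: "submodule N R M \<Longrightarrow> N \<subseteq> carrier M"
  by (rule submoduleE(1))

lemma submodule_zero: "submodule N R M \<Longrightarrow> \<zero>\<^bsub>M\<^esub> \<in> N"
  using submodule.axioms(1) subgroup.one_closed by fastforce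

lemma submodule_minus: "\<lbrakk>submodule N R M; a \<in> N; b \<in> N\<rbrakk> \<Longrightarrow> a \<ominus>\<^bsub>M\<^esub> b \<in> N"
  unfolding a_minus_def using submoduleE(3,5) by blast

lemma minus_add_cancel: "\<lbrakk>a \<in> carrier M; b \<in> carrier M\<rbrakk> \<Longrightarrow> a \<ominus>\<^bsub>M\<^esub> b \<oplus>\<^bsub>M\<^esub> b = a"
  by (simp add: a_minus_def M.a_assoc M.l_neg)

lemma add_minus_cancel: "\<lbrakk>a \<in> carrier M; b \<in> carrier M\<rbrakk> \<Longrightarrow> a \<oplus>\<^bsub>M\<^esub> b \<ominus>\<^bsub>M\<^esub> b = a"
  by (simp add: a_minus_def M.a_assoc M.r_neg)

lemma minus_self: "a \<in> carrier M \<Longrightarrow> a \<ominus>\<^bsub>M\<^esub> a = \<zero>\<^bsub>M\<^esub>"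
  by (simp add: a_minus_def M.r_neg)

lemma minus_eq_zeroD: "\<lbrakk>a \<ominus>\<^bsub>M\<^esub> b = \<zero>\<^bsub>M\<^esub>; a \<in> carrier M; b \<in> carrier M\<rbrakk> \<Longrightarrow> a = b"
  by (metis minus_add_cancel M.l_zero)

lemma minus_minus_zero: "a \<in> carrier M \<Longrightarrow> a \<ominus>\<^bsub>M\<^esub> \<zero>\<^bsub>M\<^esub> = a"
  by (simp add: a_minus_def a_inv_def)

lemma submodule_diffD: "\<lbrakk>submodule N R M; a \<ominus>\<^bsub>M\<^esub> b \<in> N; b \<in> N; a \<in> carrier M\<rbrakk> \<Longrightarrow> a \<in> N"
  using submoduleE(5)[of N "a \<ominus>\<^bsub>M\<^esub> b" b] minus_add_cancel[of a b] submoduleE(1)[of N] by auto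

lemma diff_trans: "\<lbrakk>a \<in> carrier M; b \<in> carrier M; c \<in> carrier M\<rbrakk> \<Longrightarrow>
    (a \<ominus>\<^bsub>M\<^esub> b) \<oplus>\<^bsub>M\<^esub> (b \<ominus>\<^bsub>M\<^esub> c) = a \<ominus>\<^bsub>M\<^esub> c"
  by (simp add: a_minus_def M.a_assoc M.r_neg1)

lemma diff_add: "\<lbrakk>a \<in> carrier M; b \<in> carrier M; c \<in> carrier M; d \<in> carrier M\<rbrakk> \<Longrightarrow>
    (a \<oplus>\<^bsub>M\<^esub> c) \<ominus>\<^bsub>M\<^esub> (b \<oplus>\<^bsub>M\<^esub> d) = (a \<ominus>\<^bsub>M\<^esub> b) \<oplus>\<^bsub>M\<^esub> (c \<ominus>\<^bsub>M\<^esub> d)"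
  by (simp add: a_minus_def M.minus_add M.a_ac)

lemma smult_diff: "\<lbrakk>r \<in> carrier R; a \<in> carrier M; b \<in> carrier M\<rbrakk> \<Longrightarrow>
    r \<odot>\<^bsub>M\<^esub> (a \<ominus>\<^bsub>M\<^esub> b) = r \<odot>\<^bsub>M\<^esub> a \<ominus>\<^bsub>M\<^esub> r \<odot>\<^bsub>M\<^esub> b"
  by (simp add: a_minus_def smult_r_distr smult_r_minus)

lemma minus_swap: "\<lbrakk>a \<in> carrier M; b \<in> carrier M\<rbrakk> \<Longrightarrow> \<ominus>\<^bsub>M\<^esub> (a \<ominus>\<^bsub>M\<^esub> b) = b \<ominus>\<^bsub>M\<^esub> a"
  by (simp add: a_minus_def M.minus_add M.a_comm)

lemma diff_swap_in: "\<lbrakk>submodule N R M; a \<ominus>\<^bsub>M\<^esub> b \<in> N; a \<in> carrier M; b \<in> carrier M\<rbrakk> \<Longrightarrow> b \<ominus>\<^bsub>M\<^esub> a \<in> N"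
  using submoduleE(3)[of N "a \<ominus>\<^bsub>M\<^esub> b"] minus_swap[of a b] by simp

lemma submodule_Inter:
  assumes "\<N> \<noteq> {}" "\<And>N. N \<in> \<N> \<Longrightarrow> submodule N R M"
  shows "submodule (\<Inter>\<N>) R M"
proof (rule submoduleI)
  show "\<Inter>\<N> \<subseteq> carrier M" using assms submodule_subset by blast
  show "\<zero>\<^bsub>M\<^esub> \<in> \<Inter>\<N>" using assms(2) submodule_zero by blast
  show "\<ominus>\<^bsub>M\<^esub> a \<in> \<Inter>\<N>" if "a \<in> \<Inter>\<N>" for a
    using that submoduleE(3)[OF assms(2)] by blast
  show "a \<oplus>\<^bsub>M\<^esub> b \<in> \<Inter>\<N>" if "a \<in> \<Inter>\<N>" "b \<in> \<Inter>\<N>" for a b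
    using that submoduleE(5)[OF assms(2)] by blast
  show "r \<odot>\<^bsub>M\<^esub> b \<in> \<Inter>\<N>" if "r \<in> carrier R" "b \<in> \<Inter>\<N>" for r b
    using that submoduleE(4)[OF assms(2)] by blast
qed

lemma submodule_Int: "\<lbrakk>submodule N R M; submodule N' R M\<rbrakk> \<Longrightarrow> submodule (N \<inter> N') R M"
  using submodule_Inter[of "{N, N'}"] by auto

lemma mspan_submodule: "S \<subseteq> carrier M \<Longrightarrow> submodule (mspan R M S) R M"
  unfolding hull_def using carrier_is_submodule by (intro submodule_Inter) auto

lemma mspan_minimal: "\<lbrakk>submodule N R M; S \<subseteq> N\<rbrakk> \<Longrightarrow> mspan R M S \<subseteq> N"
  by (rule hull_minimal)

lemma submodule_trivial: "submodule {\<zero>\<^bsub>M\<^esub>} R M"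
  by (rule submoduleI) auto

lemma mspan_empty: "mspan R M {} = {\<zero>\<^bsub>M\<^esub>}"
  using mspan_minimal[OF submodule_trivial] submodule_zero[OF mspan_submodule[of "{}"]] by blast

lemma submodule_add:
  assumes N: "submodule N R M" and N': "submodule N' R M"
  shows "submodule (N <+>\<^bsub>M\<^esub> N') R M"
proof -
  note sub = submodule_subset[OF N] submodule_subset[OF N']
  have eq: "N <+>\<^bsub>M\<^esub> N' = {a \<oplus>\<^bsub>M\<^esub> b | a b. a \<in> N \<and> b \<in> N'}"
    by (auto simp: set_add_def')
  show ?thesis unfolding eq
  proof (rule submoduleI, safe)
    fix a b assume "a \<in> N" "b \<in> N'"
    then show "a \<oplus>\<^bsub>M\<^esub> b \<in> carrier M" using sub by auto
    show "\<exists>a' b'. \<ominus>\<^bsub>M\<^esub> (a \<oplus>\<^bsub>M\<^esub> b) = a' \<oplus>\<^bsub>M\<^esub> b' \<and> a' \<in> N \<and> b' \<in> N'"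
      using \<open>a \<in> N\<close> \<open>b \<in> N'\<close> sub submoduleE(3)[OF N, of a] submoduleE(3)[OF N', of b] M.minus_add[of a b]
      by blast
    fix c d assume "c \<in> N" "d \<in> N'"
    then have "(a \<oplus>\<^bsub>M\<^esub> b) \<oplus>\<^bsub>M\<^esub> (c \<oplus>\<^bsub>M\<^esub> d) = (a \<oplus>\<^bsub>M\<^esub> c) \<oplus>\<^bsub>M\<^esub> (b \<oplus>\<^bsub>M\<^esub> d)"
      using \<open>a \<in> N\<close> \<open>b \<in> N'\<close> sub by (auto simp: M.a_ac subset_iff)
    then show "\<exists>a' b'. (a \<oplus>\<^bsub>M\<^esub> b) \<oplus>\<^bsub>M\<^esub> (c \<oplus>\<^bsub>M\<^esub> d) = a' \<oplus>\<^bsub>M\<^esub> b' \<and> a' \<in> N \<and> b' \<in> N'"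
      using \<open>a \<in> N\<close> \<open>b \<in> N'\<close> \<open>c \<in> N\<close> \<open>d \<in> N'\<close> submoduleE(5)[OF N] submoduleE(5)[OF N'] by blast
  next
    fix r a b assume "r \<in> carrier R" "a \<in> N" "b \<in> N'"
    then show "\<exists>a' b'. r \<odot>\<^bsub>M\<^esub> (a \<oplus>\<^bsub>M\<^esub> b) = a' \<oplus>\<^bsub>M\<^esub> b' \<and> a' \<in> N \<and> b' \<in> N'"
      using sub smult_r_distr[of r a b] submoduleE(4)[OF N, of r a] submoduleE(4)[OF N', of r b] by blast
  next
    show "\<exists>a b. \<zero>\<^bsub>M\<^esub> = a \<oplus>\<^bsub>M\<^esub> b \<and> a \<in> N \<and> b \<in> N'"
      using submodule_zero[OF N] submodule_zero[OF N'] M.l_zero[OF M.zero_closed] by metis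
  qed
qed

lemma subset_add_left:
  assumes N: "submodule N R M" and N': "submodule N' R M"
  shows "N \<subseteq> N <+>\<^bsub>M\<^esub> N'"
proof
  fix x assume "x \<in> N"
  then show "x \<in> N <+>\<^bsub>M\<^esub> N'"
    using submodule_zero[OF N'] submodule_subset[OF N] M.r_zero unfolding set_add_def' by force
qed

lemma subset_add_right:
  assumes N: "submodule N R M" and N': "submodule N' R M"
  shows "N' \<subseteq> N <+>\<^bsub>M\<^esub> N'"
proof
  fix x assume "x \<in> N'"
  then show "x \<in> N <+>\<^bsub>M\<^esub> N'"
    using submodule_zero[OF N] submodule_subset[OF N'] M.l_zero unfolding set_add_def' by force
qed

lemma submodule_multiples: "x \<in> carrier M \<Longrightarrow> submodule {r \<odot>\<^bsub>M\<^esub> x | r. r \<in> carrier R} R M"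
proof (rule submoduleI, safe)
  assume x: "x \<in> carrier M"
  show "\<exists>r. \<zero>\<^bsub>M\<^esub> = r \<odot>\<^bsub>M\<^esub> x \<and> r \<in> carrier R" using x smult_l_null R.zero_closed by metis
  fix r assume r: "r \<in> carrier R"
  show "r \<odot>\<^bsub>M\<^esub> x \<in> carrier M" using x r by auto
  show "\<exists>s. \<ominus>\<^bsub>M\<^esub> (r \<odot>\<^bsub>M\<^esub> x) = s \<odot>\<^bsub>M\<^esub> x \<and> s \<in> carrier R"
    using x r smult_l_minus[of r x] R.a_inv_closed[of r] by metis
  fix s assume s: "s \<in> carrier R"
  show "\<exists>q. r \<odot>\<^bsub>M\<^esub> x \<oplus>\<^bsub>M\<^esub> s \<odot>\<^bsub>M\<^esub> x = q \<odot>\<^bsub>M\<^esub> x \<and> q \<in> carrier R"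
    using x r s smult_l_distr by (metis R.a_closed)
  show "\<exists>q. s \<odot>\<^bsub>M\<^esub> (r \<odot>\<^bsub>M\<^esub> x) = q \<odot>\<^bsub>M\<^esub> x \<and> q \<in> carrier R"
    using x r s smult_assoc1 by (metis R.m_closed)
qed

lemma mspan_insert_decomp:
  assumes x: "x \<in> carrier M" and S: "S \<subseteq> carrier M" and y: "y \<in> mspan R M (insert x S)"
  shows "\<exists>r\<in>carrier R. \<exists>n\<in>mspan R M S. y = r \<odot>\<^bsub>M\<^esub> x \<oplus>\<^bsub>M\<^esub> n"
proof -
  let ?X = "{r \<odot>\<^bsub>M\<^esub> x | r. r \<in> carrier R}"
  note X = submodule_multiples[OF x] and S' = mspan_submodule[OF S]
  have "x \<in> ?X" using x smult_one R.one_closed by force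
  then have "insert x S \<subseteq> ?X <+>\<^bsub>M\<^esub> mspan R M S"
    using subset_add_left[OF X S'] subset_add_right[OF X S'] hull_subset[of S] by blast
  then have "y \<in> ?X <+>\<^bsub>M\<^esub> mspan R M S"
    using mspan_minimal[OF submodule_add[OF X S']] y by blast
  then show ?thesis unfolding set_add_def' by blast
qed

lemma fg_subset: "fg R M N \<Longrightarrow> submodule N R M \<Longrightarrow> \<exists>S. finite S \<and> S \<subseteq> carrier M \<and> mspan R M S = N"
  unfolding fg_def using submodule_subset by blast

text \<open>Induction on the number of generators. The coefficients with which the new generator x
  occurs in N form an ideal; lifts of its generators, together with generators of the part of N
  inside the span of S, generate N.\<close>

lemma fg_submodule_of_span:
  assumes noeth: "noetherian_ring R"
  shows "\<lbrakk>finite S; S \<subseteq> carrier M; submodule N R M; N \<subseteq> mspan R M S\<rbrakk> \<Longrightarrow> fg R M N"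
proof (induction S arbitrary: N rule: finite_induct)
  case empty
  have "\<zero>\<^bsub>M\<^esub> \<in> N" by (rule submodule_zero) fact
  then have "N = mspan R M {}" using empty(3) unfolding mspan_empty by blast
  then show ?case unfolding fg_def by blast
next
  case (insert x S)
  note N = \<open>submodule N R M\<close>
  have x: "x \<in> carrier M" and S: "S \<subseteq> carrier M" using insert by auto
  note S' = mspan_submodule[OF S]
  have "fg R M (N \<inter> mspan R M S)"
    using insert.IH[OF S submodule_Int[OF N S']] by blast
  then obtain T where T: "finite T" "T \<subseteq> N \<inter> mspan R M S" "mspan R M T = N \<inter> mspan R M S"
    unfolding fg_def by blast
  \<comment> \<open>Defined for any submodule L, because the ideal for N is later compared with the
    one for the span of the chosen elements W.\<close>
  define lead where "lead L = {r \<in> carrier R. \<exists>n\<in>mspan R M S. r \<odot>\<^bsub>M\<^esub> x \<oplus>\<^bsub>M\<^esub> n \<in> L}" for L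
  have ideal: "ideal (lead L) R" if L: "submodule L R M" for L
  proof (rule idealI)
    show "ring R" by (rule R.ring_axioms)
    have "\<zero> \<odot>\<^bsub>M\<^esub> x \<oplus>\<^bsub>M\<^esub> \<zero>\<^bsub>M\<^esub> \<in> L" using x submodule_zero[OF L] by simp
    then have zero: "\<zero> \<in> lead L" unfolding lead_def using submodule_zero[OF S'] by blast
    have smult: "r \<otimes> a \<in> lead L" if ar: "a \<in> lead L" "r \<in> carrier R" for a r
    proof -
      obtain n where n: "n \<in> mspan R M S" "a \<odot>\<^bsub>M\<^esub> x \<oplus>\<^bsub>M\<^esub> n \<in> L" "a \<in> carrier R"
        using ar unfolding lead_def by blast
      have "n \<in> carrier M" using n S' submodule_subset by blast
      then have "(r \<otimes> a) \<odot>\<^bsub>M\<^esub> x \<oplus>\<^bsub>M\<^esub> r \<odot>\<^bsub>M\<^esub> n = r \<odot>\<^bsub>M\<^esub> (a \<odot>\<^bsub>M\<^esub> x \<oplus>\<^bsub>M\<^esub> n)"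
        using x n that by (simp add: smult_r_distr smult_assoc1)
      then show ?thesis unfolding lead_def using n that submoduleE(4)[OF L] submoduleE(4)[OF S']
        by (metis (mono_tags, lifting) R.m_closed mem_Collect_eq)
    qed
    have add: "a \<oplus> b \<in> lead L" if ab: "a \<in> lead L" "b \<in> lead L" for a b
    proof -
      obtain n m where n: "n \<in> mspan R M S" "a \<odot>\<^bsub>M\<^esub> x \<oplus>\<^bsub>M\<^esub> n \<in> L" "a \<in> carrier R"
        and m: "m \<in> mspan R M S" "b \<odot>\<^bsub>M\<^esub> x \<oplus>\<^bsub>M\<^esub> m \<in> L" "b \<in> carrier R"
        using ab unfolding lead_def by blast
      have "n \<in> carrier M" "m \<in> carrier M" using n m S' submodule_subset by blast+
      then have "(a \<oplus> b) \<odot>\<^bsub>M\<^esub> x \<oplus>\<^bsub>M\<^esub> (n \<oplus>\<^bsub>M\<^esub> m) = (a \<odot>\<^bsub>M\<^esub> x \<oplus>\<^bsub>M\<^esub> n) \<oplus>\<^bsub>M\<^esub> (b \<odot>\<^bsub>M\<^esub> x \<oplus>\<^bsub>M\<^esub> m)"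
        using x n m by (simp add: smult_l_distr M.a_ac)
      then show ?thesis unfolding lead_def using n m submoduleE(5)[OF L] submoduleE(5)[OF S']
        by (smt (verit) R.a_closed mem_Collect_eq)
    qed
    show "subgroup (lead L) (add_monoid R)"
    proof (rule R.add.subgroupI)
      show "lead L \<subseteq> carrier R" unfolding lead_def by blast
      show "lead L \<noteq> {}" using zero by blast
      show "\<ominus> a \<in> lead L" if "a \<in> lead L" for a
        using smult[OF that, of "\<ominus> \<one>"] that unfolding lead_def by (simp add: R.l_minus)
    qed (rule add)
    show "r \<otimes> a \<in> lead L" "a \<otimes> r \<in> lead L" if "a \<in> lead L" "r \<in> carrier R" for a r
      using smult[OF that] that R.m_comm unfolding lead_def by auto
  qed
  obtain A where A: "A \<subseteq> carrier R" "finite A" "lead N = Idl A"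
    using noetherian_ring.finetely_gen[OF noeth ideal[OF N]] by blast
  have "A \<subseteq> lead N" using A R.genideal_self by blast
  then have "\<forall>a\<in>A. \<exists>n\<in>mspan R M S. a \<odot>\<^bsub>M\<^esub> x \<oplus>\<^bsub>M\<^esub> n \<in> N" unfolding lead_def by blast
  then obtain n where n: "\<And>a. a \<in> A \<Longrightarrow> n a \<in> mspan R M S" "\<And>a. a \<in> A \<Longrightarrow> a \<odot>\<^bsub>M\<^esub> x \<oplus>\<^bsub>M\<^esub> n a \<in> N"
    by metis
  define W where "W = T \<union> (\<lambda>a. a \<odot>\<^bsub>M\<^esub> x \<oplus>\<^bsub>M\<^esub> n a) ` A"
  have W: "finite W" "W \<subseteq> N" unfolding W_def using T A n by auto
  have spanW: "submodule (mspan R M W) R M" by (rule mspan_submodule) (use W submodule_subset[OF N] in blast)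
  have "A \<subseteq> lead (mspan R M W)"
    using A(1) n(1) hull_subset[of W] unfolding lead_def W_def by blast
  then have lead: "lead N \<subseteq> lead (mspan R M W)" using A(3) R.genideal_minimal ideal[OF spanW] by blast
  have WN: "mspan R M W \<subseteq> N" using mspan_minimal[OF N] W by blast
  have "N \<subseteq> mspan R M W"
  proof
    fix y assume y: "y \<in> N"
    then obtain r m where rm: "r \<in> carrier R" "m \<in> mspan R M S" "y = r \<odot>\<^bsub>M\<^esub> x \<oplus>\<^bsub>M\<^esub> m"
      using mspan_insert_decomp[OF x S] insert.prems by blast
    then have "r \<in> lead N" unfolding lead_def using y by blast
    then obtain m' where m': "m' \<in> mspan R M S" "r \<odot>\<^bsub>M\<^esub> x \<oplus>\<^bsub>M\<^esub> m' \<in> mspan R M W"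
      using lead unfolding lead_def by blast
    have mc: "m \<in> carrier M" "m' \<in> carrier M" using m' rm S' submodule_subset by blast+
    \<comment> \<open>Subtracting an element of the span of W with the same coefficient at x leaves
      a difference in the span of S.\<close>
    have eq: "y \<ominus>\<^bsub>M\<^esub> (r \<odot>\<^bsub>M\<^esub> x \<oplus>\<^bsub>M\<^esub> m') = m \<ominus>\<^bsub>M\<^esub> m'"
      using rm mc x by (simp add: diff_add minus_self)
    have "m \<ominus>\<^bsub>M\<^esub> m' \<in> N \<inter> mspan R M S"
      using submodule_minus[OF N y, of "r \<odot>\<^bsub>M\<^esub> x \<oplus>\<^bsub>M\<^esub> m'"] m' WN eq submodule_minus[OF S' rm(2) m'(1)] by auto
    then have "m \<ominus>\<^bsub>M\<^esub> m' \<in> mspan R M W" using T(3) hull_mono[of T W] unfolding W_def by blast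
    then show "y \<in> mspan R M W" using submodule_diffD[OF spanW _ m'(2), of y] eq y submodule_subset[OF N] by auto
  qed
  then show ?case unfolding fg_def using W WN by blast
qed

lemma fg_submodule:
  assumes "noetherian_ring R" "fg R M L" "submodule L R M" "submodule N R M" "N \<subseteq> L"
  shows "fg R M N"
  using fg_subset[OF assms(2,3)] fg_submodule_of_span[OF assms(1)] assms(4,5) by blast

lemma submodule_Union_chain:
  assumes "\<And>k::nat. submodule (N k) R M" "\<And>k. N k \<subseteq> N (Suc k)"
  shows "submodule (\<Union>k. N k) R M"
proof -
  have mono: "N i \<subseteq> N j" if "i \<le> j" for i j using lift_Suc_mono_le[of N] assms(2) that by blast
  show ?thesis
  proof (rule submoduleI)
    show "(\<Union>k. N k) \<subseteq> carrier M" using assms(1) submodule_subset by blast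
    show "\<zero>\<^bsub>M\<^esub> \<in> (\<Union>k. N k)" using assms(1) submodule_zero by blast
    show "a \<oplus>\<^bsub>M\<^esub> b \<in> (\<Union>k. N k)" if ab: "a \<in> (\<Union>k. N k)" "b \<in> (\<Union>k. N k)" for a b
    proof -
      obtain i j where ij: "a \<in> N i" "b \<in> N j" using ab by blast
      then have "a \<in> N (max i j)" "b \<in> N (max i j)" using mono[of i "max i j"] mono[of j "max i j"] by auto
      then show ?thesis using submoduleE(5)[OF assms(1)] by blast
    qed
    show "\<ominus>\<^bsub>M\<^esub> a \<in> (\<Union>k. N k)" if "a \<in> (\<Union>k. N k)" for a
      using that submoduleE(3)[OF assms(1)] by blast
    show "r \<odot>\<^bsub>M\<^esub> b \<in> (\<Union>k. N k)" if "r \<in> carrier R" "b \<in> (\<Union>k. N k)" for r b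
      using that submoduleE(4)[OF assms(1)] by blast
  qed
qed

text \<open>The union of the chain is finitely generated, being a submodule of L, and finitely many
  generators occur at one stage.\<close>

lemma fg_chain_stable:
  assumes "noetherian_ring R" "fg R M L" "submodule L R M"
    and N: "\<And>k::nat. submodule (N k) R M" "\<And>k. N k \<subseteq> N (Suc k)" "\<And>k. N k \<subseteq> L"
  shows "\<exists>e. \<forall>k. N k \<subseteq> N e"
proof -
  have mono: "N i \<subseteq> N j" if "i \<le> j" for i j using lift_Suc_mono_le[of N] N(2) that by blast
  have "fg R M (\<Union>k. N k)"
    using fg_submodule[OF assms(1-3)] submodule_Union_chain[of N, OF N(1,2)] N(3) by blast
  then obtain S where S: "finite S" "S \<subseteq> (\<Union>k. N k)" "mspan R M S = (\<Union>k. N k)" unfolding fg_def by blast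
  have "\<exists>e. S \<subseteq> N e" using S(1,2)
  proof (induction S rule: finite_induct)
    case (insert x S)
    then obtain e i where "S \<subseteq> N e" "x \<in> N i" by blast
    then have "insert x S \<subseteq> N (max e i)" using mono[of e "max e i"] mono[of i "max e i"] by auto
    then show ?case by blast
  qed auto
  then obtain e where "S \<subseteq> N e" by blast
  then have "(\<Union>k. N k) \<subseteq> N e" using mspan_minimal[OF N(1)] S(3) by blast
  then show ?thesis by blast
qed

lemma fg_finite_span: "\<lbrakk>finite S; S \<subseteq> carrier M\<rbrakk> \<Longrightarrow> fg R M (mspan R M S)"
  unfolding fg_def using hull_subset[of S] by blast

lemma mspan_Un_decomp:
  assumes S: "S \<subseteq> carrier M" and T: "T \<subseteq> carrier M" and y: "y \<in> mspan R M (S \<union> T)"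
  shows "\<exists>a\<in>mspan R M S. \<exists>b\<in>mspan R M T. y = a \<oplus>\<^bsub>M\<^esub> b"
proof -
  note S' = mspan_submodule[OF S] and T' = mspan_submodule[OF T]
  have "S \<union> T \<subseteq> mspan R M S <+>\<^bsub>M\<^esub> mspan R M T"
    using subset_add_left[OF S' T'] subset_add_right[OF S' T'] hull_subset[of S] hull_subset[of T] by blast
  then have "y \<in> mspan R M S <+>\<^bsub>M\<^esub> mspan R M T"
    using mspan_minimal[OF submodule_add[OF S' T']] y by blast
  then show ?thesis unfolding set_add_def' by blast
qed

lemma submodule_vimage:
  assumes f: "f \<in> carrier M \<rightarrow> carrier M" "\<And>x y. \<lbrakk>x \<in> carrier M; y \<in> carrier M\<rbrakk> \<Longrightarrow> f (x \<oplus>\<^bsub>M\<^esub> y) = f x \<oplus>\<^bsub>M\<^esub> f y"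
    "\<And>r x. \<lbrakk>r \<in> carrier R; x \<in> carrier M\<rbrakk> \<Longrightarrow> f (r \<odot>\<^bsub>M\<^esub> x) = r \<odot>\<^bsub>M\<^esub> f x"
    and N: "submodule N R M"
  shows "submodule {x \<in> carrier M. f x \<in> N} R M"
proof (rule submoduleI')
  have zero: "\<zero>\<^bsub>R\<^esub> \<odot>\<^bsub>M\<^esub> \<zero>\<^bsub>M\<^esub> = \<zero>\<^bsub>M\<^esub>" by simp
  have "f \<zero>\<^bsub>M\<^esub> = \<zero>\<^bsub>M\<^esub>" using f(3)[of "\<zero>\<^bsub>R\<^esub>" "\<zero>\<^bsub>M\<^esub>"] f(1) zero by force
  then show "\<zero>\<^bsub>M\<^esub> \<in> {x \<in> carrier M. f x \<in> N}" using submodule_zero[OF N] by simp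
  show "r \<odot>\<^bsub>M\<^esub> x \<in> {x \<in> carrier M. f x \<in> N}" if "r \<in> carrier R" "x \<in> {x \<in> carrier M. f x \<in> N}" for r x
    using that f(3) submoduleE(4)[OF N] by auto
  show "x \<oplus>\<^bsub>M\<^esub> y \<in> {x \<in> carrier M. f x \<in> N}" if "x \<in> {x \<in> carrier M. f x \<in> N}" "y \<in> {x \<in> carrier M. f x \<in> N}" for x y
    using that f(2) submoduleE(5)[OF N] by auto
qed auto

text \<open>Hilbert's basis theorem for a module with an endomorphism \<open>f\<close>, that is, a module over the
  polynomial ring. The set \<open>L k\<close> consists of the leading coefficients of degree \<open>k\<close>.\<close>

lemma Hilbert_basis_endomorphism:
  assumes noeth: "noetherian_ring R"
    and f: "f \<in> carrier M \<rightarrow> carrier M" "\<And>x y. \<lbrakk>x \<in> carrier M; y \<in> carrier M\<rbrakk> \<Longrightarrow> f (x \<oplus>\<^bsub>M\<^esub> y) = f x \<oplus>\<^bsub>M\<^esub> f y"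
      "\<And>r x. \<lbrakk>r \<in> carrier R; x \<in> carrier M\<rbrakk> \<Longrightarrow> f (r \<odot>\<^bsub>M\<^esub> x) = r \<odot>\<^bsub>M\<^esub> f x"
    and S: "finite S" "S \<subseteq> carrier M"
    and N: "submodule N R M" "\<And>x. x \<in> N \<Longrightarrow> f x \<in> N" "N \<subseteq> mspan R M (\<Union>k. (f ^^ k) ` S)"
  shows "\<exists>W. finite W \<and> W \<subseteq> N \<and> N \<subseteq> mspan R M (\<Union>k. (f ^^ k) ` W)"
proof -
  have fkc: "(f ^^ k) x \<in> carrier M" if "x \<in> carrier M" for x k
    using that f(1) by (induction k) auto
  have fk: "(f ^^ k) x \<in> carrier M" "(f ^^ k) (x \<oplus>\<^bsub>M\<^esub> y) = (f ^^ k) x \<oplus>\<^bsub>M\<^esub> (f ^^ k) y"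
    "r \<in> carrier R \<Longrightarrow> (f ^^ k) (r \<odot>\<^bsub>M\<^esub> x) = r \<odot>\<^bsub>M\<^esub> (f ^^ k) x"
    if "x \<in> carrier M" "y \<in> carrier M" for x y r k
    using that fkc by (induction k) (simp_all add: f(2,3) funcset_mem[OF f(1)])
  define X where "X = mspan R M S"
  have X: "submodule X R M" "fg R M X" unfolding X_def using S mspan_submodule fg_finite_span by auto
  have Xc: "X \<subseteq> carrier M" using X submodule_subset by blast
  \<comment> \<open>The elements of degree below k in f.\<close>
  define F where "F k = mspan R M (\<Union>j<k. (f ^^ j) ` S)" for k
  have gen: "(\<Union>j\<in>J. (f ^^ j) ` S) \<subseteq> carrier M" for J using fk(1) S by blast
  have F: "submodule (F k) R M" for k unfolding F_def using mspan_submodule[OF gen] by blast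
  have FSuc: "f y \<in> F (Suc k)" if "y \<in> F k" for y k
  proof -
    have "(\<Union>j<k. (f ^^ j) ` S) \<subseteq> {x \<in> carrier M. f x \<in> F (Suc k)}"
    proof safe
      fix j s assume "j < k" "s \<in> S"
      then show "(f ^^ j) s \<in> carrier M" using fk(1) S by blast
      have "f ((f ^^ j) s) = (f ^^ Suc j) s" by simp
      then show "f ((f ^^ j) s) \<in> F (Suc k)" unfolding F_def using \<open>j < k\<close> \<open>s \<in> S\<close>
        by (intro hull_inc UN_I[of "Suc j"]) auto
    qed
    then show ?thesis
      using mspan_minimal[OF submodule_vimage[of f, OF f F]] that unfolding F_def by blast
  qed
  have Fdecomp: "\<exists>x\<in>X. \<exists>z\<in>F k. y = (f ^^ k) x \<oplus>\<^bsub>M\<^esub> z" if y: "y \<in> F (Suc k)" for y k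
  proof -
    have "(\<Union>j<Suc k. (f ^^ j) ` S) = (f ^^ k) ` S \<union> (\<Union>j<k. (f ^^ j) ` S)" unfolding lessThan_Suc by blast
    then have "y \<in> mspan R M ((f ^^ k) ` S \<union> (\<Union>j<k. (f ^^ j) ` S))" using y unfolding F_def by simp
    then obtain a b where ab: "a \<in> mspan R M ((f ^^ k) ` S)" "b \<in> F k" "y = a \<oplus>\<^bsub>M\<^esub> b"
      using mspan_Un_decomp[of "(f ^^ k) ` S" "\<Union>j<k. (f ^^ j) ` S" y] gen[of "{k}"] gen[of "{..<k}"]
      unfolding F_def by auto
    have "submodule ((f ^^ k) ` X) R M"
    proof (rule submoduleI')
      show "(f ^^ k) ` X \<subseteq> carrier M" using fk(1) Xc by blast
      have "(f ^^ k) \<zero>\<^bsub>M\<^esub> = \<zero>\<^bsub>M\<^esub>"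
        using fk(3)[of "\<zero>\<^bsub>M\<^esub>" "\<zero>\<^bsub>M\<^esub>" "\<zero>\<^bsub>R\<^esub>" k] fk(1)[of "\<zero>\<^bsub>M\<^esub>" "\<zero>\<^bsub>M\<^esub>" k] by simp
      then show "\<zero>\<^bsub>M\<^esub> \<in> (f ^^ k) ` X" using submodule_zero[OF X(1)] by force
      show "r \<odot>\<^bsub>M\<^esub> a \<in> (f ^^ k) ` X" if ra: "r \<in> carrier R" "a \<in> (f ^^ k) ` X" for r a
      proof -
        obtain x where x: "x \<in> X" "a = (f ^^ k) x" using ra by blast
        then have "r \<odot>\<^bsub>M\<^esub> a = (f ^^ k) (r \<odot>\<^bsub>M\<^esub> x)" using fk(3)[of x x r k] ra(1) Xc by auto
        then show ?thesis using submoduleE(4)[OF X(1) ra(1) x(1)] by blast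
      qed
      show "a \<oplus>\<^bsub>M\<^esub> b \<in> (f ^^ k) ` X" if ab': "a \<in> (f ^^ k) ` X" "b \<in> (f ^^ k) ` X" for a b
      proof -
        obtain x y where x: "x \<in> X" "a = (f ^^ k) x" "y \<in> X" "b = (f ^^ k) y" using ab' by blast
        then have "a \<oplus>\<^bsub>M\<^esub> b = (f ^^ k) (x \<oplus>\<^bsub>M\<^esub> y)" using fk(2)[of x y k] Xc by (metis subsetD)
        then show ?thesis using submoduleE(5)[OF X(1) x(1) x(3)] by blast
      qed
    qed
    moreover have "(f ^^ k) ` S \<subseteq> (f ^^ k) ` X" unfolding X_def using hull_subset[of S] by blast
    ultimately have "a \<in> (f ^^ k) ` X" using mspan_minimal ab(1) by blast
    then show ?thesis using ab by blast
  qed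
  define L where "L k = {x \<in> X. \<exists>z\<in>F k. (f ^^ k) x \<oplus>\<^bsub>M\<^esub> z \<in> N}" for k
  have L: "submodule (L k) R M" for k
  proof (rule submoduleI')
    show "L k \<subseteq> carrier M" unfolding L_def using Xc by blast
    have "(f ^^ k) \<zero>\<^bsub>M\<^esub> = \<zero>\<^bsub>M\<^esub>"
      using fk(3)[of "\<zero>\<^bsub>M\<^esub>" "\<zero>\<^bsub>M\<^esub>" "\<zero>\<^bsub>R\<^esub>" k] fk(1)[of "\<zero>\<^bsub>M\<^esub>" "\<zero>\<^bsub>M\<^esub>" k] by simp
    then have "(f ^^ k) \<zero>\<^bsub>M\<^esub> \<oplus>\<^bsub>M\<^esub> \<zero>\<^bsub>M\<^esub> \<in> N" using submodule_zero[OF N(1)] by simp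
    then show "\<zero>\<^bsub>M\<^esub> \<in> L k" unfolding L_def using submodule_zero[OF X(1)] submodule_zero[OF F] by blast
    show "r \<odot>\<^bsub>M\<^esub> a \<in> L k" if ra: "r \<in> carrier R" "a \<in> L k" for r a
    proof -
      obtain z where z: "z \<in> F k" "(f ^^ k) a \<oplus>\<^bsub>M\<^esub> z \<in> N" "a \<in> X" using ra unfolding L_def by blast
      have c: "z \<in> carrier M" "a \<in> carrier M" using z F Xc submodule_subset by blast+
      have "(f ^^ k) (r \<odot>\<^bsub>M\<^esub> a) \<oplus>\<^bsub>M\<^esub> r \<odot>\<^bsub>M\<^esub> z = r \<odot>\<^bsub>M\<^esub> ((f ^^ k) a \<oplus>\<^bsub>M\<^esub> z)"
        using fk(1,3)[of a a] c ra(1) by (simp add: smult_r_distr)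
      then show ?thesis unfolding L_def
        using submoduleE(4)[OF N(1) ra(1) z(2)] submoduleE(4)[OF F ra(1) z(1)] submoduleE(4)[OF X(1) ra(1) z(3)]
        by (auto intro: bexI[of _ "r \<odot>\<^bsub>M\<^esub> z"])
    qed
    show "a \<oplus>\<^bsub>M\<^esub> b \<in> L k" if ab: "a \<in> L k" "b \<in> L k" for a b
    proof -
      obtain z w where z: "z \<in> F k" "(f ^^ k) a \<oplus>\<^bsub>M\<^esub> z \<in> N" "a \<in> X"
        and w: "w \<in> F k" "(f ^^ k) b \<oplus>\<^bsub>M\<^esub> w \<in> N" "b \<in> X" using ab unfolding L_def by blast
      have c: "z \<in> carrier M" "a \<in> carrier M" "w \<in> carrier M" "b \<in> carrier M"
        using z w F Xc submodule_subset by blast+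
      have "(f ^^ k) (a \<oplus>\<^bsub>M\<^esub> b) \<oplus>\<^bsub>M\<^esub> (z \<oplus>\<^bsub>M\<^esub> w) = ((f ^^ k) a \<oplus>\<^bsub>M\<^esub> z) \<oplus>\<^bsub>M\<^esub> ((f ^^ k) b \<oplus>\<^bsub>M\<^esub> w)"
        using fk(2)[of a b] fk(1)[of a b] fk(1)[of b a] c by (simp add: M.a_ac)
      then show ?thesis unfolding L_def
        using submoduleE(5)[OF N(1) z(2) w(2)] submoduleE(5)[OF F z(1) w(1)] submoduleE(5)[OF X(1) z(3) w(3)]
        by (auto intro: bexI[of _ "z \<oplus>\<^bsub>M\<^esub> w"])
    qed
  qed
  \<comment> \<open>Applying f raises the degree by one and keeps the leading coefficient.\<close>
  have Lmono: "L k \<subseteq> L (Suc k)" for k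
  proof
    fix x assume "x \<in> L k"
    then obtain z where z: "z \<in> F k" "(f ^^ k) x \<oplus>\<^bsub>M\<^esub> z \<in> N" "x \<in> X" unfolding L_def by blast
    have c: "z \<in> carrier M" "x \<in> carrier M" using z F Xc submodule_subset by blast+
    have "(f ^^ Suc k) x \<oplus>\<^bsub>M\<^esub> f z \<in> N" using N(2)[OF z(2)] f(2)[OF fk(1)[OF c(2) c(2)] c(1)] by simp
    then show "x \<in> L (Suc k)" unfolding L_def using z(3) FSuc[OF z(1)] by blast
  qed
  obtain e where e: "\<And>k. L k \<subseteq> L e"
    using fg_chain_stable[OF noeth X(2,1), of L] L Lmono unfolding L_def by blast
  have "\<exists>W. finite W \<and> W \<subseteq> N \<and> (\<forall>x\<in>L k. \<exists>z\<in>F k. (f ^^ k) x \<oplus>\<^bsub>M\<^esub> z \<in> mspan R M W)" for k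
  proof -
    have "L k \<subseteq> X" unfolding L_def by blast
    then have "fg R M (L k)" using fg_submodule[OF noeth X(2,1) L] by blast
    then obtain T where T: "finite T" "T \<subseteq> L k" "mspan R M T = L k" unfolding fg_def by blast
    then have "\<forall>x\<in>T. \<exists>z\<in>F k. (f ^^ k) x \<oplus>\<^bsub>M\<^esub> z \<in> N" unfolding L_def by blast
    then obtain z where z: "\<And>x. x \<in> T \<Longrightarrow> z x \<in> F k" "\<And>x. x \<in> T \<Longrightarrow> (f ^^ k) x \<oplus>\<^bsub>M\<^esub> z x \<in> N" by metis
    define W where "W = (\<lambda>x. (f ^^ k) x \<oplus>\<^bsub>M\<^esub> z x) ` T"
    have W: "finite W" "W \<subseteq> N" unfolding W_def using T z by auto
    have Ws: "submodule (mspan R M W) R M" by (rule mspan_submodule) (use W submodule_subset[OF N(1)] in blast)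
    \<comment> \<open>Having f^k x in the span of W up to lower degrees is a submodule condition on
      x, so it is checked on the generators T only.\<close>
    let ?Q = "mspan R M W <+>\<^bsub>M\<^esub> F k"
    have Q: "submodule ?Q R M" using submodule_add[OF Ws F] .
    have fkPi: "(f ^^ k) \<in> carrier M \<rightarrow> carrier M" using fk(1) by blast
    have Qv: "submodule {x \<in> carrier M. (f ^^ k) x \<in> ?Q} R M"
      by (rule submodule_vimage[OF fkPi _ _ Q]) (use fk in auto)
    have "T \<subseteq> {x \<in> carrier M. (f ^^ k) x \<in> ?Q}"
    proof safe
      fix x assume x: "x \<in> T"
      then show xc: "x \<in> carrier M" using T(2) \<open>L k \<subseteq> X\<close> Xc by blast
      have zc: "z x \<in> carrier M" using z(1)[OF x] F submodule_subset by blast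
      have "(f ^^ k) x = ((f ^^ k) x \<oplus>\<^bsub>M\<^esub> z x) \<oplus>\<^bsub>M\<^esub> (\<ominus>\<^bsub>M\<^esub> z x)"
        using fk(1)[OF xc xc] zc by (simp add: M.a_assoc M.r_neg)
      moreover have "(f ^^ k) x \<oplus>\<^bsub>M\<^esub> z x \<in> mspan R M W" using x unfolding W_def by (simp add: hull_inc)
      moreover have "\<ominus>\<^bsub>M\<^esub> z x \<in> F k" using submoduleE(3)[OF F z(1)[OF x]] .
      ultimately show "(f ^^ k) x \<in> ?Q" unfolding set_add_def' by blast
    qed
    then have LQ: "L k \<subseteq> {x \<in> carrier M. (f ^^ k) x \<in> ?Q}" using mspan_minimal[OF Qv] T(3) by blast
    have "\<exists>z\<in>F k. (f ^^ k) x \<oplus>\<^bsub>M\<^esub> z \<in> mspan R M W" if x: "x \<in> L k" for x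
    proof -
      obtain a b where ab: "a \<in> mspan R M W" "b \<in> F k" "(f ^^ k) x = a \<oplus>\<^bsub>M\<^esub> b"
        using LQ x unfolding set_add_def' by blast
      have c: "a \<in> carrier M" "b \<in> carrier M" using ab Ws F submodule_subset by blast+
      have "(f ^^ k) x \<oplus>\<^bsub>M\<^esub> (\<ominus>\<^bsub>M\<^esub> b) = a" using ab c by (simp add: M.a_assoc M.r_neg)
      then show ?thesis using ab(1) submoduleE(3)[OF F ab(2)] by (metis (full_types))
    qed
    then show ?thesis using W by blast
  qed
  then obtain W where W: "\<And>k. finite (W k)" "\<And>k. W k \<subseteq> N"
    "\<And>k x. x \<in> L k \<Longrightarrow> \<exists>z\<in>F k. (f ^^ k) x \<oplus>\<^bsub>M\<^esub> z \<in> mspan R M (W k)" by metis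
  \<comment> \<open>No new leading coefficients occur beyond degree e, so the elements chosen for
    the degrees up to e suffice.\<close>
  define V where "V = (\<Union>k\<le>e. W k)"
  define P where "P = mspan R M (\<Union>k. (f ^^ k) ` V)"
  have V: "finite V" "V \<subseteq> N" unfolding V_def using W by auto
  have Nc: "N \<subseteq> carrier M" using N submodule_subset by blast
  have Vc: "(\<Union>k. (f ^^ k) ` V) \<subseteq> carrier M" using V Nc fk(1) by blast
  have P: "submodule P R M" unfolding P_def using mspan_submodule[OF Vc] .
  have Pf: "f y \<in> P" if "y \<in> P" for y
  proof -
    have "(\<Union>k. (f ^^ k) ` V) \<subseteq> {x \<in> carrier M. f x \<in> P}"
    proof safe
      fix j s assume s: "s \<in> V"
      then show "(f ^^ j) s \<in> carrier M" using Vc by blast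
      have "f ((f ^^ j) s) = (f ^^ Suc j) s" by simp
      then show "f ((f ^^ j) s) \<in> P" unfolding P_def using s
        by (intro hull_inc UN_I[of "Suc j"]) auto
    qed
    then show ?thesis
      using mspan_minimal[OF submodule_vimage[of f, OF f P]] that unfolding P_def by blast
  qed
  have Pfk: "(f ^^ j) y \<in> P" if "y \<in> P" for y j using Pf that by (induction j) auto
  have VP: "mspan R M (W k) \<subseteq> P" if "k \<le> e" for k
    using mspan_minimal[OF P] that unfolding P_def V_def
    by (intro hull_mono) (auto intro!: UN_I[of 0])
  have fN: "(f ^^ j) y \<in> N" if "y \<in> N" for y j using N(2) that by (induction j) auto
  have PN: "P \<subseteq> N" unfolding P_def by (rule mspan_minimal[OF N(1)]) (use V fN in blast)
  have F_shift: "(f ^^ j) z \<in> F (k + j)" if "z \<in> F k" for z j k using FSuc that by (induction j) auto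
  \<comment> \<open>For k > e the leading coefficient occurs already in degree e, and f^(k - e)
    moves the witness up to degree k.\<close>
  have lead: "\<exists>z\<in>F k. (f ^^ k) x \<oplus>\<^bsub>M\<^esub> z \<in> P" if x: "x \<in> L k" for x k
  proof (cases "k \<le> e")
    case True
    then show ?thesis using W(3)[OF x] VP by blast
  next
    case False
    obtain z where z: "z \<in> F e" "(f ^^ e) x \<oplus>\<^bsub>M\<^esub> z \<in> P" using W(3)[of x e] e[of k] x VP[of e] by auto
    have c: "x \<in> carrier M" "z \<in> carrier M" using x L z(1) F submodule_subset by blast+
    have "(f ^^ (k - e)) ((f ^^ e) x) = (f ^^ k) x" using False by (simp flip: funpow_add[unfolded comp_def, THEN fun_cong])
    then have "(f ^^ k) x \<oplus>\<^bsub>M\<^esub> (f ^^ (k - e)) z \<in> P"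
      using Pfk[OF z(2), of "k - e"] fk(2)[of "(f ^^ e) x" z "k - e"] fk(1)[of x x] c by simp
    moreover have "(f ^^ (k - e)) z \<in> F k" using F_shift[OF z(1), of "k - e"] False by simp
    ultimately show ?thesis by blast
  qed
  \<comment> \<open>Removing the leading term by an element of P lowers the degree.\<close>
  have "y \<in> P" if "y \<in> N" "y \<in> F k" for y k using that
  proof (induction k arbitrary: y)
    case 0
    then have "y = \<zero>\<^bsub>M\<^esub>" unfolding F_def by (simp add: mspan_empty)
    then show ?case using submodule_zero[OF P] by simp
  next
    case (Suc k)
    obtain x z where x: "x \<in> X" "z \<in> F k" "y = (f ^^ k) x \<oplus>\<^bsub>M\<^esub> z" using Fdecomp[OF Suc.prems(2)] by blast
    then have "x \<in> L k" unfolding L_def using Suc.prems by blast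
    then obtain z' where z': "z' \<in> F k" "(f ^^ k) x \<oplus>\<^bsub>M\<^esub> z' \<in> P" using lead by blast
    have c: "x \<in> carrier M" "z \<in> carrier M" "z' \<in> carrier M" using x z' Xc F submodule_subset by blast+
    have eq: "y \<ominus>\<^bsub>M\<^esub> ((f ^^ k) x \<oplus>\<^bsub>M\<^esub> z') = z \<ominus>\<^bsub>M\<^esub> z'"
      using c x(3) fk(1)[of x x k] by (simp add: diff_add minus_self)
    have "z \<ominus>\<^bsub>M\<^esub> z' \<in> N" using submodule_minus[OF N(1) Suc.prems(1), of "(f ^^ k) x \<oplus>\<^bsub>M\<^esub> z'"] z'(2) PN unfolding eq by blast
    moreover have "z \<ominus>\<^bsub>M\<^esub> z' \<in> F k" using submodule_minus[OF F x(2) z'(1)] .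
    ultimately have "y \<ominus>\<^bsub>M\<^esub> ((f ^^ k) x \<oplus>\<^bsub>M\<^esub> z') \<in> P" using Suc.IH eq by simp
    then show ?case using submodule_diffD[OF P _ z'(2)] Suc.prems(1) Nc by blast
  qed
  moreover have "\<exists>k. y \<in> F k" if "y \<in> N" for y
  proof -
    have Fmono: "F k \<subseteq> F (Suc k)" for k unfolding F_def by (intro hull_mono) (force simp: lessThan_Suc)
    have "(\<Union>k. (f ^^ k) ` S) \<subseteq> (\<Union>k. F k)" unfolding F_def
      by (auto intro!: exI[of _ "Suc _"] hull_inc)
    then have "mspan R M (\<Union>k. (f ^^ k) ` S) \<subseteq> (\<Union>k. F k)"
      by (rule mspan_minimal[OF submodule_Union_chain[of F, OF F Fmono]])
    then show ?thesis using N(3) that by blast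
  qed
  ultimately have "N \<subseteq> P" by blast
  then show ?thesis using V unfolding P_def by blast
qed

end

section \<open>Subrings of fields\<close>

lemma ring_of_type_simps:
  "carrier ring_of_type_algebra = UNIV" "x \<otimes>\<^bsub>ring_of_type_algebra\<^esub> y = x * y"
  "x \<oplus>\<^bsub>ring_of_type_algebra\<^esub> y = x + y" "\<zero>\<^bsub>ring_of_type_algebra\<^esub> = 0" "\<one>\<^bsub>ring_of_type_algebra\<^esub> = 1"
  by (simp_all add: ring_of_type_algebra_def)

locale field_subring =
  fixes A :: "'a::field set"
  assumes zero_in: "0 \<in> A" and one_in: "1 \<in> A"
    and add_in: "\<lbrakk>x \<in> A; y \<in> A\<rbrakk> \<Longrightarrow> x + y \<in> A"
    and mult_in: "\<lbrakk>x \<in> A; y \<in> A\<rbrakk> \<Longrightarrow> x * y \<in> A"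
    and uminus_in: "x \<in> A \<Longrightarrow> - x \<in> A"
begin

lemma diff_in: "\<lbrakk>x \<in> A; y \<in> A\<rbrakk> \<Longrightarrow> x - y \<in> A"
  using add_in[of x "- y"] uminus_in by simp

lemma sum_in: "(\<And>i. i \<in> I \<Longrightarrow> f i \<in> A) \<Longrightarrow> sum f I \<in> A"
  by (induction I rule: infinite_finite_induct) (auto simp: zero_in add_in)

lemma power_in: "x \<in> A \<Longrightarrow> x ^ n \<in> A"
  by (induction n) (auto simp: one_in mult_in)

lemma of_nat_in: "of_nat n \<in> A"
  by (induction n) (auto simp: zero_in one_in add_in)

lemma of_int_in: "of_int n \<in> A"
  by (cases n) (auto simp: of_nat_in uminus_in diff_in one_in simp del: of_nat_Suc)

lemma poly_in: "\<lbrakk>set (coeffs f) \<subseteq> A; x \<in> A\<rbrakk> \<Longrightarrow> poly f x \<in> A"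
proof (induction f)
  case (pCons a f)
  then show ?case
    by (auto simp: zero_in add_in mult_in cCons_def split: if_splits)
qed (simp add: zero_in)

lemma subset_ring_simps:
  "carrier (subset_ring A) = A" "x \<otimes>\<^bsub>subset_ring A\<^esub> y = x * y" "x \<oplus>\<^bsub>subset_ring A\<^esub> y = x + y"
  "\<zero>\<^bsub>subset_ring A\<^esub> = 0" "\<one>\<^bsub>subset_ring A\<^esub> = 1"
  by (simp_all add: ring_of_type_algebra_def)

lemma cring_subset_ring: "cring (subset_ring A)"
proof (rule cringI)
  show "abelian_group (subset_ring A)"
    by (rule abelian_groupI)
      (auto simp: ring_of_type_algebra_def zero_in add_in algebra_simps intro!: bexI[of _ "- _"] uminus_in)
  show "comm_monoid (subset_ring A)"
    by (rule comm_monoidI) (auto simp: ring_of_type_algebra_def one_in mult_in)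
qed (auto simp: ring_of_type_algebra_def algebra_simps)

lemma ideal_subset_ring:
  "ideal I (subset_ring A) \<longleftrightarrow> I \<subseteq> A \<and> 0 \<in> I \<and> (\<forall>x\<in>I. \<forall>y\<in>I. x + y \<in> I) \<and> (\<forall>x\<in>I. \<forall>a\<in>A. a * x \<in> I)"
  (is "_ \<longleftrightarrow> ?R")
proof
  assume "ideal I (subset_ring A)"
  then interpret ideal I "subset_ring A" .
  have "x + y \<in> I" if "x \<in> I" "y \<in> I" for x y using additive_subgroup.a_closed[OF is_additive_subgroup that] by (simp add: ring_of_type_simps)
  moreover have "a * x \<in> I" if "x \<in> I" "a \<in> A" for x a
    using I_l_closed[of x a] that by (simp add: ring_of_type_simps)
  moreover have "0 \<in> I" using additive_subgroup.zero_closed[OF is_additive_subgroup] by (simp add: ring_of_type_simps)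
  moreover have "I \<subseteq> A" using a_subset by simp
  ultimately show ?R by blast
next
  assume R: ?R
  interpret cring "subset_ring A" by (rule cring_subset_ring)
  show "ideal I (subset_ring A)"
  proof (rule idealI)
    show "subgroup I (add_monoid (subset_ring A))"
    proof (rule add.subgroupI)
      fix a assume a: "a \<in> I"
      have "\<ominus>\<^bsub>subset_ring A\<^esub> a = - a" using minus_equality[of "- a" a] a R uminus_in
        by (auto simp: ring_of_type_simps)
      moreover have "- a \<in> I" using R a uminus_in[OF one_in] by fastforce
      ultimately show "\<ominus>\<^bsub>subset_ring A\<^esub> a \<in> I" by simp
    qed (use R in \<open>auto simp: ring_of_type_simps\<close>)
  qed (use R in \<open>auto simp: ring_of_type_simps mult.commute ring_axioms\<close>)
qed

text \<open>Sets the zero ideal aside and replaces the generated ideal by a minimality condition,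
  which can be checked on elements of the field.\<close>

lemma noetherian_subset_ringI:
  assumes "\<And>I x. \<lbrakk>ideal I (subset_ring A); x \<in> I; x \<noteq> 0\<rbrakk> \<Longrightarrow>
    \<exists>S. finite S \<and> S \<subseteq> I \<and> (\<forall>J. ideal J (subset_ring A) \<and> S \<subseteq> J \<longrightarrow> I \<subseteq> J)"
  shows "noetherian_ring (subset_ring A)"
proof -
  interpret cring "subset_ring A" by (rule cring_subset_ring)
  show ?thesis
  proof (rule noetherian_ringI)
    fix I assume I: "ideal I (subset_ring A)"
    have I0: "0 \<in> I" "I \<subseteq> A" using I unfolding ideal_subset_ring by auto
    have "\<exists>S. finite S \<and> S \<subseteq> I \<and> (\<forall>J. ideal J (subset_ring A) \<and> S \<subseteq> J \<longrightarrow> I \<subseteq> J)"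
    proof (cases "I = {0}")
      case True
      then show ?thesis by (intro exI[of _ "{0}"]) auto
    next
      case False
      then show ?thesis using assms[OF I] I0 by blast
    qed
    then obtain S where S: "finite S" "S \<subseteq> I" "\<forall>J. ideal J (subset_ring A) \<and> S \<subseteq> J \<longrightarrow> I \<subseteq> J" by (elim exE conjE)
    have Sc: "S \<subseteq> carrier (subset_ring A)" using S(2) I0 by (simp add: subset_ring_simps)
    have "I = Idl\<^bsub>subset_ring A\<^esub> S"
      using genideal_minimal[OF I S(2)] S(3)[rule_format, OF conjI, OF genideal_ideal[OF Sc] genideal_self[OF Sc]] by (rule equalityI[rotated])
    then show "\<exists>S\<subseteq>carrier (subset_ring A). finite S \<and> I = Idl\<^bsub>subset_ring A\<^esub> S" using S(1) Sc by blast
  qed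
qed

text \<open>The field as a module over its subring A, so that the results on finitely generated
  submodules apply to powers of an element.\<close>

definition fmod :: "('a, 'a) module" where
  "fmod = \<lparr>carrier = UNIV, monoid.mult = undefined, one = undefined, ring.zero = 0, add = (+), smult = (*)\<rparr>"

lemma fmod_simps: "carrier fmod = UNIV" "\<zero>\<^bsub>fmod\<^esub> = 0" "x \<oplus>\<^bsub>fmod\<^esub> y = x + y" "a \<odot>\<^bsub>fmod\<^esub> x = a * x"
  unfolding fmod_def by simp_all

lemma module_fmod: "Module.module (subset_ring A) fmod"
proof (rule moduleI)
  show "abelian_group fmod"
    by (rule abelian_groupI) (auto simp: fmod_simps algebra_simps intro: exI[of _ "- _"])
qed (auto simp: fmod_simps ring_of_type_simps cring_subset_ring distrib_left distrib_right mult.assoc)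

lemma submodule_fmod:
  "submodule N (subset_ring A) fmod \<longleftrightarrow>
    0 \<in> N \<and> (\<forall>x\<in>N. \<forall>y\<in>N. x + y \<in> N) \<and> (\<forall>x\<in>N. \<forall>a\<in>A. a * x \<in> N)" (is "_ \<longleftrightarrow> ?R")
proof -
  interpret Module.module "subset_ring A" fmod by (rule module_fmod)
  show ?thesis
  proof
    assume N: "submodule N (subset_ring A) fmod"
    show ?R using submodule_zero[OF N] submoduleE(4,5)[OF N] by (auto simp: fmod_simps subset_ring_simps)
  next
    assume ?R
    then show "submodule N (subset_ring A) fmod"
      by (intro submoduleI') (auto simp: fmod_simps subset_ring_simps)
  qed
qed

abbreviation fspan :: "'a set \<Rightarrow> 'a set" where "fspan S \<equiv> mspan (subset_ring A) fmod S"

lemma fspan_submodule: "submodule (fspan S) (subset_ring A) fmod"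
  by (rule module.mspan_submodule[OF module_fmod]) (simp add: fmod_simps)

lemma fspan_closed: "0 \<in> fspan S" "\<lbrakk>x \<in> fspan S; y \<in> fspan S\<rbrakk> \<Longrightarrow> x + y \<in> fspan S"
  "\<lbrakk>a \<in> A; x \<in> fspan S\<rbrakk> \<Longrightarrow> a * x \<in> fspan S"
  using fspan_submodule[of S] unfolding submodule_fmod by auto

lemma fspan_sum: "(\<And>i. i \<in> I \<Longrightarrow> f i \<in> fspan S) \<Longrightarrow> sum f I \<in> fspan S"
  by (induction I rule: infinite_finite_induct) (auto simp: fspan_closed)

lemma fspan_minimal:
  "\<lbrakk>S \<subseteq> N; 0 \<in> N; \<And>x y. \<lbrakk>x \<in> N; y \<in> N\<rbrakk> \<Longrightarrow> x + y \<in> N; \<And>x a. \<lbrakk>x \<in> N; a \<in> A\<rbrakk> \<Longrightarrow> a * x \<in> N\<rbrakk> \<Longrightarrow> fspan S \<subseteq> N"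
  by (rule hull_minimal) (auto simp: submodule_fmod)

subsection \<open>Integral elements\<close>

lemma base_subset_integral_closure: "A \<subseteq> integral_closure A"
proof
  fix x assume "x \<in> A"
  then show "x \<in> integral_closure A" unfolding integral_closure_def
    using uminus_in one_in zero_in by (intro CollectI exI[of _ "[:- x, 1:]"]) (auto simp: cCons_def)
qed

lemma monic_root_power:
  fixes f :: "'a poly"
  assumes "Polynomial.lead_coeff f = 1" "poly f x = 0"
  shows "x ^ Polynomial.degree f = - (\<Sum>i<Polynomial.degree f. Polynomial.coeff f i * x ^ i)"
proof -
  have "0 = (\<Sum>i\<le>Polynomial.degree f. Polynomial.coeff f i * x ^ i)" using assms(2) by (simp add: poly_altdef)
  also have "\<dots> = (\<Sum>i<Polynomial.degree f. Polynomial.coeff f i * x ^ i) + x ^ Polynomial.degree f"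
    using assms(1) by (simp flip: lessThan_Suc_atMost)
  finally show ?thesis by (simp add: add_eq_0_iff)
qed

lemma coeff_in: "set (coeffs f) \<subseteq> A \<Longrightarrow> Polynomial.coeff f i \<in> A"
  using zero_in by (metis coeff_in_coeffs coeff_0 coeff_eq_0 leI subsetD)

text \<open>The monic equation rewrites \<open>x ^ k\<close> through lower powers as soon as k
  reaches its degree.\<close>

lemma integral_imp_powers_finite_span:
  assumes "x \<in> integral_closure A"
  shows "\<exists>S. finite S \<and> range (\<lambda>k. x ^ k) \<subseteq> fspan S"
proof -
  obtain f where f: "Polynomial.lead_coeff f = 1" "set (coeffs f) \<subseteq> A" "poly f x = 0"
    using assms unfolding integral_closure_def by blast
  let ?S = "(\<lambda>i. x ^ i) ` {..<Polynomial.degree f}"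
  have "x ^ k \<in> fspan ?S" for k
  proof (induction k rule: less_induct)
    case (less k)
    show ?case
    proof (cases "k < Polynomial.degree f")
      case True
      then show ?thesis by (auto intro: hull_inc)
    next
      case False
      then have "x ^ k = x ^ (k - Polynomial.degree f) * x ^ Polynomial.degree f" by (simp flip: power_add)
      also have "\<dots> = (\<Sum>i<Polynomial.degree f. (- Polynomial.coeff f i) * x ^ (k - Polynomial.degree f + i))"
        using monic_root_power[OF f(1,3)]
        by (simp add: sum_distrib_left sum_negf power_add algebra_simps)
      also have "\<dots> \<in> fspan ?S"
        using False by (intro fspan_sum fspan_closed(3) less.IH uminus_in coeff_in[OF f(2)]) auto
      finally show ?thesis .
    qed
  qed
  then show ?thesis by blast
qed

lemma powers_finite_span_imp_integral:
  assumes noeth: "noetherian_ring (subset_ring A)" and S: "finite S" "range (\<lambda>k. x ^ k) \<subseteq> fspan S"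
  shows "x \<in> integral_closure A"
proof -
  interpret Module.module "subset_ring A" fmod by (rule module_fmod)
  define N where "N k = fspan ((\<lambda>i. x ^ i) ` {..<k})" for k
  have "N k \<subseteq> fspan S" for k unfolding N_def
    by (rule mspan_minimal[OF fspan_submodule]) (use S(2) in blast)
  moreover have "N k \<subseteq> N (Suc k)" for k unfolding N_def by (intro hull_mono) auto
  moreover have "fg (subset_ring A) fmod (fspan S)" using fg_finite_span[OF S(1)] by (simp add: fmod_simps)
  ultimately obtain e where e: "\<And>k. N k \<subseteq> N e"
    using fg_chain_stable[OF noeth _ fspan_submodule[of S], of N] fspan_submodule unfolding N_def by blast
  have "x ^ e \<in> N (Suc e)" unfolding N_def by (auto intro: hull_inc)
  then have xe: "x ^ e \<in> N e" using e by blast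
  have "N e \<subseteq> {y. \<exists>a. (\<forall>i. a i \<in> A) \<and> y = (\<Sum>i<e. a i * x ^ i)}" unfolding N_def
  proof (rule fspan_minimal, safe)
    fix i :: nat assume "i < e"
    then show "\<exists>a. (\<forall>i. a i \<in> A) \<and> x ^ i = (\<Sum>i<e. a i * x ^ i)"
      by (intro exI[of _ "\<lambda>j. if j = i then 1 else 0"]) (auto simp: zero_in one_in if_distrib if_distribR sum.delta cong: if_cong)
  next
    show "\<exists>a. (\<forall>i. a i \<in> A) \<and> 0 = (\<Sum>i<e. a i * x ^ i)"
      by (intro exI[of _ "\<lambda>_. 0"]) (auto simp: zero_in)
  next
    fix a b :: "nat \<Rightarrow> 'a" assume "\<forall>i. a i \<in> A" "\<forall>i. b i \<in> A"
    then show "\<exists>c. (\<forall>i. c i \<in> A) \<and> (\<Sum>i<e. a i * x ^ i) + (\<Sum>i<e. b i * x ^ i) = (\<Sum>i<e. c i * x ^ i)"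
      by (intro exI[of _ "\<lambda>i. a i + b i"]) (auto simp: add_in sum.distrib algebra_simps)
  next
    fix a and b :: "nat \<Rightarrow> 'a" assume "\<forall>i. b i \<in> A" "a \<in> A"
    then show "\<exists>c. (\<forall>i. c i \<in> A) \<and> a * (\<Sum>i<e. b i * x ^ i) = (\<Sum>i<e. c i * x ^ i)"
      by (intro exI[of _ "\<lambda>i. a * b i"]) (auto simp: mult_in sum_distrib_left algebra_simps)
  qed
  then obtain a where a: "\<And>i. a i \<in> A" "x ^ e = (\<Sum>i<e. a i * x ^ i)" using xe by blast
  define g where "g = (\<Sum>i<e. Polynomial.monom (a i) i)"
  have cg: "Polynomial.coeff g i = (if i < e then a i else 0)" for i
    unfolding g_def by (simp add: coeff_sum sum.delta cong: if_cong)
  define f where "f = Polynomial.monom 1 e - g"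
  have cf: "Polynomial.coeff f i = (if i = e then 1 else if i < e then - a i else 0)" for i
    unfolding f_def by (auto simp: cg)
  have deg: "Polynomial.degree f = e"
    by (rule antisym) (auto intro: degree_le le_degree simp: cf)
  have "poly f x = x ^ e - (\<Sum>i<e. a i * x ^ i)"
    unfolding f_def g_def by (simp add: poly_sum poly_monom)
  then have "poly f x = 0" using a by simp
  moreover have "set (coeffs f) \<subseteq> A"
    using a uminus_in one_in zero_in by (auto simp: coeffs_def cf simp del: upt_Suc)
  moreover have "Polynomial.lead_coeff f = 1" using deg cf by simp
  ultimately show ?thesis unfolding integral_closure_def by blast
qed

text \<open>If the powers of x lie in the span of S and those of y in the span of T, then the powers
  of x y and of x + y lie in the span of the products s t.\<close>

lemma integral_closure_subring:
  assumes noeth: "noetherian_ring (subset_ring A)"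
  shows "field_subring (integral_closure A)"
proof -
  have mult_add: "x * y \<in> integral_closure A \<and> x + y \<in> integral_closure A"
    if xy: "x \<in> integral_closure A" "y \<in> integral_closure A" for x y
  proof -
    obtain S T where S: "finite S" "range (\<lambda>k. x ^ k) \<subseteq> fspan S" and T: "finite T" "range (\<lambda>k. y ^ k) \<subseteq> fspan T"
      using xy[THEN integral_imp_powers_finite_span] by blast
    let ?W = "(\<lambda>(s, t). s * t) ` (S \<times> T)"
    have fin: "finite ?W" using S T by simp
    have 1: "s * y ^ j \<in> fspan ?W" if "s \<in> S" for s j
    proof -
      have "fspan T \<subseteq> {t. s * t \<in> fspan ?W}"
      proof (rule fspan_minimal)
        show "T \<subseteq> {t. s * t \<in> fspan ?W}" using that by (auto intro!: hull_inc)
      qed (auto simp: fspan_closed distrib_left mult.left_commute[of s])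
      then show ?thesis using T(2) by blast
    qed
    have prod: "x ^ i * y ^ j \<in> fspan ?W" for i j
    proof -
      have "fspan S \<subseteq> {s. s * y ^ j \<in> fspan ?W}"
        by (rule fspan_minimal) (auto simp: fspan_closed distrib_right mult.assoc 1)
      then show ?thesis using S(2) by blast
    qed
    have "(x * y) ^ k \<in> fspan ?W" for k using prod[of k k] by (simp add: power_mult_distrib)
    moreover have "(x + y) ^ k \<in> fspan ?W" for k
      unfolding binomial_ring mult.assoc by (intro fspan_sum fspan_closed(3) of_nat_in prod)
    ultimately show ?thesis using powers_finite_span_imp_integral[OF noeth fin] by blast
  qed
  have sub: "x \<in> A \<Longrightarrow> x \<in> integral_closure A" for x using base_subset_integral_closure by blast
  show ?thesis
  proof
    show "- x \<in> integral_closure A" if "x \<in> integral_closure A" for x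
      using mult_add[OF sub[OF uminus_in[OF one_in]] that] by simp
  qed (use mult_add sub zero_in one_in in auto)
qed

end

section \<open>Finite extensions of the field of p-adic numbers\<close>

text \<open>The image \<open>A\<close> of the \<open>p\<close>-adic integers in a field of finite degree over its field of
  fractions. The assumption \<open>digits\<close> is the form in which completeness is used.\<close>

locale padic_extension = field_subring A for A :: "'a::field set" +
  fixes p :: nat and N :: nat
  assumes p_prime: "Factorial_Ring.prime p"
    and p_nonzero: "of_nat p \<noteq> (0::'a)"
    and p_not_unit: "y \<in> A \<Longrightarrow> of_nat p * y \<noteq> 1"
    and nonzero_in_A: "\<lbrakk>x \<in> A; x \<noteq> 0\<rbrakk> \<Longrightarrow> \<exists>k u v. x = of_nat p ^ k * u \<and> u \<in> A \<and> v \<in> A \<and> u * v = 1"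
    and digits: "\<exists>z\<in>A. \<forall>n. \<exists>w\<in>A. z - (\<Sum>j<n. of_nat (c j) * of_nat p ^ j) = of_nat p ^ n * w"
    and residue_A: "x \<in> A \<Longrightarrow> \<exists>c::int. \<exists>w\<in>A. x = of_int c + of_nat p * w"
    and dependence: "\<exists>c. (\<forall>i\<le>N. c i \<in> A) \<and> (\<exists>i\<le>N. c i \<noteq> 0) \<and> (\<Sum>i\<le>N. c i * f i) = (0::'a)"
begin

abbreviation P :: 'a where "P \<equiv> of_nat p"

abbreviation \<O> :: "'a set" where "\<O> \<equiv> integral_closure A"

lemma P_in: "P \<in> A" by (rule of_nat_in)

text \<open>Nonzero elements are powers of p times units, so a nonzero ideal is generated by the
  smallest power of p that it contains.\<close>

lemma noetherian_base: "noetherian_ring (subset_ring A)"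
proof (rule noetherian_subset_ringI)
  fix I x assume I: "ideal I (subset_ring A)" and x: "x \<in> I" "x \<noteq> 0"
  have closed: "0 \<in> I" "I \<subseteq> A" "\<And>x a. \<lbrakk>x \<in> I; a \<in> A\<rbrakk> \<Longrightarrow> a * x \<in> I" using I unfolding ideal_subset_ring by auto
  have ppow: "\<exists>k v. P ^ k \<in> I \<and> v \<in> A \<and> y = P ^ k * v" if y: "y \<in> I" "y \<noteq> 0" for y
  proof -
    obtain k u v where kuv: "y = P ^ k * u" "u \<in> A" "v \<in> A" "u * v = 1" using nonzero_in_A y closed(2) by blast
    then have "v * y = P ^ k" by (simp add: algebra_simps)
    then have "P ^ k \<in> I" using closed(3)[OF y(1) kuv(3)] by simp
    then show ?thesis using kuv(1,2) by blast
  qed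
  have ex: "\<exists>k. P ^ k \<in> I" using ppow[OF x] by (elim exE conjE) (rule exI)
  define k where "k = (LEAST k. P ^ k \<in> I)"
  have k: "P ^ k \<in> I" unfolding k_def using ex by (rule LeastI_ex)
  have "I \<subseteq> J" if J: "ideal J (subset_ring A)" "P ^ k \<in> J" for J
  proof
    fix y assume y: "y \<in> I"
    show "y \<in> J"
    proof (cases "y = 0")
      case True
      then show ?thesis using J unfolding ideal_subset_ring by simp
    next
      case False
      then obtain j u where j: "P ^ j \<in> I" "u \<in> A" "y = P ^ j * u" using ppow[OF y] by blast
      then have "k \<le> j" unfolding k_def by (intro Least_le)
      then have "y = (u * P ^ (j - k)) * P ^ k" using j by (simp add: mult.assoc flip: power_add)
      moreover have "u * P ^ (j - k) \<in> A" using j P_in by (intro mult_in power_in)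
      ultimately show ?thesis using J unfolding ideal_subset_ring by blast
    qed
  qed
  then show "\<exists>S. finite S \<and> S \<subseteq> I \<and> (\<forall>J. ideal J (subset_ring A) \<and> S \<subseteq> J \<longrightarrow> I \<subseteq> J)"
    using k by (intro exI[of _ "{P ^ k}"]) auto
qed

sublocale O: field_subring \<O>
  by (rule integral_closure_subring[OF noetherian_base])

lemma A_subset_O: "A \<subseteq> \<O>" by (rule base_subset_integral_closure)

lemma P_in_O: "P \<in> \<O>" by (rule O.of_nat_in)

text \<open>A monic equation of degree n for an inverse of p, multiplied by p^n, would write 1 as p
  times an element of A.\<close>

lemma P_not_unit_O: assumes y: "y \<in> \<O>" shows "P * y \<noteq> 1"
proof
  assume Py: "P * y = 1"
  obtain f where f: "Polynomial.lead_coeff f = 1" "set (coeffs f) \<subseteq> A" "poly f y = 0"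
    using y unfolding integral_closure_def by blast
  let ?n = "Polynomial.degree f"
  have "1 = P ^ ?n * y ^ ?n" using Py by (simp flip: power_mult_distrib)
  also have "\<dots> = - (\<Sum>i<?n. Polynomial.coeff f i * (P ^ ?n * y ^ i))"
    by (simp add: monic_root_power[OF f(1,3)] sum_distrib_left algebra_simps)
  also have "(\<Sum>i<?n. Polynomial.coeff f i * (P ^ ?n * y ^ i)) = (\<Sum>i<?n. Polynomial.coeff f i * (P * P ^ (?n - Suc i)))"
  proof (rule sum.cong)
    fix i assume "i \<in> {..<?n}"
    then have "P ^ ?n = P ^ Suc (?n - Suc i) * P ^ i" by (simp flip: power_add power_Suc)
    then have "P ^ ?n * y ^ i = P ^ Suc (?n - Suc i) * (P * y) ^ i" by (simp only: power_mult_distrib mult.assoc)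
    then show "Polynomial.coeff f i * (P ^ ?n * y ^ i) = Polynomial.coeff f i * (P * P ^ (?n - Suc i))" using Py by simp
  qed simp
  also have "\<dots> = P * (\<Sum>i<?n. Polynomial.coeff f i * P ^ (?n - Suc i))"
    by (simp add: sum_distrib_left algebra_simps)
  finally have "P * (- (\<Sum>i<?n. Polynomial.coeff f i * P ^ (?n - Suc i))) = 1" by simp
  moreover have "- (\<Sum>i<?n. Polynomial.coeff f i * P ^ (?n - Suc i)) \<in> A"
    using coeff_in[OF f(2)] P_in by (intro uminus_in sum_in mult_in power_in)
  ultimately show False using p_not_unit by blast
qed

text \<open>In a monic equation of least degree the constant term is a nonzero element of A and a
  multiple of x; up to a unit it is a power of p.\<close>

lemma divides_power:
  assumes x: "x \<in> \<O>" "x \<noteq> 0"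
  shows "\<exists>y\<in>\<O>. \<exists>k. x * y = P ^ k"
proof -
  let ?Q = "\<lambda>f. Polynomial.lead_coeff f = 1 \<and> set (coeffs f) \<subseteq> A \<and> poly f x = 0"
  have "\<exists>f. ?Q f" using x unfolding integral_closure_def by blast
  then obtain f where f: "?Q f" and min: "\<And>g. ?Q g \<Longrightarrow> Polynomial.degree f \<le> Polynomial.degree g"
    using ex_has_least_nat[of ?Q _ Polynomial.degree] by blast
  obtain a g where fg: "f = pCons a g" by (cases f)
  have g0: "g \<noteq> 0" using f fg by auto
  then have g: "Polynomial.lead_coeff g = 1" "set (coeffs g) \<subseteq> A" "a \<in> A"
    using f unfolding fg by (auto simp: cCons_def split: if_splits)
  have eq: "x * (- poly g x) = a" using f unfolding fg by (simp add: add_eq_0_iff)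
  have "a \<noteq> 0"
  proof
    assume "a = 0"
    then have "?Q g" using eq x(2) g by simp
    from min[OF this] show False using g0 unfolding fg by simp
  qed
  then obtain k u v where kuv: "a = P ^ k * u" "u \<in> A" "v \<in> A" "u * v = 1" using nonzero_in_A g by blast
  have "set (coeffs g) \<subseteq> \<O>" using g A_subset_O by blast
  then have "- poly g x * v \<in> \<O>" using O.poly_in x(1) kuv A_subset_O by (intro O.mult_in O.uminus_in) auto
  moreover have "x * (- poly g x * v) = P ^ k"
    using eq kuv by (metis mult.assoc mult.right_neutral)
  ultimately show ?thesis by blast
qed

lemma P_power_nonzero: "P ^ k \<noteq> 0" using p_nonzero by simp

lemma Inter_P_power: assumes "x \<in> \<O>" "\<And>k. \<exists>y\<in>\<O>. x = P ^ k * y" shows "x = 0"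
proof (rule ccontr)
  assume "x \<noteq> 0"
  then obtain y k where y: "y \<in> \<O>" "x * y = P ^ k" using divides_power assms(1) by blast
  obtain z where z: "z \<in> \<O>" "x = P ^ Suc k * z" using assms(2) by blast
  then have "P ^ k * (P * (z * y)) = P ^ k * 1" using y by (simp add: algebra_simps)
  then have "P * (z * y) = 1" using P_power_nonzero by (metis mult_left_cancel)
  then show False using P_not_unit_O[OF O.mult_in[OF z(1) y(1)]] by blast
qed

text \<open>The powers of x are linearly dependent over A. If c is the leading coefficient of a
  relation of degree d, multiplying the relation by c^(d - 1) gives a monic equation for c x, and c
  is a power of p times a unit.\<close>

lemma fraction: "\<exists>k. P ^ k * x \<in> \<O>"
proof -
  obtain c where c: "\<And>i. i \<le> N \<Longrightarrow> c i \<in> A" "\<exists>i\<le>N. c i \<noteq> 0" "(\<Sum>i\<le>N. c i * x ^ i) = 0"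
    using dependence[of "\<lambda>i. x ^ i"] by blast
  define d where "d = Max {i. i \<le> N \<and> c i \<noteq> 0}"
  have fin: "finite {i. i \<le> N \<and> c i \<noteq> 0}" by simp
  have d: "d \<le> N" "c d \<noteq> 0" using Max_in[OF fin] c(2) unfolding d_def by auto
  have dmax: "i \<le> d" if "i \<le> N" "c i \<noteq> 0" for i using Max_ge[OF fin] that unfolding d_def by blast
  have "(\<Sum>i\<le>N. c i * x ^ i) = (\<Sum>i\<le>d. c i * x ^ i)"
    using d dmax by (intro sum.mono_neutral_right) auto
  then have sum0: "(\<Sum>i<d. c i * x ^ i) + c d * x ^ d = 0" using c(3) by (simp flip: lessThan_Suc_atMost)
  show ?thesis
  proof (cases "d = 0")
    case True
    then show ?thesis using sum0 d by simp
  next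
    case False
    let ?y = "c d * x"
    define a where "a i = c i * c d ^ (d - Suc i)" for i
    have a: "a i \<in> A" if "i < d" for i unfolding a_def using c(1) d that by (intro mult_in power_in) auto
    have "(\<Sum>i<d. a i * ?y ^ i) = c d ^ (d - 1) * (\<Sum>i<d. c i * x ^ i)"
      unfolding sum_distrib_left
    proof (rule sum.cong)
      fix i assume "i \<in> {..<d}"
      then have "c d ^ (d - Suc i) * c d ^ i = c d ^ (d - 1)" by (simp flip: power_add)
      then show "a i * ?y ^ i = c d ^ (d - 1) * (c i * x ^ i)"
        unfolding a_def power_mult_distrib by (metis mult.assoc mult.left_commute)
    qed simp
    also have "\<dots> = - (c d ^ (d - 1) * (c d * x ^ d))" using sum0 by (simp add: add_eq_0_iff2)
    also have "c d ^ (d - 1) * (c d * x ^ d) = ?y ^ d"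
      using False by (simp add: power_mult_distrib flip: mult.assoc power_Suc2)
    finally have root: "?y ^ d + (\<Sum>i<d. a i * ?y ^ i) = 0" by simp
    define f where "f = Polynomial.monom 1 d + (\<Sum>i<d. Polynomial.monom (a i) i)"
    have cf: "Polynomial.coeff f i = (if i = d then 1 else if i < d then a i else 0)" for i
      unfolding f_def by (auto simp: coeff_sum sum.delta cong: if_cong)
    have deg: "Polynomial.degree f = d"
      by (rule antisym) (auto intro: degree_le le_degree simp: cf)
    have "poly f ?y = 0" using root unfolding f_def by (simp add: poly_sum poly_monom)
    moreover have "set (coeffs f) \<subseteq> A" using a one_in zero_in by (auto simp: coeffs_def cf simp del: upt_Suc)
    moreover have "Polynomial.lead_coeff f = 1" using deg cf by simp
    ultimately have y: "?y \<in> \<O>" unfolding integral_closure_def by blast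
    obtain k u v where kuv: "c d = P ^ k * u" "u \<in> A" "v \<in> A" "u * v = 1" using nonzero_in_A c(1) d by blast
    then have eq: "v * ?y = P ^ k * x" by (simp add: algebra_simps)
    have "v * ?y \<in> \<O>" using O.mult_in[OF subsetD[OF A_subset_O kuv(3)] y] .
    then show ?thesis unfolding eq by (rule exI)
  qed
qed

text \<open>Elements that are linearly independent modulo \<open>p\<close> are linearly independent over the field of
  fractions of \<open>A\<close>, so there are at most \<open>N\<close> of them.\<close>

definition indep_mod :: "nat \<Rightarrow> (nat \<Rightarrow> 'a) \<Rightarrow> bool" where
  "indep_mod m x \<longleftrightarrow> (\<forall>i<m. x i \<in> \<O>) \<and>
    (\<forall>c. (\<exists>b\<in>\<O>. (\<Sum>i<m. of_int (c i) * x i) = P * b) \<longrightarrow> (\<forall>i<m. int p dvd c i))"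

lemma indep_mod_bound: assumes ind: "indep_mod m x" shows "m \<le> N"
proof (rule ccontr)
  assume "\<not> m \<le> N"
  then have m: "N < m" by simp
  obtain c where c: "\<And>i. i \<le> N \<Longrightarrow> c i \<in> A" "\<exists>i\<le>N. c i \<noteq> 0" "(\<Sum>i\<le>N. c i * x i) = 0"
    using dependence by blast
  define J where "J = {i. i \<le> N \<and> c i \<noteq> 0}"
  have J: "finite J" "J \<noteq> {}" using c(2) unfolding J_def by auto
  have "\<forall>i\<in>J. \<exists>k u v. c i = P ^ k * u \<and> u \<in> A \<and> v \<in> A \<and> u * v = 1"
    using nonzero_in_A c(1) unfolding J_def by blast
  then obtain e u v where euv: "\<And>i. i \<in> J \<Longrightarrow> c i = P ^ (e i) * u i" "\<And>i. i \<in> J \<Longrightarrow> u i \<in> A"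
    "\<And>i. i \<in> J \<Longrightarrow> v i \<in> A" "\<And>i. i \<in> J \<Longrightarrow> u i * v i = 1" by metis
  \<comment> \<open>The common power of p is divided out of the relation, so that the coefficient at
    i0 becomes a unit and the relation stays nontrivial modulo p.\<close>
  define e0 where "e0 = Min (e ` J)"
  obtain i0 where i0: "i0 \<in> J" "e i0 = e0" using Min_in[of "e ` J"] J unfolding e0_def by (metis (no_types, lifting) finite_imageI image_is_empty imageE)
  have e0: "e0 \<le> e i" if "i \<in> J" for i unfolding e0_def using J that by simp
  define c' where "c' i = (if i \<in> J then P ^ (e i - e0) * u i else 0)" for i
  have c'A: "c' i \<in> A" for i unfolding c'_def using euv P_in zero_in by (auto intro!: mult_in power_in)
  have "c i = P ^ e0 * c' i" if "i \<le> N" for i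
    using euv(1)[of i] e0[of i] that unfolding c'_def J_def
    by (auto simp: mult.assoc[symmetric] simp flip: power_add)
  then have "P ^ e0 * (\<Sum>i\<le>N. c' i * x i) = (\<Sum>i\<le>N. c i * x i)"
    by (simp add: sum_distrib_left mult.assoc)
  then have sum0: "(\<Sum>i\<le>N. c' i * x i) = 0" using c(3) P_power_nonzero by (metis mult_eq_0_iff)
  have "\<forall>i. \<exists>d::int. \<exists>w\<in>A. c' i = of_int d + P * w" using residue_A c'A by blast
  then obtain d w where dw: "\<And>i. w i \<in> A" "\<And>i. c' i = of_int (d i) + P * w i" by metis
  \<comment> \<open>Pads the relation with zeros, since independence is stated for all m > N
    elements.\<close>
  define d' where "d' i = (if i \<le> N then d i else 0)" for i
  have "(\<Sum>i<m. of_int (d' i) * x i) = (\<Sum>i\<le>N. of_int (d i) * x i)"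
    using m unfolding d'_def by (intro sum.mono_neutral_cong_right) auto
  also have "\<dots> = (\<Sum>i\<le>N. c' i * x i - P * w i * x i)"
    using dw(2) by (intro sum.cong) (auto simp: algebra_simps)
  also have "\<dots> = P * (- (\<Sum>i\<le>N. w i * x i))"
    using sum0 by (simp add: sum_subtractf sum_distrib_left mult.assoc)
  finally have eq: "(\<Sum>i<m. of_int (d' i) * x i) = P * (- (\<Sum>i\<le>N. w i * x i))" .
  have xO: "x i \<in> \<O>" if "i \<le> N" for i using ind m that unfolding indep_mod_def by auto
  have "w i * x i \<in> \<O>" if "i \<le> N" for i using dw(1)[of i] A_subset_O xO[OF that] by (intro O.mult_in) auto
  then have "- (\<Sum>i\<le>N. w i * x i) \<in> \<O>" by (intro O.uminus_in O.sum_in) auto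
  then have "\<forall>i<m. int p dvd d' i" using ind eq unfolding indep_mod_def by blast
  moreover have i0N: "i0 \<le> N" using i0 unfolding J_def by simp
  ultimately have "int p dvd d i0" using m unfolding d'_def by (auto dest: spec[of _ i0])
  then obtain q where q: "d i0 = int p * q" by blast
  have "u i0 = P * (of_int q + w i0)" using dw(2)[of i0] i0 q unfolding c'_def by (simp add: algebra_simps)
  then have "P * ((of_int q + w i0) * v i0) = 1" using euv(4)[OF i0(1)] by (simp add: mult.assoc)
  moreover have "(of_int q + w i0) * v i0 \<in> A" using dw(1) euv(3)[OF i0(1)] of_int_in by (intro mult_in add_in)
  ultimately show False using p_not_unit by blast
qed

text \<open>A family independent modulo p of maximal length spans the integers modulo p: any further
  element satisfies a relation in which its own coefficient is prime to p.\<close>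

lemma residue_basis:
  "\<exists>m x. (\<forall>i<m. x i \<in> \<O>) \<and>
    (\<forall>a\<in>\<O>. \<exists>c::nat \<Rightarrow> nat. \<exists>b\<in>\<O>. (\<forall>i<m. c i < p) \<and> a = (\<Sum>i<m. of_nat (c i) * x i) + P * b)"
proof -
  define ms where "ms = {m. \<exists>x. indep_mod m x}"
  have "ms \<subseteq> {..N}" unfolding ms_def using indep_mod_bound by auto
  then have fin: "finite ms" using finite_subset by blast
  have "0 \<in> ms" unfolding ms_def indep_mod_def by auto
  then have "Max ms \<in> ms" using Max_in[OF fin] by blast
  then obtain m x where m: "m = Max ms" and ind: "indep_mod m x" unfolding ms_def by blast
  have notind: "\<not> indep_mod (Suc m) y" for y using Max_ge[OF fin, of "Suc m"] m unfolding ms_def by auto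
  have xO: "\<And>i. i < m \<Longrightarrow> x i \<in> \<O>" using ind unfolding indep_mod_def by blast
  have "\<exists>c::nat \<Rightarrow> nat. \<exists>b\<in>\<O>. (\<forall>i<m. c i < p) \<and> a = (\<Sum>i<m. of_nat (c i) * x i) + P * b"
    if a: "a \<in> \<O>" for a
  proof -
    have "\<forall>i<Suc m. (x(m := a)) i \<in> \<O>" using xO a by (auto simp: less_Suc_eq)
    then obtain c b where b: "b \<in> \<O>" "(\<Sum>i<Suc m. of_int (c i) * (x(m := a)) i) = P * b"
      and ndvd: "\<exists>i<Suc m. \<not> int p dvd c i" using notind[of "x(m := a)"] unfolding indep_mod_def by blast
    have eq: "(\<Sum>i<m. of_int (c i) * x i) + of_int (c m) * a = P * b" using b(2) by simp
    have cm: "\<not> int p dvd c m"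
    proof
      assume "int p dvd c m"
      then obtain q where q: "c m = int p * q" by blast
      have "(\<Sum>i<m. of_int (c i) * x i) = P * (b - of_int q * a)" using eq q by (simp add: algebra_simps)
      moreover have "b - of_int q * a \<in> \<O>" using b a O.of_int_in by (intro O.diff_in O.mult_in)
      ultimately have "\<forall>i<m. int p dvd c i" using ind unfolding indep_mod_def by blast
      then show False using ndvd \<open>int p dvd c m\<close> by (auto simp: less_Suc_eq)
    qed
    \<comment> \<open>Inverts the coefficient of a modulo p; afterwards the other coefficients are
      reduced to digits below p.\<close>
    have "coprime (int p) (c m)" using cm p_prime by (intro prime_imp_coprime) auto
    then obtain r s where rs: "r * int p + s * c m = 1" using bezout_int[of "int p" "c m"] by auto
    define d where "d i = (- s * c i) mod int p" for i
    have p0: "int p > 0" using p_prime prime_gt_0_nat by simp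
    have d: "0 \<le> d i" "d i < int p" "- s * c i = d i + int p * ((- s * c i) div int p)" for i
      unfolding d_def using p0 by auto
    let ?w = "of_int r * a + of_int s * b + (\<Sum>i<m. of_int ((- s * c i) div int p) * x i)"
    have "(of_int 1 :: 'a) = of_int (r * int p + s * c m)" using rs by simp
    then have one: "(1::'a) = of_int r * P + of_int s * of_int (c m)" by simp
    have "a = (of_int r * P + of_int s * of_int (c m)) * a" using one by simp
    also have "\<dots> = of_int r * P * a + of_int s * (P * b - (\<Sum>i<m. of_int (c i) * x i))"
      unfolding eq[symmetric] by (simp add: algebra_simps)
    also have "\<dots> = P * (of_int r * a + of_int s * b) + (\<Sum>i<m. of_int (- s * c i) * x i)"
      by (simp add: algebra_simps sum_distrib_left sum_negf)
    also have "(\<Sum>i<m. of_int (- s * c i) * x i) =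
        (\<Sum>i<m. of_int (d i) * x i + P * (of_int ((- s * c i) div int p) * x i))"
    proof (rule sum.cong)
      fix i
      have "(of_int (- s * c i) :: 'a) = of_int (d i + int p * ((- s * c i) div int p))" using d(3) by metis
      then show "of_int (- s * c i) * x i = of_int (d i) * x i + P * (of_int ((- s * c i) div int p) * x i)"
        by (simp add: algebra_simps)
    qed simp
    also have "\<dots> = (\<Sum>i<m. of_int (d i) * x i) + P * (\<Sum>i<m. of_int ((- s * c i) div int p) * x i)"
      by (simp add: sum.distrib sum_distrib_left)
    finally have "a = (\<Sum>i<m. of_int (d i) * x i) + P * ?w" by (simp add: algebra_simps)
    moreover have "(of_int (d i) :: 'a) = of_nat (nat (d i))" for i using d(1) by simp
    moreover have "?w \<in> \<O>" using a b xO O.of_int_in by (intro O.add_in O.mult_in O.sum_in) auto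
    moreover have "\<forall>i<m. nat (d i) < p" using d p0 by (auto simp: nat_less_iff)
    ultimately show ?thesis by (intro exI[of _ "\<lambda>i. nat (d i)"] bexI[of _ ?w]) auto
  qed
  then show ?thesis using xO by blast
qed

text \<open>The digits along the residue basis represent all classes modulo p, and k rounds of them
  all classes modulo p^k.\<close>

lemma residue_finite: "\<exists>F. finite F \<and> F \<subseteq> \<O> \<and> (\<forall>a\<in>\<O>. \<exists>f\<in>F. \<exists>b\<in>\<O>. a = f + P ^ k * b)"
proof (induction k)
  case 0
  show ?case by (intro exI[of _ "{0}"]) (auto simp: O.zero_in)
next
  case (Suc k)
  then obtain F where F: "finite F" "F \<subseteq> \<O>" "\<And>a. a \<in> \<O> \<Longrightarrow> \<exists>f\<in>F. \<exists>b\<in>\<O>. a = f + P ^ k * b" by blast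
  obtain m x where x: "\<And>i. i < m \<Longrightarrow> x i \<in> \<O>"
    and basis: "\<And>a. a \<in> \<O> \<Longrightarrow> \<exists>c::nat \<Rightarrow> nat. \<exists>b\<in>\<O>. (\<forall>i<m. c i < p) \<and> a = (\<Sum>i<m. of_nat (c i) * x i) + P * b"
    using residue_basis by blast
  define G where "G = (\<lambda>c. \<Sum>i<m. of_nat (c i) * x i) ` ({..<m} \<rightarrow>\<^sub>E {..<p})"
  have G: "finite G" "G \<subseteq> \<O>" unfolding G_def
    using x O.of_nat_in by (auto intro!: finite_imageI finite_PiE O.sum_in O.mult_in)
  have "\<exists>f\<in>(\<lambda>(f, g). f + P ^ k * g) ` (F \<times> G). \<exists>b\<in>\<O>. a = f + P ^ Suc k * b" if a: "a \<in> \<O>" for a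
  proof -
    obtain f b where f: "f \<in> F" "b \<in> \<O>" "a = f + P ^ k * b" using F(3)[OF a] by blast
    obtain c b' where c: "\<forall>i<m. c i < p" "b' \<in> \<O>" "b = (\<Sum>i<m. of_nat (c i) * x i) + P * b'"
      using basis[OF f(2)] by blast
    have "(\<Sum>i<m. of_nat (c i) * x i) = (\<Sum>i<m. of_nat (restrict c {..<m} i) * x i)" by simp
    moreover have "restrict c {..<m} \<in> {..<m} \<rightarrow>\<^sub>E {..<p}" using c by auto
    ultimately have g: "(\<Sum>i<m. of_nat (c i) * x i) \<in> G" unfolding G_def by blast
    have "a = (f + P ^ k * (\<Sum>i<m. of_nat (c i) * x i)) + P ^ Suc k * b'" using f c by (simp add: algebra_simps)
    then show ?thesis using f(1) g c(2) by force
  qed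
  moreover have "(\<lambda>(f, g). f + P ^ k * g) ` (F \<times> G) \<subseteq> \<O>"
    using F(2) G(2) P_in_O by (auto intro!: O.add_in O.mult_in O.power_in)
  ultimately show ?case using F(1) G(1) by (intro exI[of _ "(\<lambda>(f, g). f + P ^ k * g) ` (F \<times> G)"]) auto
qed

text \<open>A nonzero ideal contains some p^k. It is generated by p^k and those among finitely many
  representatives modulo p^k that belong to it.\<close>

lemma noetherian_integers: "noetherian_ring (subset_ring \<O>)"
proof (rule O.noetherian_subset_ringI)
  fix I x assume I: "ideal I (subset_ring \<O>)" and x: "x \<in> I" "x \<noteq> 0"
  have closed: "0 \<in> I" "I \<subseteq> \<O>" "\<And>x y. \<lbrakk>x \<in> I; y \<in> I\<rbrakk> \<Longrightarrow> x + y \<in> I" "\<And>x a. \<lbrakk>x \<in> I; a \<in> \<O>\<rbrakk> \<Longrightarrow> a * x \<in> I"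
    using I unfolding O.ideal_subset_ring by auto
  obtain y k where y: "y \<in> \<O>" "x * y = P ^ k" using divides_power x closed(2) by blast
  then have k: "P ^ k \<in> I" using closed(4)[OF x(1) y(1)] by (simp add: mult.commute)
  obtain F where F: "finite F" "F \<subseteq> \<O>" "\<And>a. a \<in> \<O> \<Longrightarrow> \<exists>f\<in>F. \<exists>b\<in>\<O>. a = f + P ^ k * b"
    using residue_finite[of k] by meson
  have "I \<subseteq> J" if J: "ideal J (subset_ring \<O>)" "insert (P ^ k) (F \<inter> I) \<subseteq> J" for J
  proof
    fix a assume a: "a \<in> I"
    then obtain f b where f: "f \<in> F" "b \<in> \<O>" "a = f + P ^ k * b" using F(3) closed(2) by blast
    have "- b * P ^ k \<in> I" using k f(2) O.uminus_in by (intro closed(4))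
    then have "a + - b * P ^ k \<in> I" using a closed(3) by blast
    then have "f \<in> I" using f by (simp add: algebra_simps)
    then have "f \<in> J" "P ^ k \<in> J" using f(1) J(2) by auto
    then have "f + b * P ^ k \<in> J" using J(1) f(2) unfolding O.ideal_subset_ring by blast
    then show "a \<in> J" using f by (simp add: mult.commute)
  qed
  then show "\<exists>S. finite S \<and> S \<subseteq> I \<and> (\<forall>J. ideal J (subset_ring \<O>) \<and> S \<subseteq> J \<longrightarrow> I \<subseteq> J)"
    using k F(1) by (intro exI[of _ "insert (P ^ k) (F \<inter> I)"]) auto
qed

text \<open>The sequence is expanded in base p along the residue basis; the limit is formed
  separately along each basis element, where the digits have a sum in A.\<close>

lemma complete:
  assumes a: "\<And>k. a k \<in> \<O>" "\<And>k. \<exists>b\<in>\<O>. a (Suc k) - a k = P ^ k * b"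
  shows "\<exists>l\<in>\<O>. \<forall>k. \<exists>b\<in>\<O>. l - a k = P ^ k * b"
proof -
  obtain m x where x: "\<And>i. i < m \<Longrightarrow> x i \<in> \<O>"
    and basis: "\<And>a. a \<in> \<O> \<Longrightarrow> \<exists>c::nat \<Rightarrow> nat. \<exists>b\<in>\<O>. (\<forall>i<m. c i < p) \<and> a = (\<Sum>i<m. of_nat (c i) * x i) + P * b"
    using residue_basis by blast
  obtain b where b: "\<And>k. b k \<in> \<O>" "\<And>k. a (Suc k) = a k + P ^ k * b k"
    using a(2) by (metis add.commute diff_add_cancel)
  obtain dig rem where dr: "\<And>a. a \<in> \<O> \<Longrightarrow> rem a \<in> \<O>"
    "\<And>a. a \<in> \<O> \<Longrightarrow> a = (\<Sum>i<m. of_nat (dig a i) * x i) + P * rem a" using basis by metis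
  \<comment> \<open>The carries of the expansion: what the first k digits leave of
    \<open>a k\<close> is \<open>P ^ k * e k\<close>.\<close>
  define e where "e = rec_nat (a 0) (\<lambda>k e. rem (e + b k))"
  have e0: "e 0 = a 0" and eS: "e (Suc k) = rem (e k + b k)" for k unfolding e_def by simp_all
  have eO: "e k \<in> \<O>" for k by (induction k) (auto simp: e0 eS a dr b O.add_in)
  define c where "c k = dig (e k + b k)" for k
  have step: "e k + b k = (\<Sum>i<m. of_nat (c k i) * x i) + P * e (Suc k)" for k
    unfolding c_def eS by (rule dr(2)) (intro O.add_in eO b)
  have expand: "a k = (\<Sum>i<m. (\<Sum>j<k. of_nat (c j i) * P ^ j) * x i) + P ^ k * e k" for k
  proof (induction k)
    case (Suc k)
    have "a (Suc k) = (\<Sum>i<m. (\<Sum>j<k. of_nat (c j i) * P ^ j) * x i) + P ^ k * (e k + b k)"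
      using b(2) Suc by (simp add: algebra_simps)
    also have "P ^ k * (e k + b k) = (\<Sum>i<m. of_nat (c k i) * P ^ k * x i) + P ^ Suc k * e (Suc k)"
      unfolding step by (simp add: algebra_simps sum_distrib_left)
    finally show ?case by (simp add: sum.distrib algebra_simps)
  qed (simp add: e0)
  \<comment> \<open>The completeness of the p-adic integers enters here, once for every basis
    element.\<close>
  have "\<forall>i. \<exists>z\<in>A. \<forall>n. \<exists>w\<in>A. z - (\<Sum>j<n. of_nat (c j i) * P ^ j) = P ^ n * w" using digits by auto
  then obtain z w where z: "\<And>i. z i \<in> A" "\<And>i n. w i n \<in> A"
    "\<And>i n. z i - (\<Sum>j<n. of_nat (c j i) * P ^ j) = P ^ n * w i n" by metis
  define l where "l = (\<Sum>i<m. z i * x i)"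
  have "l \<in> \<O>" unfolding l_def using z(1) A_subset_O x by (intro O.sum_in O.mult_in) auto
  moreover have "\<exists>b\<in>\<O>. l - a k = P ^ k * b" for k
  proof
    have "l - a k = (\<Sum>i<m. (z i - (\<Sum>j<k. of_nat (c j i) * P ^ j)) * x i) - P ^ k * e k"
      unfolding l_def expand[of k] by (simp add: sum_subtractf algebra_simps)
    also have "\<dots> = P ^ k * ((\<Sum>i<m. w i k * x i) - e k)"
      unfolding z(3) by (simp add: algebra_simps sum_distrib_left)
    finally show "l - a k = P ^ k * ((\<Sum>i<m. w i k * x i) - e k)" .
    have "w i k \<in> \<O>" for i using z(2) A_subset_O by blast
    then show "(\<Sum>i<m. w i k * x i) - e k \<in> \<O>"
      using x eO by (intro O.diff_in O.sum_in O.mult_in) auto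
  qed
  ultimately show ?thesis by blast
qed

text \<open>The inverse is the limit of the geometric series.\<close>

lemma one_minus_P_unit: assumes b: "b \<in> \<O>" shows "\<exists>u\<in>\<O>. (1 - P * b) * u = 1"
proof -
  define a where "a k = (\<Sum>j<k. (P * b) ^ j)" for k
  have Pb: "P * b \<in> \<O>" using b P_in_O by (intro O.mult_in)
  have aO: "a k \<in> \<O>" for k unfolding a_def using Pb by (intro O.sum_in O.power_in)
  have "\<exists>c\<in>\<O>. a (Suc k) - a k = P ^ k * c" for k
    unfolding a_def using O.power_in[OF b, of k] by (auto simp: power_mult_distrib)
  then obtain l where l: "l \<in> \<O>" "\<And>k. \<exists>c\<in>\<O>. l - a k = P ^ k * c" using complete[of a] aO by blast
  have fin: "(1 - P * b) * a k = 1 - (P * b) ^ k" for k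
    unfolding a_def by (rule one_diff_power_eq[symmetric])
  have "(1 - P * b) * l - 1 = 0"
  proof (rule Inter_P_power)
    show "(1 - P * b) * l - 1 \<in> \<O>" using O.mult_in[OF O.diff_in[OF O.one_in Pb] l(1)] O.one_in by (rule O.diff_in)
    fix k
    obtain c where c: "c \<in> \<O>" "l - a k = P ^ k * c" using l(2) by blast
    have "(1 - P * b) * l - 1 = (1 - P * b) * (l - a k) + ((1 - P * b) * a k - 1)" by (simp add: algebra_simps)
    also have "\<dots> = (1 - P * b) * (P ^ k * c) - (P * b) ^ k" unfolding c(2) fin by simp
    also have "\<dots> = P ^ k * ((1 - P * b) * c - b ^ k)" by (simp add: algebra_simps power_mult_distrib)
    finally show "\<exists>y\<in>\<O>. (1 - P * b) * l - 1 = P ^ k * y"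
      using Pb c b O.one_in by (intro bexI[of _ "(1 - P * b) * c - b ^ k"]) (auto intro!: O.diff_in O.mult_in O.power_in)
  qed
  then show ?thesis using l(1) by (intro bexI[of _ l]) auto
qed

text \<open>This is the locality of the ring. As there are finitely many classes modulo p, some
  power a^M is idempotent modulo p; it lifts to a true idempotent, which is 0 or 1 in a field. In
  the first case p divides a^M, in the second a^M is 1 up to a multiple of p, hence a unit.\<close>

lemma unit_or_nilpotent:
  assumes a: "a \<in> \<O>"
  shows "(\<exists>u\<in>\<O>. a * u = 1) \<or> (\<exists>m>0. \<exists>b\<in>\<O>. a ^ m = P * b)"
proof -
  obtain F where F: "finite F" "F \<subseteq> \<O>" "\<And>a. a \<in> \<O> \<Longrightarrow> \<exists>f\<in>F. \<exists>b\<in>\<O>. a = f + P ^ 1 * b"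
    using residue_finite[of 1] by meson
  have "\<forall>n. \<exists>f. f \<in> F \<and> (\<exists>b\<in>\<O>. a ^ n = f + P * b)" using F(3) O.power_in[OF a] by fastforce
  then obtain f where f: "\<And>n. f n \<in> F" "\<And>n. \<exists>b\<in>\<O>. a ^ n = f n + P * b" by metis
  have "\<not> inj f"
  proof
    assume "inj f"
    then have "infinite (range f)" by (rule range_inj_infinite)
    then show False using F(1) f(1) finite_subset[of "range f" F] by blast
  qed
  then obtain i j where ij: "i < j" "f i = f j" unfolding inj_def by (metis linorder_neqE_nat)
  define d where "d = j - i"
  have d0: "d > 0" using ij unfolding d_def by simp
  have base: "\<exists>b\<in>\<O>. a ^ (i + d) - a ^ i = P * b"
  proof -
    obtain b b' where b: "b \<in> \<O>" "a ^ i = f i + P * b" "b' \<in> \<O>" "a ^ j = f j + P * b'" using f(2) by metis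
    then have "a ^ (i + d) - a ^ i = P * (b' - b)" using ij unfolding d_def by (simp add: algebra_simps)
    then show ?thesis using O.diff_in b by blast
  qed
  have step: "\<exists>b\<in>\<O>. a ^ (i + t + s * d) - a ^ (i + t) = P * b" for t s
  proof (induction s)
    case 0
    show ?case using O.zero_in by auto
  next
    case (Suc s)
    then obtain b where b: "b \<in> \<O>" "a ^ (i + t + s * d) - a ^ (i + t) = P * b" by blast
    obtain b' where b': "b' \<in> \<O>" "a ^ (i + d) - a ^ i = P * b'" using base by blast
    have "a ^ (i + t + Suc s * d) - a ^ (i + t) = a ^ (t + s * d) * (a ^ (i + d) - a ^ i) + (a ^ (i + t + s * d) - a ^ (i + t))"
      by (simp add: algebra_simps power_add)
    also have "\<dots> = P * (a ^ (t + s * d) * b' + b)" unfolding b b' by (simp add: algebra_simps)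
    finally show ?case using b b' a by (intro bexI[of _ "a ^ (t + s * d) * b' + b"]) (auto intro!: O.add_in O.mult_in O.power_in)
  qed
  \<comment> \<open>From the exponent i on the powers of a are periodic modulo p with period d; a
    multiple of d that is at least i yields an idempotent.\<close>
  define M where "M = Suc i * d"
  have M: "M > 0" "i \<le> M" unfolding M_def using d0 by (auto simp: trans_le_add2)
  have "\<exists>b\<in>\<O>. a ^ (M + M) - a ^ M = P * b"
    using step[of "M - i" "Suc i"] M unfolding M_def by simp
  then obtain b0 where b0: "b0 \<in> \<O>" "(a ^ M)\<^sup>2 - a ^ M = P * b0" by (auto simp: power2_eq_square power_add)
  \<comment> \<open>Newton iteration for idempotents: it squares the defect e^2 - e up to a factor,
    so one more power of p is gained at every step.\<close>
  define e where "e = rec_nat (a ^ M) (\<lambda>_ e. 3 * e\<^sup>2 - 2 * e ^ 3)"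
  have e0: "e 0 = a ^ M" and eS: "e (Suc k) = 3 * (e k)\<^sup>2 - 2 * e k ^ 3" for k unfolding e_def by simp_all
  have num: "(numeral n :: 'a) \<in> \<O>" for n using O.of_nat_in[of "numeral n"] by simp
  have eO: "e k \<in> \<O>" for k
    by (induction k) (auto simp: e0 eS intro!: O.power_in a O.diff_in O.mult_in num)
  have idem: "\<exists>b\<in>\<O>. (e k)\<^sup>2 - e k = P ^ Suc k * b" for k
  proof (induction k)
    case 0
    show ?case using b0 by (auto simp: e0)
  next
    case (Suc k)
    then obtain b where b: "b \<in> \<O>" "(e k)\<^sup>2 - e k = P ^ Suc k * b" by blast
    have "(e (Suc k))\<^sup>2 - e (Suc k) = ((e k)\<^sup>2 - e k)\<^sup>2 * (4 * (e k)\<^sup>2 - 4 * e k - 3)"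
      unfolding eS by (simp add: algebra_simps power2_eq_square power3_eq_cube)
    also have "\<dots> = P ^ Suc (Suc k) * (P ^ k * b\<^sup>2 * (4 * (e k)\<^sup>2 - 4 * e k - 3))"
      unfolding b by (simp add: power2_eq_square algebra_simps)
    finally show ?case using b eO P_in_O
      by (intro bexI[of _ "P ^ k * b\<^sup>2 * (4 * (e k)\<^sup>2 - 4 * e k - 3)"]) (auto intro!: O.mult_in O.power_in O.diff_in num)
  qed
  have "\<exists>b\<in>\<O>. e (Suc k) - e k = P ^ k * b" for k
  proof -
    obtain b where b: "b \<in> \<O>" "(e k)\<^sup>2 - e k = P ^ Suc k * b" using idem by blast
    have "e (Suc k) - e k = ((e k)\<^sup>2 - e k) * (1 - 2 * e k)" unfolding eS by (simp add: algebra_simps power2_eq_square power3_eq_cube)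
    also have "\<dots> = P ^ k * (P * b * (1 - 2 * e k))" unfolding b by (simp add: algebra_simps)
    finally show ?thesis using b eO P_in_O O.one_in
      by (intro bexI[of _ "P * b * (1 - 2 * e k)"]) (auto intro!: O.mult_in O.diff_in num)
  qed
  then obtain l where l: "l \<in> \<O>" "\<And>k. \<exists>b\<in>\<O>. l - e k = P ^ k * b" using complete[of e] eO by blast
  have "l\<^sup>2 - l = 0"
  proof (rule Inter_P_power)
    show "l\<^sup>2 - l \<in> \<O>" using l(1) by (intro O.diff_in O.power_in)
    fix k
    obtain b c where b: "b \<in> \<O>" "(e k)\<^sup>2 - e k = P ^ Suc k * b" and c: "c \<in> \<O>" "l - e k = P ^ k * c" using idem l(2) by metis
    have "l\<^sup>2 - l = (l - e k) * (l + e k - 1) + ((e k)\<^sup>2 - e k)" by (simp add: algebra_simps power2_eq_square)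
    also have "\<dots> = P ^ k * (c * (l + e k - 1) + P * b)" unfolding b c by (simp add: algebra_simps)
    finally show "\<exists>y\<in>\<O>. l\<^sup>2 - l = P ^ k * y" using b c l(1) eO P_in_O O.one_in
      by (intro bexI[of _ "c * (l + e k - 1) + P * b"]) (auto intro!: O.mult_in O.add_in O.diff_in)
  qed
  then have l01: "l = 0 \<or> l = 1" by (simp add: power2_eq_square)
  have "\<exists>b\<in>\<O>. l - a ^ M = P * b"
  proof -
    obtain c where c: "c \<in> \<O>" "l - e 1 = P * c" using l(2)[of 1] by auto
    have "l - a ^ M = (l - e 1) + ((a ^ M)\<^sup>2 - a ^ M) * (1 - 2 * a ^ M)" using eS[of 0] e0 by (simp add: algebra_simps power2_eq_square power3_eq_cube)
    also have "\<dots> = P * (c + b0 * (1 - 2 * a ^ M))" unfolding b0 c by (simp add: algebra_simps)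
    finally show ?thesis using c b0 a O.one_in
      by (intro bexI[of _ "c + b0 * (1 - 2 * a ^ M)"]) (auto intro!: O.mult_in O.add_in O.diff_in O.power_in num)
  qed
  then obtain b where b: "b \<in> \<O>" "l - a ^ M = P * b" by blast
  from l01 show ?thesis
  proof
    assume "l = 0"
    then have "a ^ M = P * (- b)" using b by (metis diff_0 minus_equation_iff mult_minus_right)
    then show ?thesis using M(1) O.uminus_in[OF b(1)] by blast
  next
    assume "l = 1"
    then have aM: "a ^ M = 1 - P * b" using b by (simp add: algebra_simps)
    obtain u where u: "u \<in> \<O>" "(1 - P * b) * u = 1" using one_minus_P_unit[OF b(1)] by blast
    have "a * (a ^ (M - 1) * u) = 1" using u(2) M(1) by (simp add: mult.assoc[symmetric] power_eq_if flip: aM)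
    then show ?thesis using u a by (intro disjI1 bexI[of _ "a ^ (M - 1) * u"]) (auto intro!: O.mult_in O.power_in)
  qed
qed

end

subsection \<open>The ring of p-adic integers\<close>

text \<open>Unreduced representatives of p-adic integers. With them the ring operations are
  pointwise operations on integers, and reduction is confined to \<open>padic_class\<close>.\<close>

definition padic_compatible :: "nat \<Rightarrow> (nat \<Rightarrow> int) \<Rightarrow> bool" where
  "padic_compatible p f \<longleftrightarrow> (\<forall>n. int p ^ n dvd f (Suc n) - f n)"

definition padic_class :: "nat \<Rightarrow> (nat \<Rightarrow> int) \<Rightarrow> nat \<Rightarrow> int" where
  "padic_class p f n = f n mod int p ^ n"

lemma padic_compatible_le:
  assumes f: "padic_compatible p f" and "n \<le> m" shows "int p ^ n dvd f m - f n"
  using assms(2)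
proof (induction m rule: dec_induct)
  case (step m)
  have "int p ^ m dvd f (Suc m) - f m" using f unfolding padic_compatible_def by blast
  then have "int p ^ n dvd f (Suc m) - f m" using step(1) le_imp_power_dvd dvd_trans by blast
  then show ?case using step(3) dvd_add[of "int p ^ n" "f (Suc m) - f m" "f m - f n"] by simp
qed simp

lemma padic_class_eq_iff: "padic_class p f = padic_class p g \<longleftrightarrow> (\<forall>n. int p ^ n dvd f n - g n)"
  by (auto simp: padic_class_def fun_eq_iff mod_eq_dvd_iff)

lemma padic_compatible_arith:
  assumes "padic_compatible p f" "padic_compatible p g"
  shows "padic_compatible p (\<lambda>n. f n + g n)" "padic_compatible p (\<lambda>n. f n * g n)" "padic_compatible p (\<lambda>n. c)"
proof -
  have eq: "f (Suc n) + g (Suc n) - (f n + g n) = (f (Suc n) - f n) + (g (Suc n) - g n)"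
    "f (Suc n) * g (Suc n) - f n * g n = (f (Suc n) - f n) * g (Suc n) + f n * (g (Suc n) - g n)" for n
    by (simp_all add: algebra_simps)
  show "padic_compatible p (\<lambda>n. f n + g n)" "padic_compatible p (\<lambda>n. f n * g n)" "padic_compatible p (\<lambda>n. c)"
    using assms unfolding padic_compatible_def eq by auto
qed

lemma padic_class_carrier:
  assumes "p > 0" "padic_compatible p f" shows "padic_class p f \<in> carrier (padic_int_ring p)"
proof -
  have "f (Suc n) mod int p ^ Suc n mod int p ^ n = f n mod int p ^ n" for n
    using assms(2) unfolding padic_compatible_def by (simp add: mod_mod_cancel mod_eq_dvd_iff)
  then show ?thesis using assms(1) by (simp add: padic_int_ring_def padic_class_def)
qed

lemma padic_carrier_class:
  assumes "x \<in> carrier (padic_int_ring p)" shows "padic_compatible p x" "padic_class p x = x"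
proof -
  have x: "0 \<le> x n" "x n < int p ^ n" "x (Suc n) mod int p ^ n = x n" for n
    using assms unfolding padic_int_ring_def by auto
  have "x (Suc n) mod int p ^ n = x n mod int p ^ n" for n using x by (simp add: x(3))
  then show "padic_compatible p x" unfolding padic_compatible_def mod_eq_dvd_iff by blast
  show "padic_class p x = x" using x by (simp add: padic_class_def fun_eq_iff)
qed

lemma padic_class_ops:
  "padic_class p f \<oplus>\<^bsub>padic_int_ring p\<^esub> padic_class p g = padic_class p (\<lambda>n. f n + g n)"
  "padic_class p f \<otimes>\<^bsub>padic_int_ring p\<^esub> padic_class p g = padic_class p (\<lambda>n. f n * g n)"
  "\<one>\<^bsub>padic_int_ring p\<^esub> = padic_class p (\<lambda>n. 1)"
  by (auto simp: padic_int_ring_def padic_class_def fun_eq_iff mod_simps)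

locale padic_embedding =
  fixes p :: nat and \<iota> :: "(nat \<Rightarrow> int) \<Rightarrow> 'a::field"
  assumes p_prime: "Factorial_Ring.prime p"
    and hom: "\<iota> \<in> ring_hom (padic_int_ring p) ring_of_type_algebra"
    and inj: "inj_on \<iota> (carrier (padic_int_ring p))"
begin

abbreviation cmp where "cmp \<equiv> padic_compatible p"

definition emb :: "(nat \<Rightarrow> int) \<Rightarrow> 'a" where "emb f = \<iota> (padic_class p f)"

abbreviation A where "A \<equiv> \<iota> ` carrier (padic_int_ring p)"

lemma p_pos: "p > 0" using p_prime prime_gt_0_nat by blast

lemma A_emb: "A = emb ` Collect cmp"
  using padic_carrier_class padic_class_carrier[OF p_pos] unfolding emb_def by (force simp: image_iff)

lemma emb_in: "cmp f \<Longrightarrow> emb f \<in> A" unfolding A_emb by blast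

lemma emb_cases: assumes "x \<in> A" obtains f where "cmp f" "x = emb f" using assms unfolding A_emb by blast

lemma emb_cong: "(\<And>n. int p ^ n dvd f n - g n) \<Longrightarrow> emb f = emb g"
  unfolding emb_def using padic_class_eq_iff by metis

lemma emb_eq_iff: "\<lbrakk>cmp f; cmp g\<rbrakk> \<Longrightarrow> emb f = emb g \<longleftrightarrow> (\<forall>n. int p ^ n dvd f n - g n)"
  unfolding emb_def padic_class_eq_iff[symmetric]
  using inj padic_class_carrier[OF p_pos] by (auto dest: inj_onD)

lemma emb_add: "\<lbrakk>cmp f; cmp g\<rbrakk> \<Longrightarrow> emb (\<lambda>n. f n + g n) = emb f + emb g"
  unfolding emb_def padic_class_ops[symmetric]
  using ring_hom_add[OF hom] padic_class_carrier[OF p_pos] by (simp add: ring_of_type_simps)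

lemma emb_mult: "\<lbrakk>cmp f; cmp g\<rbrakk> \<Longrightarrow> emb (\<lambda>n. f n * g n) = emb f * emb g"
  unfolding emb_def padic_class_ops[symmetric]
  using ring_hom_mult[OF hom] padic_class_carrier[OF p_pos] by (simp add: ring_of_type_simps)

lemma emb_one: "emb (\<lambda>n. 1) = 1"
  unfolding emb_def padic_class_ops[symmetric] using ring_hom_one[OF hom] by (simp add: ring_of_type_simps)

lemma cmp_const: "cmp (\<lambda>n. c)" unfolding padic_compatible_def by simp

lemma emb_zero: "emb (\<lambda>n. 0) = 0"
proof -
  have "emb (\<lambda>n. 0) + emb (\<lambda>n. 0) = emb (\<lambda>n. 0) + 0" using emb_add[OF cmp_const[of 0] cmp_const[of 0]] by simp
  then show ?thesis by (metis add_left_cancel)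
qed

lemma emb_nat: "emb (\<lambda>n. int c) = of_nat c"
proof (induction c)
  case (Suc c)
  then show ?case using emb_add[OF cmp_const[of 1] cmp_const[of "int c"]] by (simp add: emb_one)
qed (simp add: emb_zero)

lemma emb_minus: "cmp f \<Longrightarrow> emb (\<lambda>n. - f n) = - emb f" and cmp_minus: "cmp f \<Longrightarrow> cmp (\<lambda>n. - f n)"
proof -
  assume f: "cmp f"
  have "cmp (\<lambda>n. (- 1) * f n)" using padic_compatible_arith(2)[OF cmp_const[of "-1"] f] .
  then show m: "cmp (\<lambda>n. - f n)" by simp
  show "emb (\<lambda>n. - f n) = - emb f"
    using emb_add[OF f m] emb_zero by (simp add: add_eq_0_iff)
qed

lemma emb_int: "emb (\<lambda>n. c) = of_int c"
proof (cases "c \<ge> 0")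
  case True
  then show ?thesis using emb_nat[of "nat c"] by simp
next
  case False
  then show ?thesis using emb_minus[OF cmp_const[of "- c"]] emb_nat[of "nat (- c)"] by simp
qed

text \<open>Since \<open>f (m + k)\<close> matters only modulo p^(m + k), its quotient by p^k is
  determined modulo p^m; hence the shift of the index.\<close>

lemma divide_power:
  assumes f: "cmp f" and d: "\<And>m. m \<ge> k \<Longrightarrow> int p ^ k dvd f m"
  defines "g \<equiv> \<lambda>m. f (m + k) div int p ^ k"
  shows "cmp g" "emb f = of_nat p ^ k * emb g" "f (m + k) = int p ^ k * g m"
proof -
  have pk: "int p ^ k \<noteq> 0" using p_pos by simp
  show fg: "f (m + k) = int p ^ k * g m" for m unfolding g_def using d[of "m + k"] by simp
  show g: "cmp g" unfolding padic_compatible_def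
  proof
    fix n
    have "int p ^ (n + k) dvd f (Suc n + k) - f (n + k)" using f unfolding padic_compatible_def by simp
    also have "f (Suc n + k) - f (n + k) = int p ^ k * (g (Suc n) - g n)" unfolding fg by (simp add: algebra_simps)
    finally show "int p ^ n dvd g (Suc n) - g n" using pk p_pos by (simp add: power_add mult.commute[of "int p ^ n"])
  qed
  have "emb f = emb (\<lambda>n. int (p ^ k) * g n)"
  proof (rule emb_cong)
    fix n show "int p ^ n dvd f n - int (p ^ k) * g n"
      using padic_compatible_le[OF f, of n "n + k"] fg[of n] by (simp add: dvd_diff_commute)
  qed
  then show "emb f = of_nat p ^ k * emb g"
    using emb_mult[OF cmp_const g, of "int (p ^ k)"] emb_nat[of "p ^ k"] by simp
qed

text \<open>Every \<open>g m\<close> is prime to p and is inverted modulo p^m; the inverses are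
  compatible because they are unique modulo p^m.\<close>

lemma unit:
  assumes g: "cmp g" and ndvd: "\<not> int p dvd g 1"
  shows "\<exists>h. cmp h \<and> emb g * emb h = 1"
proof -
  have cop: "coprime (int p ^ m) (g m)" for m
  proof (cases m)
    case (Suc k)
    have "int p dvd g m - g 1" using padic_compatible_le[OF g, of 1 m] Suc by simp
    then have "\<not> int p dvd g m" using ndvd by (metis dvd_diff_commute dvd_diff_right_iff diff_add_cancel dvd_add_right_iff)
    then show ?thesis using p_prime by (intro coprime_power_left_iff[THEN iffD2] disjI1 prime_imp_coprime) auto
  qed simp
  have "\<exists>h. int p ^ m dvd g m * h - 1" for m
  proof -
    obtain r s where "r * int p ^ m + s * g m = 1" using bezout_int[of "int p ^ m" "g m"] cop[of m] by auto
    then have "g m * s - 1 = int p ^ m * (- r)" by (simp add: algebra_simps)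
    then show ?thesis by (metis dvd_triv_left)
  qed
  then obtain h where h: "\<And>m. int p ^ m dvd g m * h m - 1" by metis
  have "cmp h" unfolding padic_compatible_def
  proof
    fix n
    have "int p ^ n dvd g (Suc n) * h (Suc n) - 1"
      by (rule dvd_trans[OF le_imp_power_dvd h]) simp
    moreover have "int p ^ n dvd (g (Suc n) - g n) * h (Suc n)"
      using g unfolding padic_compatible_def by auto
    ultimately have "int p ^ n dvd (g (Suc n) * h (Suc n) - 1) - (g (Suc n) - g n) * h (Suc n) - (g n * h n - 1)"
      using h[of n] by (rule dvd_diff[OF dvd_diff])
    then have "int p ^ n dvd g n * (h (Suc n) - h n)" by (simp add: algebra_simps)
    then show "int p ^ n dvd h (Suc n) - h n" using cop[of n] coprime_dvd_mult_right_iff by blast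
  qed
  moreover have "emb (\<lambda>n. g n * h n) = emb (\<lambda>n. 1)" by (rule emb_cong) (rule h)
  ultimately show ?thesis using emb_mult[OF g] emb_one by auto
qed

lemma subring_A: "field_subring A"
proof
  show "0 \<in> A" using emb_in[OF cmp_const[of 0]] emb_zero by simp
  show "1 \<in> A" using emb_in[OF cmp_const[of 1]] emb_one by simp
  show "x + y \<in> A" if xy: "x \<in> A" "y \<in> A" for x y
  proof -
    obtain f g where "cmp f" "x = emb f" "cmp g" "y = emb g" using xy emb_cases by metis
    then show ?thesis using emb_add emb_in[OF padic_compatible_arith(1)] by metis
  qed
  show "x * y \<in> A" if xy: "x \<in> A" "y \<in> A" for x y
  proof -
    obtain f g where "cmp f" "x = emb f" "cmp g" "y = emb g" using xy emb_cases by metis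
    then show ?thesis using emb_mult emb_in[OF padic_compatible_arith(2)] by metis
  qed
  show "- x \<in> A" if x: "x \<in> A" for x
  proof -
    obtain f where "cmp f" "x = emb f" using x emb_cases by metis
    then show ?thesis using emb_minus emb_in[OF cmp_minus] by metis
  qed
qed

sublocale A: field_subring A by (rule subring_A)

text \<open>Let n be the first index at which p^n does not divide the term. It is positive, and its
  predecessor is the valuation: after division by that power of p the quotient is prime to
  p.\<close>

lemma nonzero_decomp:
  assumes x: "x \<in> A" "x \<noteq> 0"
  shows "\<exists>k u v. x = of_nat p ^ k * u \<and> u \<in> A \<and> v \<in> A \<and> u * v = 1"
proof -
  obtain f where f: "cmp f" "x = emb f" using x emb_cases by metis
  have "\<exists>n. \<not> int p ^ n dvd f n" using emb_cong[of f "\<lambda>_. 0"] x f emb_zero by auto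
  then obtain n where n: "\<not> int p ^ n dvd f n" and min: "\<And>m. m < n \<Longrightarrow> int p ^ m dvd f m"
    using exists_least_iff[of "\<lambda>n. \<not> int p ^ n dvd f n"] by blast
  then obtain k where k: "n = Suc k" by (cases n) auto
  have d: "int p ^ k dvd f m" if "m \<ge> k" for m
    using padic_compatible_le[OF f(1) that] min[of k] k by (metis diff_add_cancel dvd_add lessI)
  define g where "g = (\<lambda>m. f (m + k) div int p ^ k)"
  have g: "cmp g" "emb f = of_nat p ^ k * emb g" "\<And>m. f (m + k) = int p ^ k * g m"
    using divide_power[OF f(1) d] unfolding g_def by auto
  have "\<not> int p dvd g 1" using n g(3)[of 1] k by (auto simp: mult.commute)
  then obtain h where "cmp h" "emb g * emb h = 1" using unit[OF g(1)] by blast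
  then show ?thesis using g(1,2) f(2) emb_in by (intro exI[of _ k] exI[of _ "emb g"] exI[of _ "emb h"]) simp
qed

lemma not_unit: assumes y: "y \<in> A" shows "of_nat p * y \<noteq> 1"
proof
  assume eq: "of_nat p * y = 1"
  obtain f where f: "cmp f" "y = emb f" using y emb_cases by metis
  have "emb (\<lambda>n. int p * f n) = emb (\<lambda>n. 1)"
    using emb_mult[OF cmp_const f(1), of "int p"] emb_nat emb_one eq f by simp
  then have "int p ^ 1 dvd int p * f 1 - 1"
    using emb_eq_iff[OF padic_compatible_arith(2)[OF cmp_const f(1)] cmp_const] by blast
  then have "int p dvd 1" by (simp add: dvd_diff_right_iff)
  then show False using p_prime by (metis int_dvd_int_iff int_ops(2) not_prime_unit)
qed

lemma p_nonzero: "of_nat p \<noteq> (0::'a)"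
proof
  assume "of_nat p = (0::'a)"
  then have "emb (\<lambda>n. int p) = emb (\<lambda>n. 0)" using emb_nat emb_zero by simp
  then have "int p ^ 2 dvd int p - 0" using emb_eq_iff[OF cmp_const cmp_const] by blast
  then have "int p * int p dvd int p * 1" by (simp add: power2_eq_square)
  then have "int p dvd 1" using p_pos by (subst (asm) dvd_times_left_cancel_iff) auto
  then show False using p_prime by (metis int_dvd_int_iff int_ops(2) not_prime_unit)
qed

lemma digit_expansion: "\<exists>z\<in>A. \<forall>n. \<exists>w\<in>A. z - (\<Sum>j<n. of_nat (c j) * of_nat p ^ j) = of_nat p ^ n * w"
proof -
  define s where "s n = (\<Sum>j<n. int (c j) * int p ^ j)" for n
  have s: "cmp s" unfolding padic_compatible_def s_def by simp
  have "\<exists>w\<in>A. emb s - (\<Sum>j<n. of_nat (c j) * of_nat p ^ j) = of_nat p ^ n * w" for n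
  proof -
    have c: "cmp (\<lambda>m. s m + (- s n))" by (rule padic_compatible_arith(1)[OF s cmp_const])
    have "int p ^ n dvd s m + (- s n)" if "m \<ge> n" for m using padic_compatible_le[OF s that] by simp
    then obtain g where g: "cmp g" "emb (\<lambda>m. s m + (- s n)) = of_nat p ^ n * emb g"
      using divide_power[OF c] by blast
    have "emb (\<lambda>m. s m + (- s n)) = emb s - of_int (s n)"
      using emb_add[OF s cmp_const, of "- s n"] emb_int[of "- s n"] by simp
    then show ?thesis using g emb_in unfolding s_def by (intro bexI[of _ "emb g"]) auto
  qed
  then show ?thesis using emb_in[OF s] by blast
qed

lemma residue: assumes x: "x \<in> A" shows "\<exists>c::int. \<exists>w\<in>A. x = of_int c + of_nat p * w"
proof -
  obtain f where f: "cmp f" "x = emb f" using x emb_cases by metis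
  have c: "cmp (\<lambda>m. f m + (- f 1))" by (rule padic_compatible_arith(1)[OF f(1) cmp_const])
  have "int p ^ 1 dvd f m + (- f 1)" if "m \<ge> 1" for m using padic_compatible_le[OF f(1) that] by simp
  then obtain g where g: "cmp g" "emb (\<lambda>m. f m + (- f 1)) = of_nat p ^ 1 * emb g"
    using divide_power[OF c] by blast
  have "emb (\<lambda>m. f m + (- f 1)) = x - of_int (f 1)"
    using emb_add[OF f(1) cmp_const, of "- f 1"] emb_int[of "- f 1"] f by simp
  then have "x = of_int (f 1) + of_nat p * emb g" using g by (simp add: algebra_simps)
  then show ?thesis using emb_in[OF g(1)] by blast
qed

text \<open>The elements that have a nonzero denominator in A are closed under the field
  operations.\<close>

lemma fraction_field:
  assumes "k \<in> generate_field ring_of_type_algebra A"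
  shows "\<exists>z\<in>A. z \<noteq> 0 \<and> z * k \<in> A"
  using assms
proof (induction rule: generate_field.induct)
  case one
  then show ?case using A.one_in by (intro bexI[of _ 1]) (auto simp: ring_of_type_simps)
next
  case (incl h)
  then show ?case using A.one_in by (intro bexI[of _ 1]) auto
next
  case (a_inv h)
  interpret field "ring_of_type_algebra :: 'a ring" by (rule field_from_type_algebra)
  have "\<ominus>\<^bsub>ring_of_type_algebra\<^esub> h = - h"
    using minus_equality[of "- h" h] by (simp add: ring_of_type_simps)
  then show ?case using a_inv A.uminus_in by (metis mult_minus_right)
next
  case (m_inv h)
  interpret field "ring_of_type_algebra :: 'a ring" by (rule field_from_type_algebra)
  have h0: "h \<noteq> 0" using m_inv by (simp add: ring_of_type_simps)
  have "h * inv\<^bsub>ring_of_type_algebra\<^esub> h = 1"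
    using Units_r_inv[of h] field_Units h0 by (simp add: ring_of_type_simps)
  moreover obtain z where z: "z \<in> A" "z \<noteq> 0" "z * h \<in> A" using m_inv by blast
  ultimately have "(z * h) * inv\<^bsub>ring_of_type_algebra\<^esub> h = z" by (simp add: mult.assoc)
  then have "(z * h) * inv\<^bsub>ring_of_type_algebra\<^esub> h \<in> A" using z(1) by metis
  then show ?case using z(2,3) h0 by (intro bexI[of _ "z * h"]) simp_all
next
  case (eng_add h1 h2)
  then obtain z1 z2 where z: "z1 \<in> A" "z1 \<noteq> 0" "z1 * h1 \<in> A" "z2 \<in> A" "z2 \<noteq> 0" "z2 * h2 \<in> A" by blast
  have "z1 * z2 * (h1 + h2) = z2 * (z1 * h1) + z1 * (z2 * h2)" by (simp add: algebra_simps)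
  then have "z1 * z2 * (h1 + h2) \<in> A" using z A.add_in A.mult_in by metis
  then show ?case using z A.mult_in by (intro bexI[of _ "z1 * z2"]) (auto simp: ring_of_type_simps)
next
  case (eng_mult h1 h2)
  then obtain z1 z2 where z: "z1 \<in> A" "z1 \<noteq> 0" "z1 * h1 \<in> A" "z2 \<in> A" "z2 \<noteq> 0" "z2 * h2 \<in> A" by blast
  have "z1 * z2 * (h1 * h2) = (z1 * h1) * (z2 * h2)" by (simp add: algebra_simps)
  then have "z1 * z2 * (h1 * h2) \<in> A" using z A.mult_in by metis
  then show ?case using z A.mult_in by (intro bexI[of _ "z1 * z2"]) (auto simp: ring_of_type_simps)
qed

text \<open>N + 1 elements are dependent over the field of fractions. The relation is multiplied by
  the product of the denominators of all coefficients, grouped so that each coefficient meets its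
  own denominator.\<close>

lemma dependent_family:
  assumes "ring.dimension ring_of_type_algebra N (generate_field ring_of_type_algebra A) UNIV"
  shows "\<exists>c. (\<forall>i\<le>N. c i \<in> A) \<and> (\<exists>i\<le>N. c i \<noteq> 0) \<and> (\<Sum>i\<le>N. c i * x i) = (0::'a)"
proof -
  interpret field "ring_of_type_algebra :: 'a ring" by (rule field_from_type_algebra)
  let ?K = "generate_field ring_of_type_algebra A"
  have K: "subfield ?K ring_of_type_algebra"
    by (rule generate_field_is_subfield) (simp add: ring_of_type_simps)
  define Us where "Us = map x [0..<Suc N]"
  have "\<not> independent ?K Us"
    using independent_length_le_dimension[OF K assms, of Us] unfolding Us_def by auto
  then obtain Ks where Ks: "length Ks = length Us" "combine Ks Us = \<zero>\<^bsub>ring_of_type_algebra\<^esub>"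
    "set Ks \<subseteq> ?K" "set Ks \<noteq> {\<zero>\<^bsub>ring_of_type_algebra\<^esub>}"
    using dependent_imp_non_trivial_combine[OF K, of Us] by (metis ring_of_type_simps(1) subset_UNIV)
  have comb: "combine Ks Us = (\<Sum>i<length Us. Ks ! i * Us ! i)" if "length Ks = length Us" for Ks Us :: "'a list"
    using that
    by (induction Ks Us rule: list_induct2) (auto simp: ring_of_type_simps sum.lessThan_Suc_shift simp del: sum.lessThan_Suc)
  have len: "length Us = Suc N" "length Ks = Suc N" using Ks unfolding Us_def by auto
  have sum0: "(\<Sum>i\<le>N. Ks ! i * x i) = 0"
  proof -
    have "Us ! i = x i" if "i < Suc N" for i using that unfolding Us_def by (simp del: upt_Suc)
    then show ?thesis using Ks(2) comb[OF Ks(1)] len by (simp add: ring_of_type_simps lessThan_Suc_atMost)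
  qed
  have nz: "\<exists>i\<le>N. Ks ! i \<noteq> 0"
  proof (rule ccontr)
    assume "\<not> ?thesis"
    then have "set Ks = {0}" using len by (force simp: set_conv_nth less_Suc_eq_le)
    then show False using Ks(4) by (simp add: ring_of_type_simps)
  qed
  have "\<forall>i\<in>{..N}. \<exists>z\<in>A. z \<noteq> 0 \<and> z * Ks ! i \<in> A"
  proof
    fix i assume "i \<in> {..N}"
    then have "Ks ! i \<in> ?K" using Ks(3) len by auto
    then show "\<exists>z\<in>A. z \<noteq> 0 \<and> z * Ks ! i \<in> A" by (rule fraction_field)
  qed
  then obtain z where z: "\<And>i. i \<le> N \<Longrightarrow> z i \<in> A" "\<And>i. i \<le> N \<Longrightarrow> z i \<noteq> 0" "\<And>i. i \<le> N \<Longrightarrow> z i * Ks ! i \<in> A"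
    by (metis atMost_iff)
  define c where "c i = (\<Prod>j\<in>{..N} - {i}. z j) * (z i * Ks ! i)" for i
  have prod_in: "(\<Prod>j\<in>J. z j) \<in> A" if "J \<subseteq> {..N}" for J
    using finite_subset[OF that finite_atMost] that
    by (induction J rule: finite_induct) (auto simp: A.one_in z intro!: A.mult_in)
  have prod: "c i = (\<Prod>j\<le>N. z j) * Ks ! i" if "i \<le> N" for i
    using that prod.remove[of "{..N}" i z] unfolding c_def by (simp add: algebra_simps)
  have "(\<Sum>i\<le>N. c i * x i) = (\<Prod>j\<le>N. z j) * (\<Sum>i\<le>N. Ks ! i * x i)"
    by (simp add: prod sum_distrib_left mult.assoc)
  moreover have "c i \<in> A" if "i \<le> N" for i unfolding c_def
    by (intro A.mult_in[OF prod_in z(3)[OF that]]) auto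
  moreover have "\<exists>i\<le>N. c i \<noteq> 0" using nz z by (auto simp: prod)
  ultimately show ?thesis using sum0 by (intro exI[of _ c]) auto
qed

lemma padic_extension:
  assumes "ring.dimension ring_of_type_algebra N (generate_field ring_of_type_algebra A) UNIV"
  shows "padic_extension A p N"
  by unfold_locales
    (use p_prime p_nonzero not_unit nonzero_decomp digit_expansion residue dependent_family[OF assms] in auto)

end

lemma padic_field_integers_extension:
  assumes "Factorial_Ring.prime p" "padic_field_integers p \<O>"
  obtains A N where "padic_extension A p N" "\<O> = integral_closure A"
proof -
  obtain \<iota> where \<iota>: "\<iota> \<in> ring_hom (padic_int_ring p) ring_of_type_algebra" "inj_on \<iota> (carrier (padic_int_ring p))"
    and fin: "ring.finite_dimension ring_of_type_algebra
         (generate_field ring_of_type_algebra (\<iota> ` carrier (padic_int_ring p))) UNIV"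
    and O: "\<O> = integral_closure (\<iota> ` carrier (padic_int_ring p))"
    using assms(2) unfolding padic_field_integers_def by blast
  interpret padic_embedding p \<iota> using assms(1) \<iota> by unfold_locales
  obtain N where "ring.dimension ring_of_type_algebra N (generate_field ring_of_type_algebra A) UNIV"
    using fin unfolding ring.finite_dimension_def[OF ring_from_type_algebra] by blast
  then show ?thesis using padic_extension that O by blast
qed

lemma noetherian_padic_integers:
  assumes "Factorial_Ring.prime p" "padic_field_integers p \<O>"
  shows "noetherian_ring (subset_ring \<O>)" "cring (subset_ring \<O>)"
proof -
  obtain A N where "padic_extension A p N" and O: "\<O> = integral_closure A"
    using padic_field_integers_extension[OF assms] by blast
  then interpret padic_extension A p N by blast
  show "noetherian_ring (subset_ring \<O>)" "cring (subset_ring \<O>)"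
    unfolding O by (rule noetherian_integers, rule O.cring_subset_ring)
qed

section \<open>Complete discrete valuation rings with finite residue field\<close>

text \<open>Common ground of the p-adic and the Laurent series case. The axiom \<open>unif\<close>
  is kept for the residue field, whose cardinality enters the Teichmueller representatives.\<close>

locale cdvr = field_subring A for A :: "'a::field set" +
  fixes \<pi> :: 'a
  assumes pi_in: "\<pi> \<in> A" and pi_nonzero: "\<pi> \<noteq> 0"
    and pi_not_unit: "y \<in> A \<Longrightarrow> \<pi> * y \<noteq> 1"
    and decomp: "\<lbrakk>x \<in> A; x \<noteq> 0\<rbrakk> \<Longrightarrow> \<exists>k u v. x = \<pi> ^ k * u \<and> u \<in> A \<and> v \<in> A \<and> u * v = 1"
    and fraction: "\<exists>k. \<pi> ^ k * x \<in> A"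
    and residue_finite: "\<exists>F. finite F \<and> F \<subseteq> A \<and> (\<forall>a\<in>A. \<exists>f\<in>F. \<exists>b\<in>A. a = f + \<pi> * b)"
    and complete: "\<lbrakk>\<And>k. s k \<in> A; \<And>k. \<exists>b\<in>A. s (Suc k) - s k = \<pi> ^ k * b\<rbrakk> \<Longrightarrow>
      \<exists>l\<in>A. \<forall>k. \<exists>b\<in>A. l - s k = \<pi> ^ k * b"
    and unif: "uniformizer A \<pi>"
begin

section \<open>Powers of the maximal ideal\<close>

definition pw :: "nat \<Rightarrow> 'a set" where "pw k = (\<lambda>b. \<pi> ^ k * b) ` A"

lemma pwI: "b \<in> A \<Longrightarrow> \<pi> ^ k * b \<in> pw k"
  unfolding pw_def by blast

lemma pi_power_nonzero: "\<pi> ^ k \<noteq> 0" using pi_nonzero by simp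

lemma pw_iff: "x \<in> pw k \<longleftrightarrow> x / \<pi> ^ k \<in> A"
  unfolding pw_def using pi_nonzero by (auto simp: image_iff intro!: bexI[of _ "x / \<pi> ^ k"])

lemma pw_0: "pw 0 = A" unfolding pw_def by simp

lemma pw_zero: "0 \<in> pw k" using pwI[OF zero_in, of k] by simp

lemma pw_add: "\<lbrakk>x \<in> pw k; y \<in> pw k\<rbrakk> \<Longrightarrow> x + y \<in> pw k"
  unfolding pw_iff by (simp add: add_divide_distrib add_in)

lemma pw_uminus: "x \<in> pw k \<Longrightarrow> - x \<in> pw k"
  unfolding pw_iff using uminus_in[of "x / \<pi> ^ k"] by simp

lemma pw_diff: "\<lbrakk>x \<in> pw k; y \<in> pw k\<rbrakk> \<Longrightarrow> x - y \<in> pw k"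
  using pw_add[of x k "- y"] pw_uminus by simp

lemma pw_sum: "(\<And>i. i \<in> I \<Longrightarrow> f i \<in> pw k) \<Longrightarrow> sum f I \<in> pw k"
  by (induction I rule: infinite_finite_induct) (auto simp: pw_zero pw_add)

lemma pw_mult: "\<lbrakk>x \<in> pw j; y \<in> pw k\<rbrakk> \<Longrightarrow> x * y \<in> pw (j + k)"
  unfolding pw_iff using mult_in[of "x / \<pi> ^ j" "y / \<pi> ^ k"] by (simp add: power_add)

lemma pw_mult_A: "\<lbrakk>x \<in> pw k; a \<in> A\<rbrakk> \<Longrightarrow> x * a \<in> pw k" "\<lbrakk>x \<in> pw k; a \<in> A\<rbrakk> \<Longrightarrow> a * x \<in> pw k"
  using pw_mult[of x k a 0] pw_mult[of a 0 x k] by (auto simp: pw_0)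

lemma pi_power_pw: "\<pi> ^ k \<in> pw k" using pwI[OF one_in, of k] by simp

lemma pw_antimono: assumes "j \<le> k" "x \<in> pw k" shows "x \<in> pw j"
proof -
  have "\<pi> ^ (k - j) * (x / \<pi> ^ k) \<in> A" using assms pi_in unfolding pw_iff by (intro mult_in power_in)
  moreover have "\<pi> ^ k = \<pi> ^ (k - j) * \<pi> ^ j" using assms by (simp flip: power_add)
  ultimately show ?thesis unfolding pw_iff using pi_nonzero by (simp add: field_simps)
qed

lemma pw_in: "x \<in> pw k \<Longrightarrow> x \<in> A" using pw_antimono[of 0 k x] by (simp add: pw_0)

lemma complete_pw:
  assumes "\<And>k. s k \<in> A" "\<And>k. s (Suc k) - s k \<in> pw k"
  shows "\<exists>l\<in>A. \<forall>k. l - s k \<in> pw k"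
proof -
  have "\<exists>b\<in>A. s (Suc k) - s k = \<pi> ^ k * b" for k using assms(2)[of k] unfolding pw_def by blast
  then show ?thesis using complete[of s] assms(1) unfolding pw_def by (auto simp: image_iff)
qed

lemma unit_or_pw: assumes x: "x \<in> A" shows "x \<in> pw 1 \<or> x \<noteq> 0 \<and> inverse x \<in> A"
proof (cases "x = 0")
  case True
  then show ?thesis by (simp add: pw_zero)
next
  case False
  then obtain k u v where kuv: "x = \<pi> ^ k * u" "u \<in> A" "v \<in> A" "u * v = 1" using decomp[OF x] by blast
  show ?thesis
  proof (cases k)
    case 0
    then have "inverse x = v" using kuv by (simp add: inverse_unique)
    then show ?thesis using False kuv by simp
  next
    case (Suc j)
    then have "x \<in> pw k" using kuv pwI by blast
    then show ?thesis using pw_antimono[of 1 k] Suc by simp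
  qed
qed

lemma pw_1_not_unit: "\<lbrakk>x \<in> pw 1; x \<noteq> 0; inverse x \<in> A\<rbrakk> \<Longrightarrow> False"
  using pi_not_unit[of "x / \<pi> * inverse x"] mult_in[of "x / \<pi>" "inverse x"] pi_nonzero unfolding pw_iff by simp

lemma inverse_pi_notin: "inverse \<pi> \<notin> A"
  using pi_not_unit[of "inverse \<pi>"] pi_nonzero by auto

lemma one_plus_unit: assumes x: "x \<in> pw 1" shows "1 + x \<noteq> 0" "inverse (1 + x) \<in> A"
proof -
  have "1 + x \<notin> pw 1"
  proof
    assume "1 + x \<in> pw 1"
    then have "1 \<in> pw 1" using pw_diff[OF _ x, of "1 + x"] by simp
    then show False using pw_1_not_unit[of 1] one_in by simp
  qed
  then show "1 + x \<noteq> 0" "inverse (1 + x) \<in> A"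
    using unit_or_pw[OF add_in[OF one_in pw_in[OF x]]] by auto
qed

lemma Inter_pw: assumes "\<And>k. x \<in> pw k" shows "x = 0"
proof (rule ccontr)
  assume x0: "x \<noteq> 0"
  have "x \<in> A" using assms[of 0] by (simp add: pw_0)
  then obtain k u v where kuv: "x = \<pi> ^ k * u" "u \<in> A" "v \<in> A" "u * v = 1" using decomp x0 by blast
  have "x / \<pi> ^ Suc k \<in> A" using assms[of "Suc k"] unfolding pw_iff .
  then have "u / \<pi> \<in> A" using kuv pi_nonzero by simp
  then have "u / \<pi> * v \<in> A" using kuv by (intro mult_in)
  moreover have "u / \<pi> * v = inverse \<pi>" using kuv by (simp add: field_simps)
  ultimately show False using inverse_pi_notin by simp
qed

lemma fraction_pw: "\<exists>k. \<pi> ^ k * x \<in> pw j"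
proof -
  obtain k where "\<pi> ^ k * x \<in> A" using fraction by blast
  then have "\<pi> ^ j * (\<pi> ^ k * x) \<in> pw j" by (rule pwI)
  then show ?thesis by (intro exI[of _ "j + k"]) (simp add: power_add mult.assoc)
qed

lemma fraction_all: "\<exists>k. \<forall>n\<ge>k. \<pi> ^ n * x \<in> A"
proof -
  obtain k where k: "\<pi> ^ k * x \<in> A" using fraction by blast
  have "\<pi> ^ n * x \<in> A" if "n \<ge> k" for n
  proof -
    have "\<pi> ^ n * x = \<pi> ^ (n - k) * (\<pi> ^ k * x)" using that by (simp add: mult.assoc[symmetric] flip: power_add)
    then show ?thesis using mult_in[OF power_in[OF pi_in] k] by metis
  qed
  then show ?thesis by blast
qed

subsection \<open>Teichmueller representatives\<close>

abbreviation q where "q \<equiv> residue_card A \<pi>"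

text \<open>Lagrange's theorem in the multiplicative group of the residue field gives the Frobenius
  congruence, in its additive group the vanishing of q.\<close>

lemma residue_field:
  shows q_pos: "q > 0" and q_pw: "of_nat q \<in> pw 1" and Frobenius: "x \<in> A \<Longrightarrow> x ^ q - x \<in> pw 1"
proof -
  let ?R = "subset_ring A" and ?I = "PIdl\<^bsub>subset_ring A\<^esub> \<pi>"
  interpret R: cring ?R by (rule cring_subset_ring)
  have max: "maximalideal ?I ?R" using unif unfolding uniformizer_def by simp
  then interpret I: maximalideal ?I ?R .
  interpret K: field "?R Quot ?I" using I.quotient_is_field[OF R.cring_axioms] .
  have I: "?I = pw 1" unfolding cgenideal_def pw_def by (auto simp: ring_of_type_simps mult.commute)
  have hom: "(+>\<^bsub>?R\<^esub>) ?I \<in> ring_hom ?R (?R Quot ?I)" by (rule I.rcos_ring_hom)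
  have eq: "x - y \<in> pw 1" if "?I +>\<^bsub>?R\<^esub> x = ?I +>\<^bsub>?R\<^esub> y" "x \<in> A" "y \<in> A" for x y
  proof -
    have "x \<in> ?I +>\<^bsub>?R\<^esub> y" using I.a_rcos_self[of x] that by simp
    then obtain i where "i \<in> ?I" "x = i + y" unfolding a_r_coset_def' by (auto simp: ring_of_type_simps)
    then show ?thesis using I by simp
  qed
  have cong: "?I +>\<^bsub>?R\<^esub> x = ?I +>\<^bsub>?R\<^esub> y" if "x - y \<in> pw 1" "x \<in> A" "y \<in> A" for x y
  proof -
    have "x = (x - y) \<oplus>\<^bsub>?R\<^esub> y" by (simp add: ring_of_type_simps)
    then have "x \<in> ?I +>\<^bsub>?R\<^esub> y" unfolding a_r_coset_def' using that I by blast
    then show ?thesis using R.a_repr_independence[OF _ _ I.a_subgroup, of x y] that by simp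
  qed
  obtain F where F: "finite F" "F \<subseteq> A" "\<And>a. a \<in> A \<Longrightarrow> \<exists>f\<in>F. \<exists>b\<in>A. a = f + \<pi> * b" using residue_finite by meson
  have "carrier (?R Quot ?I) \<subseteq> (\<lambda>f. ?I +>\<^bsub>?R\<^esub> f) ` F"
  proof
    fix X assume "X \<in> carrier (?R Quot ?I)"
    then obtain a where a: "a \<in> A" "X = ?I +>\<^bsub>?R\<^esub> a" unfolding FactRing_def A_RCOSETS_def' by auto
    obtain f b where f: "f \<in> F" "b \<in> A" "a = f + \<pi> * b" using F(3)[OF a(1)] by blast
    then have "a - f \<in> pw 1" using pwI[of b 1] by simp
    then have "X = ?I +>\<^bsub>?R\<^esub> f" using cong a f F(2) by blast
    then show "X \<in> (\<lambda>f. ?I +>\<^bsub>?R\<^esub> f) ` F" using f by blast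
  qed
  then have fin: "finite (carrier (?R Quot ?I))" using F(1) finite_subset by blast
  have ord: "Coset.order (?R Quot ?I) = q" unfolding residue_card_def Coset.order_def by simp
  show qp: "q > 0" unfolding residue_card_def using fin K.zero_closed by (auto simp: card_gt_0_iff)
  show "x ^ q - x \<in> pw 1" if x: "x \<in> A" for x
  proof -
    let ?y = "?I +>\<^bsub>?R\<^esub> x"
    have y: "?y \<in> carrier (?R Quot ?I)" using ring_hom_closed[OF hom, of x] x by simp
    have pow: "?I +>\<^bsub>?R\<^esub> (x ^ n) = ?y [^]\<^bsub>?R Quot ?I\<^esub> n" for n
    proof (induction n)
      case 0
      show ?case using ring_hom_one[OF hom] by (simp add: ring_of_type_simps)
    next
      case (Suc n)
      have "?I +>\<^bsub>?R\<^esub> (x ^ n * x) = (?I +>\<^bsub>?R\<^esub> (x ^ n)) \<otimes>\<^bsub>?R Quot ?I\<^esub> ?y"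
        using ring_hom_mult[OF hom, of "x ^ n" x] power_in[OF x] x by (simp add: ring_of_type_simps)
      then show ?case using Suc by (simp add: mult.commute)
    qed
    have "?y [^]\<^bsub>?R Quot ?I\<^esub> q = ?y"
    proof (cases "?y = \<zero>\<^bsub>?R Quot ?I\<^esub>")
      case True
      then show ?thesis using qp K.nat_pow_zero by auto
    next
      case False
      interpret M: group "Multiplicative_Group.mult_of (?R Quot ?I)" by (rule K.field_mult_group)
      have "Coset.order (Multiplicative_Group.mult_of (?R Quot ?I)) = q - 1"
        using K.order_mult_of[OF fin] ord by simp
      then have "?y [^]\<^bsub>Multiplicative_Group.mult_of (?R Quot ?I)\<^esub> (q - 1) = \<one>\<^bsub>?R Quot ?I\<^esub>"
        using M.pow_order_eq_1[of ?y] y False by simp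
      then have "?y [^]\<^bsub>?R Quot ?I\<^esub> (q - 1) = \<one>\<^bsub>?R Quot ?I\<^esub>" by (simp add: Multiplicative_Group.nat_pow_mult_of)
      then have "?y [^]\<^bsub>?R Quot ?I\<^esub> Suc (q - 1) = ?y" using y by simp
      then show ?thesis using qp by simp
    qed
    then show ?thesis using eq[OF _ power_in[OF x] x] pow[of q] by simp
  qed
  have nat: "?I +>\<^bsub>?R\<^esub> (of_nat n) = [n] \<cdot>\<^bsub>?R Quot ?I\<^esub> \<one>\<^bsub>?R Quot ?I\<^esub>" for n
  proof (induction n)
    case 0
    show ?case using ring_hom_zero[OF hom R.ring_axioms K.ring_axioms] by (simp add: ring_of_type_simps)
  next
    case (Suc n)
    have "?I +>\<^bsub>?R\<^esub> (of_nat n + 1) = (?I +>\<^bsub>?R\<^esub> (of_nat n)) \<oplus>\<^bsub>?R Quot ?I\<^esub> \<one>\<^bsub>?R Quot ?I\<^esub>"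
      using ring_hom_add[OF hom, of "of_nat n" 1] ring_hom_one[OF hom] of_nat_in one_in by (simp add: ring_of_type_simps)
    then show ?case using Suc by (simp add: add.commute)
  qed
  have "[q] \<cdot>\<^bsub>?R Quot ?I\<^esub> \<one>\<^bsub>?R Quot ?I\<^esub> = \<zero>\<^bsub>?R Quot ?I\<^esub>"
    using K.add.pow_order_eq_1[of "\<one>\<^bsub>?R Quot ?I\<^esub>"] ord unfolding Coset.order_def by simp
  then have "?I +>\<^bsub>?R\<^esub> (of_nat q) = ?I +>\<^bsub>?R\<^esub> 0"
    using nat[of q] nat[of 0] by simp
  then show "of_nat q \<in> pw 1" using eq[OF _ of_nat_in zero_in] by simp
qed

text \<open>The difference of the q-th powers is y - z times a sum congruent to
  \<open>q * z ^ (q - 1)\<close>, hence to 0, modulo pi.\<close>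

lemma power_q_cong:
  assumes "y \<in> A" "z \<in> A" "k \<ge> 1" "y - z \<in> pw k"
  shows "y ^ q - z ^ q \<in> pw (Suc k)"
proof -
  have yz: "y - z \<in> pw 1" using assms(3,4) by (rule pw_antimono)
  have "y ^ i - z ^ i \<in> pw 1" for i
  proof (induction i)
    case (Suc i)
    have "y ^ Suc i - z ^ Suc i = (y - z) * y ^ i + z * (y ^ i - z ^ i)" by (simp add: algebra_simps)
    then show ?case
      using pw_add[OF pw_mult_A(1)[OF yz power_in[OF assms(1)]] pw_mult_A(2)[OF Suc assms(2)]] by metis
  qed (simp add: pw_zero)
  then have "z ^ (q - Suc i) * y ^ i - z ^ (q - Suc i) * z ^ i \<in> pw 1" for i
    using pw_mult_A(2)[OF _ power_in[OF assms(2)]] by (metis right_diff_distrib)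
  then have "(\<Sum>i<q. z ^ (q - Suc i) * y ^ i - z ^ (q - Suc i) * z ^ i) \<in> pw 1" by (intro pw_sum)
  moreover have "(\<Sum>i<q. z ^ (q - Suc i) * z ^ i) = of_nat q * z ^ (q - 1)"
  proof -
    have "(\<Sum>i<q. z ^ (q - Suc i) * z ^ i) = (\<Sum>i<q. z ^ (q - 1))"
      by (intro sum.cong) (auto simp flip: power_add)
    then show ?thesis by simp
  qed
  moreover have "of_nat q * z ^ (q - 1) \<in> pw 1" using q_pw assms by (intro pw_mult_A power_in)
  ultimately have "(\<Sum>i<q. z ^ (q - Suc i) * y ^ i) \<in> pw 1"
    using pw_add[of "(\<Sum>i<q. z ^ (q - Suc i) * y ^ i - z ^ (q - Suc i) * z ^ i)" 1 "of_nat q * z ^ (q - 1)"]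
    by (simp add: sum_subtractf)
  from pw_mult[OF assms(4) this] show ?thesis by (simp add: power_diff_sumr2 mult.commute)
qed

text \<open>Raising to the power q fixes both elements but improves their congruence by one power of
  pi.\<close>

lemma teichmueller_unique:
  assumes "x \<in> teichmueller A \<pi>" "y \<in> teichmueller A \<pi>" "x - y \<in> pw 1"
  shows "x = y"
proof -
  have xy: "x \<in> A" "x ^ q = x" "y \<in> A" "y ^ q = y" using assms unfolding teichmueller_def by auto
  have "x - y \<in> pw (Suc k)" for k
    by (induction k) (use assms(3) power_q_cong[of x y] xy in auto)
  then have "x - y \<in> pw k" for k using pw_antimono[of k "Suc k"] by simp
  then show ?thesis using Inter_pw[of "x - y"] by simp
qed

text \<open>The representative is the limit of the powers of x with exponent q^k.\<close>

lemma teichmueller_exists: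
  assumes x: "x \<in> A" shows "\<exists>\<tau>\<in>teichmueller A \<pi>. x - \<tau> \<in> pw 1"
proof -
  define s where "s k = x ^ (q ^ k)" for k
  have s: "s k \<in> A" "s (Suc k) = s k ^ q" for k
    unfolding s_def using power_in[OF x] by (auto simp: mult.commute simp flip: power_mult)
  have step: "s (Suc k) - s k \<in> pw (Suc k)" for k
  proof (induction k)
    case 0
    show ?case using Frobenius[OF x] by (simp add: s_def)
  next
    case (Suc k)
    show ?case using power_q_cong[OF s(1) s(1) _ Suc] s(2) by simp
  qed
  then have "s (Suc k) - s k \<in> pw k" for k using pw_antimono[of k "Suc k"] by simp
  then obtain l where l: "l \<in> A" "\<And>k. l - s k \<in> pw k" using complete_pw[of s] s(1) by blast
  have "l ^ q - l \<in> pw k" for k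
  proof -
    have "l ^ q - s (Suc (Suc k)) \<in> pw (Suc (Suc k))"
      using power_q_cong[OF l(1) s(1) _ l(2)[of "Suc k"]] s(2) by simp
    then have "l ^ q - l \<in> pw (Suc (Suc k))" using pw_diff[OF _ l(2)[of "Suc (Suc k)"]] by fastforce
    then show ?thesis using pw_antimono[of k "Suc (Suc k)"] by simp
  qed
  then have "l ^ q = l" using Inter_pw[of "l ^ q - l"] by simp
  moreover have "x - l \<in> pw 1"
  proof -
    have "(l - s 1) + (s 1 - s 0) \<in> pw 1" using l(2)[of 1] step[of 0] by (intro pw_add) auto
    then have "l - x \<in> pw 1" by (simp add: s_def)
    then show ?thesis using pw_uminus by fastforce
  qed
  ultimately show ?thesis using l(1) unfolding teichmueller_def by blast
qed

lemma teichmueller_subset: "teichmueller A \<pi> \<subseteq> A"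
  unfolding teichmueller_def by blast

lemma teichmueller_finite: "finite (teichmueller A \<pi>)"
proof -
  obtain F where F: "finite F" "F \<subseteq> A" "\<And>a. a \<in> A \<Longrightarrow> \<exists>f\<in>F. \<exists>b\<in>A. a = f + \<pi> * b" using residue_finite by meson
  have "\<forall>x\<in>teichmueller A \<pi>. \<exists>f\<in>F. x - f \<in> pw 1"
  proof
    fix x assume "x \<in> teichmueller A \<pi>"
    then obtain f b where "f \<in> F" "b \<in> A" "x = f + \<pi> * b" using F(3) teichmueller_subset by blast
    then show "\<exists>f\<in>F. x - f \<in> pw 1" using pwI[of b 1] by (intro bexI[of _ f]) auto
  qed
  then obtain g where g: "\<And>x. x \<in> teichmueller A \<pi> \<Longrightarrow> g x \<in> F" "\<And>x. x \<in> teichmueller A \<pi> \<Longrightarrow> x - g x \<in> pw 1" by metis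
  have "inj_on g (teichmueller A \<pi>)"
  proof (rule inj_onI)
    fix x y assume xy: "x \<in> teichmueller A \<pi>" "y \<in> teichmueller A \<pi>" "g x = g y"
    have "(x - g x) - (y - g y) \<in> pw 1" by (rule pw_diff[OF g(2)[OF xy(1)] g(2)[OF xy(2)]])
    then show "x = y" using teichmueller_unique xy by simp
  qed
  then show ?thesis using F(1) g(1) by (meson finite_imageD finite_subset image_subsetI)
qed

lemma zero_teichmueller: "0 \<in> teichmueller A \<pi>"
  unfolding teichmueller_def using q_pos zero_in by simp

subsection \<open>Topology\<close>

text \<open>The balls x + pi^k A are cofinal among the generating sets x + a A, because some power
  of pi is a multiple of a.\<close>

lemma openin_field_topology:
  "openin (field_topology A) S \<longleftrightarrow> (\<forall>x\<in>S. \<exists>k. \<forall>b\<in>pw k. x + b \<in> S)"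
proof
  assume "openin (field_topology A) S"
  then have "generate_topology_on {(\<lambda>y. x + a * y) ` A | x a. a \<noteq> 0} S"
    unfolding field_topology_def openin_topology_generated_by_iff .
  then show "\<forall>x\<in>S. \<exists>k. \<forall>b\<in>pw k. x + b \<in> S"
  proof (induction rule: generate_topology_on.induct)
    case (Int S S')
    show ?case
    proof
      fix x assume x: "x \<in> S \<inter> S'"
      then obtain k k' where k: "\<forall>b\<in>pw k. x + b \<in> S" "\<forall>b\<in>pw k'. x + b \<in> S'" using Int by blast
      then show "\<exists>k. \<forall>b\<in>pw k. x + b \<in> S \<inter> S'"
        using pw_antimono[of k "max k k'"] pw_antimono[of k' "max k k'"] by (intro exI[of _ "max k k'"]) auto
    qed
  next
    case (UN \<K>)
    then show ?case by (meson UnionE UnionI)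
  next
    case (Basis S)
    then obtain x0 a where S: "S = (\<lambda>y. x0 + a * y) ` A" "a \<noteq> 0" by blast
    show ?case
    proof
      fix x assume "x \<in> S"
      then obtain y where y: "y \<in> A" "x = x0 + a * y" using S by blast
      obtain k where k: "\<pi> ^ k * inverse a \<in> A" using fraction by blast
      have "x + b \<in> S" if b: "b \<in> pw k" for b
      proof -
        obtain c where c: "c \<in> A" "b = \<pi> ^ k * c" using b unfolding pw_def by blast
        have "x + b = x0 + a * (y + \<pi> ^ k * inverse a * c)" using y c S(2) by (simp add: field_simps)
        moreover have "y + \<pi> ^ k * inverse a * c \<in> A" by (intro add_in mult_in[OF k] y c)
        ultimately show ?thesis unfolding S by blast
      qed
      then show "\<exists>k. \<forall>b\<in>pw k. x + b \<in> S" by blast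
    qed
  qed auto
next
  assume R: "\<forall>x\<in>S. \<exists>k. \<forall>b\<in>pw k. x + b \<in> S"
  show "openin (field_topology A) S"
  proof (subst openin_subopen, safe)
    fix x assume "x \<in> S"
    then obtain k where k: "\<forall>b\<in>pw k. x + b \<in> S" using R by blast
    let ?U = "(\<lambda>y. x + \<pi> ^ k * y) ` A"
    have "openin (field_topology A) ?U" unfolding field_topology_def
      by (rule topology_generated_by_Basis) (use pi_power_nonzero in blast)
    moreover have "x \<in> ?U" using zero_in by (auto simp: image_iff intro!: bexI[of _ 0])
    moreover have "?U \<subseteq> S" using k pwI by auto
    ultimately show "\<exists>T. openin (field_topology A) T \<and> x \<in> T \<and> T \<subseteq> S" by blast
  qed
qed

lemma topspace_field_topology: "topspace (field_topology A) = UNIV"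
  using openin_field_topology[of UNIV] openin_subset by fastforce

lemma openin_matrix_topology:
  "openin (matrix_topology A) S \<longleftrightarrow>
    (\<forall>M\<in>S. \<exists>k. \<forall>N. (\<forall>i j. N $ i $ j - M $ i $ j \<in> pw k) \<longrightarrow> N \<in> S)"
proof -
  let ?f = "\<lambda>(M::'a^2^2) (i, j). M $ i $ j"
  let ?g = "\<lambda>\<phi>. (\<chi> i j. \<phi> (i, j)) :: 'a^2^2"
  have fg: "?f (?g \<phi>) = \<phi>" for \<phi> by (auto simp: fun_eq_iff)
  have gf: "?g (?f M) = M" for M by (simp add: vec_eq_iff)
  have "openin (matrix_topology A) S \<longleftrightarrow> (\<exists>U. openin (product_topology (\<lambda>_. field_topology A) UNIV) U \<and> S = ?f -` U)"
    unfolding matrix_topology_def openin_pullback_topology by auto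
  also have "\<dots> \<longleftrightarrow> openin (product_topology (\<lambda>_. field_topology A) UNIV) (?g -` S)"
  proof
    assume "\<exists>U. openin (product_topology (\<lambda>_. field_topology A) UNIV) U \<and> S = ?f -` U"
    then obtain U where U: "openin (product_topology (\<lambda>_. field_topology A) UNIV) U" "S = ?f -` U" by blast
    have "?g -` S = U" unfolding U(2) vimage_def mem_Collect_eq fg by simp
    then show "openin (product_topology (\<lambda>_. field_topology A) UNIV) (?g -` S)" using U by simp
  next
    assume "openin (product_topology (\<lambda>_. field_topology A) UNIV) (?g -` S)"
    moreover have "S = ?f -` (?g -` S)" by (auto simp: vimage_def vec_lambda_eta)
    ultimately show "\<exists>U. openin (product_topology (\<lambda>_. field_topology A) UNIV) U \<and> S = ?f -` U" by blast
  qed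
  also have "\<dots> \<longleftrightarrow> (\<forall>\<phi>\<in>?g -` S. \<exists>X. (\<forall>i. openin (field_topology A) (X i)) \<and> \<phi> \<in> Pi UNIV X \<and> Pi UNIV X \<subseteq> ?g -` S)"
    unfolding openin_product_topology_alt by (simp add: PiE_UNIV_domain)
  also have "\<dots> \<longleftrightarrow> (\<forall>M\<in>S. \<exists>k. \<forall>N. (\<forall>i j. N $ i $ j - M $ i $ j \<in> pw k) \<longrightarrow> N \<in> S)" (is "?L = ?R")
  proof
    assume L: ?L
    show ?R
    proof
      fix M assume M: "M \<in> S"
      then have "?f M \<in> ?g -` S" using gf by simp
      then obtain X where X: "\<And>i. openin (field_topology A) (X i)" "?f M \<in> Pi UNIV X" "Pi UNIV X \<subseteq> ?g -` S" using L by metis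
      have "\<forall>i. \<exists>k. \<forall>b\<in>pw k. ?f M i + b \<in> X i" using X(1,2) unfolding openin_field_topology by blast
      then obtain k where k: "\<And>i b. b \<in> pw (k i) \<Longrightarrow> ?f M i + b \<in> X i" by metis
      define m where "m = Max (range k)"
      have m: "k i \<le> m" for i unfolding m_def by simp
      have "N \<in> S" if N: "\<forall>i j. N $ i $ j - M $ i $ j \<in> pw m" for N
      proof -
        have "?f N \<in> Pi UNIV X"
        proof
          fix i :: "2 \<times> 2"
          have "N $ fst i $ snd i - M $ fst i $ snd i \<in> pw (k i)" using N m pw_antimono by blast
          from k[OF this] show "?f N i \<in> X i" by (simp add: case_prod_beta)
        qed
        then have "?g (?f N) \<in> S" using X(3) by blast
        then show ?thesis unfolding gf .
      qed
      then show "\<exists>k. \<forall>N. (\<forall>i j. N $ i $ j - M $ i $ j \<in> pw k) \<longrightarrow> N \<in> S" by blast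
    qed
  next
    assume R: ?R
    show ?L
    proof
      fix \<phi> assume "\<phi> \<in> ?g -` S"
      then obtain k where k: "\<And>N. (\<forall>i j. N $ i $ j - ?g \<phi> $ i $ j \<in> pw k) \<Longrightarrow> N \<in> S" using R by (metis vimageE)
      let ?X = "\<lambda>i. {y. y - \<phi> i \<in> pw k}"
      have "openin (field_topology A) (?X i)" for i unfolding openin_field_topology
      proof
        fix y assume y: "y \<in> ?X i"
        have "y + b - \<phi> i \<in> pw k" if "b \<in> pw k" for b using pw_add[OF _ that, of "y - \<phi> i"] y by (simp add: algebra_simps)
        then show "\<exists>j. \<forall>b\<in>pw j. y + b \<in> ?X i" by blast
      qed
      moreover have "\<phi> \<in> Pi UNIV ?X" using pw_zero by simp
      moreover have "Pi UNIV ?X \<subseteq> ?g -` S" 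
      proof
        fix \<psi> assume "\<psi> \<in> Pi UNIV ?X"
        then have "\<psi> i - \<phi> i \<in> pw k" for i by (cases i) (simp add: Pi_iff)
        then show "\<psi> \<in> ?g -` S" by (auto intro!: k)
      qed
      ultimately show "\<exists>X. (\<forall>i. openin (field_topology A) (X i)) \<and> \<phi> \<in> Pi UNIV X \<and> Pi UNIV X \<subseteq> ?g -` S" by (intro exI[of _ ?X] conjI allI)
    qed
  qed
  finally show ?thesis .
qed

lemma topspace_matrix_topology: "topspace (matrix_topology A) = UNIV"
  using openin_matrix_topology[of UNIV] openin_subset by fastforce

text \<open>A ball without a finite subcover contains a smaller ball of the same kind, since it is a
  finite union of smaller balls. The nested centres converge by completeness, and the open set
  around the limit covers one of these balls.\<close>

lemma compactin_ball: "compactin (field_topology A) {x. x - c \<in> pw n}"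
  unfolding compactin_def
proof (intro conjI allI impI)
  show "{x. x - c \<in> pw n} \<subseteq> topspace (field_topology A)" by (simp add: topspace_field_topology)
  fix \<U> assume "Ball \<U> (openin (field_topology A)) \<and> {x. x - c \<in> pw n} \<subseteq> \<Union>\<U>"
  then have U: "\<And>U. U \<in> \<U> \<Longrightarrow> openin (field_topology A) U" "{x. x - c \<in> pw n} \<subseteq> \<Union>\<U>" by auto
  define bad where "bad k y \<longleftrightarrow> \<not> (\<exists>\<F>. finite \<F> \<and> \<F> \<subseteq> \<U> \<and> {x. x - y \<in> pw (n + k)} \<subseteq> \<Union>\<F>)" for k y
  obtain F where F: "finite F" "F \<subseteq> A" "\<And>a. a \<in> A \<Longrightarrow> \<exists>f\<in>F. \<exists>b\<in>A. a = f + \<pi> * b" using residue_finite by meson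
  have split: "\<exists>z. bad (Suc k) z \<and> z - y \<in> pw (n + k)" if "bad k y" for k y
  proof (rule ccontr)
    assume neg: "\<not> ?thesis"
    have "\<forall>f\<in>F. \<exists>\<F>. finite \<F> \<and> \<F> \<subseteq> \<U> \<and> {x. x - (y + \<pi> ^ (n + k) * f) \<in> pw (n + Suc k)} \<subseteq> \<Union>\<F>"
    proof
      fix f assume "f \<in> F"
      then have "(y + \<pi> ^ (n + k) * f) - y \<in> pw (n + k)" using F(2) pwI by auto
      then show "\<exists>\<F>. finite \<F> \<and> \<F> \<subseteq> \<U> \<and> {x. x - (y + \<pi> ^ (n + k) * f) \<in> pw (n + Suc k)} \<subseteq> \<Union>\<F>"
        using neg unfolding bad_def by blast
    qed
    then obtain \<F> where \<F>: "\<And>f. f \<in> F \<Longrightarrow> finite (\<F> f) \<and> \<F> f \<subseteq> \<U> \<and> {x. x - (y + \<pi> ^ (n + k) * f) \<in> pw (n + Suc k)} \<subseteq> \<Union>(\<F> f)"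
      by metis
    have "{x. x - y \<in> pw (n + k)} \<subseteq> \<Union>(\<Union>f\<in>F. \<F> f)"
    proof
      fix x assume "x \<in> {x. x - y \<in> pw (n + k)}"
      then obtain a where a: "a \<in> A" "x - y = \<pi> ^ (n + k) * a" unfolding pw_def by blast
      obtain f b where f: "f \<in> F" "b \<in> A" "a = f + \<pi> * b" using F(3)[OF a(1)] by blast
      have "x - (y + \<pi> ^ (n + k) * f) = \<pi> ^ (n + Suc k) * b" using a f by (simp add: algebra_simps)
      then have "x - (y + \<pi> ^ (n + k) * f) \<in> pw (n + Suc k)" using pwI[OF f(2), of "n + Suc k"] by metis
      then show "x \<in> \<Union>(\<Union>f\<in>F. \<F> f)" using \<F>[OF f(1)] f(1) by blast
    qed
    moreover have "finite (\<Union>f\<in>F. \<F> f)" "(\<Union>f\<in>F. \<F> f) \<subseteq> \<U>" using F(1) \<F> by auto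
    ultimately show False using that unfolding bad_def by blast
  qed
  have "\<not> bad 0 c"
  proof
    assume "bad 0 c"
    then obtain s where s: "s 0 = c" "\<And>k. bad k (s k)" "\<And>k. s (Suc k) - s k \<in> pw (n + k)"
      using dependent_nat_choice[of "\<lambda>k y. bad k y \<and> (k = 0 \<longrightarrow> y = c)" "\<lambda>k y z. z - y \<in> pw (n + k)"] split by auto
    define r where "r k = (s k - c) / \<pi> ^ n" for k
    have sc: "s k - c \<in> pw n" for k
    proof (induction k)
      case (Suc k)
      have "s (Suc k) - s k \<in> pw n" using s(3)[of k] pw_antimono[of n "n + k"] by simp
      then show ?case using pw_add[OF _ Suc] by fastforce
    qed (simp add: s pw_zero)
    have "r k \<in> A" for k using sc[of k] unfolding r_def pw_iff .
    moreover have "r (Suc k) - r k \<in> pw k" for k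
      using s(3)[of k] unfolding r_def pw_iff by (simp add: power_add diff_divide_distrib)
    ultimately obtain l where l: "l \<in> A" "\<And>k. l - r k \<in> pw k" using complete_pw[of r] by blast
    define x where "x = c + \<pi> ^ n * l"
    have "x - c \<in> pw n" unfolding x_def using pwI[OF l(1)] by simp
    then obtain U0 where U0: "U0 \<in> \<U>" "x \<in> U0" using U(2) by blast
    then obtain m where m: "\<And>b. b \<in> pw m \<Longrightarrow> x + b \<in> U0" using U(1) unfolding openin_field_topology by meson
    have xs: "x - s m \<in> pw (n + m)"
    proof -
      have "x - s m = \<pi> ^ n * (l - r m)" unfolding x_def r_def using pi_nonzero by (simp add: field_simps)
      then show ?thesis using pw_mult[OF pi_power_pw l(2)] by simp
    qed
    have "{y. y - s m \<in> pw (n + m)} \<subseteq> \<Union>{U0}"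
    proof
      fix y assume "y \<in> {y. y - s m \<in> pw (n + m)}"
      then have "(y - s m) - (x - s m) \<in> pw (n + m)" using pw_diff[OF _ xs, of "y - s m"] by blast
      then have "y - x \<in> pw m" using pw_antimono[of m "n + m"] by simp
      from m[OF this] show "y \<in> \<Union>{U0}" by simp
    qed
    then have "\<not> bad m (s m)" unfolding bad_def using U0(1) by (intro notI) (metis empty_subsetI finite.emptyI finite_insert insert_subset)
    then show False using s(2) by blast
  qed
  then show "\<exists>\<F>. finite \<F> \<and> \<F> \<subseteq> \<U> \<and> {x. x - c \<in> pw n} \<subseteq> \<Union>\<F>" unfolding bad_def by auto
qed

lemma compactin_matrix_ball: "compactin (matrix_topology A) {M. \<forall>i j. M $ i $ j - C $ i $ j \<in> pw n}"
proof -
  let ?f = "\<lambda>(M::'a^2^2) (i, j). M $ i $ j"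
  let ?g = "\<lambda>\<phi>. (\<chi> i j. \<phi> (i, j)) :: 'a^2^2"
  let ?P = "product_topology (\<lambda>_::2\<times>2. field_topology A) UNIV"
  let ?K = "PiE UNIV (\<lambda>(i, j). {x. x - C $ i $ j \<in> pw n})"
  have fg: "?f (?g \<phi>) = \<phi>" for \<phi> by (auto simp: fun_eq_iff)
  have "compactin ?P ?K"
    unfolding compactin_PiE using compactin_ball by auto
  moreover have "continuous_map ?P (matrix_topology A) ?g"
    unfolding matrix_topology_def
    by (rule continuous_map_pullback') (simp_all only: comp_def fg continuous_map_id[unfolded id_def], simp)
  ultimately have "compactin (matrix_topology A) (?g ` ?K)" by (rule image_compactin)
  moreover have "?g ` ?K = {M. \<forall>i j. M $ i $ j - C $ i $ j \<in> pw n}"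
  proof safe
    fix M assume "\<forall>i j. M $ i $ j - C $ i $ j \<in> pw n"
    then have "?f M \<in> ?K" by auto
    moreover have "M = ?g (?f M)" by (simp add: vec_eq_iff)
    ultimately show "M \<in> ?g ` ?K" by blast
  qed (auto simp: PiE_iff)
  ultimately show ?thesis by simp
qed

end

section \<open>The two kinds of base field are complete discrete valuation fields\<close>

lemma (in field_subring) uniformizerD:
  assumes "uniformizer A \<pi>"
  shows "\<pi> \<in> A" and "y \<in> A \<Longrightarrow> \<pi> * y \<noteq> 1"
    and "a \<in> A \<Longrightarrow> (\<exists>b\<in>A. a = \<pi> * b) \<or> (\<exists>x\<in>A. \<exists>y\<in>A. \<pi> * x + a * y = 1)"
proof -
  let ?R = "subset_ring A" and ?I = "PIdl\<^bsub>subset_ring A\<^esub> \<pi>"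
  show pi: "\<pi> \<in> A" using assms unfolding uniformizer_def by simp
  interpret R: cring ?R by (rule cring_subset_ring)
  interpret I: maximalideal ?I ?R using assms unfolding uniformizer_def by simp
  have I: "?I = {\<pi> * b | b. b \<in> A}" unfolding cgenideal_def by (auto simp: ring_of_type_simps mult.commute)
  show "\<pi> * y \<noteq> 1" if "y \<in> A" for y
  proof
    assume "\<pi> * y = 1"
    then have "1 \<in> ?I" unfolding I using that by force
    then have "A = ?I" using I.one_imp_carrier by (simp add: ring_of_type_simps)
    then show False using I.I_notcarr by simp
  qed
  show "(\<exists>b\<in>A. a = \<pi> * b) \<or> (\<exists>x\<in>A. \<exists>y\<in>A. \<pi> * x + a * y = 1)" if a: "a \<in> A" for a
  proof -
    \<comment> \<open>By maximality the ideal generated by pi and a is either the one generated by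
      pi or the whole ring.\<close>
    define J where "J = {\<pi> * x + a * y | x y. x \<in> A \<and> y \<in> A}"
    have "ideal J ?R" unfolding ideal_subset_ring
    proof (intro conjI ballI)
      show "J \<subseteq> A" unfolding J_def using pi a by (auto intro!: add_in mult_in)
      show "0 \<in> J" unfolding J_def using zero_in by force
      fix u v assume "u \<in> J" "v \<in> J"
      then obtain x y x' y' where *: "x \<in> A" "y \<in> A" "x' \<in> A" "y' \<in> A" "u = \<pi> * x + a * y" "v = \<pi> * x' + a * y'"
        unfolding J_def by blast
      then have "u + v = \<pi> * (x + x') + a * (y + y')" by (simp add: algebra_simps)
      then show "u + v \<in> J" unfolding J_def using * add_in by blast
    next
      fix u c assume "u \<in> J" "c \<in> A"
      then obtain x y where *: "x \<in> A" "y \<in> A" "u = \<pi> * x + a * y" unfolding J_def by blast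
      then have "c * u = \<pi> * (c * x) + a * (c * y)" by (simp add: algebra_simps)
      then show "c * u \<in> J" unfolding J_def using * \<open>c \<in> A\<close> mult_in by blast
    qed
    moreover have "?I \<subseteq> J" unfolding I J_def using zero_in by force
    moreover have aJ: "a \<in> J" unfolding J_def using zero_in one_in by force
    moreover have "J \<subseteq> A" unfolding J_def using pi a by (auto intro!: add_in mult_in)
    ultimately have "J = ?I \<or> J = A" using I.I_maximal[of J] by simp
    then show ?thesis
    proof
      assume "J = ?I"
      then show ?thesis using aJ unfolding I by blast
    next
      assume "J = A"
      then have "1 \<in> J" using one_in by simp
      then show ?thesis unfolding J_def by force
    qed
  qed
qed

text \<open>Since pi divides p and p divides some power pi^m, finiteness, separation and
  completeness are transferred from powers of p to powers of pi.\<close>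

lemma (in padic_extension) cdvr:
  assumes unif: "uniformizer \<O> \<pi>"
  shows "cdvr \<O> \<pi>"
proof -
  note pi = O.uniformizerD[OF unif]
  \<comment> \<open>Otherwise pi and p generate the unit ideal; but 1 - p y is a unit, so pi would
    be one.\<close>
  have "\<exists>b\<in>\<O>. P = \<pi> * b"
  proof (rule ccontr)
    assume "\<not> ?thesis"
    then obtain x y where xy: "x \<in> \<O>" "y \<in> \<O>" "\<pi> * x + P * y = 1" using pi(3)[OF P_in_O] by blast
    obtain u where u: "u \<in> \<O>" "(1 - P * y) * u = 1" using one_minus_P_unit[OF xy(2)] by blast
    have "\<pi> * x = 1 - P * y" using xy(3) by (simp add: algebra_simps)
    then have "\<pi> * (x * u) = 1" using u by (simp add: mult.assoc[symmetric])
    then show False using pi(2) O.mult_in xy u by blast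
  qed
  then obtain b where b: "b \<in> \<O>" "P = \<pi> * b" by blast
  have pi0: "\<pi> \<noteq> 0" using b p_nonzero by auto
  obtain m c where m: "m > 0" "c \<in> \<O>" "\<pi> ^ m = P * c" using unit_or_nilpotent[OF pi(1)] pi(2) by blast
  have pm: "\<pi> ^ (m * k) = P ^ k * c ^ k" for k using m(3) by (simp add: power_mult power_mult_distrib)
  \<comment> \<open>The element pi is prime: if it does not divide y, it is coprime to y and hence
    to every power of y.\<close>
  have prime: "\<exists>d\<in>\<O>. y = \<pi> * d" if y: "y \<in> \<O>" and yn: "\<exists>d\<in>\<O>. y ^ n = \<pi> * d" for y n
  proof (rule ccontr)
    assume "\<not> ?thesis"
    then obtain x z where xz: "x \<in> \<O>" "z \<in> \<O>" "\<pi> * x + y * z = 1" using pi(3)[OF y] by blast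
    from yn show False
    proof (induction n)
      case 0
      then show ?case using pi(2) by fastforce
    next
      case (Suc n)
      then obtain d where d: "d \<in> \<O>" "y ^ Suc n = \<pi> * d" by blast
      have "y ^ n = y ^ n * (\<pi> * x + y * z)" using xz by simp
      also have "\<dots> = \<pi> * (y ^ n * x) + y ^ Suc n * z" by (simp add: algebra_simps)
      also have "\<dots> = \<pi> * (y ^ n * x + d * z)" unfolding d by (simp add: algebra_simps)
      finally have "\<exists>d\<in>\<O>. y ^ n = \<pi> * d"
        using O.add_in[OF O.mult_in[OF O.power_in[OF y] xz(1)] O.mult_in[OF d(1) xz(2)]] by blast
      then show ?case by (rule Suc.IH)
    qed
  qed
  show ?thesis
  proof
    show "\<pi> \<in> \<O>" "\<And>y. y \<in> \<O> \<Longrightarrow> \<pi> * y \<noteq> 1" using pi by auto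
    show "\<pi> \<noteq> 0" by (rule pi0)
    show "uniformizer \<O> \<pi>" by (rule unif)
    show "\<exists>k. \<pi> ^ k * x \<in> \<O>" for x
    proof -
      obtain k where k: "P ^ k * x \<in> \<O>" using fraction by blast
      have "\<pi> ^ (m * k) * x = c ^ k * (P ^ k * x)" unfolding pm by (simp add: algebra_simps)
      then have "\<pi> ^ (m * k) * x \<in> \<O>" using O.mult_in[OF O.power_in[OF m(2)] k] by metis
      then show ?thesis by blast
    qed
    show "\<exists>F. finite F \<and> F \<subseteq> \<O> \<and> (\<forall>a\<in>\<O>. \<exists>f\<in>F. \<exists>b\<in>\<O>. a = f + \<pi> * b)"
    proof -
      obtain F where F: "finite F" "F \<subseteq> \<O>" "\<forall>a\<in>\<O>. \<exists>f\<in>F. \<exists>b\<in>\<O>. a = f + P ^ 1 * b" using residue_finite[of 1] by meson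
      have "\<forall>a\<in>\<O>. \<exists>f\<in>F. \<exists>b\<in>\<O>. a = f + \<pi> * b"
      proof
        fix a assume "a \<in> \<O>"
        then obtain f d where "f \<in> F" "d \<in> \<O>" "a = f + P ^ 1 * d" using F(3) by blast
        then show "\<exists>f\<in>F. \<exists>b\<in>\<O>. a = f + \<pi> * b"
          using b(2) O.mult_in[OF b(1), of d] by (metis mult.assoc power_one_right)
      qed
      then show ?thesis using F by blast
    qed
    show "\<exists>k u v. x = \<pi> ^ k * u \<and> u \<in> \<O> \<and> v \<in> \<O> \<and> u * v = 1" if x: "x \<in> \<O>" "x \<noteq> 0" for x
    proof -
      \<comment> \<open>Some power of pi does not divide x, as otherwise all powers of p would. One
        step before the first such power the cofactor y is not divisible by pi; it is a unit, since
        otherwise p, and with it pi, would divide a power of y.\<close>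
      let ?Q = "\<lambda>k. \<not> (\<exists>y\<in>\<O>. x = \<pi> ^ k * y)"
      have "\<exists>k. ?Q k"
      proof (rule ccontr)
        assume neg: "\<not> ?thesis"
        have "\<exists>y\<in>\<O>. x = P ^ k * y" for k
        proof -
          obtain y where y: "y \<in> \<O>" "x = \<pi> ^ (m * k) * y" using neg by blast
          then show ?thesis unfolding pm
            using O.mult_in[OF O.power_in[OF m(2)] y(1)] by (intro bexI[of _ "c ^ k * y"]) (auto simp: mult.assoc)
        qed
        then show False using Inter_P_power x by blast
      qed
      then obtain k where k: "?Q k" "\<And>j. j < k \<Longrightarrow> \<not> ?Q j" using exists_least_iff[of ?Q] by blast
      have "k \<noteq> 0"
      proof
        assume "k = 0"
        then have "x = \<pi> ^ k * x" by simp
        then show False using k(1) x(1) by blast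
      qed
      then obtain j where j: "k = Suc j" by (cases k) auto
      then obtain y where y: "y \<in> \<O>" "x = \<pi> ^ j * y" using k(2)[of j] by auto
      have nd: "\<not> (\<exists>d\<in>\<O>. y = \<pi> * d)"
      proof
        assume "\<exists>d\<in>\<O>. y = \<pi> * d"
        then obtain d where "d \<in> \<O>" "y = \<pi> * d" by blast
        then have "x = \<pi> ^ k * d" using y j by (simp add: algebra_simps)
        then show False using k(1) \<open>d \<in> \<O>\<close> by blast
      qed
      have "\<not> (\<exists>n>0. \<exists>d\<in>\<O>. y ^ n = P * d)"
      proof
        assume "\<exists>n>0. \<exists>d\<in>\<O>. y ^ n = P * d"
        then obtain n d where "d \<in> \<O>" "y ^ n = P * d" by blast
        then have "\<exists>d\<in>\<O>. y ^ n = \<pi> * d"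
          using b O.mult_in[OF b(1)] by (intro bexI[of _ "b * d"]) (auto simp: mult.assoc)
        then show False using prime[OF y(1)] nd by blast
      qed
      then obtain u where u: "u \<in> \<O>" "y * u = 1" using unit_or_nilpotent[OF y(1)] by blast
      then show ?thesis using y by blast
    qed
    show "\<exists>l\<in>\<O>. \<forall>k. \<exists>b\<in>\<O>. l - s k = \<pi> ^ k * b"
      if s: "\<And>k. s k \<in> \<O>" "\<And>k. \<exists>b\<in>\<O>. s (Suc k) - s k = \<pi> ^ k * b" for s
    proof -
      have tel: "\<exists>d\<in>\<O>. s j - s i = \<pi> ^ i * d" if "i \<le> j" for i j using that
      proof (induction j rule: dec_induct)
        case base
        show ?case using O.zero_in by (intro bexI[of _ 0]) auto
      next
        case (step j)
        obtain d e where d: "d \<in> \<O>" "s j - s i = \<pi> ^ i * d" and e: "e \<in> \<O>" "s (Suc j) - s j = \<pi> ^ j * e"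
          using step.IH s(2) by blast
        have "\<pi> ^ j = \<pi> ^ i * \<pi> ^ (j - i)" using step(1) by (simp flip: power_add)
        moreover have "s (Suc j) - s i = (s (Suc j) - s j) + (s j - s i)" by simp
        ultimately have "s (Suc j) - s i = \<pi> ^ i * (\<pi> ^ (j - i) * e + d)" unfolding d e by (simp add: algebra_simps)
        then show ?case using O.add_in[OF O.mult_in[OF O.power_in[OF pi(1)] e(1)] d(1)] by blast
      qed
      \<comment> \<open>Along the multiples of m the differences are divisible by pi^(m k) and so by
        p^k, which is what completeness for p requires.\<close>
      have "\<exists>d\<in>\<O>. s (m * Suc k) - s (m * k) = P ^ k * d" for k
      proof -
        obtain d where d: "d \<in> \<O>" "s (m * Suc k) - s (m * k) = \<pi> ^ (m * k) * d" using tel[of "m * k" "m * Suc k"] by auto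
        then show ?thesis unfolding pm
          using O.mult_in[OF O.power_in[OF m(2)] d(1)] by (intro bexI[of _ "c ^ k * d"]) (auto simp: mult.assoc)
      qed
      then obtain l where l: "l \<in> \<O>" "\<And>k. \<exists>d\<in>\<O>. l - s (m * k) = P ^ k * d"
        using complete[of "\<lambda>k. s (m * k)"] s(1) by blast
      have "\<exists>d\<in>\<O>. l - s k = \<pi> ^ k * d" for k
      proof -
        obtain d where d: "d \<in> \<O>" "l - s (m * k) = P ^ k * d" using l(2) by blast
        obtain e where e: "e \<in> \<O>" "s (m * k) - s k = \<pi> ^ k * e" using tel[of k "m * k"] m(1) by auto
        have "l - s k = (l - s (m * k)) + (s (m * k) - s k)" by simp
        also have "\<dots> = \<pi> ^ k * (b ^ k * d + e)" unfolding d e b(2) by (simp add: algebra_simps power_mult_distrib)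
        finally show ?thesis using O.add_in[OF O.mult_in[OF O.power_in[OF b(1)] d(1)] e(1)] by blast
      qed
      then show ?thesis using l(1) by blast
    qed
  qed
qed

text \<open>A uniformizer corresponds to a power series g = X h with h invertible, so divisibility
  by pi^k means the vanishing of the first k coefficients.\<close>

lemma laurent_cdvr:
  assumes L: "laurent_field_integers TYPE('k::{field,finite}) A" and unif: "uniformizer A \<pi>"
  shows "cdvr A \<pi>"
proof -
  obtain \<phi> :: "'k fls \<Rightarrow> 'a" where hom: "\<phi> \<in> ring_hom ring_of_type_algebra ring_of_type_algebra"
    and bij: "bij \<phi>" and A: "A = \<phi> ` range fps_to_fls"
    using L unfolding laurent_field_integers_def by blast
  have phi: "\<phi> (x * y) = \<phi> x * \<phi> y" "\<phi> (x + y) = \<phi> x + \<phi> y" "\<phi> 1 = 1" for x y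
    using ring_hom_mult[OF hom] ring_hom_add[OF hom] ring_hom_one[OF hom] by (auto simp: ring_of_type_simps)
  define \<psi> where "\<psi> f = \<phi> (fps_to_fls f)" for f
  have mult: "\<psi> (x * y) = \<psi> x * \<psi> y" and add: "\<psi> (x + y) = \<psi> x + \<psi> y" and one: "\<psi> 1 = 1" for x y
    unfolding \<psi>_def by (simp_all add: phi fls_times_fps_to_fls)
  have zero: "\<psi> 0 = 0" using add[of 0 0] by (metis add.right_neutral add_left_cancel)
  have minus: "\<psi> (- x) = - \<psi> x" for x using add[of x "- x"] zero by (simp add: add_eq_0_iff)
  have diff: "\<psi> (x - y) = \<psi> x - \<psi> y" for x y using add[of x "- y"] minus by simp
  have pow: "\<psi> (x ^ k) = \<psi> x ^ k" for x k by (induction k) (auto simp: one mult)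
  have inj: "\<psi> x = \<psi> y \<longleftrightarrow> x = y" for x y
    unfolding \<psi>_def using bij by (auto dest!: bij_is_inj injD)
  have A: "A = range \<psi>" unfolding A \<psi>_def by auto
  interpret field_subring A
  proof
    show "0 \<in> A" "1 \<in> A" unfolding A using zero one rangeI[of \<psi> 0] rangeI[of \<psi> 1] by auto
    show "x + y \<in> A" if "x \<in> A" "y \<in> A" for x y using that unfolding A by (auto simp flip: add)
    show "x * y \<in> A" if "x \<in> A" "y \<in> A" for x y using that unfolding A by (auto simp flip: mult)
    show "- x \<in> A" if "x \<in> A" for x using that unfolding A by (auto simp flip: minus)
  qed
  note pi = uniformizerD[OF unif]
  obtain g where g: "\<pi> = \<psi> g" using pi(1) unfolding A by blast
  have g0: "fps_nth g 0 = 0"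
  proof (rule ccontr)
    assume "fps_nth g 0 \<noteq> 0"
    then have "\<pi> * \<psi> (inverse g) = 1" unfolding g mult[symmetric] using inverse_mult_eq_1'[of g] one by simp
    then show False using pi(2) unfolding A by blast
  qed
  have g1: "fps_nth g 1 \<noteq> 0"
  proof -
    \<comment> \<open>By maximality X is a multiple of g, which forces the linear coefficient of g
      to be nonzero, or 1 is a combination of g and X, which is impossible as both have constant
      term 0.\<close>
    have "\<psi> fps_X \<in> A" unfolding A by blast
    then consider b where "\<psi> fps_X = \<psi> (g * b)" | x y where "\<psi> (g * x + fps_X * y) = \<psi> 1"
      using pi(3)[of "\<psi> fps_X"] unfolding A g by (auto simp: mult add one)
    then show ?thesis
    proof cases
      case 1
      then have "fps_nth fps_X 1 = fps_nth (g * b) 1" unfolding inj by simp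
      then show ?thesis using g0 by (auto simp: fps_mult_nth_1)
    next
      case 2
      then have "fps_nth (g * x + fps_X * y) 0 = 1" unfolding inj by simp
      then show ?thesis using g0 by simp
    qed
  qed
  define h where "h = fps_shift 1 g"
  have gX: "g = fps_X * h" unfolding h_def
  proof (rule fps_ext)
    fix n show "fps_nth g n = fps_nth (fps_X * fps_shift 1 g) n" using g0 by (cases n) auto
  qed
  have hh: "h * inverse h = 1" using inverse_mult_eq_1'[of h] g1 by (simp add: h_def)
  have Xk: "fps_X ^ k = g ^ k * inverse h ^ k" for k
    unfolding gX using hh by (simp add: power_mult_distrib mult.assoc flip: power_mult_distrib[of h])
  have shift: "\<exists>b\<in>A. \<psi> f = \<pi> ^ k * b" if "\<And>n. n < k \<Longrightarrow> fps_nth f n = 0" for f k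
  proof -
    have "f = fps_X ^ k * fps_shift k f" using that by (intro fps_ext) (auto simp: fps_X_power_mult_nth)
    then have "f = g ^ k * (inverse h ^ k * fps_shift k f)" unfolding Xk by (simp add: mult.assoc)
    then have "\<psi> f = \<pi> ^ k * \<psi> (inverse h ^ k * fps_shift k f)" unfolding g pow[symmetric] mult[symmetric] inj .
    then show ?thesis unfolding A by blast
  qed
  show ?thesis
  proof
    show "\<pi> \<in> A" "\<And>y. y \<in> A \<Longrightarrow> \<pi> * y \<noteq> 1" using pi by auto
    show "\<pi> \<noteq> 0" unfolding g using inj[of g 0] zero g1 by auto
    show "uniformizer A \<pi>" by (rule unif)
    show "\<exists>k u v. x = \<pi> ^ k * u \<and> u \<in> A \<and> v \<in> A \<and> u * v = 1" if x: "x \<in> A" "x \<noteq> 0" for x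
    proof -
      obtain f where f: "x = \<psi> f" using x unfolding A by blast
      have f0: "f \<noteq> 0" using f x zero by auto
      let ?k = "subdegree f"
      let ?u = "fps_shift ?k f"
      have u: "?u * inverse ?u = 1" using inverse_mult_eq_1'[of ?u] f0 by simp
      have "f = fps_X ^ ?k * ?u" using subdegree_decompose[of f] by (simp add: mult.commute)
      then have "f = g ^ ?k * (inverse h ^ ?k * ?u)" unfolding Xk by (simp add: mult.assoc)
      then have "x = \<pi> ^ ?k * \<psi> (inverse h ^ ?k * ?u)" unfolding f g pow[symmetric] mult[symmetric] inj .
      moreover have "(inverse h ^ ?k * ?u) * (h ^ ?k * inverse ?u) = (h * inverse h) ^ ?k * (?u * inverse ?u)"
        by (simp only: power_mult_distrib mult_ac)
      then have "\<psi> (inverse h ^ ?k * ?u) * \<psi> (h ^ ?k * inverse ?u) = 1"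
        unfolding mult[symmetric] using hh u one by simp
      ultimately show ?thesis unfolding A by blast
    qed
    show "\<exists>k. \<pi> ^ k * x \<in> A" for x
    proof -
      obtain y where y: "x = \<phi> y" using bij by (metis bij_pointE)
      let ?k = "nat (- fls_subdegree y)"
      have "fls_subdegree (fls_X ^ ?k * y) \<ge> 0 \<or> y = 0"
        by (cases "y = 0") (auto simp: fls_X_power_times_conv_shift)
      then have "fps_to_fls (fls_regpart (fls_X ^ ?k * y)) = fls_X ^ ?k * y"
        by (auto simp: fls_regpart_to_fls_trivial)
      then obtain f where f: "fls_X ^ ?k * y = fps_to_fls f" by metis
      have "\<pi> ^ ?k * x = \<phi> (fps_to_fls (g ^ ?k) * y)" by (simp add: g y phi \<psi>_def flip: pow[unfolded \<psi>_def])
      also have "fps_to_fls (g ^ ?k) = fps_to_fls (h ^ ?k) * fls_X ^ ?k"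
        unfolding gX by (simp add: power_mult_distrib fls_times_fps_to_fls fps_to_fls_power mult.commute)
      also have "\<phi> (fps_to_fls (h ^ ?k) * fls_X ^ ?k * y) = \<psi> (h ^ ?k * f)"
        unfolding \<psi>_def by (simp add: mult.assoc f fls_times_fps_to_fls)
      finally show ?thesis unfolding A by (intro exI[of _ ?k]) simp
    qed
    show "\<exists>F. finite F \<and> F \<subseteq> A \<and> (\<forall>a\<in>A. \<exists>f\<in>F. \<exists>b\<in>A. a = f + \<pi> * b)"
    proof (intro exI conjI ballI)
      show "finite (range (\<lambda>c. \<psi> (fps_const c)))" "range (\<lambda>c. \<psi> (fps_const c)) \<subseteq> A" unfolding A by auto
      fix a assume "a \<in> A"
      then obtain f where f: "a = \<psi> f" unfolding A by blast
      obtain b where b: "b \<in> A" "\<psi> (f - fps_const (fps_nth f 0)) = \<pi> ^ 1 * b"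
        using shift[of 1 "f - fps_const (fps_nth f 0)"] by auto
      then have "a = \<psi> (fps_const (fps_nth f 0)) + \<pi> * b" using f diff by (simp add: algebra_simps)
      then show "\<exists>f\<in>range (\<lambda>c. \<psi> (fps_const c)). \<exists>b\<in>A. a = f + \<pi> * b" using b by blast
    qed
    show "\<exists>l\<in>A. \<forall>k. \<exists>b\<in>A. l - s k = \<pi> ^ k * b"
      if s: "\<And>k. s k \<in> A" "\<And>k. \<exists>b\<in>A. s (Suc k) - s k = \<pi> ^ k * b" for s
    proof -
      have "\<forall>k. \<exists>f. s k = \<psi> f" using s(1) unfolding A by blast
      then obtain f where f: "\<And>k. s k = \<psi> (f k)" by metis
      have step: "fps_nth (f (Suc k)) n = fps_nth (f k) n" if "n < k" for k n
      proof -
        obtain b where "s (Suc k) - s k = \<pi> ^ k * \<psi> b" using s(2) unfolding A by blast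
        then have "f (Suc k) - f k = g ^ k * b" unfolding f g pow[symmetric] mult[symmetric] diff[symmetric] inj .
        then have "f (Suc k) - f k = fps_X ^ k * (h ^ k * b)" unfolding gX by (simp add: power_mult_distrib mult.assoc)
        then have "fps_nth (f (Suc k) - f k) n = 0" using that by (simp add: fps_X_power_mult_nth)
        then show ?thesis by simp
      qed
      have stable: "fps_nth (f k) n = fps_nth (f (Suc n)) n" if "n < k" for k n
        using that
      proof (induction k)
        case (Suc k)
        then show ?case using step[of n k] by (cases "n = k") auto
      qed simp
      \<comment> \<open>The n-th coefficient is constant from the index n + 1 on.\<close>
      define l where "l = Abs_fps (\<lambda>n. fps_nth (f (Suc n)) n)"
      have "\<exists>b\<in>A. \<psi> l - s k = \<pi> ^ k * b" for k
        using shift[of k "l - f k"] stable[of _ k] by (simp add: l_def diff f)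
      then show ?thesis unfolding A by blast
    qed
  qed
qed

no_notation fps_nth (infixl \<open>$\<close> 75)

section \<open>The Borel subgroup\<close>

lemma mat2_nth [simp]:
  "mat2 a b c d $ 1 $ 1 = a" "mat2 a b c d $ 1 $ 2 = b" "mat2 a b c d $ 2 $ 1 = c" "mat2 a b c d $ 2 $ 2 = d"
  by (simp_all add: mat2_def vector_2)

lemma matrix_eq_iff_entries:
  "M = N \<longleftrightarrow> M $ 1 $ 1 = N $ 1 $ 1 \<and> M $ 1 $ 2 = N $ 1 $ 2 \<and> M $ 2 $ 1 = N $ 2 $ 1 \<and> M $ 2 $ 2 = (N::'a^2^2) $ 2 $ 2"
  by (auto simp: vec_eq_iff forall_2)

lemma mult_nth: "(M ** N) $ i $ j = M $ i $ 1 * N $ 1 $ j + M $ i $ 2 * N $ 2 $ j" for M N :: "'a::semiring_1^2^2"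
  by (simp add: matrix_matrix_mult_def sum_2)

lemma one_nth [simp]: "(mat 1 :: 'a::field^2^2) $ 1 $ 1 = 1" "(mat 1 :: 'a::field^2^2) $ 1 $ 2 = 0"
  "(mat 1 :: 'a::field^2^2) $ 2 $ 1 = 0" "(mat 1 :: 'a::field^2^2) $ 2 $ 2 = 1"
  by (simp_all add: mat_def)

lemma carrier_GL2: "carrier GL2 = {M::'a::field^2^2. det M \<noteq> 0}"
  by (auto simp: GL2_def invertible_det_nz)

lemma GL2_simps [simp]: "M \<otimes>\<^bsub>GL2\<^esub> N = M ** N" "\<one>\<^bsub>GL2\<^esub> = mat 1"
  by (simp_all add: GL2_def)

lemma group_GL2: "group (GL2 :: ('a::field^2^2) monoid)"
proof (rule groupI)
  fix x :: "'a^2^2" assume "x \<in> carrier GL2"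
  then obtain y where y: "y ** x = mat 1" "x ** y = mat 1" unfolding GL2_def invertible_def by auto
  then have "invertible y" unfolding invertible_def by blast
  then show "\<exists>y\<in>carrier GL2. y \<otimes>\<^bsub>GL2\<^esub> x = \<one>\<^bsub>GL2\<^esub>" using y by (auto simp: GL2_def)
qed (auto simp: carrier_GL2 det_mul matrix_mul_assoc)

abbreviation ginv :: "'a::field^2^2 \<Rightarrow> 'a^2^2" where "ginv M \<equiv> inv\<^bsub>GL2\<^esub> M"

lemma GL2_mult_closed: "\<lbrakk>M \<in> carrier GL2; N \<in> carrier GL2\<rbrakk> \<Longrightarrow> M ** N \<in> carrier GL2"
  by (auto simp: carrier_GL2 det_mul)

lemma ginv_closed: "M \<in> carrier GL2 \<Longrightarrow> ginv M \<in> carrier GL2"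
  using group.inv_closed[OF group_GL2] .

lemma ginv_mult: "M \<in> carrier GL2 \<Longrightarrow> ginv M ** M = mat 1" "M \<in> carrier GL2 \<Longrightarrow> M ** ginv M = mat 1"
  using group.l_inv[OF group_GL2] group.r_inv[OF group_GL2] by auto

lemma ginv_unique: "\<lbrakk>M \<in> carrier GL2; N \<in> carrier GL2; N ** M = mat 1\<rbrakk> \<Longrightarrow> ginv M = N"
  using group.inv_equality[OF group_GL2, of N M] by simp

lemma ginv_cancel: "M \<in> carrier GL2 \<Longrightarrow> ginv M ** (M ** N) = N" "M \<in> carrier GL2 \<Longrightarrow> M ** (ginv M ** N) = N"
  "M \<in> carrier GL2 \<Longrightarrow> N ** M ** ginv M = N" "M \<in> carrier GL2 \<Longrightarrow> N ** ginv M ** M = N"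
  by (metis ginv_mult matrix_mul_assoc matrix_mul_lid matrix_mul_rid)+

lemma ginv_prod: "\<lbrakk>M \<in> carrier GL2; N \<in> carrier GL2\<rbrakk> \<Longrightarrow> ginv (M ** N) = ginv N ** ginv M"
  using group.inv_mult_group[OF group_GL2, of M N] by simp

lemma ginv_ginv: "M \<in> carrier GL2 \<Longrightarrow> ginv (ginv M) = M"
  using group.inv_inv[OF group_GL2, of M] by simp

lemma ginv_nth: assumes "M \<in> carrier GL2"
  shows "ginv M $ 1 $ 1 = M $ 2 $ 2 / det M" "ginv M $ 1 $ 2 = - M $ 1 $ 2 / det M"
    "ginv M $ 2 $ 1 = - M $ 2 $ 1 / det M" "ginv M $ 2 $ 2 = M $ 1 $ 1 / det M"
proof -
  let ?N = "mat2 (M $ 2 $ 2 / det M) (- M $ 1 $ 2 / det M) (- M $ 2 $ 1 / det M) (M $ 1 $ 1 / det M)"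
  have d: "det M \<noteq> 0" using assms by (simp add: carrier_GL2)
  have d': "det M = M $ 1 $ 1 * M $ 2 $ 2 - M $ 1 $ 2 * M $ 2 $ 1" by (simp add: det_2)
  have NM: "?N ** M = mat 1"
    unfolding matrix_eq_iff_entries using d by (simp add: mult_nth divide_simps) (simp add: d' algebra_simps)
  then have "det ?N * det M = 1" using det_mul[of ?N M] by (simp add: det_I)
  then have "?N \<in> carrier GL2" by (auto simp: carrier_GL2)
  then have "ginv M = ?N" using ginv_unique assms NM by blast
  then show "ginv M $ 1 $ 1 = M $ 2 $ 2 / det M" "ginv M $ 1 $ 2 = - M $ 1 $ 2 / det M"
    "ginv M $ 2 $ 1 = - M $ 2 $ 1 / det M" "ginv M $ 2 $ 2 = M $ 1 $ 1 / det M" by simp_all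
qed

lemma borel_iff: "M \<in> borel_set \<longleftrightarrow> M $ 2 $ 1 = 0 \<and> M $ 1 $ 1 \<noteq> 0 \<and> M $ 2 $ 2 \<noteq> 0"
  by (auto simp: borel_set_def carrier_GL2 det_2)

lemma borel_GL2: "M \<in> borel_set \<Longrightarrow> M \<in> carrier GL2"
  by (simp add: borel_set_def)

lemma borel_mult: "\<lbrakk>M \<in> borel_set; N \<in> borel_set\<rbrakk> \<Longrightarrow> M ** N \<in> borel_set"
  by (simp add: borel_iff mult_nth)

lemma borel_one: "mat 1 \<in> borel_set"
  by (simp add: borel_iff)

lemma borel_ginv: "M \<in> borel_set \<Longrightarrow> ginv M \<in> borel_set"
  using ginv_nth[of M] borel_GL2[of M] by (simp add: borel_iff carrier_GL2)

lemma subgroup_borel: "subgroup borel_set GL2"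
  by (rule group.subgroupI[OF group_GL2])
    (use borel_GL2 borel_mult borel_ginv borel_one in auto)

lemma group_borel: "group (GL2_on borel_set)"
  using subgroup.subgroup_is_group[OF subgroup_borel group_GL2] .

lemma inv_borel: "M \<in> borel_set \<Longrightarrow> inv\<^bsub>GL2_on borel_set\<^esub> M = ginv M"
  by (rule group.m_inv_consistent[OF group_GL2 subgroup_borel])

lemma GL2_on_simps: "M \<otimes>\<^bsub>GL2_on S\<^esub> N = M ** N" "\<one>\<^bsub>GL2_on S\<^esub> = mat 1" "carrier (GL2_on S) = S"
  by (simp_all add: GL2_def)

text \<open>Modulo the centre, the element \<open>M\<close> of the Borel subgroup acts on the line by
  \<open>y \<mapsto> slope M * y + shift M\<close>.\<close>

definition slope :: "'a::field^2^2 \<Rightarrow> 'a" where "slope M = M $ 1 $ 1 / M $ 2 $ 2"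
definition shift :: "'a::field^2^2 \<Rightarrow> 'a" where "shift M = M $ 1 $ 2 / M $ 2 $ 2"

lemma slope_nonzero: "M \<in> borel_set \<Longrightarrow> slope M \<noteq> 0"
  by (simp add: slope_def borel_iff)

lemma affine_mult:
  assumes "M \<in> borel_set" "N \<in> borel_set"
  shows "slope (M ** N) = slope M * slope N" "shift (M ** N) = slope M * shift N + shift M"
  using assms by (simp_all add: slope_def shift_def borel_iff mult_nth field_simps)

lemma affine_one: "slope (mat 1) = 1" "shift (mat 1) = 0"
  by (simp_all add: slope_def shift_def)

lemma affine_ginv:
  assumes "M \<in> borel_set"
  shows "slope (ginv M) = inverse (slope M)" "shift (ginv M) = - shift M / slope M"
proof -
  have "slope (ginv M) * slope M = 1" "slope (ginv M) * shift M + shift (ginv M) = 0"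
    using affine_mult[OF borel_ginv[OF assms] assms] ginv_mult(1)[OF borel_GL2[OF assms]] by (simp_all add: affine_one)
  then show "slope (ginv M) = inverse (slope M)" "shift (ginv M) = - shift M / slope M"
    using slope_nonzero[OF assms] by (auto simp: field_simps add_eq_0_iff2)
qed

text \<open>Commuting with the two elementary unipotent matrices already forces a scalar
  matrix.\<close>

lemma centre_iff: "M \<in> centre \<longleftrightarrow> (\<exists>z. z \<noteq> 0 \<and> M = mat2 z 0 0 z)"
proof
  assume M: "M \<in> centre"
  then have comm: "M ** N = N ** M" if "det N \<noteq> 0" for N unfolding centre_def carrier_GL2 using that by auto
  have 1: "M ** mat2 1 1 0 1 = mat2 1 1 0 1 ** M" by (rule comm) (simp add: det_2)
  have 2: "M ** mat2 1 0 1 1 = mat2 1 0 1 1 ** M" by (rule comm) (simp add: det_2)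
  have "M $ 2 $ 1 = 0" "M $ 1 $ 1 = M $ 2 $ 2" "M $ 1 $ 2 = 0"
    using 1 2 unfolding matrix_eq_iff_entries by (auto simp: mult_nth)
  moreover have "det M \<noteq> 0" using M unfolding centre_def carrier_GL2 by simp
  ultimately show "\<exists>z. z \<noteq> 0 \<and> M = mat2 z 0 0 z"
    by (intro exI[of _ "M $ 1 $ 1"]) (auto simp: matrix_eq_iff_entries det_2)
next
  assume "\<exists>z. z \<noteq> 0 \<and> M = mat2 z 0 0 z"
  then show "M \<in> centre"
    by (auto simp: centre_def carrier_GL2 det_2 matrix_eq_iff_entries mult_nth)
qed

context cdvr
begin

definition unit :: "'a \<Rightarrow> bool" where "unit x \<longleftrightarrow> x \<noteq> 0 \<and> x \<in> A \<and> inverse x \<in> A"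

lemma unit_mult: "\<lbrakk>unit x; unit y\<rbrakk> \<Longrightarrow> unit (x * y)"
  unfolding unit_def by (auto intro: mult_in)

lemma unit_inverse: "unit x \<Longrightarrow> unit (inverse x)"
  unfolding unit_def by auto

lemma unit_one: "unit 1" unfolding unit_def by (simp add: one_in)

lemma unit_in: "unit x \<Longrightarrow> x \<in> A" unfolding unit_def by simp

lemma unit_divide_in: "\<lbrakk>x \<in> A; unit y\<rbrakk> \<Longrightarrow> x / y \<in> A"
  unfolding divide_inverse unit_def by (blast intro: mult_in)

lemma unit_add_pw: assumes "unit x" "y \<in> pw 1" shows "unit (x + y)"
proof -
  have "inverse x * y \<in> pw 1" using assms pw_mult_A unfolding unit_def by blast
  then have "1 + inverse x * y \<noteq> 0" "inverse (1 + inverse x * y) \<in> A" "1 + inverse x * y \<in> A"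
    using one_plus_unit add_in one_in pw_in by blast+
  then have "unit (1 + inverse x * y)" unfolding unit_def by simp
  then have "unit (x * (1 + inverse x * y))" using assms unit_mult by blast
  moreover have "x * (1 + inverse x * y) = x + y" using assms unfolding unit_def by (simp add: distrib_left)
  ultimately show ?thesis by simp
qed

lemma not_unit_pw: "\<lbrakk>x \<in> A; \<not> unit x\<rbrakk> \<Longrightarrow> x \<in> pw 1"
  using unit_or_pw unfolding unit_def by blast

lemma unit_not_pw: "unit x \<Longrightarrow> x \<notin> pw 1"
  using pw_1_not_unit unfolding unit_def by blast

lemma Units_subset_ring: "Units (subset_ring A) = Collect unit"
proof -
  have "x \<in> A \<and> (\<exists>y\<in>A. y * x = 1 \<and> x * y = 1) \<longleftrightarrow> unit x" for x
    unfolding unit_def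
    by (auto dest: inverse_unique simp: right_inverse left_inverse intro!: bexI[of _ "inverse x"])
  then show ?thesis unfolding Units_def by (auto simp: ring_of_type_simps)
qed

abbreviation H where "H \<equiv> B0Z A"
abbreviation Bp where "Bp \<equiv> Bplus A \<pi>"

text \<open>The centre absorbs the lower right entry, so that membership depends on the affine map
  alone.\<close>

lemma H_iff: "M \<in> H \<longleftrightarrow> M \<in> borel_set \<and> unit (slope M) \<and> shift M \<in> A"
proof
  assume "M \<in> H"
  then obtain a d x z where *: "unit a" "unit d" "x \<in> A" "z \<noteq> 0" "M = mat2 a 0 0 d ** mat2 1 x 0 1 ** mat2 z 0 0 z"
    unfolding B0Z_def B0_def T0_def U0_def set_mult_def Units_subset_ring by (auto simp: centre_iff)
  have nz: "a \<noteq> 0" "d \<noteq> 0" using * unfolding unit_def by auto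
  have e: "M $ 1 $ 1 = a * z" "M $ 1 $ 2 = a * x * z" "M $ 2 $ 1 = 0" "M $ 2 $ 2 = d * z"
    using *(5) by (simp_all add: mult_nth)
  have "slope M = a * inverse d" "shift M = a * inverse d * x"
    unfolding slope_def shift_def e using *(4) nz by (simp_all add: field_simps)
  then show "M \<in> borel_set \<and> unit (slope M) \<and> shift M \<in> A"
    using * nz e unit_mult unit_inverse unit_in mult_in by (auto simp: borel_iff)
next
  assume M: "M \<in> borel_set \<and> unit (slope M) \<and> shift M \<in> A"
  let ?z = "M $ 2 $ 2"
  have nz: "?z \<noteq> 0" "slope M \<noteq> 0" "M $ 2 $ 1 = 0" using M slope_nonzero by (auto simp: borel_iff)
  have "M = mat2 (slope M) 0 0 1 ** mat2 1 (shift M / slope M) 0 1 ** mat2 ?z 0 0 ?z"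
    unfolding matrix_eq_iff_entries using nz by (simp add: mult_nth) (simp add: slope_def shift_def)
  moreover have "shift M / slope M \<in> A" using M unit_divide_in by blast
  moreover have "mat2 ?z 0 0 ?z \<in> centre" unfolding centre_iff using nz by blast
  moreover have "mat2 (slope M) 0 0 1 \<in> T0 A" unfolding T0_def Units_subset_ring using M unit_one by blast
  ultimately show "M \<in> H"
    unfolding B0Z_def B0_def U0_def set_mult_def GL2_simps by blast
qed

definition tn :: "nat \<Rightarrow> 'a^2^2" where "tn n = mat2 (\<pi> ^ n) 0 0 1"

lemma tn_borel: "tn n \<in> borel_set" unfolding tn_def borel_iff using pi_nonzero by simp

lemma affine_tn: "slope (tn n) = \<pi> ^ n" "shift (tn n) = 0"
  unfolding tn_def slope_def shift_def by simp_all

lemma tmat_pow: "tmat \<pi> [^]\<^bsub>GL2\<^esub> n = tn n"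
proof (induction n)
  case 0
  show ?case by (simp add: tn_def matrix_eq_iff_entries)
next
  case (Suc n)
  then show ?case by (simp add: tn_def tmat_def matrix_eq_iff_entries mult_nth mult.commute)
qed

lemma Bp_HtE: assumes "M \<in> Bp" obtains h n where "h \<in> H" "M = h ** tn n"
  using assms unfolding Bplus_def r_coset_def tmat_pow by auto

lemma Ht_Bp: "h \<in> H \<Longrightarrow> h ** tn n \<in> Bp"
  unfolding Bplus_def r_coset_def tmat_pow by auto

text \<open>These are the affine maps that send the ring of integers into itself; the exponent of t
  is the valuation of \<open>slope\<close>.\<close>

lemma Bp_iff: "M \<in> Bp \<longleftrightarrow> M \<in> borel_set \<and> slope M \<in> A \<and> shift M \<in> A"
proof
  assume "M \<in> Bp"
  then obtain h n where h: "h \<in> H" "M = h ** tn n" by (rule Bp_HtE)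
  then have hb: "h \<in> borel_set" "unit (slope h)" "shift h \<in> A" unfolding H_iff by auto
  then show "M \<in> borel_set \<and> slope M \<in> A \<and> shift M \<in> A"
    using affine_mult[OF hb(1) tn_borel[of n]] borel_mult[OF hb(1) tn_borel[of n]] h(2) pi_in
    by (auto simp: affine_tn intro!: mult_in power_in dest: unit_in)
next
  assume M: "M \<in> borel_set \<and> slope M \<in> A \<and> shift M \<in> A"
  then obtain k u v where kuv: "slope M = \<pi> ^ k * u" "u \<in> A" "v \<in> A" "u * v = 1"
    using decomp slope_nonzero by blast
  have u: "unit u" unfolding unit_def using kuv inverse_unique[of u v] by auto
  let ?h = "M ** ginv (tn k)"
  have Mb: "M \<in> borel_set" using M by blast
  have hb: "?h \<in> borel_set" using Mb by (intro borel_mult borel_ginv tn_borel)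
  have "slope ?h = u" "shift ?h = shift M"
    unfolding affine_mult[OF Mb borel_ginv[OF tn_borel]] affine_ginv[OF tn_borel] affine_tn
    using kuv pi_nonzero by auto
  then have "?h \<in> H" unfolding H_iff using hb u M by simp
  moreover have "M = ?h ** tn k" using ginv_cancel(4)[OF borel_GL2[OF tn_borel]] by metis
  ultimately show "M \<in> Bp" using Ht_Bp by metis
qed

lemma H_borel: "M \<in> H \<Longrightarrow> M \<in> borel_set" unfolding H_iff by simp
lemma Bp_borel: "M \<in> Bp \<Longrightarrow> M \<in> borel_set" unfolding Bp_iff by simp
lemma H_Bp: "M \<in> H \<Longrightarrow> M \<in> Bp" unfolding H_iff Bp_iff using unit_in by blast
lemma tn_Bp: "tn n \<in> Bp" unfolding Bp_iff affine_tn using tn_borel pi_in power_in zero_in by simp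

lemma H_one: "mat 1 \<in> H" unfolding H_iff affine_one using borel_one unit_one zero_in by simp

lemma H_mult: "\<lbrakk>M \<in> H; N \<in> H\<rbrakk> \<Longrightarrow> M ** N \<in> H"
  unfolding H_iff by (auto simp: affine_mult intro!: borel_mult unit_mult add_in mult_in dest: unit_in)

lemma H_ginv: "M \<in> H \<Longrightarrow> ginv M \<in> H"
  unfolding H_iff using uminus_in by (auto simp: affine_ginv intro!: borel_ginv unit_inverse unit_divide_in uminus_in)

lemma Bp_mult: "\<lbrakk>M \<in> Bp; N \<in> Bp\<rbrakk> \<Longrightarrow> M ** N \<in> Bp"
  unfolding Bp_iff by (auto simp: affine_mult intro!: borel_mult add_in mult_in)

lemma Bp_H_cancel: "\<lbrakk>h \<in> H; M \<in> borel_set\<rbrakk> \<Longrightarrow> h ** M \<in> Bp \<longleftrightarrow> M \<in> Bp"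
  using Bp_mult[of "ginv h" "h ** M"] Bp_mult[of h M] H_Bp H_ginv ginv_cancel(1) borel_GL2 H_borel by metis

lemma Bp_H_cancel_right: "\<lbrakk>h \<in> H; M \<in> borel_set\<rbrakk> \<Longrightarrow> M ** h \<in> Bp \<longleftrightarrow> M \<in> Bp"
  using Bp_mult[of "M ** h" "ginv h"] Bp_mult[of M h] H_Bp H_ginv ginv_cancel(3) borel_GL2 H_borel by metis

text \<open>Left multiplication by t^n multiplies both \<open>slope\<close> and \<open>shift\<close>
  by pi^n.\<close>

lemma tn_absorb: assumes g: "g \<in> borel_set" shows "\<exists>n0. \<forall>n\<ge>n0. tn n ** g \<in> Bp"
proof -
  obtain k k' where k: "\<And>n. n \<ge> k \<Longrightarrow> \<pi> ^ n * slope g \<in> A" "\<And>n. n \<ge> k' \<Longrightarrow> \<pi> ^ n * shift g \<in> A"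
    using fraction_all by metis
  then show ?thesis
    by (intro exI[of _ "max k k'"]) (auto simp: Bp_iff affine_mult[OF tn_borel g] affine_tn intro: borel_mult tn_borel g)
qed

subsection \<open>The elements of \<open>U(q) t\<close>\<close>

definition ut :: "'a \<Rightarrow> 'a^2^2" where "ut x = mat2 \<pi> x 0 1"

definition \<tau>s :: "'a set" where "\<tau>s = teichmueller A \<pi>"

lemma \<tau>s_in: "x \<in> \<tau>s \<Longrightarrow> x \<in> A" unfolding \<tau>s_def using teichmueller_subset by blast
lemma \<tau>s_finite: "finite \<tau>s" unfolding \<tau>s_def by (rule teichmueller_finite)
lemma \<tau>s_zero: "0 \<in> \<tau>s" unfolding \<tau>s_def by (rule zero_teichmueller)
lemma \<tau>s_unique: "\<lbrakk>x \<in> \<tau>s; y \<in> \<tau>s; x - y \<in> pw 1\<rbrakk> \<Longrightarrow> x = y" unfolding \<tau>s_def by (rule teichmueller_unique)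
lemma \<tau>s_exists: "x \<in> A \<Longrightarrow> \<exists>y\<in>\<tau>s. x - y \<in> pw 1" unfolding \<tau>s_def by (rule teichmueller_exists)

lemma Uq_iff: "u \<in> Uq A \<pi> \<longleftrightarrow> (\<exists>x\<in>\<tau>s. u = mat2 1 x 0 1)"
  unfolding Uq_def \<tau>s_def by blast

lemma u_tmat: "mat2 1 x 0 1 ** tmat \<pi> = ut x"
  unfolding ut_def tmat_def by (simp add: matrix_eq_iff_entries mult_nth)

lemma ut_borel: "ut x \<in> borel_set" unfolding ut_def borel_iff using pi_nonzero by simp

lemma affine_ut: "slope (ut x) = \<pi>" "shift (ut x) = x"
  unfolding ut_def slope_def shift_def by simp_all

lemma ut_Bp: "x \<in> A \<Longrightarrow> ut x \<in> Bp" unfolding Bp_iff affine_ut using ut_borel pi_in by simp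

lemma ut_inverse_affine:
  assumes "b \<in> borel_set"
  shows "slope (ginv (ut x) ** b) = slope b / \<pi>" "shift (ginv (ut x) ** b) = (shift b - x) / \<pi>"
  using pi_nonzero by (simp_all add: affine_mult[OF borel_ginv[OF ut_borel] assms] affine_ginv[OF ut_borel] affine_ut field_simps)

lemma ut_inverse_borel: "b \<in> borel_set \<Longrightarrow> ginv (ut x) ** b \<in> borel_set"
  by (intro borel_mult borel_ginv ut_borel)

text \<open>An integral affine map whose slope is not a unit sends all integers into a single
  residue class, and the inverse of \<open>ut x\<close> rescales the class of x to the whole
  ring.\<close>

lemma Bp_split: assumes b: "b \<in> Bp" "b \<notin> H" shows "\<exists>x\<in>\<tau>s. ginv (ut x) ** b \<in> Bp"
proof -
  have bb: "b \<in> borel_set" "slope b \<in> A" "shift b \<in> A" using b unfolding Bp_iff by auto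
  then have "slope b \<in> pw 1" using b(2) not_unit_pw unfolding H_iff by blast
  moreover obtain x where "x \<in> \<tau>s" "shift b - x \<in> pw 1" using \<tau>s_exists bb by blast
  ultimately show ?thesis unfolding Bp_iff ut_inverse_affine[OF bb(1)] pw_iff
    using ut_inverse_borel bb(1) by auto
qed

text \<open>The map \<open>ut x ** b\<close> takes its values in the residue class of x, and
  distinct Teichmueller representatives are incongruent.\<close>

lemma ut_disjoint: assumes "x \<in> \<tau>s" "y \<in> \<tau>s" "x \<noteq> y" "b \<in> Bp" shows "ginv (ut y) ** (ut x ** b) \<notin> Bp"
proof
  assume asm: "ginv (ut y) ** (ut x ** b) \<in> Bp"
  have bb: "b \<in> borel_set" "shift b \<in> A" using assms(4) unfolding Bp_iff by auto
  have "shift (ginv (ut y) ** (ut x ** b)) \<in> A" using asm unfolding Bp_iff by blast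
  then have "\<pi> * shift b + x - y \<in> pw 1"
    unfolding ut_inverse_affine[OF borel_mult[OF ut_borel bb(1)]] affine_mult[OF ut_borel bb(1)] affine_ut pw_iff by simp
  moreover have "\<pi> * shift b \<in> pw 1" using pwI[OF bb(2), of 1] by simp
  ultimately have "(\<pi> * shift b + x - y) - \<pi> * shift b \<in> pw 1" by (rule pw_diff)
  then show False using \<tau>s_unique assms by simp
qed

lemma ut_inverse_H: assumes "h \<in> H" shows "ginv (ut x) ** h \<notin> Bp"
proof -
  have h: "h \<in> borel_set" "unit (slope h)" using assms unfolding H_iff by auto
  then show ?thesis using unit_not_pw unfolding Bp_iff ut_inverse_affine[OF h(1)] pw_iff by simp
qed

text \<open>Conjugation by \<open>ut x\<close> keeps the slope and multiplies the shift by pi up to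
  integral terms, so it maps H into itself.\<close>

lemma ut_H_left: assumes h: "h \<in> H" "x \<in> A" shows "\<exists>h'\<in>H. ut x ** h = h' ** ut x"
proof
  have hb: "h \<in> borel_set" "shift h \<in> A" "unit (slope h)" using h unfolding H_iff by auto
  show "ut x ** h = (ut x ** h ** ginv (ut x)) ** ut x" using ginv_cancel(4)[OF borel_GL2[OF ut_borel]] by metis
  have "slope (ut x ** h ** ginv (ut x)) = slope h" "shift (ut x ** h ** ginv (ut x)) = \<pi> * shift h + x - slope h * x"
    unfolding affine_mult[OF borel_mult[OF ut_borel hb(1)] borel_ginv[OF ut_borel]] affine_mult[OF ut_borel hb(1)] affine_ginv[OF ut_borel] affine_ut
    using pi_nonzero by simp_all
  moreover have "ut x ** h ** ginv (ut x) \<in> borel_set" using hb(1) by (intro borel_mult borel_ginv ut_borel)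
  ultimately show "ut x ** h ** ginv (ut x) \<in> H" unfolding H_iff
    using hb h(2) pi_in by (simp add: mult_in add_in diff_in unit_in)
qed

lemma H_ut_affine: assumes "h \<in> H"
  shows "slope (ginv (ut y) ** (h ** ut x)) = slope h"
    "shift (ginv (ut y) ** (h ** ut x)) = (slope h * x + shift h - y) / \<pi>"
  using pi_nonzero H_borel[OF assms]
  by (simp_all add: ut_inverse_affine[OF borel_mult[OF H_borel[OF assms] ut_borel]] affine_mult[OF _ ut_borel] affine_ut)

lemma H_ut_iff: assumes h: "h \<in> H"
  shows "ginv (ut y) ** (h ** ut x) \<in> H \<longleftrightarrow> slope h * x + shift h - y \<in> pw 1"
  using h ut_inverse_borel[OF borel_mult[OF H_borel[OF h] ut_borel]]
  unfolding H_iff[of "ginv (ut y) ** (h ** ut x)"] H_ut_affine[OF h] pw_iff H_iff[of h] by simp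

text \<open>As an affine map h takes the residue class of x to that of
  \<open>slope h * x + shift h\<close>, and every class has exactly one representative.\<close>

lemma H_ut_exists: assumes "h \<in> H" "x \<in> \<tau>s" shows "\<exists>!y. y \<in> \<tau>s \<and> ginv (ut y) ** (h ** ut x) \<in> H"
proof -
  have "slope h * x + shift h \<in> A" using assms \<tau>s_in unfolding H_iff by (auto intro!: add_in mult_in dest: unit_in)
  then obtain y where y: "y \<in> \<tau>s" "slope h * x + shift h - y \<in> pw 1" using \<tau>s_exists by blast
  moreover have "z = y" if "z \<in> \<tau>s" "slope h * x + shift h - z \<in> pw 1" for z
    using \<tau>s_unique[OF that(1) y(1)] pw_diff[OF y(2) that(2)] by simp
  ultimately show ?thesis unfolding H_ut_iff[OF assms(1)] by blast
qed

text \<open>Resolves the definite description for the inverse of b; inverting the element of H found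
  there gives the one through which b acts in \<open>etale_target\<close>.\<close>

lemma etale_index_eq:
  assumes b: "b \<in> H" and x: "x \<in> \<tau>s"
  shows "\<exists>y\<in>\<tau>s. etale_index A \<pi> b (mat2 1 x 0 1) = mat2 1 y 0 1 \<and> ginv (ut x) ** (b ** ut y) \<in> H"
proof -
  have b': "ginv b \<in> H" using H_ginv[OF b] .
  obtain y where y: "y \<in> \<tau>s" "ginv (ut y) ** (ginv b ** ut x) \<in> H"
    and uniq: "\<And>z. \<lbrakk>z \<in> \<tau>s; ginv (ut z) ** (ginv b ** ut x) \<in> H\<rbrakk> \<Longrightarrow> z = y"
    using H_ut_exists[OF b' x] by blast
  have char: "(\<exists>b'\<in>H. inv\<^bsub>GL2\<^esub> b \<otimes>\<^bsub>GL2\<^esub> mat2 1 x 0 1 \<otimes>\<^bsub>GL2\<^esub> tmat \<pi> = mat2 1 z 0 1 \<otimes>\<^bsub>GL2\<^esub> tmat \<pi> \<otimes>\<^bsub>GL2\<^esub> b')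
    \<longleftrightarrow> ginv (ut z) ** (ginv b ** ut x) \<in> H" for z
  proof -
    have "(\<exists>b'\<in>H. ginv b ** ut x = ut z ** b') \<longleftrightarrow> ginv (ut z) ** (ginv b ** ut x) \<in> H"
      using ginv_cancel(1,2)[OF borel_GL2[OF ut_borel]] by metis
    then show ?thesis by (simp add: u_tmat flip: matrix_mul_assoc)
  qed
  have "etale_index A \<pi> b (mat2 1 x 0 1) = mat2 1 y 0 1"
    unfolding etale_index_def
  proof (rule the_equality)
    show "mat2 1 y 0 1 \<in> Uq A \<pi> \<and> (\<exists>b'\<in>H. inv\<^bsub>GL2\<^esub> b \<otimes>\<^bsub>GL2\<^esub> mat2 1 x 0 1 \<otimes>\<^bsub>GL2\<^esub> tmat \<pi> = mat2 1 y 0 1 \<otimes>\<^bsub>GL2\<^esub> tmat \<pi> \<otimes>\<^bsub>GL2\<^esub> b')"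
      unfolding char Uq_iff using y by blast
    fix u' assume "u' \<in> Uq A \<pi> \<and> (\<exists>b'\<in>H. inv\<^bsub>GL2\<^esub> b \<otimes>\<^bsub>GL2\<^esub> mat2 1 x 0 1 \<otimes>\<^bsub>GL2\<^esub> tmat \<pi> = u' \<otimes>\<^bsub>GL2\<^esub> tmat \<pi> \<otimes>\<^bsub>GL2\<^esub> b')"
    then show "u' = mat2 1 y 0 1" unfolding Uq_iff using uniq char by blast
  qed
  moreover have "ginv (ut x) ** (b ** ut y) \<in> H"
  proof -
    note c = borel_GL2[OF ut_borel] borel_GL2[OF H_borel[OF b]]
    have "ginv (ginv (ut y) ** (ginv b ** ut x)) = ginv (ut x) ** (b ** ut y)"
      using c by (simp add: ginv_prod ginv_closed GL2_mult_closed ginv_ginv matrix_mul_assoc)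
    then show ?thesis using H_ginv[OF y(2)] by simp
  qed
  ultimately show ?thesis using y(1) by blast
qed

subsection \<open>Open subsets\<close>

definition near :: "nat \<Rightarrow> 'a^2^2 \<Rightarrow> 'a^2^2 \<Rightarrow> bool" where
  "near k M N \<longleftrightarrow> (\<forall>i j. N $ i $ j - M $ i $ j \<in> pw k)"

lemma openin_sub_iff:
  "openin (subtopology (matrix_topology A) C) S \<longleftrightarrow> S \<subseteq> C \<and> (\<forall>M\<in>S. \<exists>k. \<forall>N\<in>C. near k M N \<longrightarrow> N \<in> S)"
proof
  assume "openin (subtopology (matrix_topology A) C) S"
  then obtain S' where S': "openin (matrix_topology A) S'" "S = S' \<inter> C" unfolding openin_subtopology by blast
  then show "S \<subseteq> C \<and> (\<forall>M\<in>S. \<exists>k. \<forall>N\<in>C. near k M N \<longrightarrow> N \<in> S)"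
    unfolding openin_matrix_topology near_def by (metis IntD1 IntI Int_lower2)
next
  assume R: "S \<subseteq> C \<and> (\<forall>M\<in>S. \<exists>k. \<forall>N\<in>C. near k M N \<longrightarrow> N \<in> S)"
  define S' where "S' = {N. \<exists>M\<in>S. \<exists>k. (\<forall>N\<in>C. near k M N \<longrightarrow> N \<in> S) \<and> near k M N}"
  have "openin (matrix_topology A) S'" unfolding openin_matrix_topology
  proof
    fix N assume "N \<in> S'"
    then obtain M k where M: "M \<in> S" "\<forall>N\<in>C. near k M N \<longrightarrow> N \<in> S" "near k M N" unfolding S'_def by blast
    have "N' \<in> S'" if N': "\<forall>i j. N' $ i $ j - N $ i $ j \<in> pw k" for N'
    proof -
      have "near k M N'" unfolding near_def
      proof (intro allI)
        fix i j
        have "(N' $ i $ j - N $ i $ j) + (N $ i $ j - M $ i $ j) \<in> pw k" using N' M(3) unfolding near_def by (intro pw_add) auto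
        then show "N' $ i $ j - M $ i $ j \<in> pw k" by simp
      qed
      then show ?thesis unfolding S'_def using M by blast
    qed
    then show "\<exists>k. \<forall>N'. (\<forall>i j. N' $ i $ j - N $ i $ j \<in> pw k) \<longrightarrow> N' \<in> S'" by blast
  qed
  moreover have "S = S' \<inter> C"
  proof
    show "S \<subseteq> S' \<inter> C" unfolding S'_def near_def using R pw_zero by (fastforce simp: near_def)
    show "S' \<inter> C \<subseteq> S" unfolding S'_def by blast
  qed
  ultimately show "openin (subtopology (matrix_topology A) C) S" unfolding openin_subtopology by blast
qed

text \<open>Multiplication by C loses no more precision than the largest denominator among the
  entries of C.\<close>

lemma near_mult: "\<exists>K. \<forall>M N. near K M N \<longrightarrow> near k (C ** M) (C ** N) \<and> near k (M ** C) (N ** C)"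
proof -
  have "\<forall>i j. \<exists>K. \<pi> ^ K * C $ i $ j \<in> pw k" using fraction_pw by blast
  then obtain e where e: "\<And>i j. \<pi> ^ (e i j) * C $ i $ j \<in> pw k" by metis
  define K where "K = Max (range (\<lambda>(i, j). e i j))"
  have K: "e i j \<le> K" for i j unfolding K_def by (rule Max_ge) (auto intro: image_eqI[of _ _ "(i, j)"])
  have D: "C $ i $ j * x \<in> pw k" if "x \<in> pw K" for i j x
  proof -
    have "x \<in> pw (e i j)" using K that pw_antimono by blast
    then obtain y where y: "y \<in> A" "x = \<pi> ^ (e i j) * y" unfolding pw_def by blast
    have "(\<pi> ^ (e i j) * C $ i $ j) * y \<in> pw k" using e y(1) by (rule pw_mult_A)
    then show ?thesis using y(2) by (simp add: mult_ac)
  qed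
  have "near k (C ** M) (C ** N) \<and> near k (M ** C) (N ** C)" if MN: "near K M N" for M N
    unfolding near_def mult_nth
  proof (intro conjI allI)
    fix i j
    have "C $ i $ 1 * (N $ 1 $ j - M $ 1 $ j) + C $ i $ 2 * (N $ 2 $ j - M $ 2 $ j) \<in> pw k"
      using MN unfolding near_def by (intro pw_add D) auto
    then show "C $ i $ 1 * N $ 1 $ j + C $ i $ 2 * N $ 2 $ j - (C $ i $ 1 * M $ 1 $ j + C $ i $ 2 * M $ 2 $ j) \<in> pw k"
      by (simp add: algebra_simps)
    have "C $ 1 $ j * (N $ i $ 1 - M $ i $ 1) + C $ 2 $ j * (N $ i $ 2 - M $ i $ 2) \<in> pw k"
      using MN unfolding near_def by (intro pw_add D) auto
    then show "N $ i $ 1 * C $ 1 $ j + N $ i $ 2 * C $ 2 $ j - (M $ i $ 1 * C $ 1 $ j + M $ i $ 2 * C $ 2 $ j) \<in> pw k"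
      by (simp add: algebra_simps)
  qed
  then show ?thesis by blast
qed

lemma open_translate:
  assumes S: "openin (subtopology (matrix_topology A) borel_set) S" and g: "g \<in> borel_set"
  shows "openin (subtopology (matrix_topology A) borel_set) {b \<in> borel_set. g ** b \<in> S}"
    "openin (subtopology (matrix_topology A) borel_set) {b \<in> borel_set. b ** g \<in> S}"
proof -
  have S': "\<forall>M\<in>S. \<exists>k. \<forall>N\<in>borel_set. near k M N \<longrightarrow> N \<in> S" using S unfolding openin_sub_iff by blast
  show "openin (subtopology (matrix_topology A) borel_set) {b \<in> borel_set. g ** b \<in> S}"
    unfolding openin_sub_iff
  proof safe
    fix M assume "M \<in> borel_set" "g ** M \<in> S"
    then obtain k where "\<forall>N\<in>borel_set. near k (g ** M) N \<longrightarrow> N \<in> S" using S' by blast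
    then show "\<exists>k. \<forall>N\<in>borel_set. near k M N \<longrightarrow> N \<in> {b \<in> borel_set. g ** b \<in> S}"
      using near_mult[of k g] borel_mult[OF g] by (metis (mono_tags, lifting) mem_Collect_eq)
  qed
  show "openin (subtopology (matrix_topology A) borel_set) {b \<in> borel_set. b ** g \<in> S}"
    unfolding openin_sub_iff
  proof safe
    fix M assume "M \<in> borel_set" "M ** g \<in> S"
    then obtain k where "\<forall>N\<in>borel_set. near k (M ** g) N \<longrightarrow> N \<in> S" using S' by blast
    then show "\<exists>k. \<forall>N\<in>borel_set. near k M N \<longrightarrow> N \<in> {b \<in> borel_set. b ** g \<in> S}"
      using near_mult[of k g] borel_mult[OF _ g] by (metis (mono_tags, lifting) mem_Collect_eq)
  qed
qed

lemma open_H: "openin (subtopology (matrix_topology A) borel_set) H"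
  unfolding openin_sub_iff
proof safe
  fix M assume "M \<in> H"
  then have M: "M \<in> borel_set" "unit (slope M)" "shift M \<in> A" unfolding H_iff by auto
  let ?d = "M $ 2 $ 2"
  have d: "?d \<noteq> 0" using M(1) by (simp add: borel_iff)
  \<comment> \<open>A perturbation by multiples of pi^k changes the entries, divided by the lower
    right entry of M, by elements of the maximal ideal; the slope stays a unit and the shift stays
    integral.\<close>
  obtain k where k: "\<pi> ^ k * inverse ?d \<in> pw 1" using fraction_pw by blast
  have "N \<in> H" if N: "N \<in> borel_set" "near k M N" for N
  proof -
    define e where "e i j = (N $ i $ j - M $ i $ j) / ?d" for i j
    have e: "e i j \<in> pw 1" for i j
    proof -
      obtain y where y: "y \<in> A" "N $ i $ j - M $ i $ j = \<pi> ^ k * y" using N(2) unfolding near_def pw_def by blast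
      have "(\<pi> ^ k * inverse ?d) * y \<in> pw 1" using k y(1) by (rule pw_mult_A)
      then show ?thesis unfolding e_def y(2) by (simp add: field_simps)
    qed
    have Ne: "N $ i $ j / ?d = M $ i $ j / ?d + e i j" for i j unfolding e_def by (simp add: diff_divide_distrib)
    have den: "unit (1 + e 2 2)" using unit_add_pw[OF unit_one e] .
    have n22: "N $ 2 $ 2 / ?d = 1 + e 2 2" using Ne[of 2 2] d by simp
    have quot: "N $ i $ j / N $ 2 $ 2 = (N $ i $ j / ?d) / (N $ 2 $ 2 / ?d)" for i j using d by simp
    have "slope N = (slope M + e 1 1) / (1 + e 2 2)" unfolding slope_def quot[of 1 1] n22 Ne[of 1 1] ..
    then have "unit (slope N)" unfolding divide_inverse using den unit_add_pw[OF M(2) e] by (auto intro!: unit_mult unit_inverse)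
    moreover have "shift N = (shift M + e 1 2) / (1 + e 2 2)" unfolding shift_def quot[of 1 2] n22 Ne[of 1 2] ..
    then have "shift N \<in> A" using den M(3) pw_in[OF e] by (auto intro!: unit_divide_in add_in)
    ultimately show ?thesis unfolding H_iff using N(1) by simp
  qed
  then show "\<exists>k. \<forall>N\<in>borel_set. near k M N \<longrightarrow> N \<in> H" by blast
qed (rule H_borel)

subsection \<open>Congruence subgroups\<close>

text \<open>The principal congruence subgroup of level l; it is a group only for l \<ge> 1.\<close>

definition K :: "nat \<Rightarrow> ('a^2^2) set" where "K l = {M. near l (mat 1) M}"

lemma K_iff: "M \<in> K l \<longleftrightarrow> M $ 1 $ 1 - 1 \<in> pw l \<and> M $ 1 $ 2 \<in> pw l \<and> M $ 2 $ 1 \<in> pw l \<and> M $ 2 $ 2 - 1 \<in> pw l"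
  unfolding K_def near_def by (auto simp: forall_2)

lemma K_one: "mat 1 \<in> K l" unfolding K_iff by (simp add: pw_zero)

lemma K_antimono: "j \<le> l \<Longrightarrow> K l \<subseteq> K j"
  unfolding K_iff subset_iff using pw_antimono by blast

lemma K_in: assumes "M \<in> K l" shows "M $ i $ j \<in> A"
proof -
  have "M $ i $ j - mat 1 $ i $ j \<in> A" using assms pw_in unfolding K_def near_def by blast
  moreover have "(mat 1 :: 'a^2^2) $ i $ j \<in> A" by (simp add: mat_def one_in zero_in)
  ultimately show ?thesis using add_in by fastforce
qed

lemma K_mult: assumes "M \<in> K l" "N \<in> K l" shows "M ** N \<in> K l"
  unfolding K_def near_def mem_Collect_eq
proof (intro allI)
  fix i j
  have N: "N $ i' $ j' - (mat 1 :: 'a^2^2) $ i' $ j' \<in> pw l" for i' j' using assms(2) unfolding K_def near_def by blast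
  have M: "M $ i $ j - (mat 1 :: 'a^2^2) $ i $ j \<in> pw l" using assms(1) unfolding K_def near_def by blast
  have "M $ i $ 1 * (N $ 1 $ j - (mat 1 :: 'a^2^2) $ 1 $ j) + M $ i $ 2 * (N $ 2 $ j - (mat 1 :: 'a^2^2) $ 2 $ j)
    + (M $ i $ j - (mat 1 :: 'a^2^2) $ i $ j) \<in> pw l"
    using N M K_in[OF assms(1)] by (intro pw_add pw_mult_A) auto
  moreover have "M $ i $ 1 * (mat 1 :: 'a^2^2) $ 1 $ j + M $ i $ 2 * (mat 1 :: 'a^2^2) $ 2 $ j = M $ i $ j"
    using mult_nth[of M "mat 1" i j] by simp
  ultimately show "(M ** N) $ i $ j - (mat 1 :: 'a^2^2) $ i $ j \<in> pw l"
    unfolding mult_nth by (simp add: algebra_simps)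
qed

lemma K_det: assumes "M \<in> K l" "l \<ge> 1" shows "unit (det M)"
proof -
  have M: "M $ 1 $ 1 - 1 \<in> pw 1" "M $ 1 $ 2 \<in> pw 1" "M $ 2 $ 1 \<in> pw 1" "M $ 2 $ 2 - 1 \<in> pw 1"
    using assms K_antimono[of 1 l] K_iff[of M 1] by auto
  have "(M $ 1 $ 1 - 1) * M $ 2 $ 2 + (M $ 2 $ 2 - 1) - M $ 1 $ 2 * M $ 2 $ 1 \<in> pw 1"
    by (rule pw_diff[OF pw_add[OF pw_mult_A(1)[OF M(1)] M(4)] pw_mult_A(1)[OF M(2)]]) (rule K_in[OF assms(1)])+
  then have "unit (1 + ((M $ 1 $ 1 - 1) * M $ 2 $ 2 + (M $ 2 $ 2 - 1) - M $ 1 $ 2 * M $ 2 $ 1))"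
    by (rule unit_add_pw[OF unit_one])
  then show ?thesis by (simp add: det_2 algebra_simps)
qed

lemma K_GL2: "\<lbrakk>M \<in> K l; l \<ge> 1\<rbrakk> \<Longrightarrow> M \<in> carrier GL2"
  using K_det unfolding unit_def carrier_GL2 by blast

text \<open>The inverse is integral because the determinant is a unit, and M^-1 - 1 = - M^-1 (M -
  1).\<close>

lemma K_ginv: assumes M: "M \<in> K l" "l \<ge> 1" shows "ginv M \<in> K l"
proof -
  note c = K_GL2[OF M]
  have inA: "ginv M $ i $ j \<in> A" for i j
    using ginv_nth[OF c] K_in[OF M(1)] unit_divide_in[OF _ K_det[OF M]] uminus_in exhaust_2[of i] exhaust_2[of j] by metis
  show ?thesis unfolding K_def near_def mem_Collect_eq
  proof (intro allI)
    fix i j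
    have "- (ginv M $ i $ 1 * (M $ 1 $ j - (mat 1 :: 'a^2^2) $ 1 $ j) + ginv M $ i $ 2 * (M $ 2 $ j - (mat 1 :: 'a^2^2) $ 2 $ j)) \<in> pw l"
      using inA M(1) unfolding K_def near_def by (intro pw_uminus pw_add pw_mult_A) auto
    moreover have "ginv M $ i $ 1 * M $ 1 $ j + ginv M $ i $ 2 * M $ 2 $ j = (mat 1 :: 'a^2^2) $ i $ j"
      "ginv M $ i $ 1 * (mat 1 :: 'a^2^2) $ 1 $ j + ginv M $ i $ 2 * (mat 1 :: 'a^2^2) $ 2 $ j = ginv M $ i $ j"
      using mult_nth[of "ginv M" M i j] ginv_mult(1)[OF c] mult_nth[of "ginv M" "mat 1" i j] by auto
    ultimately show "ginv M $ i $ j - (mat 1 :: 'a^2^2) $ i $ j \<in> pw l"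
      by (simp add: algebra_simps)
  qed
qed

lemma subgroup_K: "l \<ge> 1 \<Longrightarrow> subgroup (K l) GL2"
  by (rule group.subgroupI[OF group_GL2])
    (use K_one in \<open>auto simp: K_GL2 K_ginv K_mult\<close>)

lemma open_K: assumes "l \<ge> 1" shows "openin (subtopology (matrix_topology A) (carrier GL2)) (K l)"
  unfolding openin_sub_iff
proof (intro conjI ballI)
  show "K l \<subseteq> carrier GL2" using K_GL2 assms by blast
  fix M assume M: "M \<in> K l"
  have "N \<in> K l" if N: "near l M N" for N
    unfolding K_def near_def mem_Collect_eq
  proof (intro allI)
    fix i j
    have "(N $ i $ j - M $ i $ j) + (M $ i $ j - (mat 1 :: 'a^2^2) $ i $ j) \<in> pw l"
      using N M unfolding K_def near_def by (intro pw_add) auto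
    then show "N $ i $ j - (mat 1 :: 'a^2^2) $ i $ j \<in> pw l" by simp
  qed
  then show "\<exists>k. \<forall>N\<in>carrier GL2. near k M N \<longrightarrow> N \<in> K l" by blast
qed

lemma compact_K: assumes "l \<ge> 1" shows "compactin (subtopology (matrix_topology A) (carrier GL2)) (K l)"
  using compactin_matrix_ball[of "mat 1" l] K_GL2[OF _ assms] unfolding compactin_subtopology K_def near_def by blast

end

section \<open>Representations of the Borel subgroup\<close>

locale borel_rep = cdvr A \<pi> + smooth_rep R "GL2_on borel_set" "matrix_topology A" V
  for A :: "'a::field set" and \<pi> :: 'a and R :: "'r ring" and V :: "('r, 'v, 'a^2^2) rep" (structure) +
  assumes noetherian: "noetherian_ring R"
begin

abbreviation T where "T \<equiv> matrix_topology A"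
abbreviation sp :: "('a^2^2) set \<Rightarrow> 'v set \<Rightarrow> 'v set" where "sp X W \<equiv> act_span R V X W"

section \<open>Linearity of the action and spans of translates\<close>

lemma act_in: "\<lbrakk>g \<in> borel_set; v \<in> carrier V\<rbrakk> \<Longrightarrow> act V g v \<in> carrier V"
  using act_closed by (simp add: GL2_on_simps)

lemma act_plus: "\<lbrakk>g \<in> borel_set; v \<in> carrier V; w \<in> carrier V\<rbrakk> \<Longrightarrow> act V g (v \<oplus> w) = act V g v \<oplus> act V g w"
  using act_add by (simp add: GL2_on_simps)

lemma act_scalar: "\<lbrakk>g \<in> borel_set; r \<in> carrier R; v \<in> carrier V\<rbrakk> \<Longrightarrow> act V g (r \<odot> v) = r \<odot> act V g v"
  using act_smult by (simp add: GL2_on_simps)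

lemma act_id: "v \<in> carrier V \<Longrightarrow> act V (mat 1) v = v"
  using act_one by (simp add: GL2_on_simps)

lemma act_comp: "\<lbrakk>g \<in> borel_set; h \<in> borel_set; v \<in> carrier V\<rbrakk> \<Longrightarrow> act V (g ** h) v = act V g (act V h v)"
  using act_mult[of g h v] unfolding GL2_on_simps by simp

lemma act_zero: "g \<in> borel_set \<Longrightarrow> act V g \<zero> = \<zero>"
  using act_scalar[of g "\<zero>\<^bsub>R\<^esub>" "\<zero>"] act_in[of g "\<zero>"] by simp

lemma act_minus: "\<lbrakk>g \<in> borel_set; v \<in> carrier V; w \<in> carrier V\<rbrakk> \<Longrightarrow> act V g (v \<ominus> w) = act V g v \<ominus> act V g w"
proof -
  assume g: "g \<in> borel_set" and v: "v \<in> carrier V" and w: "w \<in> carrier V"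
  have "act V g (v \<ominus> w) \<oplus> act V g w = act V g v"
    using g v w by (simp add: minus_add_cancel flip: act_plus)
  then show ?thesis using g v w add_minus_cancel[of "act V g (v \<ominus> w)" "act V g w"] by (simp add: act_in)
qed

lemma act_cancel: "\<lbrakk>g \<in> borel_set; v \<in> carrier V\<rbrakk> \<Longrightarrow> act V (ginv g) (act V g v) = v"
  "\<lbrakk>g \<in> borel_set; v \<in> carrier V\<rbrakk> \<Longrightarrow> act V g (act V (ginv g) v) = v"
  by (simp_all add: act_comp[symmetric] borel_ginv ginv_mult borel_GL2 act_id)

lemma submodule_act_vimage: "\<lbrakk>g \<in> borel_set; submodule N R V\<rbrakk> \<Longrightarrow> submodule {v \<in> carrier V. act V g v \<in> N} R V"
  by (rule submodule_vimage) (auto simp: act_in act_plus act_scalar)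

lemma act_fixes_near_one:
  assumes "v \<in> carrier V" shows "\<exists>k. \<forall>g\<in>borel_set. near k (mat 1) g \<longrightarrow> act V g v = v"
proof -
  have "openin (subtopology T borel_set) {h \<in> borel_set. act V h v = v}" using smooth[OF assms] by (simp add: GL2_on_simps)
  then show ?thesis unfolding openin_sub_iff using borel_one act_id[OF assms] by blast
qed

text \<open>The set is empty or a translate of the stabiliser of v. Smoothness of quotients rests on
  this form, because a class is fixed as soon as v moves to any vector of the class.\<close>

lemma open_act_eq:
  assumes v: "v \<in> carrier V" shows "openin (subtopology T borel_set) {h \<in> borel_set. act V h v = w}"
proof (cases "\<exists>g\<in>borel_set. act V g v = w")
  case True
  then obtain g where g: "g \<in> borel_set" "act V g v = w" by blast
  have "openin (subtopology T borel_set) {h \<in> borel_set. act V h v = v}" using smooth[OF v] by (simp add: GL2_on_simps)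
  then have "openin (subtopology T borel_set) {b \<in> borel_set. ginv g ** b \<in> {h \<in> borel_set. act V h v = v}}"
    using borel_ginv[OF g(1)] by (rule open_translate)
  moreover have "{b \<in> borel_set. ginv g ** b \<in> {h \<in> borel_set. act V h v = v}} = {h \<in> borel_set. act V h v = w}"
  proof -
    have "act V (ginv g ** b) v = v \<longleftrightarrow> act V b v = w" if b: "b \<in> borel_set" for b
      using act_comp[OF borel_ginv[OF g(1)] b v] act_cancel[OF g(1)] act_in[OF b v] g(2) v by metis
    then show ?thesis using borel_mult[OF borel_ginv[OF g(1)]] by blast
  qed
  ultimately show ?thesis by simp
next
  case False
  then have "{h \<in> borel_set. act V h v = w} = {}" by auto
  then show ?thesis by (metis openin_empty)
qed

lemma sp_submodule: "\<lbrakk>X \<subseteq> borel_set; W \<subseteq> carrier V\<rbrakk> \<Longrightarrow> submodule (sp X W) R V"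
  unfolding act_span_def by (rule mspan_submodule) (use act_in in auto)

lemma sp_inc: "\<lbrakk>x \<in> X; w \<in> W\<rbrakk> \<Longrightarrow> act V x w \<in> sp X W"
  unfolding act_span_def by (rule hull_inc) blast

lemma sp_minimal: "\<lbrakk>submodule N R V; \<And>x w. \<lbrakk>x \<in> X; w \<in> W\<rbrakk> \<Longrightarrow> act V x w \<in> N\<rbrakk> \<Longrightarrow> sp X W \<subseteq> N"
  unfolding act_span_def by (rule mspan_minimal) auto

lemma sp_mono: "\<lbrakk>X \<subseteq> X'; W \<subseteq> W'\<rbrakk> \<Longrightarrow> sp X W \<subseteq> sp X' W'"
  unfolding act_span_def by (rule hull_mono) auto

lemma sp_act:
  assumes "g \<in> borel_set" "X \<subseteq> borel_set" "Y \<subseteq> borel_set" "W \<subseteq> carrier V" "\<And>x. x \<in> X \<Longrightarrow> g ** x \<in> Y" "v \<in> sp X W"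
  shows "act V g v \<in> sp Y W"
proof -
  have "sp X W \<subseteq> {v \<in> carrier V. act V g v \<in> sp Y W}"
  proof (rule sp_minimal[OF submodule_act_vimage[OF assms(1) sp_submodule[OF assms(3,4)]]])
    fix x w assume "x \<in> X" "w \<in> W"
    then show "act V x w \<in> {v \<in> carrier V. act V g v \<in> sp Y W}"
      using sp_inc[OF assms(5), of x w W] assms act_in by (auto simp: subset_iff simp flip: act_comp)
  qed
  then show ?thesis using assms(6) by blast
qed

lemma sp_id_subset: "\<lbrakk>mat 1 \<in> X; W \<subseteq> carrier V\<rbrakk> \<Longrightarrow> W \<subseteq> sp X W"
proof
  fix w assume "mat 1 \<in> X" "W \<subseteq> carrier V" "w \<in> W"
  then show "w \<in> sp X W" using sp_inc[of "mat 1" X w W] act_id[of w] by auto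
qed

subsection \<open>Subquotients\<close>

lemma submodule_restrict:
  assumes "submodule Y R V" shows "submodule N R (V \<downharpoonright> Y) \<longleftrightarrow> submodule N R V \<and> N \<subseteq> Y"
proof -
  interpret Y: Module.module R "V \<downharpoonright> Y" using submodule.submodule_is_module[OF assms module_axioms] .
  show ?thesis
  proof
    assume N: "submodule N R (V \<downharpoonright> Y)"
    have "N \<subseteq> Y" using Y.submodule_subset[OF N] by simp
    moreover have "submodule N R V"
      using Y.submodule_zero[OF N] Y.submoduleE(4,5)[OF N] \<open>N \<subseteq> Y\<close> submodule_subset[OF assms] by (intro submoduleI') auto
    ultimately show "submodule N R V \<and> N \<subseteq> Y" by blast
  next
    assume N: "submodule N R V \<and> N \<subseteq> Y"
    then show "submodule N R (V \<downharpoonright> Y)"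
      using submodule_zero submoduleE(4,5) by (intro Y.submoduleI') auto
  qed
qed

lemma act_span_restrict:
  assumes Y: "submodule Y R V" and XW: "\<And>x w. \<lbrakk>x \<in> X; w \<in> W\<rbrakk> \<Longrightarrow> act V x w \<in> Y"
  shows "act_span R (V \<downharpoonright> Y) X W = sp X W"
proof
  have sub: "sp X W \<subseteq> Y" by (rule sp_minimal[OF Y XW])
  have sm: "submodule (sp X W) R V" unfolding act_span_def
    by (rule mspan_submodule) (use XW submodule_subset[OF Y] in auto)
  show "act_span R (V \<downharpoonright> Y) X W \<subseteq> sp X W"
    unfolding act_span_def[of R "V \<downharpoonright> Y"]
    by (rule hull_minimal) (use sub sm sp_inc in \<open>auto simp: submodule_restrict[OF Y]\<close>)
  show "sp X W \<subseteq> act_span R (V \<downharpoonright> Y) X W"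
    unfolding act_span_def[of R "V \<downharpoonright> Y"] hull_def
    using sp_minimal by (auto simp: submodule_restrict[OF Y]) blast
qed

text \<open>Presenting a subquotient \<open>D\<close> as the image of a submodule \<open>Y\<close> under \<open>\<kappa>\<close> covers both the quotients
  by a submodule and \<open>D_rep\<close>, whose action is not induced from one on \<open>Vplus\<close>.\<close>

lemma smooth_rep_image:
  assumes S: "S \<subseteq> borel_set" "mat 1 \<in> S" "\<And>g h. \<lbrakk>g \<in> S; h \<in> S\<rbrakk> \<Longrightarrow> g ** h \<in> S"
    and Y: "submodule Y R V" "\<And>h y. \<lbrakk>h \<in> S; y \<in> Y\<rbrakk> \<Longrightarrow> act V h y \<in> Y"
    and D: "carrier D = \<kappa> ` Y" "\<zero>\<^bsub>D\<^esub> = \<kappa> \<zero>"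
      "\<And>x y. \<lbrakk>x \<in> Y; y \<in> Y\<rbrakk> \<Longrightarrow> \<kappa> x \<oplus>\<^bsub>D\<^esub> \<kappa> y = \<kappa> (x \<oplus> y)"
      "\<And>r y. \<lbrakk>r \<in> carrier R; y \<in> Y\<rbrakk> \<Longrightarrow> r \<odot>\<^bsub>D\<^esub> \<kappa> y = \<kappa> (r \<odot> y)"
      "\<And>h y. \<lbrakk>h \<in> S; y \<in> Y\<rbrakk> \<Longrightarrow> act D h (\<kappa> y) = \<kappa> (act V h y)"
  shows "smooth_rep R (GL2_on S) T D"
proof -
  have Yc: "Y \<subseteq> carrier V" using submodule_subset[OF Y(1)] .
  note cl = submodule_zero[OF Y(1)] submoduleE(3,4,5)[OF Y(1)] subsetD[OF Yc]
  have mod: "Module.module R D"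
  proof (rule moduleI)
    show "cring R" by (rule R.cring_axioms)
    show "abelian_group D"
    proof (rule abelian_groupI)
      fix x assume "x \<in> carrier D"
      then obtain y where y: "y \<in> Y" "x = \<kappa> y" using D(1) by blast
      then have "\<kappa> (\<ominus> y) \<oplus>\<^bsub>D\<^esub> x = \<zero>\<^bsub>D\<^esub>" using D cl by (simp add: M.l_neg)
      then show "\<exists>y\<in>carrier D. y \<oplus>\<^bsub>D\<^esub> x = \<zero>\<^bsub>D\<^esub>" using cl(2)[OF y(1)] D(1) by blast
    qed (use cl in \<open>auto simp: D M.a_ac\<close>)
  qed (use cl in \<open>auto simp: D smult_l_distr smult_r_distr smult_assoc1\<close>)
  have mon: "monoid (GL2_on S)"
    by (rule monoidI) (auto simp: S matrix_mul_assoc)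
  show ?thesis
  proof (rule smooth_rep.intro[OF mod mon], unfold_locales)
    fix v assume "v \<in> carrier D"
    then obtain y where y: "y \<in> Y" "v = \<kappa> y" using D(1) by blast
    \<comment> \<open>The stabiliser of the class of y is the union, over the representatives w of
      this class, of the open sets of elements that move y to w.\<close>
    have eq: "{h \<in> carrier (GL2_on S). act D h v = v} =
        (\<Union>w\<in>{w \<in> Y. \<kappa> w = \<kappa> y}. {h \<in> borel_set. act V h y = w}) \<inter> S"
      using y D(5) S(1) Y(2) by (auto simp: GL2_on_simps)
    have "openin (subtopology T borel_set) (\<Union>w\<in>{w \<in> Y. \<kappa> w = \<kappa> y}. {h \<in> borel_set. act V h y = w})"
      using open_act_eq cl(5) y(1) by (intro openin_Union) auto
    then have "openin (subtopology (subtopology T borel_set) S) {h \<in> carrier (GL2_on S). act D h v = v}"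
      unfolding eq openin_subtopology[of _ S] by blast
    then show "openin (subtopology T (carrier (GL2_on S))) {h \<in> carrier (GL2_on S). act D h v = v}"
      using S(1) by (simp add: subtopology_subtopology Int_absorb1 GL2_on_simps)
  next
    fix v assume "v \<in> carrier D"
    then obtain y where "y \<in> Y" "v = \<kappa> y" using D(1) by blast
    then show "act D \<one>\<^bsub>GL2_on S\<^esub> v = v" using D(5)[OF S(2), of y] act_id[OF cl(5)] by (simp add: GL2_on_simps)
  next
    fix g h v assume gh: "g \<in> carrier (GL2_on S)" "h \<in> carrier (GL2_on S)" and "v \<in> carrier D"
    then obtain y where y: "y \<in> Y" "v = \<kappa> y" using D(1) by blast
    have gh': "g \<in> S" "h \<in> S" using gh by (auto simp: GL2_on_simps)
    then have "act D (g ** h) (\<kappa> y) = act D g (act D h (\<kappa> y))"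
      using D(5) S(3) Y(2) act_comp[of g h y] cl(5) S(1) y(1) by (metis subsetD)
    then show "act D (g \<otimes>\<^bsub>GL2_on S\<^esub> h) v = act D g (act D h v)" unfolding GL2_on_simps y(2) .
  qed (use cl Y(2) S(1) in \<open>auto simp: D act_plus act_scalar subset_iff\<close>)
qed

text \<open>Generation is needed only up to \<open>\<kappa>\<close>: the preimage of a submodule of
  D is a submodule of V, to which the minimality of the span applies.\<close>

lemma smooth_tf_image:
  assumes S: "S \<subseteq> borel_set" "mat 1 \<in> S" "\<And>g h. \<lbrakk>g \<in> S; h \<in> S\<rbrakk> \<Longrightarrow> g ** h \<in> S"
    and Y: "submodule Y R V" "\<And>h y. \<lbrakk>h \<in> S; y \<in> Y\<rbrakk> \<Longrightarrow> act V h y \<in> Y"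
    and D: "carrier D = \<kappa> ` Y" "\<zero>\<^bsub>D\<^esub> = \<kappa> \<zero>"
      "\<And>x y. \<lbrakk>x \<in> Y; y \<in> Y\<rbrakk> \<Longrightarrow> \<kappa> x \<oplus>\<^bsub>D\<^esub> \<kappa> y = \<kappa> (x \<oplus> y)"
      "\<And>r y. \<lbrakk>r \<in> carrier R; y \<in> Y\<rbrakk> \<Longrightarrow> r \<odot>\<^bsub>D\<^esub> \<kappa> y = \<kappa> (r \<odot> y)"
      "\<And>h y. \<lbrakk>h \<in> S; y \<in> Y\<rbrakk> \<Longrightarrow> act D h (\<kappa> y) = \<kappa> (act V h y)"
    and W: "finite W" "W \<subseteq> Y" "\<And>y. y \<in> Y \<Longrightarrow> \<exists>y'\<in>sp S W. \<kappa> y = \<kappa> y'"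
  shows "smooth_tf R (GL2_on S) T D"
proof -
  have rep: "smooth_rep R (GL2_on S) T D" by (rule smooth_rep_image[OF S Y D])
  interpret D: smooth_rep R "GL2_on S" T D by (rule rep)
  have Yc: "Y \<subseteq> carrier V" using submodule_subset[OF Y(1)] .
  note cl = submodule_zero[OF Y(1)] submoduleE(3,4,5)[OF Y(1)]
  have "carrier D \<subseteq> L" if L: "submodule L R D" "{act D x w | x w. x \<in> S \<and> w \<in> \<kappa> ` W} \<subseteq> L" for L
  proof -
    have "submodule {y \<in> Y. \<kappa> y \<in> L} R V"
    proof (rule submoduleI')
      show "{y \<in> Y. \<kappa> y \<in> L} \<subseteq> carrier V" using Yc by blast
      show "\<zero> \<in> {y \<in> Y. \<kappa> y \<in> L}" using cl D.submodule_zero[OF L(1)] D(2) by simp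
      fix a b assume "a \<in> {y \<in> Y. \<kappa> y \<in> L}" "b \<in> {y \<in> Y. \<kappa> y \<in> L}"
      then show "a \<oplus> b \<in> {y \<in> Y. \<kappa> y \<in> L}" using cl(4) D.submoduleE(5)[OF L(1)] D(3) by fastforce
    next
      fix r a assume "r \<in> carrier R" "a \<in> {y \<in> Y. \<kappa> y \<in> L}"
      then show "r \<odot> a \<in> {y \<in> Y. \<kappa> y \<in> L}" using cl(3) D.submoduleE(4)[OF L(1)] D(4) by fastforce
    qed
    moreover have "act V x w \<in> {y \<in> Y. \<kappa> y \<in> L}" if "x \<in> S" "w \<in> W" for x w
    proof -
      have "act D x (\<kappa> w) \<in> L" using L(2) that by blast
      then show ?thesis using that Y(2) W(2) D(5)[of x w] by auto
    qed
    ultimately have "sp S W \<subseteq> {y \<in> Y. \<kappa> y \<in> L}" by (rule sp_minimal)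
    then show ?thesis unfolding D(1) using W(3) by force
  qed
  moreover have "{act D x w | x w. x \<in> S \<and> w \<in> \<kappa> ` W} \<subseteq> carrier D"
    unfolding D(1) using D(5) Y(2) W(2) by force
  ultimately have "act_span R D S (\<kappa> ` W) = carrier D"
    unfolding act_span_def by (intro hull_unique D.carrier_is_submodule)
  moreover have "\<kappa> ` W \<subseteq> carrier D" unfolding D(1) using W(2) by blast
  ultimately show ?thesis using rep W(1) unfolding smooth_tf_def finite_type_def GL2_on_simps by blast
qed

lemma smooth_rep_sub:
  assumes S: "S \<subseteq> borel_set" "mat 1 \<in> S" "\<And>g h. \<lbrakk>g \<in> S; h \<in> S\<rbrakk> \<Longrightarrow> g ** h \<in> S"
    and Y: "submodule Y R V" "\<And>h y. \<lbrakk>h \<in> S; y \<in> Y\<rbrakk> \<Longrightarrow> act V h y \<in> Y"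
  shows "smooth_rep R (GL2_on S) T (V \<downharpoonright> Y)"
  by (rule smooth_rep_image[OF S Y, of _ "\<lambda>x. x"]) auto

lemma smooth_tf_sub:
  assumes Y: "submodule Y R V" "\<And>h y. \<lbrakk>h \<in> H; y \<in> Y\<rbrakk> \<Longrightarrow> act V h y \<in> Y"
    and W: "finite W" "W \<subseteq> Y" "Y \<subseteq> sp H W"
  shows "smooth_tf R (GL2_on H) T (V \<downharpoonright> Y)"
  by (rule smooth_tf_image[where Y = Y and \<kappa> = "\<lambda>x. x" and W = W])
    (use H_borel H_one H_mult Y W in auto)

lemma finite_type_subD:
  assumes Y: "submodule Y R V" "\<And>h y. \<lbrakk>h \<in> H; y \<in> Y\<rbrakk> \<Longrightarrow> act V h y \<in> Y"
    and ft: "finite_type R (GL2_on H) (V \<downharpoonright> Y)"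
  obtains W where "finite W" "W \<subseteq> Y" "Y = sp H W"
proof -
  obtain W where W: "finite W" "W \<subseteq> Y" "act_span R (V \<downharpoonright> Y) H W = Y"
    using ft unfolding finite_type_def GL2_on_simps by auto
  have "act_span R (V \<downharpoonright> Y) H W = sp H W" by (rule act_span_restrict[OF Y(1)]) (use W(2) Y(2) in blast)
  then show ?thesis using that W by metis
qed

lemma coset_in_iff:
  assumes N: "submodule N R V" and x: "x \<in> carrier V" and y: "y \<in> carrier V"
  shows "y \<in> N +> x \<longleftrightarrow> y \<ominus> x \<in> N"
proof
  assume "y \<in> N +> x"
  then obtain n where "n \<in> N" "y = n \<oplus> x" unfolding a_r_coset_def' by blast
  then show "y \<ominus> x \<in> N" using add_minus_cancel x submodule_subset[OF N] by auto
next
  assume "y \<ominus> x \<in> N"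
  then show "y \<in> N +> x" unfolding a_r_coset_def' using minus_add_cancel[OF y x] by blast
qed

lemma coset_carrier: "\<lbrakk>submodule N R V; x \<in> carrier V\<rbrakk> \<Longrightarrow> N +> x \<subseteq> carrier V"
  unfolding a_r_coset_def' using submodule_subset by blast

lemma coset_eq_iff:
  assumes N: "submodule N R V" and x: "x \<in> carrier V" and y: "y \<in> carrier V"
  shows "N +> x = N +> y \<longleftrightarrow> x \<ominus> y \<in> N"
proof
  assume "N +> x = N +> y"
  moreover have "x \<in> N +> x" unfolding coset_in_iff[OF N x x] using minus_self[OF x] submodule_zero[OF N] by simp
  ultimately show "x \<ominus> y \<in> N" using coset_in_iff[OF N y x] by simp
next
  assume xy: "x \<ominus> y \<in> N"
  then have yx: "y \<ominus> x \<in> N" using diff_swap_in[OF N _ x y] by blast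
  have "z \<in> N +> x \<longleftrightarrow> z \<in> N +> y" if z: "z \<in> carrier V" for z
    unfolding coset_in_iff[OF N x z] coset_in_iff[OF N y z]
    using submoduleE(5)[OF N _ xy, of "z \<ominus> x"] submoduleE(5)[OF N _ yx, of "z \<ominus> y"] diff_trans x y z by auto
  then show "N +> x = N +> y" using coset_carrier[OF N x] coset_carrier[OF N y] by blast
qed

text \<open>Evaluates the operations of \<open>quot_rep\<close> and \<open>D_rep\<close>, which are
  defined on cosets as sets: the image of a coset need not be a coset until N is added.\<close>

lemma set_plus_image_coset:
  assumes N: "submodule N R V" and x: "x \<in> carrier V"
    and X: "X \<subseteq> carrier V" "X \<noteq> {}" "\<And>y. y \<in> X \<Longrightarrow> y \<ominus> x \<in> N"
  shows "N <+>\<^bsub>V\<^esub> X = N +> x"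
proof -
  have "N +> y = N +> x" if "y \<in> X" for y using coset_eq_iff[OF N _ x, of y] X(1,3) that by blast
  moreover have "N <+>\<^bsub>V\<^esub> X = (\<Union>y\<in>X. N +> y)" unfolding set_add_def' a_r_coset_def' by blast
  ultimately show ?thesis using X(2) by auto
qed

lemma act_diff_in:
  assumes "g \<in> borel_set" "x \<in> carrier V" "y \<in> carrier V" "x \<ominus> y \<in> N" "\<And>n. n \<in> N \<Longrightarrow> act V g n \<in> N'"
  shows "act V g x \<ominus> act V g y \<in> N'"
  using assms act_minus by metis

lemma quotient_ops:
  assumes N: "submodule N R V" "N \<subseteq> Y" "\<And>h y. \<lbrakk>h \<in> H; y \<in> N\<rbrakk> \<Longrightarrow> act V h y \<in> N"
    and Y: "submodule Y R V" "\<And>h y. \<lbrakk>h \<in> H; y \<in> Y\<rbrakk> \<Longrightarrow> act V h y \<in> Y"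
  defines "D \<equiv> quot_rep (V \<downharpoonright> Y) N" and "\<kappa> \<equiv> \<lambda>y. N +> y"
  shows "carrier D = \<kappa> ` Y" "\<zero>\<^bsub>D\<^esub> = \<kappa> \<zero>"
    "\<And>x y. \<lbrakk>x \<in> Y; y \<in> Y\<rbrakk> \<Longrightarrow> \<kappa> x \<oplus>\<^bsub>D\<^esub> \<kappa> y = \<kappa> (x \<oplus> y)"
    "\<And>r y. \<lbrakk>r \<in> carrier R; y \<in> Y\<rbrakk> \<Longrightarrow> r \<odot>\<^bsub>D\<^esub> \<kappa> y = \<kappa> (r \<odot> y)"
    "\<And>h y. \<lbrakk>h \<in> H; y \<in> Y\<rbrakk> \<Longrightarrow> act D h (\<kappa> y) = \<kappa> (act V h y)"
proof -
  have Yc: "Y \<subseteq> carrier V" using submodule_subset[OF Y(1)] .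
  have addY: "set_add (V \<downharpoonright> Y) = set_add V" by (simp add: set_add_def set_mult_def fun_eq_iff)
  have cosY: "N +>\<^bsub>V \<downharpoonright> Y\<^esub> y = N +> y" for y by (simp add: a_r_coset_def')
  have mem: "x \<in> \<kappa> y \<longleftrightarrow> x \<in> carrier V \<and> x \<ominus> y \<in> N" if "y \<in> carrier V" for x y
    unfolding \<kappa>_def using coset_in_iff[OF N(1) that, of x] coset_carrier[OF N(1) that] by blast
  have self: "y \<in> \<kappa> y" if "y \<in> carrier V" for y
    using mem[OF that] minus_self[OF that] submodule_zero[OF N(1)] that by simp
  show "carrier D = \<kappa> ` Y" unfolding D_def quot_rep_def \<kappa>_def by (auto simp: A_RCOSETS_def' cosY)
  show "\<zero>\<^bsub>D\<^esub> = \<kappa> \<zero>"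
  proof -
    have "\<kappa> \<zero> = N" using mem[OF M.zero_closed] minus_minus_zero submodule_subset[OF N(1)] by auto
    then show ?thesis unfolding D_def quot_rep_def by simp
  qed
  show "\<kappa> x \<oplus>\<^bsub>D\<^esub> \<kappa> y = \<kappa> (x \<oplus> y)" if xy: "x \<in> Y" "y \<in> Y" for x y
  proof -
    have c: "x \<in> carrier V" "y \<in> carrier V" using xy Yc by auto
    have sub: "set_add V (\<kappa> x) (\<kappa> y) \<subseteq> \<kappa> (x \<oplus> y)"
    proof
      fix z assume "z \<in> set_add V (\<kappa> x) (\<kappa> y)"
      then obtain a b where ab: "a \<in> \<kappa> x" "b \<in> \<kappa> y" "z = a \<oplus> b" unfolding set_add_def' by blast
      then have "(a \<ominus> x) \<oplus> (b \<ominus> y) \<in> N" using mem c submoduleE(5)[OF N(1)] by blast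
      then show "z \<in> \<kappa> (x \<oplus> y)" using ab mem c diff_add by auto
    qed
    have "\<kappa> (x \<oplus> y) \<subseteq> set_add V (\<kappa> x) (\<kappa> y)"
    proof
      fix z assume "z \<in> \<kappa> (x \<oplus> y)"
      then have z: "z \<in> carrier V" "z \<ominus> (x \<oplus> y) \<in> N" using mem c by auto
      let ?a = "z \<ominus> y"
      have "?a \<ominus> x = z \<ominus> (x \<oplus> y)" using z(1) c by (simp add: a_minus_def M.minus_add M.a_ac)
      then have "?a \<in> \<kappa> x" using mem[OF c(1)] z c by simp
      moreover have "z = ?a \<oplus> y" using minus_add_cancel z c by simp
      ultimately show "z \<in> set_add V (\<kappa> x) (\<kappa> y)" unfolding set_add_def' using self[OF c(2)] by blast
    qed
    then show ?thesis using sub unfolding D_def quot_rep_def by (simp add: addY)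
  qed
  show "r \<odot>\<^bsub>D\<^esub> \<kappa> y = \<kappa> (r \<odot> y)" if ry: "r \<in> carrier R" "y \<in> Y" for r y
  proof -
    have c: "y \<in> carrier V" using ry Yc by auto
    have "N <+>\<^bsub>V\<^esub> (\<lambda>x. r \<odot> x) ` \<kappa> y = \<kappa> (r \<odot> y)" unfolding \<kappa>_def
    proof (rule set_plus_image_coset[OF N(1)])
      show "r \<odot> y \<in> carrier V" using ry c by simp
      show "(\<lambda>x. r \<odot> x) ` (N +> y) \<subseteq> carrier V" using ry coset_carrier[OF N(1) c] by auto
      show "(\<lambda>x. r \<odot> x) ` (N +> y) \<noteq> {}" using self[OF c] unfolding \<kappa>_def by blast
      fix z assume "z \<in> (\<lambda>x. r \<odot> x) ` (N +> y)"
      then obtain x where x: "x \<in> carrier V" "x \<ominus> y \<in> N" "z = r \<odot> x" using mem[OF c] unfolding \<kappa>_def by blast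
      then show "z \<ominus> r \<odot> y \<in> N" using smult_diff[OF ry(1) x(1) c] submoduleE(4)[OF N(1) ry(1) x(2)] by simp
    qed
    then show ?thesis unfolding D_def quot_rep_def by (simp add: addY)
  qed
  show "act D h (\<kappa> y) = \<kappa> (act V h y)" if hy: "h \<in> H" "y \<in> Y" for h y
  proof -
    have c: "y \<in> carrier V" "h \<in> borel_set" using hy Yc H_borel by auto
    have "N <+>\<^bsub>V\<^esub> act V h ` \<kappa> y = \<kappa> (act V h y)" unfolding \<kappa>_def
    proof (rule set_plus_image_coset[OF N(1)])
      show "act V h y \<in> carrier V" using c act_in by simp
      show "act V h ` (N +> y) \<subseteq> carrier V" using c act_in coset_carrier[OF N(1) c(1)] by auto
      show "act V h ` (N +> y) \<noteq> {}" using self[OF c(1)] unfolding \<kappa>_def by blast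
      fix z assume "z \<in> act V h ` (N +> y)"
      then obtain x where x: "x \<in> carrier V" "x \<ominus> y \<in> N" "z = act V h x" using mem[OF c(1)] unfolding \<kappa>_def by blast
      then show "z \<ominus> act V h y \<in> N" using act_diff_in[OF c(2) x(1) c(1) x(2) N(3)[OF hy(1)]] by simp
    qed
    then show ?thesis unfolding D_def quot_rep_def by (simp add: addY)
  qed
qed

lemma smooth_tf_quot:
  assumes N: "submodule N R V" "N \<subseteq> Y" "\<And>h y. \<lbrakk>h \<in> H; y \<in> N\<rbrakk> \<Longrightarrow> act V h y \<in> N"
    and Y: "submodule Y R V" "\<And>h y. \<lbrakk>h \<in> H; y \<in> Y\<rbrakk> \<Longrightarrow> act V h y \<in> Y"
    and W: "finite W" "W \<subseteq> Y" "\<And>y. y \<in> Y \<Longrightarrow> \<exists>y'\<in>sp H W. y \<ominus> y' \<in> N"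
  shows "smooth_tf R (GL2_on H) T (quot_rep (V \<downharpoonright> Y) N)"
proof (rule smooth_tf_image[OF _ H_one H_mult Y quotient_ops[OF N Y] W(1,2)])
  show "H \<subseteq> borel_set" using H_borel by blast
  fix y assume y: "y \<in> Y"
  then obtain y' where y': "y' \<in> sp H W" "y \<ominus> y' \<in> N" using W(3) by blast
  have "submodule (sp H W) R V"
    by (rule sp_submodule) (use H_borel W(2) submodule_subset[OF Y(1)] in auto)
  then have "y' \<in> carrier V" using submodule_subset y'(1) by blast
  then show "\<exists>y'\<in>sp H W. N +> y = N +> y'"
    using coset_eq_iff[OF N(1), of y y'] y y' submodule_subset[OF Y(1)] by blast
qed

subsection \<open>Subrepresentations of representations of finite type\<close>

lemma (in cdvr) residues_finite: "\<exists>F. finite F \<and> (\<forall>a\<in>A. \<exists>f\<in>F. a - f \<in> pw k)"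
proof (induction k)
  case 0
  show ?case by (intro exI[of _ "{0}"]) (simp add: pw_0)
next
  case (Suc k)
  then obtain F where F: "finite F" "\<forall>a\<in>A. \<exists>f\<in>F. a - f \<in> pw k" by blast
  obtain G where G: "finite G" "\<forall>a\<in>A. \<exists>f\<in>G. \<exists>b\<in>A. a = f + \<pi> * b" using residue_finite by meson
  have "\<exists>f\<in>(\<lambda>(f, g). f + \<pi> ^ k * g) ` (F \<times> G). a - f \<in> pw (Suc k)" if a: "a \<in> A" for a
  proof -
    obtain f where f: "f \<in> F" "a - f \<in> pw k" using F(2) a by blast
    then obtain c where c: "c \<in> A" "a - f = \<pi> ^ k * c" unfolding pw_def by blast
    obtain g b where g: "g \<in> G" "b \<in> A" "c = g + \<pi> * b" using G(2) c(1) by blast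
    have "a - (f + \<pi> ^ k * g) = \<pi> ^ Suc k * b" using c g by (simp add: algebra_simps)
    then have "a - (f + \<pi> ^ k * g) \<in> pw (Suc k)" using pwI[OF g(2)] by metis
    then show ?thesis using f(1) g(1) by force
  qed
  then show ?case using F(1) G(1) by (intro exI[of _ "(\<lambda>(f, g). f + \<pi> ^ k * g) ` (F \<times> G)"]) auto
qed

text \<open>With the scalar units it generates the centre, and its action plays the role of the
  variable in Hilbert's basis theorem.\<close>

definition (in cdvr) \<zeta> :: "'a^2^2" where "\<zeta> = mat2 \<pi> 0 0 \<pi>"

definition (in cdvr) \<zeta>n :: "nat \<Rightarrow> 'a^2^2" where "\<zeta>n n = mat2 (\<pi> ^ n) 0 0 (\<pi> ^ n)"

lemma (in cdvr) \<zeta>n_H: "\<zeta>n n \<in> H"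
  unfolding H_iff \<zeta>n_def borel_iff using pi_nonzero by (simp add: slope_def shift_def unit_one zero_in)

lemma (in cdvr) \<zeta>_H: "\<zeta> \<in> H"
  using \<zeta>n_H[of 1] by (simp add: \<zeta>_def \<zeta>n_def)

text \<open>This is the compact group B0, the part of H that is integral together with its
  inverse.\<close>

definition (in cdvr) H_A :: "('a^2^2) set" where "H_A = {h \<in> H. unit (h $ 2 $ 2)}"

text \<open>Up to a unit the lower right entry of h is a power of pi with an exponent of either
  sign. It is split over both sides of the equation, because only nonnegative powers belong to the
  polynomial ring.\<close>

lemma (in cdvr) H_decomp:
  assumes h: "h \<in> H" shows "\<exists>j k. \<exists>h0\<in>H_A. \<zeta>n j ** h = \<zeta>n k ** h0"
proof -
  let ?d = "h $ 2 $ 2"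
  have hb: "h $ 2 $ 1 = 0" "h $ 1 $ 1 \<noteq> 0" "?d \<noteq> 0" using h unfolding H_iff borel_iff by auto
  obtain j where j: "\<pi> ^ j * ?d \<in> A" using fraction by blast
  obtain k u v where kuv: "\<pi> ^ j * ?d = \<pi> ^ k * u" "u \<in> A" "v \<in> A" "u * v = 1"
    using decomp[OF j] hb pi_nonzero by auto
  have u: "unit u" unfolding unit_def using kuv inverse_unique[of u v] by auto
  define h0 where "h0 = mat2 (slope h * u) (shift h * u) 0 u"
  have nz: "u \<noteq> 0" using u unfolding unit_def by simp
  have "slope h0 = slope h" "shift h0 = shift h" "h0 \<in> borel_set"
    using nz hb unfolding h0_def slope_def shift_def borel_iff by auto
  then have "h0 \<in> H_A" unfolding H_A_def H_iff using h u unfolding H_iff by (simp add: h0_def)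
  moreover have "\<zeta>n j ** h = \<zeta>n k ** h0"
    unfolding matrix_eq_iff_entries \<zeta>n_def h0_def mult_nth using hb kuv(1)
    by (simp add: slope_def shift_def field_simps)
  ultimately show ?thesis by blast
qed

lemma (in cdvr) H_A_entries: "h \<in> H_A \<Longrightarrow> h $ i $ j \<in> A"
proof -
  assume "h \<in> H_A"
  then have h: "h $ 2 $ 1 = 0" "h $ 2 $ 2 \<noteq> 0" "unit (slope h)" "shift h \<in> A" "unit (h $ 2 $ 2)"
    unfolding H_A_def H_iff borel_iff by auto
  have "h $ 1 $ 1 = slope h * h $ 2 $ 2" "h $ 1 $ 2 = shift h * h $ 2 $ 2" using h by (simp_all add: slope_def shift_def)
  then show ?thesis using h exhaust_2[of i] exhaust_2[of j] by (auto simp: zero_in intro!: mult_in dest: unit_in)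
qed

lemma (in cdvr) H_A_ginv: assumes "h \<in> H_A" shows "ginv h $ i $ j \<in> A"
proof -
  have h: "h \<in> H" "unit (h $ 2 $ 2)" using assms unfolding H_A_def by auto
  have "h $ 1 $ 1 = slope h * h $ 2 $ 2" using h unfolding H_iff borel_iff by (simp add: slope_def)
  then have "unit (h $ 1 $ 1)" using h unit_mult unfolding H_iff by simp
  then have "unit (det h)" using h unit_mult unfolding H_iff borel_iff by (simp add: det_2)
  then show ?thesis
    using ginv_nth[OF borel_GL2[OF H_borel[OF h(1)]]] H_A_entries[OF assms] unit_divide_in uminus_in
      exhaust_2[of i] exhaust_2[of j] by metis
qed

text \<open>By smoothness w is fixed by all elements close to 1 to some precision k, so
  \<open>act V h w\<close> depends only on the entries of h modulo pi^k.\<close>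

lemma finite_H_A_orbit:
  assumes W: "finite W" "W \<subseteq> carrier V"
  shows "finite {act V h w | h w. h \<in> H_A \<and> w \<in> W}"
proof -
  have "finite ((\<lambda>h. act V h w) ` H_A)" if w: "w \<in> carrier V" for w
  proof -
    obtain k where k: "\<And>g. \<lbrakk>g \<in> borel_set; near k (mat 1) g\<rbrakk> \<Longrightarrow> act V g w = w" using act_fixes_near_one[OF w] by blast
    obtain F where F: "finite F" "\<forall>a\<in>A. \<exists>f\<in>F. a - f \<in> pw k" using residues_finite by blast
    then obtain f where f: "\<And>a. a \<in> A \<Longrightarrow> f a \<in> F" "\<And>a. a \<in> A \<Longrightarrow> a - f a \<in> pw k" by metis
    define r where "r h = (f (h $ 1 $ 1), f (h $ 1 $ 2), f (h $ 2 $ 2))" for h :: "'a^2^2"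
    have "r ` H_A \<subseteq> F \<times> F \<times> F" unfolding r_def using f(1) H_A_entries by auto
    then have fin: "finite (r ` H_A)" using F(1) finite_subset by blast
    have eq: "act V h w = act V h' w" if h: "h \<in> H_A" "h' \<in> H_A" "r h = r h'" for h h'
    proof -
      have hb: "h \<in> borel_set" "h' \<in> borel_set" using h unfolding H_A_def H_iff by auto
      have "h $ i $ j - h' $ i $ j \<in> pw k" if "(i, j) \<in> {(1, 1), (1, 2), (2, 2)}" for i j
      proof -
        have "f (h $ i $ j) = f (h' $ i $ j)" using h(3) that unfolding r_def by auto
        then have "(h $ i $ j - f (h $ i $ j)) - (h' $ i $ j - f (h' $ i $ j)) = h $ i $ j - h' $ i $ j" by simp
        then show ?thesis using pw_diff[OF f(2) f(2)] H_A_entries h by metis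
      qed
      moreover have "h $ 2 $ 1 - h' $ 2 $ 1 \<in> pw k" using hb unfolding borel_iff by (simp add: pw_zero)
      ultimately have d: "h $ i $ j - h' $ i $ j \<in> pw k" for i j
        using exhaust_2[of i] exhaust_2[of j] by auto
      have "near k (mat 1) (ginv h' ** h)" unfolding near_def
      proof (intro allI)
        fix i j
        have "ginv h' $ i $ 1 * (h $ 1 $ j - h' $ 1 $ j) + ginv h' $ i $ 2 * (h $ 2 $ j - h' $ 2 $ j) \<in> pw k"
          using d H_A_ginv[OF h(2)] by (intro pw_add pw_mult_A(2))
        moreover have "(mat 1 :: 'a^2^2) $ i $ j = ginv h' $ i $ 1 * h' $ 1 $ j + ginv h' $ i $ 2 * h' $ 2 $ j"
          using ginv_mult(1)[OF borel_GL2[OF hb(2)]] mult_nth[of "ginv h'" h' i j] by simp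
        ultimately show "(ginv h' ** h) $ i $ j - (mat 1 :: 'a^2^2) $ i $ j \<in> pw k"
          unfolding mult_nth by (simp add: algebra_simps)
      qed
      then have "act V (ginv h' ** h) w = w" using k borel_mult borel_ginv hb by blast
      then have "act V h' (act V (ginv h' ** h) w) = act V h' w" by simp
      then show ?thesis using hb w act_comp[of h' "ginv h' ** h" w] borel_mult borel_ginv ginv_cancel(2)[OF borel_GL2[OF hb(2)]] by metis
    qed
    have "(\<lambda>h. act V h w) ` H_A \<subseteq> (\<lambda>c. act V (inv_into H_A r c) w) ` (r ` H_A)"
    proof
      fix x assume "x \<in> (\<lambda>h. act V h w) ` H_A"
      then obtain h where h: "h \<in> H_A" "x = act V h w" by blast
      have "inv_into H_A r (r h) \<in> H_A" "r (inv_into H_A r (r h)) = r h"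
        using h(1) by (auto intro: inv_into_into f_inv_into_f)
      then have "x = act V (inv_into H_A r (r h)) w" using eq h by metis
      then show "x \<in> (\<lambda>c. act V (inv_into H_A r c) w) ` (r ` H_A)" using h(1) by blast
    qed
    then show ?thesis using fin finite_subset by blast
  qed
  then have "finite (\<Union>w\<in>W. (\<lambda>h. act V h w) ` H_A)" using W by blast
  moreover have "(\<Union>w\<in>W. (\<lambda>h. act V h w) ` H_A) = {act V h w | h w. h \<in> H_A \<and> w \<in> W}" by blast
  ultimately show ?thesis by simp
qed

text \<open>The orbit S of W under the compact part of H is finite, so the module Y spanned by the
  powers of pi applied to S is finitely generated over the polynomial ring, and Hilbert's theorem
  applies to the part of N inside Y. Every element of N enters Y after multiplication by a power of
  pi, which is invertible in H.\<close>

lemma sub_finite_type: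
  assumes W: "finite W" "W \<subseteq> carrier V"
    and N: "submodule N R V" "N \<subseteq> sp H W" "\<And>h y. \<lbrakk>h \<in> H; y \<in> N\<rbrakk> \<Longrightarrow> act V h y \<in> N"
  obtains W' where "finite W'" "W' \<subseteq> N" "N = sp H W'"
proof -
  have Hb: "H \<subseteq> borel_set" using H_borel by blast
  define S where "S = {act V h w | h w. h \<in> H_A \<and> w \<in> W}"
  have S: "finite S" "S \<subseteq> carrier V"
    unfolding S_def using finite_H_A_orbit[OF W] act_in W(2) by (auto simp: H_A_def H_iff)
  let ?f = "act V \<zeta>"
  have \<zeta>b: "\<zeta> \<in> borel_set" "\<zeta>n j \<in> borel_set" for j using \<zeta>_H \<zeta>n_H H_borel by auto
  have fk: "(?f ^^ k) v = act V (\<zeta>n k) v" if "v \<in> carrier V" for v k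
  proof (induction k)
    case 0
    have "\<zeta>n 0 = mat 1" unfolding \<zeta>n_def by (simp add: matrix_eq_iff_entries)
    then show ?case using act_id that by simp
  next
    case (Suc k)
    have "\<zeta>n (Suc k) = \<zeta> ** \<zeta>n k" unfolding \<zeta>n_def \<zeta>_def by (simp add: matrix_eq_iff_entries mult_nth)
    then show ?case using Suc act_comp[OF \<zeta>b(1) \<zeta>b(2) that] by simp
  qed
  have \<zeta>n_add: "\<zeta>n i ** \<zeta>n j = \<zeta>n (i + j)" for i j
    unfolding \<zeta>n_def by (simp add: matrix_eq_iff_entries mult_nth power_add)
  define Y where "Y = mspan R V (\<Union>k. (?f ^^ k) ` S)"
  have gen: "(\<Union>k. (?f ^^ k) ` S) \<subseteq> carrier V" using S(2) fk act_in \<zeta>b by (auto simp: subset_iff)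
  have Y: "submodule Y R V" unfolding Y_def using mspan_submodule[OF gen] .
  have Yf: "act V (\<zeta>n j) y \<in> Y" if "y \<in> Y" for y j
  proof -
    have "Y \<subseteq> {v \<in> carrier V. act V (\<zeta>n j) v \<in> Y}" unfolding Y_def
    proof (rule mspan_minimal)
      show "submodule {v \<in> carrier V. act V (\<zeta>n j) v \<in> mspan R V (\<Union>k. (?f ^^ k) ` S)} R V"
        using submodule_act_vimage[OF \<zeta>b(2) Y] unfolding Y_def .
      show "(\<Union>k. (?f ^^ k) ` S) \<subseteq> {v \<in> carrier V. act V (\<zeta>n j) v \<in> mspan R V (\<Union>k. (?f ^^ k) ` S)}"
      proof safe
        fix k s assume s: "s \<in> S"
        then show "(?f ^^ k) s \<in> carrier V" using gen by blast
        have sc: "s \<in> carrier V" using s S by blast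
        have "act V (\<zeta>n j) ((?f ^^ k) s) = (?f ^^ (j + k)) s"
          unfolding fk[OF sc] using act_comp[OF \<zeta>b(2) \<zeta>b(2) sc, of j k] \<zeta>n_add by simp
        then show "act V (\<zeta>n j) ((?f ^^ k) s) \<in> mspan R V (\<Union>k. (?f ^^ k) ` S)"
          using s by (auto intro!: hull_inc)
      qed
    qed
    then show ?thesis using that by blast
  qed
  let ?N = "N \<inter> Y"
  have N': "submodule ?N R V" using submodule_Int[OF N(1) Y] .
  have fN: "?f y \<in> ?N" if "y \<in> ?N" for y
  proof -
    have "\<zeta> = \<zeta>n 1" unfolding \<zeta>_def \<zeta>n_def by simp
    then show ?thesis using that N(3)[OF \<zeta>_H] Yf[of y 1] by auto
  qed
  obtain W' where W': "finite W'" "W' \<subseteq> ?N" "?N \<subseteq> mspan R V (\<Union>k. (?f ^^ k) ` W')"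
    using Hilbert_basis_endomorphism[OF noetherian, of ?f S ?N] act_in[OF \<zeta>b(1)] act_plus[OF \<zeta>b(1)] act_scalar[OF \<zeta>b(1)] S N' fN
    unfolding Y_def by blast
  have W'c: "W' \<subseteq> carrier V" using W'(2) N(1) submodule_subset by blast
  have spW': "submodule (sp H W') R V" using sp_submodule[OF Hb W'c] .
  have sub: "?N \<subseteq> sp H W'"
  proof -
    have "(\<Union>k. (?f ^^ k) ` W') \<subseteq> sp H W'"
      using fk W'c sp_inc[OF \<zeta>n_H] by (auto simp: subset_iff)
    then show ?thesis using mspan_minimal[OF spW'] W'(3) by blast
  qed
  \<comment> \<open>Y need not be stable under the inverse of pi, so Q collects all vectors that
    some power of pi moves into Y.\<close>
  define Q where "Q = {v \<in> carrier V. \<exists>j. act V (\<zeta>n j) v \<in> Y}"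
  have shift: "act V (\<zeta>n (i + j)) v \<in> Y" if "act V (\<zeta>n j) v \<in> Y" "v \<in> carrier V" for i j v
    using Yf[OF that(1), of i] act_comp[OF \<zeta>b(2) \<zeta>b(2) that(2), of i j] \<zeta>n_add by simp
  have Q: "submodule Q R V"
  proof (rule submoduleI')
    show "Q \<subseteq> carrier V" unfolding Q_def by blast
    show "\<zero> \<in> Q" unfolding Q_def using act_zero[OF \<zeta>b(2)] submodule_zero[OF Y] by simp
  next
    fix a b assume "a \<in> Q" "b \<in> Q"
    then obtain i j where ab: "a \<in> carrier V" "b \<in> carrier V" "act V (\<zeta>n i) a \<in> Y" "act V (\<zeta>n j) b \<in> Y" unfolding Q_def by blast
    then have "act V (\<zeta>n (i + j)) b \<in> Y" "act V (\<zeta>n (i + j)) a \<in> Y" using shift[of j b i] shift[of i a j] by (auto simp: add.commute)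
    then have "act V (\<zeta>n (i + j)) (a \<oplus> b) \<in> Y" using act_plus[OF \<zeta>b(2) ab(1,2)] submoduleE(5)[OF Y] by simp
    then show "a \<oplus> b \<in> Q" unfolding Q_def using ab by auto
  next
    fix r a assume "r \<in> carrier R" "a \<in> Q"
    then show "r \<odot> a \<in> Q" unfolding Q_def using act_scalar[OF \<zeta>b(2)] submoduleE(4)[OF Y] by fastforce
  qed
  have "sp H W \<subseteq> Q"
  proof (rule sp_minimal[OF Q])
    fix h w assume hw: "h \<in> H" "w \<in> W"
    then have wc: "w \<in> carrier V" using W by blast
    obtain j k h0 where h0: "h0 \<in> H_A" "\<zeta>n j ** h = \<zeta>n k ** h0" using H_decomp[OF hw(1)] by blast
    have h0b: "h0 \<in> borel_set" using h0(1) unfolding H_A_def H_iff by blast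
    have s: "act V h0 w \<in> S" unfolding S_def using h0(1) hw(2) by blast
    have "act V (\<zeta>n j) (act V h w) = act V (\<zeta>n k) (act V h0 w)"
      using h0(2) act_comp[OF \<zeta>b(2) H_borel[OF hw(1)] wc] act_comp[OF \<zeta>b(2) h0b wc] by metis
    also have "\<dots> = (?f ^^ k) (act V h0 w)" using fk act_in[OF h0b wc] by simp
    also have "\<dots> \<in> Y" unfolding Y_def using s by (auto intro!: hull_inc)
    finally show "act V h w \<in> Q" unfolding Q_def using act_in[OF H_borel[OF hw(1)] wc] by blast
  qed
  have "N \<subseteq> sp H W'"
  proof
    fix y assume y: "y \<in> N"
    then obtain j where j: "y \<in> carrier V" "act V (\<zeta>n j) y \<in> Y" using N(2) \<open>sp H W \<subseteq> Q\<close> unfolding Q_def by blast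
    then have "act V (\<zeta>n j) y \<in> sp H W'" using sub N(3)[OF \<zeta>n_H y] by blast
    then have "act V (ginv (\<zeta>n j)) (act V (\<zeta>n j) y) \<in> sp H W'"
      using sp_act[OF borel_ginv[OF \<zeta>b(2)] Hb Hb W'c] H_mult[OF H_ginv[OF \<zeta>n_H]] by blast
    then show "y \<in> sp H W'" using act_cancel(1)[OF \<zeta>b(2) j(1)] by simp
  qed
  moreover have "sp H W' \<subseteq> N" using sp_minimal[OF N(1)] N(3) W'(2) by blast
  ultimately show ?thesis using that W'(1,2) by blast
qed

end

section \<open>The functors\<close>

locale gen_rep = borel_rep +
  fixes V0 :: "'c set" and S0 :: "'c set"
  assumes V0_sub: "submodule V0 R V" and V0_act: "\<lbrakk>h \<in> H; v \<in> V0\<rbrakk> \<Longrightarrow> act V h v \<in> V0"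
    and S0: "finite S0" "S0 \<subseteq> V0" "V0 = sp H S0"
    and generates: "sp borel_set V0 = carrier V"
begin

section \<open>The submodules V^+, V^- and Delta\<close>

definition Vp where "Vp = sp Bp V0"
definition Vm where "Vm = sp (borel_set - Bp) V0"
definition \<Delta> where "\<Delta> = Vp \<inter> Vm"

lemma V0_carrier: "V0 \<subseteq> carrier V" using submodule_subset[OF V0_sub] .

lemma Bp_sub: "Bp \<subseteq> borel_set" and H_sub: "H \<subseteq> borel_set" using Bp_borel H_borel by blast+

lemma Vp_sub: "submodule Vp R V" unfolding Vp_def using sp_submodule[OF Bp_sub V0_carrier] .
lemma Vm_sub: "submodule Vm R V" unfolding Vm_def by (rule sp_submodule[OF _ V0_carrier]) blast
lemma \<Delta>_sub: "submodule \<Delta> R V" unfolding \<Delta>_def using submodule_Int[OF Vp_sub Vm_sub] .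

lemma Vp_carrier: "v \<in> Vp \<Longrightarrow> v \<in> carrier V" using submodule_subset[OF Vp_sub] by blast
lemma Vm_carrier: "v \<in> Vm \<Longrightarrow> v \<in> carrier V" using submodule_subset[OF Vm_sub] by blast

lemma Vp_act: "\<lbrakk>b \<in> Bp; v \<in> Vp\<rbrakk> \<Longrightarrow> act V b v \<in> Vp"
  unfolding Vp_def by (rule sp_act[OF _ Bp_sub Bp_sub V0_carrier]) (use Bp_borel Bp_mult in auto)

text \<open>Because B^+ is a monoid, the inverse of an element of B^+ maps the complement of B^+
  into itself.\<close>

lemma Vm_act: "\<lbrakk>b \<in> Bp; v \<in> Vm\<rbrakk> \<Longrightarrow> act V (ginv b) v \<in> Vm"
  unfolding Vm_def
proof (rule sp_act[OF borel_ginv[OF Bp_borel] _ _ V0_carrier])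
  fix x assume b: "b \<in> Bp" and x: "x \<in> borel_set - Bp"
  then have "ginv b ** x \<in> borel_set" using borel_mult borel_ginv Bp_borel by blast
  moreover have "ginv b ** x \<notin> Bp"
    using Bp_mult[OF b, of "ginv b ** x"] x ginv_cancel(2)[OF borel_GL2[OF Bp_borel[OF b]]] by auto
  ultimately show "ginv b ** x \<in> borel_set - Bp" by blast
qed auto

lemma Vm_H: "\<lbrakk>h \<in> H; v \<in> Vm\<rbrakk> \<Longrightarrow> act V h v \<in> Vm"
  using Vm_act[OF H_Bp[OF H_ginv]] ginv_ginv[OF borel_GL2[OF H_borel]] by metis

lemma Vp_H: "\<lbrakk>h \<in> H; v \<in> Vp\<rbrakk> \<Longrightarrow> act V h v \<in> Vp"
  using Vp_act H_Bp by blast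

lemma \<Delta>_H: "\<lbrakk>h \<in> H; v \<in> \<Delta>\<rbrakk> \<Longrightarrow> act V h v \<in> \<Delta>"
  unfolding \<Delta>_def using Vp_H Vm_H by blast

lemma V0_Vp: "V0 \<subseteq> Vp"
  unfolding Vp_def by (rule sp_id_subset[OF H_Bp[OF H_one] V0_carrier])

lemma Vp_Vm_sum:
  assumes "v \<in> carrier V" shows "\<exists>a\<in>Vp. \<exists>b\<in>Vm. v = a \<oplus> b"
proof -
  have "sp borel_set V0 \<subseteq> Vp <+>\<^bsub>V\<^esub> Vm"
  proof (rule sp_minimal[OF submodule_add[OF Vp_sub Vm_sub]])
    fix x :: "'a^2^2" and w assume "x \<in> borel_set" "w \<in> V0"
    then have "act V x w \<in> Vp \<or> act V x w \<in> Vm" unfolding Vp_def Vm_def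
      by (cases "x \<in> Bp") (simp_all add: sp_inc)
    then show "act V x w \<in> Vp <+>\<^bsub>V\<^esub> Vm" using subset_add_left[OF Vp_sub Vm_sub] subset_add_right[OF Vp_sub Vm_sub] by blast
  qed
  then show ?thesis using assms unfolding generates set_add_def' by blast
qed

lemma Vp_Vm_diff:
  assumes "v \<in> carrier V" shows "\<exists>a\<in>Vp. v \<ominus> a \<in> Vm"
proof -
  obtain a b where ab: "a \<in> Vp" "b \<in> Vm" "v = a \<oplus> b" using Vp_Vm_sum[OF assms] by blast
  then have "v \<ominus> a = b" using add_minus_cancel[of b a] Vp_carrier Vm_carrier by (simp add: M.a_comm)
  then show ?thesis using ab by blast
qed

lemma act_finsum:
  "\<lbrakk>finite I; g \<in> borel_set; \<And>i. i \<in> I \<Longrightarrow> f i \<in> carrier V\<rbrakk> \<Longrightarrow>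
    act V g (\<Oplus>i\<in>I. f i) = (\<Oplus>i\<in>I. act V g (f i))"
proof (induction I rule: finite_induct)
  case empty
  then show ?case by (simp add: act_zero)
next
  case (insert i I)
  then have "act V g (f i \<oplus> (\<Oplus>i\<in>I. f i)) = act V g (f i) \<oplus> (\<Oplus>i\<in>I. act V g (f i))"
    by (subst act_plus) (auto intro!: M.finsum_closed)
  then show ?case using insert act_in by (simp add: Pi_iff)
qed

lemma finsum_in:
  assumes N: "submodule N R V" shows "\<lbrakk>finite I; \<And>i. i \<in> I \<Longrightarrow> f i \<in> N\<rbrakk> \<Longrightarrow> (\<Oplus>i\<in>I. f i) \<in> N"
proof (induction I rule: finite_induct)
  case empty
  then show ?case using submodule_zero[OF N] by simp
next
  case (insert i I)
  then have "f \<in> I \<rightarrow> carrier V" "f i \<in> carrier V" using submodule_subset[OF N] by auto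
  then show ?case using insert submoduleE(5)[OF N] by simp
qed

subsection \<open>Independence of the generating subrepresentation\<close>

lemma tn_eventually:
  assumes "v \<in> carrier V" shows "\<exists>n0. \<forall>n\<ge>n0. act V (tn n) v \<in> Vp"
proof -
  let ?Q = "{v \<in> carrier V. \<exists>n0. \<forall>n\<ge>n0. act V (tn n) v \<in> Vp}"
  have "submodule ?Q R V"
  proof (rule submoduleI')
    show "\<zero> \<in> ?Q" using act_zero[OF tn_borel] submodule_zero[OF Vp_sub] by simp
  next
    fix a b assume "a \<in> ?Q" "b \<in> ?Q"
    then obtain i j where ab: "a \<in> carrier V" "b \<in> carrier V" "\<forall>n\<ge>i. act V (tn n) a \<in> Vp" "\<forall>n\<ge>j. act V (tn n) b \<in> Vp" by blast
    then have "\<forall>n\<ge>max i j. act V (tn n) (a \<oplus> b) \<in> Vp"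
      using act_plus[OF tn_borel ab(1,2)] submoduleE(5)[OF Vp_sub] by simp
    then show "a \<oplus> b \<in> ?Q" using ab by blast
  next
    fix r a assume r: "r \<in> carrier R" and "a \<in> ?Q"
    then obtain i where a: "a \<in> carrier V" "\<forall>n\<ge>i. act V (tn n) a \<in> Vp" by blast
    then have "\<forall>n\<ge>i. act V (tn n) (r \<odot> a) \<in> Vp"
      using act_scalar[OF tn_borel r a(1)] submoduleE(4)[OF Vp_sub r] by simp
    then show "r \<odot> a \<in> ?Q" using a r by blast
  qed auto
  moreover have "act V g w \<in> ?Q" if g: "g \<in> borel_set" "w \<in> V0" for g w
  proof -
    have wc: "w \<in> carrier V" using g V0_carrier by blast
    obtain n0 where n0: "\<And>n. n \<ge> n0 \<Longrightarrow> tn n ** g \<in> Bp" using tn_absorb[OF g(1)] by blast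
    have "act V (tn n) (act V g w) \<in> Vp" if "n \<ge> n0" for n
      using sp_inc[OF n0[OF that] g(2)] act_comp[OF tn_borel g(1) wc, of n] unfolding Vp_def by simp
    then show ?thesis using act_in[OF g(1) wc] by blast
  qed
  ultimately have "sp borel_set V0 \<subseteq> ?Q" by (rule sp_minimal)
  then show ?thesis using assms unfolding generates by blast
qed

lemma compare_generators:
  assumes "gen_rep A \<pi> R V V1 S1"
  shows "\<exists>W. finite W \<and> W \<subseteq> sp Bp V1 \<and> (\<forall>y\<in>sp Bp V1. \<exists>y'\<in>sp H W. y \<ominus> y' \<in> Vp \<inter> sp Bp V1)"
proof -
  interpret G: gen_rep A \<pi> R V V1 S1 by (rule assms)
  have S1: "finite S1" "S1 \<subseteq> V1" "V1 = sp H S1" using G.S0 by auto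
  have S1c: "S1 \<subseteq> carrier V" using S1(2) G.V0_carrier by blast
  have "\<forall>s\<in>S1. \<exists>n0. \<forall>n\<ge>n0. act V (tn n) s \<in> Vp" using tn_eventually S1c by blast
  then obtain m where m: "\<And>s n. \<lbrakk>s \<in> S1; n \<ge> m s\<rbrakk> \<Longrightarrow> act V (tn n) s \<in> Vp" by metis
  define n0 where "n0 = Max (insert 0 (m ` S1))"
  have n0: "act V (tn n) s \<in> Vp" if "s \<in> S1" "n \<ge> n0" for s n
  proof -
    have "m s \<le> n0" unfolding n0_def using S1(1) that by (intro Max_ge) auto
    then show ?thesis using m that by simp
  qed
  define W where "W = (\<lambda>(n, s). act V (tn n) s) ` ({..<n0} \<times> S1)"
  have inV1: "act V (tn n) s \<in> G.Vp" if "s \<in> S1" for n s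
    using G.Vp_act[OF tn_Bp] G.V0_Vp S1(2) that by blast
  have W: "finite W" "W \<subseteq> G.Vp" unfolding W_def using S1(1) inV1 by auto
  have Wc: "W \<subseteq> carrier V" using W(2) G.Vp_carrier by blast
  let ?I = "Vp \<inter> G.Vp"
  have I: "submodule ?I R V" using submodule_Int[OF Vp_sub G.Vp_sub] .
  have spW: "submodule (sp H W) R V" using sp_submodule[OF H_sub Wc] .
  let ?X = "sp H W <+>\<^bsub>V\<^esub> ?I"
  have X: "submodule ?X R V" using submodule_add[OF spW I] .
  have "sp Bp V1 \<subseteq> ?X"
  proof (rule sp_minimal[OF X])
    fix b v assume b: "b \<in> Bp" and v: "v \<in> V1"
    have "sp H S1 \<subseteq> {v \<in> carrier V. act V b v \<in> ?X}"
    proof (rule sp_minimal[OF submodule_act_vimage[OF Bp_borel[OF b] X]])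
      fix h s assume hs: "h \<in> H" "s \<in> S1"
      have sc: "s \<in> carrier V" using hs S1c by blast
      \<comment> \<open>The product b h is again of the form h' t^n, with the factor h' in front,
        where stability under H absorbs it.\<close>
      have "b ** h \<in> Bp" using Bp_mult[OF b H_Bp[OF hs(1)]] .
      then obtain h' n where h': "h' \<in> H" "b ** h = h' ** tn n" by (rule Bp_HtE)
      have eq: "act V b (act V h s) = act V h' (act V (tn n) s)"
        using h'(2) act_comp[OF Bp_borel[OF b] H_borel[OF hs(1)] sc] act_comp[OF H_borel[OF h'(1)] tn_borel sc] by metis
      have "act V h' (act V (tn n) s) \<in> ?X"
      proof (cases "n < n0")
        case True
        then have "act V (tn n) s \<in> W" unfolding W_def using hs(2) by force
        then show ?thesis using sp_inc[OF h'(1)] subset_add_left[OF spW I] by blast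
      next
        case False
        then have "act V (tn n) s \<in> ?I" using n0[OF hs(2)] inV1[OF hs(2)] by simp
        then have "act V h' (act V (tn n) s) \<in> ?I" using Vp_H[OF h'(1)] G.Vp_H[OF h'(1)] by blast
        then show ?thesis using subset_add_right[OF spW I] by blast
      qed
      then show "act V h s \<in> {v \<in> carrier V. act V b v \<in> ?X}" using eq act_in[OF H_borel[OF hs(1)] sc] by simp
    qed
    then show "act V b v \<in> ?X" using v S1(3) by blast
  qed
  have "\<exists>y'\<in>sp H W. y \<ominus> y' \<in> ?I" if y: "y \<in> sp Bp V1" for y
  proof -
    obtain a b where ab: "a \<in> sp H W" "b \<in> ?I" "y = a \<oplus> b" using \<open>sp Bp V1 \<subseteq> ?X\<close> y unfolding set_add_def' by blast
    then have "a \<in> carrier V" "b \<in> carrier V" using spW submodule_subset Vp_carrier by auto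
    then have "y \<ominus> a = b" using ab add_minus_cancel[of b a] by (simp add: M.a_comm)
    then show ?thesis using ab(1,2) by (intro bexI[of _ a]) simp_all
  qed
  then show ?thesis using W unfolding G.Vp_def by blast
qed

lemma zero_sub_tf: "smooth_tf R (GL2_on H) T (V \<downharpoonright> {\<zero>})"
proof (rule smooth_tf_sub[where W = "{}"])
  show "submodule {\<zero>} R V" by (rule submodule_trivial)
  show "{\<zero>} \<subseteq> sp H {}" using submodule_zero[OF sp_submodule[OF H_sub, of "{}"]] by simp
qed (use act_zero H_borel in auto)

text \<open>The graph of the identity on N, to be read as a morphism of the quotient category from Y
  to Y'.\<close>

lemma prod_diag_subrep:
  assumes "submodule N R V" "\<And>h y. \<lbrakk>h \<in> H; y \<in> N\<rbrakk> \<Longrightarrow> act V h y \<in> N"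
    and Y: "submodule Y R V" "submodule Y' R V" "N \<subseteq> Y" "N \<subseteq> Y'"
  shows "subrep R (GL2_on H) (prod_rep (V \<downharpoonright> Y) (V \<downharpoonright> Y')) (Id_on N)"
proof -
  have Nc: "N \<subseteq> carrier V" using assms(1) submodule_subset by blast
  let ?P = "prod_rep (V \<downharpoonright> Y) (V \<downharpoonright> Y')"
  interpret Y: Module.module R "V \<downharpoonright> Y" using submodule.submodule_is_module[OF Y(1) module_axioms] .
  interpret Y': Module.module R "V \<downharpoonright> Y'" using submodule.submodule_is_module[OF Y(2) module_axioms] .
  have "Module.module R ?P"
  proof (rule moduleI)
    show "abelian_group ?P"
    proof (rule abelian_groupI)
      fix x assume "x \<in> carrier ?P"
      then obtain a b where ab: "a \<in> Y" "b \<in> Y'" "x = (a, b)" unfolding prod_rep_def by auto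
      then show "\<exists>y\<in>carrier ?P. y \<oplus>\<^bsub>?P\<^esub> x = \<zero>\<^bsub>?P\<^esub>"
        using Y.l_neg[of a] Y'.l_neg[of b] Y.a_inv_closed[of a] Y'.a_inv_closed[of b]
        by (intro bexI[of _ "(\<ominus>\<^bsub>V \<downharpoonright> Y\<^esub> a, \<ominus>\<^bsub>V \<downharpoonright> Y'\<^esub> b)"]) (auto simp: prod_rep_def)
    qed (use Y.a_closed Y'.a_closed Y.zero_closed Y'.zero_closed Y.a_assoc Y'.a_assoc Y.a_comm Y'.a_comm Y.l_zero Y'.l_zero
        in \<open>auto simp: prod_rep_def\<close>)
  qed (use Y.smult_closed Y'.smult_closed Y.smult_l_distr Y'.smult_l_distr Y.smult_r_distr Y'.smult_r_distr
      Y.smult_assoc1 Y'.smult_assoc1 Y.smult_one Y'.smult_one R.cring_axioms in \<open>auto simp: prod_rep_def\<close>)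
  then interpret P: Module.module R ?P .
  have "submodule (Id_on N) R ?P"
    by (rule P.submoduleI') (use submodule_zero[OF assms(1)] submoduleE(4,5)[OF assms(1)] Y(3,4) in \<open>auto simp: prod_rep_def Id_on_def\<close>)
  then show ?thesis unfolding subrep_def using assms(2) by (auto simp: prod_rep_def Id_on_def GL2_on_simps)
qed

text \<open>Both Y / N and Y' / N are of finite type, so the graph of the identity on N represents
  an isomorphism as well as its inverse.\<close>

lemma iso_of_common_sub:
  assumes N: "submodule N R V" "\<And>h y. \<lbrakk>h \<in> H; y \<in> N\<rbrakk> \<Longrightarrow> act V h y \<in> N"
    and Y: "submodule Y R V" "\<And>h y. \<lbrakk>h \<in> H; y \<in> Y\<rbrakk> \<Longrightarrow> act V h y \<in> Y" "N \<subseteq> Y"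
      "finite W" "W \<subseteq> Y" "\<And>y. y \<in> Y \<Longrightarrow> \<exists>y'\<in>sp H W. y \<ominus> y' \<in> N"
    and Y': "submodule Y' R V" "\<And>h y. \<lbrakk>h \<in> H; y \<in> Y'\<rbrakk> \<Longrightarrow> act V h y \<in> Y'" "N \<subseteq> Y'"
      "finite W'" "W' \<subseteq> Y'" "\<And>y. y \<in> Y' \<Longrightarrow> \<exists>y'\<in>sp H W'. y \<ominus> y' \<in> N"
  shows "iso_mod_tf R (GL2_on H) T (V \<downharpoonright> Y) (V \<downharpoonright> Y')"
proof -
  have zero: "\<zero> \<in> N" using submodule_zero[OF N(1)] .
  have Hz: "act V h \<zero> = \<zero>" if "h \<in> H" for h using act_zero H_borel that by blast
  have Nc: "N \<subseteq> carrier V" using N submodule_subset by blast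
  have dom: "Domain (Id_on N) = N" by auto
  have im: "N \<inter> {\<zero>} = {\<zero>}" using zero by auto
  have comp: "Id_on N O Id_on N = Id_on N" by auto
  have rep: "smooth_rep R (GL2_on H) T (V \<downharpoonright> Y)" "smooth_rep R (GL2_on H) T (V \<downharpoonright> Y')"
    using smooth_rep_sub[OF H_sub H_one H_mult Y(1,2)] smooth_rep_sub[OF H_sub H_one H_mult Y'(1,2)] by auto
  have q: "smooth_tf R (GL2_on H) T (quot_rep (V \<downharpoonright> Y) N)" "smooth_tf R (GL2_on H) T (quot_rep (V \<downharpoonright> Y') N)"
    using smooth_tf_quot[OF N(1) Y(3) N(2) Y(1,2,4,5,6)] smooth_tf_quot[OF N(1) Y'(3) N(2) Y'(1,2,4,5,6)] by auto
  have m1: "Id_on N \<in> qmor R (GL2_on H) T (V \<downharpoonright> Y) (V \<downharpoonright> Y')"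
    unfolding qmor_def using prod_diag_subrep[OF N Y(1) Y'(1) Y(3) Y'(3)] q zero_sub_tf by (simp add: dom im)
  have m2: "Id_on N \<in> qmor R (GL2_on H) T (V \<downharpoonright> Y') (V \<downharpoonright> Y)"
    unfolding qmor_def using prod_diag_subrep[OF N Y'(1) Y(1) Y'(3) Y(3)] q zero_sub_tf by (simp add: dom im)
  have e: "qmor_eq R (GL2_on H) T (V \<downharpoonright> Z) (V \<downharpoonright> Z) (Id_on N O Id_on N) (Id_on (carrier (V \<downharpoonright> Z)))"
    if Z: "submodule Z R V" "N \<subseteq> Z" "smooth_tf R (GL2_on H) T (quot_rep (V \<downharpoonright> Z) N)" for Z
    unfolding qmor_eq_def comp
  proof (rule exI[of _ N], rule exI[of _ "{\<zero>}"], intro conjI ballI)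
    interpret Z: Module.module R "V \<downharpoonright> Z" using submodule.submodule_is_module[OF Z(1) module_axioms] .
    show "subrep R (GL2_on H) (V \<downharpoonright> Z) N" unfolding subrep_def submodule_restrict[OF Z(1)] using N Z by (auto simp: GL2_on_simps)
    show "subrep R (GL2_on H) (V \<downharpoonright> Z) {\<zero>}" unfolding subrep_def submodule_restrict[OF Z(1)]
      using submodule_trivial zero Z Hz by (auto simp: GL2_on_simps)
    show "N \<subseteq> Domain (Id_on N) \<inter> Domain (Id_on (carrier (V \<downharpoonright> Z)))" using Z by auto
    show "smooth_tf R (GL2_on H) T (quot_rep (V \<downharpoonright> Z) N)" by (rule Z(3))
    show "smooth_tf R (GL2_on H) T (V \<downharpoonright> Z \<downharpoonright> {\<zero>})" using zero_sub_tf by simp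
    fix x y y' assume "x \<in> N" "y \<in> Id_on N `` {x}" "y' \<in> Id_on (carrier (V \<downharpoonright> Z)) `` {x}"
    then have "y = x" "y' = x" "x \<in> carrier (V \<downharpoonright> Z)" using Z(2) by auto
    then show "y \<ominus>\<^bsub>V \<downharpoonright> Z\<^esub> y' \<in> {\<zero>}" using Z.minus_self[of x] by simp
  qed
  show ?thesis unfolding iso_mod_tf_def using rep m1 m2 e[OF Y(1,3) q(1)] e[OF Y'(1,3) q(2)] by blast
qed

lemma Vplus_independent:
  assumes "gen_rep A \<pi> R V V1 S1"
  shows "iso_mod_tf R (GL2_on H) T (V \<downharpoonright> Vp) (V \<downharpoonright> sp Bp V1)"
proof -
  interpret G: gen_rep A \<pi> R V V1 S1 by (rule assms)
  have Vp1: "sp Bp V1 = G.Vp" unfolding G.Vp_def ..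
  obtain W' where W': "finite W'" "W' \<subseteq> G.Vp" "\<And>y. y \<in> G.Vp \<Longrightarrow> \<exists>y'\<in>sp H W'. y \<ominus> y' \<in> Vp \<inter> G.Vp"
    using compare_generators[OF assms] unfolding Vp1 by blast
  obtain W where W: "finite W" "W \<subseteq> Vp" "\<And>y. y \<in> Vp \<Longrightarrow> \<exists>y'\<in>sp H W. y \<ominus> y' \<in> G.Vp \<inter> Vp"
    using G.compare_generators[OF gen_rep_axioms] unfolding Vp_def[symmetric] by blast
  show ?thesis unfolding Vp1
    by (rule iso_of_common_sub[of "Vp \<inter> G.Vp" Vp W G.Vp W'])
      (use submodule_Int[OF Vp_sub G.Vp_sub] Vp_sub G.Vp_sub Vp_H G.Vp_H W W' in \<open>auto simp: Int_commute\<close>)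
qed

subsection \<open>Filtration of \<open>\<langle>B\<^sup>+ V0\<rangle>\<close>\<close>

text \<open>The elements of B^+ whose slope has valuation at most n, that is, the union of the H t^k
  with k \<le> n.\<close>

definition Bl :: "nat \<Rightarrow> ('a^2^2) set" where "Bl n = {b \<in> Bp. \<pi> ^ n / slope b \<in> A}"
definition Vl :: "nat \<Rightarrow> 'c set" where "Vl n = sp (Bl n) V0"

lemma Bl_sub: "Bl n \<subseteq> borel_set" unfolding Bl_def using Bp_borel by blast
lemma Vl_sub: "submodule (Vl n) R V" unfolding Vl_def using sp_submodule[OF Bl_sub V0_carrier] .
lemma Vl_Vp: "Vl n \<subseteq> Vp" unfolding Vl_def Vp_def by (rule sp_mono) (auto simp: Bl_def)

lemma Bl_mono: "Bl n \<subseteq> Bl (Suc n)"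
proof
  fix b assume b: "b \<in> Bl n"
  then have "\<pi> * (\<pi> ^ n / slope b) \<in> A" unfolding Bl_def using mult_in[OF pi_in] by blast
  then show "b \<in> Bl (Suc n)" using b unfolding Bl_def by simp
qed

lemma Vl_mono: "Vl n \<subseteq> Vl (Suc n)" unfolding Vl_def by (rule sp_mono[OF Bl_mono]) simp

lemma Vp_level: assumes "v \<in> Vp" shows "\<exists>n. v \<in> Vl n"
proof -
  have "Vp \<subseteq> (\<Union>n. Vl n)" unfolding Vp_def
  proof (rule sp_minimal)
    show "submodule (\<Union>n. Vl n) R V" by (rule submodule_Union_chain[of Vl, OF Vl_sub Vl_mono])
    fix b w assume b: "b \<in> Bp" "w \<in> V0"
    obtain k where "\<pi> ^ k * inverse (slope b) \<in> A" using fraction by blast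
    then have "b \<in> Bl k" unfolding Bl_def using b by (simp add: divide_inverse)
    then show "act V b w \<in> (\<Union>n. Vl n)" unfolding Vl_def using sp_inc b(2) by blast
  qed
  then show ?thesis using assms by blast
qed

lemma Vl_0: "Vl 0 \<subseteq> V0" unfolding Vl_def
proof (rule sp_minimal[OF V0_sub])
  fix b w assume b: "b \<in> Bl 0" "w \<in> V0"
  then have "b \<in> H" unfolding Bl_def H_iff Bp_iff unit_def using slope_nonzero by (auto simp: inverse_eq_divide)
  then show "act V b w \<in> V0" using V0_act b by blast
qed

text \<open>Elements of H contribute to v0. Any other element of B^+ lies in some
  \<open>ut x\<close> B^+; taking out this factor divides the slope by pi, so the depth falls from n
  + 1 to n.\<close>

lemma Vl_decomp:
  assumes "v \<in> Vl (Suc n)"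
  shows "\<exists>v0\<in>V0. \<exists>e. (\<forall>x\<in>\<tau>s. e x \<in> Vl n) \<and> v = v0 \<oplus> (\<Oplus>x\<in>\<tau>s. act V (ut x) (e x))"
proof -
  let ?Q = "{v0 \<oplus> (\<Oplus>x\<in>\<tau>s. act V (ut x) (e x)) | v0 e. v0 \<in> V0 \<and> (\<forall>x\<in>\<tau>s. e x \<in> Vl n)}"
  have Vlc: "Vl n \<subseteq> carrier V" using Vl_sub submodule_subset by blast
  have ec: "act V (ut x) y \<in> carrier V" if "y \<in> Vl n" for x y using act_in[OF ut_borel] Vlc that by blast
  have sc: "(\<Oplus>x\<in>\<tau>s. act V (ut x) (e x)) \<in> carrier V" if "\<forall>x\<in>\<tau>s. e x \<in> Vl n" for e
    using ec that by (intro M.finsum_closed) auto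
  have zero: "(\<Oplus>x\<in>\<tau>s. act V (ut x) \<zero>) = \<zero>" using act_zero[OF ut_borel] by simp
  have "submodule ?Q R V"
  proof (rule submoduleI')
    show "?Q \<subseteq> carrier V" using sc V0_carrier by auto
    show "\<zero> \<in> ?Q" using zero submodule_zero[OF V0_sub] submodule_zero[OF Vl_sub, of n]
      by (intro CollectI exI[of _ "\<zero>"] exI[of _ "\<lambda>_. \<zero>"]) auto
  next
    fix a b assume "a \<in> ?Q" "b \<in> ?Q"
    then obtain v e w f where v: "v \<in> V0" "\<forall>x\<in>\<tau>s. e x \<in> Vl n" "a = v \<oplus> (\<Oplus>x\<in>\<tau>s. act V (ut x) (e x))"
      and w: "w \<in> V0" "\<forall>x\<in>\<tau>s. f x \<in> Vl n" "b = w \<oplus> (\<Oplus>x\<in>\<tau>s. act V (ut x) (f x))" by blast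
    have "(\<Oplus>x\<in>\<tau>s. act V (ut x) (e x \<oplus> f x)) = (\<Oplus>x\<in>\<tau>s. act V (ut x) (e x) \<oplus> act V (ut x) (f x))"
      using v(2) w(2) Vlc ec by (intro M.finsum_cong') (auto simp: act_plus[OF ut_borel] subset_iff)
    also have "\<dots> = (\<Oplus>x\<in>\<tau>s. act V (ut x) (e x)) \<oplus> (\<Oplus>x\<in>\<tau>s. act V (ut x) (f x))"
      using v(2) w(2) ec by (intro M.finsum_addf) auto
    finally have "a \<oplus> b = (v \<oplus> w) \<oplus> (\<Oplus>x\<in>\<tau>s. act V (ut x) (e x \<oplus> f x))"
      using v w sc[OF v(2)] sc[OF w(2)] V0_carrier by (simp add: M.a_ac subset_iff)
    moreover have "v \<oplus> w \<in> V0" using submoduleE(5)[OF V0_sub] v w by blast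
    moreover have "\<forall>x\<in>\<tau>s. e x \<oplus> f x \<in> Vl n" using submoduleE(5)[OF Vl_sub] v w by blast
    ultimately show "a \<oplus> b \<in> ?Q" by (intro CollectI exI[of _ "v \<oplus> w"] exI[of _ "\<lambda>x. e x \<oplus> f x"]) simp
  next
    fix r a assume r: "r \<in> carrier R" and "a \<in> ?Q"
    then obtain v e where v: "v \<in> V0" "\<forall>x\<in>\<tau>s. e x \<in> Vl n" "a = v \<oplus> (\<Oplus>x\<in>\<tau>s. act V (ut x) (e x))" by blast
    have "(\<Oplus>x\<in>\<tau>s. act V (ut x) (r \<odot> e x)) = (\<Oplus>x\<in>\<tau>s. r \<odot> act V (ut x) (e x))"
      using v(2) Vlc ec r by (intro M.finsum_cong') (auto simp: act_scalar[OF ut_borel] subset_iff)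
    also have "\<dots> = r \<odot> (\<Oplus>x\<in>\<tau>s. act V (ut x) (e x))"
      using v(2) ec r \<tau>s_finite by (intro finsum_smult_ldistr[symmetric]) auto
    finally have "r \<odot> a = (r \<odot> v) \<oplus> (\<Oplus>x\<in>\<tau>s. act V (ut x) (r \<odot> e x))"
      using v sc[OF v(2)] V0_carrier r by (simp add: smult_r_distr subset_iff)
    moreover have "r \<odot> v \<in> V0" using submoduleE(4)[OF V0_sub r] v by blast
    moreover have "\<forall>x\<in>\<tau>s. r \<odot> e x \<in> Vl n" using submoduleE(4)[OF Vl_sub r] v by blast
    ultimately show "r \<odot> a \<in> ?Q" by (intro CollectI exI[of _ "r \<odot> v"] exI[of _ "\<lambda>x. r \<odot> e x"]) simp
  qed
  moreover have "act V b w \<in> ?Q" if b: "b \<in> Bl (Suc n)" "w \<in> V0" for b w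
  proof (cases "b \<in> H")
    case True
    then have "act V b w \<in> V0" using V0_act b by blast
    moreover have "act V b w = act V b w \<oplus> (\<Oplus>x\<in>\<tau>s. act V (ut x) \<zero>)"
      unfolding zero using calculation V0_carrier by auto
    ultimately show ?thesis using submodule_zero[OF Vl_sub, of n]
      by (intro CollectI exI[of _ "act V b w"] exI[of _ "\<lambda>_. \<zero>"]) blast
  next
    case False
    have bp: "b \<in> Bp" "\<pi> ^ Suc n / slope b \<in> A" using b unfolding Bl_def by auto
    have bb: "b \<in> borel_set" using Bp_borel bp by blast
    have wc: "w \<in> carrier V" using b V0_carrier by blast
    obtain x where x: "x \<in> \<tau>s" "ginv (ut x) ** b \<in> Bp" using Bp_split[OF bp(1) False] by blast
    have "ginv (ut x) ** b \<in> Bl n" unfolding Bl_def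
      using x bp ut_inverse_affine[OF bb] by (simp add: mult.commute)
    then have d: "act V (ginv (ut x) ** b) w \<in> Vl n" unfolding Vl_def using sp_inc b by blast
    let ?e = "\<lambda>y. if x = y then act V (ginv (ut x) ** b) w else \<zero>"
    have eV: "\<forall>y\<in>\<tau>s. ?e y \<in> Vl n" using d submodule_zero[OF Vl_sub] by auto
    have "(\<Oplus>y\<in>\<tau>s. act V (ut y) (?e y)) = (\<Oplus>y\<in>\<tau>s. if x = y then act V (ut y) (act V (ginv (ut x) ** b) w) else \<zero>)"
      using ec[OF d] by (intro M.finsum_cong') (auto simp: act_zero[OF ut_borel])
    also have "\<dots> = act V (ut x) (act V (ginv (ut x) ** b) w)"
      using x(1) \<tau>s_finite ec[OF d] by (intro M.finsum_singleton) auto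
    also have "\<dots> = act V b w"
      using act_comp[OF ut_borel ut_inverse_borel[OF bb] wc] ginv_cancel(2)[OF borel_GL2[OF ut_borel]] by metis
    finally have "act V b w = \<zero> \<oplus> (\<Oplus>y\<in>\<tau>s. act V (ut y) (?e y))" using act_in[OF bb wc] by simp
    then show ?thesis using eV submodule_zero[OF V0_sub]
      by (intro CollectI exI[of _ "\<zero>"] exI[of _ ?e]) blast
  qed
  ultimately have "sp (Bl (Suc n)) V0 \<subseteq> ?Q" by (rule sp_minimal)
  then show ?thesis using assms unfolding Vl_def[of "Suc n"] by blast
qed

lemma ut_inverse_Vm: "\<lbrakk>x \<in> \<tau>s; v \<in> Vm\<rbrakk> \<Longrightarrow> act V (ginv (ut x)) v \<in> Vm"
  using Vm_act[OF ut_Bp[OF \<tau>s_in]] by blast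

lemma ut_inverse_V0: assumes "v \<in> V0" shows "act V (ginv (ut x)) v \<in> Vm"
proof -
  have "ginv (ut x) \<in> borel_set - Bp"
    using ut_inverse_H[OF H_one, of x] borel_ginv[OF ut_borel, of x] by simp
  then show ?thesis unfolding Vm_def by (rule sp_inc[OF _ assms])
qed

lemma ut_cross_Vm: assumes "x \<in> \<tau>s" "y \<in> \<tau>s" "x \<noteq> y" "v \<in> Vp"
  shows "act V (ginv (ut y)) (act V (ut x) v) \<in> Vm"
proof -
  have g: "ginv (ut y) ** ut x \<in> borel_set" using borel_mult borel_ginv ut_borel by blast
  have "act V (ginv (ut y) ** ut x) v \<in> sp (borel_set - Bp) V0"
  proof (rule sp_act[OF g Bp_sub _ V0_carrier])
    fix b assume b: "b \<in> Bp"
    then have "ginv (ut y) ** (ut x ** b) \<notin> Bp" using ut_disjoint assms by blast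
    then show "ginv (ut y) ** ut x ** b \<in> borel_set - Bp"
      using borel_mult[OF g Bp_borel[OF b]] by (simp add: matrix_mul_assoc)
  qed (use assms(4) Vp_def in auto)
  then show ?thesis using act_comp[OF borel_ginv[OF ut_borel] ut_borel Vp_carrier[OF assms(4)]] unfolding Vm_def by simp
qed

text \<open>Modulo V^- the coordinate \<open>e y\<close> of a decomposition is thus determined by
  the vector itself. Both the etale property and the analysis of vectors fixed by U0 rest on
  this.\<close>

lemma ut_projection:
  assumes v0: "v0 \<in> V0" and e: "\<And>x. x \<in> \<tau>s \<Longrightarrow> e x \<in> Vp" and y: "y \<in> \<tau>s"
  shows "act V (ginv (ut y)) (v0 \<oplus> (\<Oplus>x\<in>\<tau>s. act V (ut x) (e x))) \<ominus> e y \<in> Vm"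
proof -
  let ?g = "ginv (ut y)"
  have gb: "?g \<in> borel_set" using borel_ginv[OF ut_borel] .
  have ec: "act V (ut x) (e x) \<in> carrier V" if "x \<in> \<tau>s" for x using act_in[OF ut_borel] Vp_carrier e that by blast
  have v0c: "v0 \<in> carrier V" using v0 V0_carrier by blast
  have eyc: "e y \<in> carrier V" using e y Vp_carrier by blast
  let ?f = "\<lambda>x. act V ?g (act V (ut x) (e x))"
  have fc: "?f x \<in> carrier V" if "x \<in> \<tau>s" for x using act_in[OF gb ec[OF that]] .
  have "act V ?g (v0 \<oplus> (\<Oplus>x\<in>\<tau>s. act V (ut x) (e x))) = act V ?g v0 \<oplus> (\<Oplus>x\<in>\<tau>s. ?f x)"
    using act_plus[OF gb v0c] act_finsum[OF \<tau>s_finite gb, of "\<lambda>x. act V (ut x) (e x)"] ec by (simp add: M.finsum_closed Pi_iff)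
  also have "(\<Oplus>x\<in>\<tau>s. ?f x) = ?f y \<oplus> (\<Oplus>x\<in>\<tau>s - {y}. ?f x)"
  proof -
    have "(\<Oplus>x\<in>insert y (\<tau>s - {y}). ?f x) = ?f y \<oplus> (\<Oplus>x\<in>\<tau>s - {y}. ?f x)"
      using \<tau>s_finite fc y by (intro M.finsum_insert) auto
    then show ?thesis using y by (simp add: insert_absorb)
  qed
  also have "?f y = e y" using act_cancel(1)[OF ut_borel eyc] .
  finally have eq: "act V ?g (v0 \<oplus> (\<Oplus>x\<in>\<tau>s. act V (ut x) (e x)))
    = act V ?g v0 \<oplus> (e y \<oplus> (\<Oplus>x\<in>\<tau>s - {y}. ?f x))" .
  let ?s = "\<Oplus>x\<in>\<tau>s - {y}. ?f x"
  have "?f x \<in> Vm" if "x \<in> \<tau>s - {y}" for x using ut_cross_Vm[of x y "e x"] that y e by blast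
  then have s: "?s \<in> Vm" using \<tau>s_finite by (intro finsum_in[OF Vm_sub]) auto
  have gv: "act V ?g v0 \<in> Vm" using ut_inverse_V0[OF v0] .
  have "act V ?g v0 \<oplus> (e y \<oplus> ?s) \<ominus> e y = act V ?g v0 \<oplus> ?s"
  proof -
    have "act V ?g v0 \<oplus> (e y \<oplus> ?s) = (act V ?g v0 \<oplus> ?s) \<oplus> e y"
      using Vm_carrier[OF gv] Vm_carrier[OF s] eyc by (simp add: M.a_ac)
    then show ?thesis using add_minus_cancel[of "act V ?g v0 \<oplus> ?s" "e y"] Vm_carrier[OF gv] Vm_carrier[OF s] eyc by simp
  qed
  then show ?thesis unfolding eq using submoduleE(5)[OF Vm_sub gv s] by simp
qed

end

subsection \<open>Finite presentations\<close>

locale presented_rep = gen_rep +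
  assumes presentation: "finite_presentation R (GL2_on borel_set) T H (V \<downharpoonright> V0)
    (natural_map (GL2_on borel_set) H V) V"
begin

section \<open>The compact induction and its functions supported on one coset\<close>

abbreviation CI where "CI \<equiv> compact_ind (GL2_on borel_set) T H (V \<downharpoonright> V0)"
abbreviation nm where "nm \<equiv> natural_map (GL2_on borel_set) H V"

text \<open>Separated from membership in \<open>CI\<close> so that functions can be cut down coset
  by coset without checking the compactness and smoothness conditions anew.\<close>

definition equivariant :: "('a^2^2 \<Rightarrow> 'c) \<Rightarrow> bool" where
  "equivariant f \<longleftrightarrow> f \<in> borel_set \<rightarrow>\<^sub>E V0 \<and> (\<forall>h\<in>H. \<forall>g\<in>borel_set. f (h ** g) = act V h (f g))"

lemma CI_iff: "f \<in> carrier CI \<longleftrightarrow> equivariant f \<and>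
    (\<exists>C. compactin (subtopology T borel_set) C \<and> {g \<in> borel_set. f g \<noteq> \<zero>} \<subseteq> H <#>\<^bsub>GL2_on borel_set\<^esub> C) \<and>
    (\<exists>K. subgroup K (GL2_on borel_set) \<and> openin (subtopology T borel_set) K \<and>
      (\<forall>g\<in>borel_set. \<forall>k\<in>K. f (g ** k) = f g))"
  unfolding compact_ind_def equivariant_def by (simp add: GL2_on_simps)

lemma CI_ops: "\<zero>\<^bsub>CI\<^esub> = (\<lambda>g\<in>borel_set. \<zero>)" "f \<oplus>\<^bsub>CI\<^esub> f' = (\<lambda>g\<in>borel_set. f g \<oplus> f' g)"
  "r \<odot>\<^bsub>CI\<^esub> f = (\<lambda>g\<in>borel_set. r \<odot> f g)" "act CI x f = (\<lambda>g\<in>borel_set. f (g ** x))"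
  unfolding compact_ind_def by (simp_all add: GL2_on_simps)

lemma V0_in: "v \<in> V0 \<Longrightarrow> v \<in> carrier V" using V0_carrier by blast

lemma equivariantD: assumes "equivariant f"
  shows "g \<in> borel_set \<Longrightarrow> f g \<in> V0" "g \<in> borel_set \<Longrightarrow> f g \<in> carrier V" "g \<notin> borel_set \<Longrightarrow> f g = undefined"
    "\<lbrakk>h \<in> H; g \<in> borel_set\<rbrakk> \<Longrightarrow> f (h ** g) = act V h (f g)"
  using assms V0_in unfolding equivariant_def by (auto simp: PiE_iff extensional_def)

lemma CI_equivariant: "f \<in> carrier CI \<Longrightarrow> equivariant f" unfolding CI_iff by blast

lemma H_b: "h \<in> H \<Longrightarrow> h \<in> borel_set" by (rule H_borel)

lemma CI_add: assumes f: "f \<in> carrier CI" and f': "f' \<in> carrier CI" shows "f \<oplus>\<^bsub>CI\<^esub> f' \<in> carrier CI"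
proof -
  obtain C K where C: "compactin (subtopology T borel_set) C" "{g \<in> borel_set. f g \<noteq> \<zero>} \<subseteq> H <#>\<^bsub>GL2_on borel_set\<^esub> C"
    and K: "subgroup K (GL2_on borel_set)" "openin (subtopology T borel_set) K" "\<forall>g\<in>borel_set. \<forall>k\<in>K. f (g ** k) = f g"
    using f unfolding CI_iff by blast
  obtain C' K' where C': "compactin (subtopology T borel_set) C'" "{g \<in> borel_set. f' g \<noteq> \<zero>} \<subseteq> H <#>\<^bsub>GL2_on borel_set\<^esub> C'"
    and K': "subgroup K' (GL2_on borel_set)" "openin (subtopology T borel_set) K'" "\<forall>g\<in>borel_set. \<forall>k\<in>K'. f' (g ** k) = f' g"
    using f' unfolding CI_iff by blast
  note e = equivariantD[OF CI_equivariant[OF f]] and e' = equivariantD[OF CI_equivariant[OF f']]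
  let ?f = "\<lambda>g\<in>borel_set. f g \<oplus> f' g"
  have "equivariant ?f" unfolding equivariant_def
    using e e' submoduleE(5)[OF V0_sub] borel_mult[OF H_b] act_plus[OF H_b] by auto
  moreover have "compactin (subtopology T borel_set) (C \<union> C')" using C C' by (intro compactin_Un)
  moreover have "{g \<in> borel_set. ?f g \<noteq> \<zero>} \<subseteq> H <#>\<^bsub>GL2_on borel_set\<^esub> (C \<union> C')"
  proof
    fix g :: "'a^2^2" assume "g \<in> {g \<in> borel_set. ?f g \<noteq> \<zero>}"
    then have "g \<in> borel_set" "f g \<noteq> \<zero> \<or> f' g \<noteq> \<zero>" by auto
    then have "g \<in> H <#>\<^bsub>GL2_on borel_set\<^esub> C \<or> g \<in> H <#>\<^bsub>GL2_on borel_set\<^esub> C'" using C(2) C'(2) by blast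
    then show "g \<in> H <#>\<^bsub>GL2_on borel_set\<^esub> (C \<union> C')" unfolding set_mult_def by blast
  qed
  moreover have "subgroup (K \<inter> K') (GL2_on borel_set)" using group.subgroups_Inter_pair[OF group_borel K(1) K'(1)] .
  moreover have "openin (subtopology T borel_set) (K \<inter> K')" using K(2) K'(2) by blast
  moreover have "\<forall>g\<in>borel_set. \<forall>k\<in>K \<inter> K'. ?f (g ** k) = ?f g"
  proof (intro ballI)
    fix g k :: "'a^2^2" assume g: "g \<in> borel_set" and k: "k \<in> K \<inter> K'"
    have "k \<in> borel_set" using k subgroup.subset[OF K(1)] by (auto simp: GL2_on_simps)
    then show "?f (g ** k) = ?f g" using g k K(3) K'(3) borel_mult[OF g] by simp
  qed
  ultimately show ?thesis unfolding CI_iff CI_ops by blast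
qed

lemma CI_smult: assumes r: "r \<in> carrier R" and f: "f \<in> carrier CI" shows "r \<odot>\<^bsub>CI\<^esub> f \<in> carrier CI"
proof -
  obtain C K where C: "compactin (subtopology T borel_set) C" "{g \<in> borel_set. f g \<noteq> \<zero>} \<subseteq> H <#>\<^bsub>GL2_on borel_set\<^esub> C"
    and K: "subgroup K (GL2_on borel_set)" "openin (subtopology T borel_set) K" "\<forall>g\<in>borel_set. \<forall>k\<in>K. f (g ** k) = f g"
    using f unfolding CI_iff by blast
  note e = equivariantD[OF CI_equivariant[OF f]]
  let ?f = "\<lambda>g\<in>borel_set. r \<odot> f g"
  have "equivariant ?f" unfolding equivariant_def
    using e r submoduleE(4)[OF V0_sub] borel_mult[OF H_b] act_scalar[OF H_b r] by auto
  moreover have "{g \<in> borel_set. ?f g \<noteq> \<zero>} \<subseteq> H <#>\<^bsub>GL2_on borel_set\<^esub> C"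
    using C(2) r by force
  moreover have "\<forall>g\<in>borel_set. \<forall>k\<in>K. ?f (g ** k) = ?f g"
  proof (intro ballI)
    fix g k :: "'a^2^2" assume g: "g \<in> borel_set" and k: "k \<in> K"
    have "k \<in> borel_set" using k subgroup.subset[OF K(1)] by (auto simp: GL2_on_simps)
    then show "?f (g ** k) = ?f g" using g k K(3) borel_mult[OF g] by simp
  qed
  ultimately show ?thesis unfolding CI_iff CI_ops using C(1) K(1,2) by blast
qed

text \<open>The function supported on \<open>H b\<inverse>\<close> that corresponds to \<open>b \<otimes> v\<close> in the tensor product
  description of the compact induction.\<close>

definition el :: "'a^2^2 \<Rightarrow> 'c \<Rightarrow> 'a^2^2 \<Rightarrow> 'c" where
  "el b v = (\<lambda>g\<in>borel_set. if g ** b \<in> H then act V (g ** b) v else \<zero>)"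

lemma el_in: assumes b: "b \<in> borel_set" and v: "v \<in> V0" shows "el b v \<in> carrier CI"
proof -
  have vc: "v \<in> carrier V" using V0_in v .
  have Hcancel: "h ** x \<in> H \<longleftrightarrow> x \<in> H" if "h \<in> H" for h x
    using H_mult[OF that] H_mult[OF H_ginv[OF that]] ginv_cancel(1)[OF borel_GL2[OF H_b[OF that]]] by metis
  have eq: "equivariant (el b v)" unfolding equivariant_def
  proof (intro conjI ballI)
    show "el b v \<in> borel_set \<rightarrow>\<^sub>E V0" unfolding el_def using V0_act[OF _ v] submodule_zero[OF V0_sub] by auto
    fix h g :: "'a^2^2" assume h: "h \<in> H" and g: "g \<in> borel_set"
    then show "el b v (h ** g) = act V h (el b v g)" unfolding el_def
      using Hcancel[OF h, of "g ** b"] act_comp[OF H_b[OF h] borel_mult[OF g b] vc] act_zero[OF H_b[OF h]]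
        borel_mult[OF H_b[OF h] g] by (simp add: matrix_mul_assoc)
  qed
  have comp: "compactin (subtopology T borel_set) {ginv b}"
    using borel_ginv[OF b] by (intro finite_imp_compactin) (auto simp: topspace_matrix_topology)
  have supp: "{g \<in> borel_set. el b v g \<noteq> \<zero>} \<subseteq> H <#>\<^bsub>GL2_on borel_set\<^esub> {ginv b}"
  proof
    fix g :: "'a^2^2" assume "g \<in> {g \<in> borel_set. el b v g \<noteq> \<zero>}"
    then have "g ** b \<in> H" unfolding el_def by (auto split: if_splits)
    moreover have "g = g ** b ** ginv b" using ginv_cancel(3)[OF borel_GL2[OF b]] by simp
    ultimately show "g \<in> H <#>\<^bsub>GL2_on borel_set\<^esub> {ginv b}" unfolding set_mult_def by (auto simp: GL2_on_simps)
  qed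
  \<comment> \<open>S is the open subgroup of H that fixes v, and right translation by its conjugate
    b S b^-1 leaves \<open>el b v\<close> unchanged.\<close>
  define S where "S = H \<inter> {h \<in> borel_set. act V h v = v}"
  define K where "K = {k \<in> borel_set. ginv b ** k ** b \<in> S}"
  have S: "openin (subtopology T borel_set) S" unfolding S_def using open_H open_act_eq[OF vc] by blast
  have "openin (subtopology T borel_set) {k \<in> borel_set. ginv b ** k \<in> {x \<in> borel_set. x ** b \<in> S}}"
    by (intro open_translate S b borel_ginv)
  moreover have "{k \<in> borel_set. ginv b ** k \<in> {x \<in> borel_set. x ** b \<in> S}} = K"
    unfolding K_def using borel_mult borel_ginv[OF b] by auto
  ultimately have Ko: "openin (subtopology T borel_set) K" by simp
  have S_mult: "x ** y \<in> S" if "x \<in> S" "y \<in> S" for x y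
    using that H_mult act_comp[OF _ _ vc, of x y] borel_mult unfolding S_def by auto
  have S_inv: "ginv x \<in> S" if "x \<in> S" for x
    using that H_ginv borel_ginv act_cancel(1)[of x v] vc unfolding S_def by auto
  have Ks: "subgroup K (GL2_on borel_set)"
  proof (rule group.subgroupI[OF group_borel])
    show "K \<subseteq> carrier (GL2_on borel_set)" unfolding K_def by (auto simp: GL2_on_simps)
    have "ginv b ** mat 1 ** b = mat 1" using ginv_mult(1)[OF borel_GL2[OF b]] by simp
    then have "mat 1 \<in> K" unfolding K_def S_def using borel_one H_one act_id[OF vc] by simp
    then show "K \<noteq> {}" by blast
  next
    fix k :: "'a^2^2" assume k: "k \<in> K"
    then have kb: "k \<in> borel_set" unfolding K_def by blast
    have "ginv (ginv b ** k ** b) = ginv b ** ginv k ** b"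
      using b kb by (simp add: ginv_prod GL2_mult_closed borel_GL2 borel_ginv ginv_ginv matrix_mul_assoc)
    then show "inv\<^bsub>GL2_on borel_set\<^esub> k \<in> K" using k S_inv[of "ginv b ** k ** b"] inv_borel[OF kb] borel_ginv[OF kb] unfolding K_def by simp
  next
    fix k k' :: "'a^2^2" assume k: "k \<in> K" "k' \<in> K"
    have "ginv b ** (k ** k') ** b = (ginv b ** k ** b) ** (ginv b ** k' ** b)"
      using ginv_cancel(2)[OF borel_GL2[OF b]] by (simp flip: matrix_mul_assoc)
    then have "k ** k' \<in> K" using k S_mult[of "ginv b ** k ** b" "ginv b ** k' ** b"] borel_mult[of k k'] unfolding K_def by auto
    then show "k \<otimes>\<^bsub>GL2_on borel_set\<^esub> k' \<in> K" unfolding GL2_on_simps .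
  qed
  have "\<forall>g\<in>borel_set. \<forall>k\<in>K. el b v (g ** k) = el b v g"
  proof (intro ballI)
    fix g k :: "'a^2^2" assume g: "g \<in> borel_set" and k: "k \<in> K"
    then have kb: "k \<in> borel_set" and s: "ginv b ** k ** b \<in> H" "act V (ginv b ** k ** b) v = v" unfolding K_def S_def by auto
    let ?s = "ginv b ** k ** b"
    have gkb: "g ** k ** b = g ** b ** ?s"
      using ginv_cancel(2)[OF borel_GL2[OF b]] by (simp flip: matrix_mul_assoc)
    have "g ** b ** ?s \<in> H \<longleftrightarrow> g ** b \<in> H"
      using H_mult[OF _ s(1), of "g ** b"] H_mult[OF _ H_ginv[OF s(1)], of "g ** b ** ?s"]
        ginv_cancel(3)[OF borel_GL2[OF H_b[OF s(1)]]] by metis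
    moreover have "act V (g ** b ** ?s) v = act V (g ** b) v"
      using act_comp[OF borel_mult[OF g b] H_b[OF s(1)] vc] s(2) by simp
    ultimately show "el b v (g ** k) = el b v g"
      unfolding el_def using g borel_mult[OF g kb] gkb by simp
  qed
  then show ?thesis unfolding CI_iff using eq comp supp Ks Ko by blast
qed

text \<open>H is open, so finitely many cosets H x cover the compact set that bounds the
  support.\<close>

lemma CI_finite_support:
  assumes f: "f \<in> carrier CI"
  shows "\<exists>X. finite X \<and> X \<subseteq> borel_set \<and> (\<forall>g\<in>borel_set. f g \<noteq> \<zero> \<longrightarrow> (\<exists>x\<in>X. g ** ginv x \<in> H))"
proof -
  obtain C where C: "compactin (subtopology T borel_set) C" "{g \<in> borel_set. f g \<noteq> \<zero>} \<subseteq> H <#>\<^bsub>GL2_on borel_set\<^esub> C"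
    using f unfolding CI_iff by blast
  have Cb: "C \<subseteq> borel_set" using C(1) compactin_subset_topspace by (fastforce simp: topspace_matrix_topology)
  let ?U = "\<lambda>x. {g \<in> borel_set. g ** ginv x \<in> H}"
  have "openin (subtopology T borel_set) U" if "U \<in> ?U ` C" for U
    using that Cb open_translate(2)[OF open_H borel_ginv] by blast
  moreover have "C \<subseteq> \<Union>(?U ` C)"
    using Cb H_one ginv_mult(2) borel_GL2 by force
  ultimately obtain \<F> where F: "finite \<F>" "\<F> \<subseteq> ?U ` C" "C \<subseteq> \<Union>\<F>" using C(1) unfolding compactin_def by meson
  obtain X where X: "X \<subseteq> C" "finite X" "\<F> = ?U ` X" using finite_subset_image[OF F(1,2)] by blast
  have "\<exists>x\<in>X. g ** ginv x \<in> H" if g: "g \<in> borel_set" "f g \<noteq> \<zero>" for g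
  proof -
    obtain h c where hc: "h \<in> H" "c \<in> C" "g = h ** c" using C(2) g unfolding set_mult_def by (auto simp: GL2_on_simps)
    then obtain x where x: "x \<in> X" "c ** ginv x \<in> H" using F(3) X(3) by blast
    then have "h ** (c ** ginv x) \<in> H" using H_mult hc(1) by blast
    then show ?thesis using x(1) hc(3) by (auto simp: matrix_mul_assoc)
  qed
  then show ?thesis using X Cb by blast
qed

text \<open>On the coset H x the function f agrees with \<open>el (ginv x) (f x)\<close>; these
  pieces are split off one coset at a time.\<close>

lemma equivariant_induct:
  assumes X: "finite X" "X \<subseteq> borel_set" and f: "equivariant f"
    and supp: "\<And>g. \<lbrakk>g \<in> borel_set; f g \<noteq> \<zero>\<rbrakk> \<Longrightarrow> \<exists>x\<in>X. g ** ginv x \<in> H"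
    and zero: "P (\<zero>\<^bsub>CI\<^esub>)" and el: "\<And>b v. \<lbrakk>b \<in> borel_set; v \<in> V0\<rbrakk> \<Longrightarrow> P (el b v)"
    and add: "\<And>f f'. \<lbrakk>P f; P f'\<rbrakk> \<Longrightarrow> P (f \<oplus>\<^bsub>CI\<^esub> f')"
  shows "P f"
  using X f supp
proof (induction X arbitrary: f rule: finite_induct)
  case empty
  then have "f = \<zero>\<^bsub>CI\<^esub>" unfolding CI_ops using equivariantD(3)[OF empty.prems(2)] by (auto simp: fun_eq_iff)
  then show ?case using zero by simp
next
  case (insert x X)
  have x: "x \<in> borel_set" using insert.prems by blast
  note e = equivariantD[OF insert.prems(2)]
  define f1 where "f1 = (\<lambda>g\<in>borel_set. if g ** ginv x \<in> H then \<zero> else f g)"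
  have Hcancel: "h ** y \<in> H \<longleftrightarrow> y \<in> H" if "h \<in> H" for h y
    using H_mult[OF that] H_mult[OF H_ginv[OF that]] ginv_cancel(1)[OF borel_GL2[OF H_b[OF that]]] by metis
  have "equivariant f1" unfolding equivariant_def
  proof (intro conjI ballI)
    show "f1 \<in> borel_set \<rightarrow>\<^sub>E V0" unfolding f1_def using e(1) submodule_zero[OF V0_sub] by auto
    fix h g :: "'a^2^2" assume h: "h \<in> H" and g: "g \<in> borel_set"
    then show "f1 (h ** g) = act V h (f1 g)"
      unfolding f1_def using Hcancel[OF h, of "g ** ginv x"] e(4)[OF h g] act_zero[OF H_b[OF h]]
        borel_mult[OF H_b[OF h] g] by (simp add: matrix_mul_assoc)
  qed
  moreover have "\<exists>y\<in>X. g ** ginv y \<in> H" if "g \<in> borel_set" "f1 g \<noteq> \<zero>" for g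
    using insert.prems(3)[OF that(1)] that unfolding f1_def by (auto split: if_splits)
  ultimately have "P f1" using insert.IH insert.prems(1) by blast
  then have "P (f1 \<oplus>\<^bsub>CI\<^esub> el (ginv x) (f x))" using add el[OF borel_ginv[OF x] e(1)[OF x]] by blast
  moreover have "f1 \<oplus>\<^bsub>CI\<^esub> el (ginv x) (f x) = f"
  proof
    fix g show "(f1 \<oplus>\<^bsub>CI\<^esub> el (ginv x) (f x)) g = f g"
    proof (cases "g \<in> borel_set")
      case True
      show ?thesis
      proof (cases "g ** ginv x \<in> H")
        case gx: True
        then have "act V (g ** ginv x) (f x) = f g" using e(4)[OF gx x] ginv_cancel(4)[OF borel_GL2[OF x]] by simp
        then show ?thesis unfolding CI_ops f1_def el_def using True gx e(2)[OF True] by simp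
      next
        case False
        then show ?thesis unfolding CI_ops f1_def el_def using True e(2)[OF True] by simp
      qed
    qed (simp add: CI_ops e(3))
  qed
  ultimately show ?case by simp
qed

lemma nm_hom: "nm \<in> rep_hom R (GL2_on borel_set) CI V"
  using presentation unfolding finite_presentation_def by blast

lemma nm_in: "f \<in> carrier CI \<Longrightarrow> nm f \<in> carrier V"
  and nm_add: "\<lbrakk>f \<in> carrier CI; f' \<in> carrier CI\<rbrakk> \<Longrightarrow> nm (f \<oplus>\<^bsub>CI\<^esub> f') = nm f \<oplus> nm f'"
  and nm_smult: "\<lbrakk>r \<in> carrier R; f \<in> carrier CI\<rbrakk> \<Longrightarrow> nm (r \<odot>\<^bsub>CI\<^esub> f) = r \<odot> nm f"
  and nm_act: "\<lbrakk>h \<in> borel_set; f \<in> carrier CI\<rbrakk> \<Longrightarrow> nm (act CI h f) = act V h (nm f)"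
proof -
  have "nm \<in> carrier CI \<rightarrow> carrier V \<and> (\<forall>x\<in>carrier CI. \<forall>y\<in>carrier CI. nm (x \<oplus>\<^bsub>CI\<^esub> y) = nm x \<oplus> nm y) \<and>
    (\<forall>r\<in>carrier R. \<forall>x\<in>carrier CI. nm (r \<odot>\<^bsub>CI\<^esub> x) = r \<odot> nm x) \<and>
    (\<forall>h\<in>borel_set. \<forall>x\<in>carrier CI. nm (act CI h x) = act V h (nm x))"
    using nm_hom unfolding rep_hom_def mem_Collect_eq GL2_on_simps .
  then show "f \<in> carrier CI \<Longrightarrow> nm f \<in> carrier V"
    and "\<lbrakk>f \<in> carrier CI; f' \<in> carrier CI\<rbrakk> \<Longrightarrow> nm (f \<oplus>\<^bsub>CI\<^esub> f') = nm f \<oplus> nm f'"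
    and "\<lbrakk>r \<in> carrier R; f \<in> carrier CI\<rbrakk> \<Longrightarrow> nm (r \<odot>\<^bsub>CI\<^esub> f) = r \<odot> nm f"
    and "\<lbrakk>h \<in> borel_set; f \<in> carrier CI\<rbrakk> \<Longrightarrow> nm (act CI h f) = act V h (nm f)" by blast+
qed

lemma nm_zero: "nm \<zero>\<^bsub>CI\<^esub> = \<zero>"
proof -
  have e: "{c \<in> rcosets\<^bsub>GL2_on borel_set\<^esub> H. \<exists>x\<in>c. \<zero>\<^bsub>CI\<^esub> x \<noteq> \<zero>} = {}"
  proof -
    have "x \<in> borel_set" if "c \<in> rcosets\<^bsub>GL2_on borel_set\<^esub> H" "x \<in> c" for c x
      using that borel_mult[OF H_b] unfolding RCOSETS_def r_coset_def by (auto simp: GL2_on_simps)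
    then show ?thesis unfolding CI_ops by auto
  qed
  show ?thesis unfolding natural_map_def e by simp
qed

lemma zero_CI: "\<zero>\<^bsub>CI\<^esub> \<in> carrier CI"
proof -
  have "el (mat 1) \<zero> = \<zero>\<^bsub>CI\<^esub>" unfolding el_def CI_ops using act_zero H_b by (auto simp: fun_eq_iff)
  then show ?thesis using el_in[OF borel_one submodule_zero[OF V0_sub]] by simp
qed

text \<open>Only the coset H b^-1 contributes, and by equivariance the chosen representative does
  not matter. For v = 0 no coset contributes, whence the separate case.\<close>

lemma nm_el: assumes b: "b \<in> borel_set" and v: "v \<in> V0" shows "nm (el b v) = act V b v"
proof (cases "v = \<zero>")
  case True
  then have "el b v = \<zero>\<^bsub>CI\<^esub>" unfolding el_def CI_ops using act_zero H_b by (auto simp: fun_eq_iff)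
  then show ?thesis using nm_zero True act_zero[OF b] by simp
next
  case False
  have vc: "v \<in> carrier V" using V0_in v .
  let ?c = "(\<lambda>h. h ** ginv b) ` H"
  have coset: "H #>\<^bsub>GL2_on borel_set\<^esub> g = (\<lambda>h. h ** g) ` H" for g unfolding r_coset_def by (auto simp: GL2_on_simps)
  have elc: "el b v (h ** ginv b) = act V h v" if "h \<in> H" for h
    unfolding el_def using that borel_mult[OF H_b[OF that] borel_ginv[OF b]] ginv_cancel(4)[OF borel_GL2[OF b]] by simp
  have index: "{c \<in> rcosets\<^bsub>GL2_on borel_set\<^esub> H. \<exists>x\<in>c. el b v x \<noteq> \<zero>} = {?c}"
  proof (intro equalityI subsetI)
    fix c assume "c \<in> {c \<in> rcosets\<^bsub>GL2_on borel_set\<^esub> H. \<exists>x\<in>c. el b v x \<noteq> \<zero>}"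
    then obtain g x where g: "g \<in> borel_set" "c = (\<lambda>h. h ** g) ` H" "x \<in> c" "el b v x \<noteq> \<zero>"
      unfolding RCOSETS_def coset by (auto simp: GL2_on_simps)
    then obtain h1 where h1: "h1 \<in> H" "x = h1 ** g" by blast
    have xb: "x \<in> borel_set" using h1 g borel_mult H_b by blast
    have xbH: "x ** b \<in> H" using g(4) xb unfolding el_def by (auto split: if_splits)
    define k where "k = ginv h1 ** (x ** b)"
    have k: "k \<in> H" unfolding k_def using H_mult H_ginv h1 xbH by blast
    have "g = k ** ginv b" unfolding k_def h1(2)
      using ginv_cancel(1)[OF borel_GL2[OF H_b[OF h1(1)]]] ginv_cancel(3)[OF borel_GL2[OF b]] by (simp add: matrix_mul_assoc[symmetric])
    then have "c = (\<lambda>h. (h ** k) ** ginv b) ` H" using g(2) by (simp add: matrix_mul_assoc)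
    also have "\<dots> = (\<lambda>h. h ** ginv b) ` ((\<lambda>h. h ** k) ` H)" by (simp add: image_image)
    also have "(\<lambda>h. h ** k) ` H = H"
    proof (intro equalityI subsetI)
      fix y assume "y \<in> H"
      then have "y = (y ** ginv k) ** k" "y ** ginv k \<in> H"
        using ginv_cancel(4)[OF borel_GL2[OF H_b[OF k]]] H_mult H_ginv k by auto
      then show "y \<in> (\<lambda>h. h ** k) ` H" by blast
    qed (use H_mult k in auto)
    finally show "c \<in> {?c}" by simp
  next
    fix c assume c: "c \<in> {?c}"
    have "?c \<in> rcosets\<^bsub>GL2_on borel_set\<^esub> H" unfolding RCOSETS_def using coset[of "ginv b"] borel_ginv[OF b] by (auto simp: GL2_on_simps)
    moreover have "el b v (mat 1 ** ginv b) \<noteq> \<zero>" using elc[OF H_one] act_id[OF vc] False by simp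
    ultimately show "c \<in> {c \<in> rcosets\<^bsub>GL2_on borel_set\<^esub> H. \<exists>x\<in>c. el b v x \<noteq> \<zero>}" using c H_one by blast
  qed
  define x where "x = (SOME x. x \<in> ?c)"
  have "x \<in> ?c" unfolding x_def by (rule someI[of "\<lambda>x. x \<in> ?c" "mat 1 ** ginv b"]) (use H_one in blast)
  then obtain h where h: "h \<in> H" "x = h ** ginv b" by blast
  have xb: "x \<in> borel_set" using h borel_mult H_b borel_ginv[OF b] by blast
  have "ginv x = b ** ginv h" using h b by (simp add: ginv_prod borel_GL2 H_b borel_ginv ginv_ginv)
  then have "act V (inv\<^bsub>GL2_on borel_set\<^esub> x) (el b v x) = act V (b ** ginv h) (act V h v)"
    using inv_borel[OF xb] elc[OF h(1)] h(2) by simp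
  also have "\<dots> = act V b v"
    using act_comp[OF b borel_ginv[OF H_b[OF h(1)]] act_in[OF H_b[OF h(1)] vc]] act_cancel(1)[OF H_b[OF h(1)] vc] by simp
  finally have val: "act V (inv\<^bsub>GL2_on borel_set\<^esub> x) (el b v x) = act V b v" .
  show ?thesis unfolding natural_map_def index using val act_in[OF b vc] unfolding x_def
    by (simp add: Let_def)
qed

text \<open>The value of \<open>f\<close> at \<open>g\<close> contributes \<open>g\<inverse> (f g)\<close> to the image of \<open>f\<close> in \<open>V\<close>, whence the inverse.\<close>

definition rst :: "('a^2^2) set \<Rightarrow> ('a^2^2 \<Rightarrow> 'c) \<Rightarrow> 'a^2^2 \<Rightarrow> 'c" where
  "rst P f = (\<lambda>g\<in>borel_set. if ginv g \<in> P then f g else \<zero>)"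

text \<open>Unions of cosets b H: for these, truncation respects equivariance and keeps or drops
  each coset as a whole.\<close>

definition right_H :: "('a^2^2) set \<Rightarrow> bool" where
  "right_H P \<longleftrightarrow> P \<subseteq> borel_set \<and> (\<forall>b\<in>borel_set. \<forall>h\<in>H. b ** h \<in> P \<longleftrightarrow> b \<in> P)"

lemma right_H_Bp: "right_H Bp" "right_H (borel_set - Bp)"
  unfolding right_H_def using Bp_sub Bp_H_cancel_right borel_mult[OF _ H_b] by auto

lemma rst_zero: "rst P \<zero>\<^bsub>CI\<^esub> = \<zero>\<^bsub>CI\<^esub>" unfolding rst_def CI_ops by (auto simp: fun_eq_iff)

lemma rst_add: "rst P (f \<oplus>\<^bsub>CI\<^esub> f') = rst P f \<oplus>\<^bsub>CI\<^esub> rst P f'" unfolding rst_def CI_ops by (auto simp: fun_eq_iff)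

lemma rst_smult: "r \<in> carrier R \<Longrightarrow> rst P (r \<odot>\<^bsub>CI\<^esub> f) = r \<odot>\<^bsub>CI\<^esub> rst P f"
  unfolding rst_def CI_ops by (auto simp: fun_eq_iff)

lemma rst_el: assumes P: "right_H P" and b: "b \<in> borel_set" and v: "v \<in> V0"
  shows "rst P (el b v) = (if b \<in> P then el b v else \<zero>\<^bsub>CI\<^esub>)"
proof -
  have "ginv g \<in> P \<longleftrightarrow> b \<in> P" if g: "g \<in> borel_set" "g ** b \<in> H" for g
  proof -
    have "b ** ginv (g ** b) = ginv g"
      using b g ginv_cancel(2)[OF borel_GL2[OF b]] by (simp add: ginv_prod borel_GL2)
    then show ?thesis using P b H_ginv[OF g(2)] unfolding right_H_def by metis
  qed
  then show ?thesis unfolding rst_def el_def CI_ops by (auto simp: fun_eq_iff)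
qed

text \<open>It suffices to truncate the functions \<open>el b v\<close>, each of which is either
  unchanged or replaced by 0.\<close>

lemma rst_CI:
  assumes f: "f \<in> carrier CI" and P: "right_H P"
  shows "rst P f \<in> carrier CI" and "nm (rst P f) \<in> sp P V0"
proof -
  have sub: "submodule (sp P V0) R V" using P sp_submodule[OF _ V0_carrier] unfolding right_H_def by blast
  obtain X where X: "finite X" "X \<subseteq> borel_set" "\<And>g. \<lbrakk>g \<in> borel_set; f g \<noteq> \<zero>\<rbrakk> \<Longrightarrow> \<exists>x\<in>X. g ** ginv x \<in> H"
    using CI_finite_support[OF f] by blast
  have "rst P f \<in> carrier CI \<and> nm (rst P f) \<in> sp P V0"
  proof (rule equivariant_induct[OF X(1,2) CI_equivariant[OF f] X(3)])
    show "rst P \<zero>\<^bsub>CI\<^esub> \<in> carrier CI \<and> nm (rst P \<zero>\<^bsub>CI\<^esub>) \<in> sp P V0"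
      unfolding rst_zero nm_zero using zero_CI submodule_zero[OF sub] by simp
    fix b :: "'a^2^2" and v assume bv: "b \<in> borel_set" "v \<in> V0"
    then show "rst P (el b v) \<in> carrier CI \<and> nm (rst P (el b v)) \<in> sp P V0"
      unfolding rst_el[OF P bv] using zero_CI el_in[OF bv] nm_el[OF bv] nm_zero submodule_zero[OF sub] sp_inc[of b P v V0] by simp
  next
    fix f f' assume "rst P f \<in> carrier CI \<and> nm (rst P f) \<in> sp P V0" "rst P f' \<in> carrier CI \<and> nm (rst P f') \<in> sp P V0"
    then show "rst P (f \<oplus>\<^bsub>CI\<^esub> f') \<in> carrier CI \<and> nm (rst P (f \<oplus>\<^bsub>CI\<^esub> f')) \<in> sp P V0"
      unfolding rst_add using CI_add nm_add submoduleE(5)[OF sub] by simp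
  qed
  then show "rst P f \<in> carrier CI" "nm (rst P f) \<in> sp P V0" by auto
qed

lemma rst_lift:
  assumes P: "right_H P" and v: "v \<in> sp P V0"
  shows "\<exists>f\<in>carrier CI. rst P f = f \<and> nm f = v"
proof -
  let ?Q = "{v. \<exists>f\<in>carrier CI. rst P f = f \<and> nm f = v}"
  have "submodule ?Q R V"
  proof (rule submoduleI')
    show "?Q \<subseteq> carrier V" using nm_in by blast
    show "\<zero> \<in> ?Q" using zero_CI nm_zero rst_zero by blast
  next
    fix a b assume "a \<in> ?Q" "b \<in> ?Q"
    then obtain f f' where "f \<in> carrier CI" "rst P f = f" "nm f = a" "f' \<in> carrier CI" "rst P f' = f'" "nm f' = b" by blast
    then show "a \<oplus> b \<in> ?Q" using CI_add nm_add by (intro CollectI bexI[of _ "f \<oplus>\<^bsub>CI\<^esub> f'"]) (simp_all add: rst_add)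
  next
    fix r a assume r: "r \<in> carrier R" and "a \<in> ?Q"
    then obtain f where "f \<in> carrier CI" "rst P f = f" "nm f = a" by blast
    then show "r \<odot> a \<in> ?Q" using CI_smult[OF r] nm_smult[OF r] by (intro CollectI bexI[of _ "r \<odot>\<^bsub>CI\<^esub> f"]) (simp_all add: rst_smult[OF r])
  qed
  moreover have "act V b w \<in> ?Q" if bw: "b \<in> P" "w \<in> V0" for b :: "'a^2^2" and w
  proof -
    have b: "b \<in> borel_set" using bw(1) P unfolding right_H_def by blast
    then show ?thesis using el_in[OF b bw(2)] nm_el[OF b bw(2)] rst_el[OF P b bw(2)] bw(1) by auto
  qed
  ultimately have "sp P V0 \<subseteq> ?Q" by (rule sp_minimal)
  then show ?thesis using v by blast
qed

lemma rst_split: assumes f: "f \<in> carrier CI" shows "rst Bp f \<oplus>\<^bsub>CI\<^esub> rst (borel_set - Bp) f = f"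
  unfolding rst_def CI_ops
  using equivariantD(2,3)[OF CI_equivariant[OF f]] borel_ginv by (auto simp: fun_eq_iff)

text \<open>The truncations to B^+ and to its complement have opposite images in V, one in V^+ and
  the other in V^-.\<close>

lemma rst_kernel_\<Delta>:
  assumes f: "f \<in> carrier CI" "nm f = \<zero>" shows "nm (rst Bp f) \<in> \<Delta>"
proof -
  note r = rst_CI[OF f(1) right_H_Bp(1)] and r' = rst_CI[OF f(1) right_H_Bp(2)]
  have p: "nm (rst Bp f) \<in> Vp" "nm (rst (borel_set - Bp) f) \<in> Vm" using r r' unfolding Vp_def Vm_def by auto
  have "nm (rst Bp f) \<oplus> nm (rst (borel_set - Bp) f) = \<zero>"
    using rst_split[OF f(1)] nm_add[OF r(1) r'(1)] f(2) by simp
  then have "nm (rst Bp f) = \<ominus> nm (rst (borel_set - Bp) f)"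
    using nm_in[OF r(1)] nm_in[OF r'(1)] by (metis M.minus_equality)
  then have "nm (rst Bp f) \<in> Vm" using submoduleE(3)[OF Vm_sub p(2)] by simp
  then show ?thesis unfolding \<Delta>_def using p by blast
qed

text \<open>The vector v is lifted twice, to a function supported on the side of B^+ and to one on
  the side of the complement; their difference lies in the kernel.\<close>

lemma \<Delta>_from_kernel:
  assumes v: "v \<in> \<Delta>" shows "\<exists>f\<in>carrier CI. nm f = \<zero> \<and> nm (rst Bp f) = v"
proof -
  have v': "v \<in> sp Bp V0" "v \<in> sp (borel_set - Bp) V0" using v unfolding \<Delta>_def Vp_def Vm_def by auto
  obtain f where f: "f \<in> carrier CI" "rst Bp f = f" "nm f = v" using rst_lift[OF right_H_Bp(1) v'(1)] by blast
  obtain f' where f': "f' \<in> carrier CI" "rst (borel_set - Bp) f' = f'" "nm f' = v" using rst_lift[OF right_H_Bp(2) v'(2)] by blast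
  have m1: "\<ominus>\<^bsub>R\<^esub> \<one>\<^bsub>R\<^esub> \<in> carrier R" by simp
  \<comment> \<open>The negative is formed as the multiple by - 1, since the operations of
    \<open>CI\<close> are used directly.\<close>
  define g where "g = (\<ominus>\<^bsub>R\<^esub> \<one>\<^bsub>R\<^esub>) \<odot>\<^bsub>CI\<^esub> f'"
  have g: "g \<in> carrier CI" unfolding g_def using CI_smult[OF m1 f'(1)] .
  have vc: "v \<in> carrier V" using nm_in f by blast
  have nmg: "nm g = \<ominus> v" unfolding g_def using nm_smult[OF m1 f'(1)] f'(3) smult_l_minus[of "\<one>\<^bsub>R\<^esub>" v] vc by simp
  have "rst Bp (rst (borel_set - Bp) f') = \<zero>\<^bsub>CI\<^esub>" unfolding rst_def CI_ops by (auto simp: fun_eq_iff)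
  then have "rst Bp g = (\<ominus>\<^bsub>R\<^esub> \<one>\<^bsub>R\<^esub>) \<odot>\<^bsub>CI\<^esub> \<zero>\<^bsub>CI\<^esub>" unfolding g_def rst_smult[OF m1] using f'(2) by simp
  then have rg: "rst Bp g = \<zero>\<^bsub>CI\<^esub>" unfolding CI_ops using m1 by (auto simp: fun_eq_iff)
  have "nm (f \<oplus>\<^bsub>CI\<^esub> g) = \<zero>" using nm_add[OF f(1) g] f(3) nmg vc by (simp add: M.r_neg)
  moreover have "nm (rst Bp (f \<oplus>\<^bsub>CI\<^esub> g)) = v"
    unfolding rst_add rg f(2) using nm_add[OF f(1) zero_CI] nm_zero f(3) vc by simp
  ultimately show ?thesis using CI_add[OF f(1) g] by blast
qed

text \<open>If \<open>c x\<inverse> \<in> H t\<^sup>n\<close> with \<open>n\<close> large, then \<open>c y\<inverse> \<in> B\<^sup>+\<close> for all \<open>y \<in> X\<close>.\<close>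

lemma splitting_finite:
  assumes X: "finite X" "X \<subseteq> borel_set"
  shows "\<exists>C. finite C \<and> C \<subseteq> borel_set \<and> (\<forall>c\<in>borel_set. (\<exists>x\<in>X. c ** ginv x \<in> Bp) \<and> (\<exists>y\<in>X. c ** ginv y \<notin> Bp) \<longrightarrow>
    (\<exists>h\<in>H. \<exists>c'\<in>C. c = h ** c'))"
proof -
  have "\<forall>x\<in>X. \<forall>y\<in>X. \<exists>n0. \<forall>n\<ge>n0. tn n ** (x ** ginv y) \<in> Bp"
    using tn_absorb borel_mult borel_ginv X(2) by blast
  then obtain m where m: "\<And>x y n. \<lbrakk>x \<in> X; y \<in> X; n \<ge> m x y\<rbrakk> \<Longrightarrow> tn n ** (x ** ginv y) \<in> Bp" by metis
  define n0 where "n0 = Max (insert 0 ((\<lambda>(x, y). m x y) ` (X \<times> X)))"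
  have n0: "m x y \<le> n0" if "x \<in> X" "y \<in> X" for x y
    unfolding n0_def using X(1) that by (intro Max_ge) auto
  define C where "C = (\<lambda>(n, x). tn n ** x) ` ({..<n0} \<times> X)"
  have "\<exists>h\<in>H. \<exists>c'\<in>C. c = h ** c'" if c: "c \<in> borel_set" "x \<in> X" "c ** ginv x \<in> Bp" "y \<in> X" "c ** ginv y \<notin> Bp" for c x y
  proof -
    obtain h n where h: "h \<in> H" "c ** ginv x = h ** tn n" using Bp_HtE[OF c(3)] by blast
    have xb: "x \<in> borel_set" "y \<in> borel_set" using c X by auto
    have ceq: "c = h ** (tn n ** x)" using h(2) ginv_cancel(4)[OF borel_GL2[OF xb(1)], of c] by (simp add: matrix_mul_assoc)
    have "n < n0"
    proof (rule ccontr)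
      assume "\<not> n < n0"
      then have "tn n ** (x ** ginv y) \<in> Bp" using m[OF c(2,4)] n0[OF c(2,4)] by simp
      then have "h ** (tn n ** (x ** ginv y)) \<in> Bp" using Bp_mult[OF H_Bp[OF h(1)]] by blast
      then show False using c(5) ceq by (simp add: matrix_mul_assoc)
    qed
    then have "tn n ** x \<in> C" unfolding C_def using c(2) by force
    then show ?thesis using ceq h(1) by blast
  qed
  moreover have "finite C" "C \<subseteq> borel_set" unfolding C_def using X borel_mult[OF tn_borel] by auto
  ultimately show ?thesis by (intro exI[of _ C]) blast
qed

lemma translate_rst:
  assumes f: "f \<in> carrier CI" "nm f = \<zero>" and fc: "\<And>c. c \<in> borel_set \<Longrightarrow> act CI c f \<in> carrier CI"
  shows "\<exists>W. finite W \<and> W \<subseteq> \<Delta> \<and> (\<forall>c\<in>borel_set. nm (rst Bp (act CI c f)) \<in> sp H W)"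
proof -
  obtain X where X: "finite X" "X \<subseteq> borel_set" "\<And>g. \<lbrakk>g \<in> borel_set; f g \<noteq> \<zero>\<rbrakk> \<Longrightarrow> \<exists>x\<in>X. g ** ginv x \<in> H"
    using CI_finite_support[OF f(1)] by blast
  obtain C where C: "finite C" "C \<subseteq> borel_set" "\<And>c. \<lbrakk>c \<in> borel_set; \<exists>x\<in>X. c ** ginv x \<in> Bp; \<exists>y\<in>X. c ** ginv y \<notin> Bp\<rbrakk> \<Longrightarrow>
    \<exists>h\<in>H. \<exists>c'\<in>C. c = h ** c'" using splitting_finite[OF X(1,2)] by metis
  have nmc: "nm (act CI c f) = \<zero>" if "c \<in> borel_set" for c
    using nm_act[OF that f(1)] f(2) act_zero[OF that] by simp
  define W where "W = (\<lambda>c. nm (rst Bp (act CI c f))) ` C"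
  have W: "finite W" "W \<subseteq> \<Delta>" unfolding W_def using C(1,2) rst_kernel_\<Delta> fc nmc by auto
  have Wc: "W \<subseteq> carrier V" using W(2) \<Delta>_sub submodule_subset by blast
  have spW: "submodule (sp H W) R V" using sp_submodule[OF H_sub Wc] .
  have "nm (rst Bp (act CI c f)) \<in> sp H W" if c: "c \<in> borel_set" for c
  proof -
    \<comment> \<open>A point g in the support of the translate satisfies g^-1 H = c x^-1 H for some
      x in X, so truncation sees only the finitely many elements c x^-1.\<close>
    have key: "\<exists>x\<in>X. (ginv g \<in> Bp) = (c ** ginv x \<in> Bp)" if g: "g \<in> borel_set" "f (g ** c) \<noteq> \<zero>" for g
    proof -
      obtain x where x: "x \<in> X" "g ** c ** ginv x \<in> H" using X(3)[OF borel_mult[OF g(1) c] g(2)] by blast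
      have xb: "x \<in> borel_set" using x X by blast
      have "c ** ginv x = ginv g ** (g ** c ** ginv x)" using ginv_cancel(1)[OF borel_GL2[OF g(1)]] by (simp flip: matrix_mul_assoc)
      then show ?thesis using Bp_H_cancel_right[OF x(2) borel_ginv[OF g(1)]] x(1) by metis
    qed
    consider "\<forall>x\<in>X. c ** ginv x \<in> Bp" | "\<forall>x\<in>X. c ** ginv x \<notin> Bp" | "\<exists>x\<in>X. c ** ginv x \<in> Bp" "\<exists>y\<in>X. c ** ginv y \<notin> Bp" by blast
    then show ?thesis
    proof cases
      case 1
      have "f (g ** c) = \<zero>" if "g \<in> borel_set" "ginv g \<notin> Bp" for g
        using key[OF that(1)] that(2) 1 by blast
      then have "rst Bp (act CI c f) = act CI c f" unfolding rst_def CI_ops by (auto simp: fun_eq_iff)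
      then show ?thesis using nmc[OF c] submodule_zero[OF spW] by simp
    next
      case 2
      have "f (g ** c) = \<zero>" if "g \<in> borel_set" "ginv g \<in> Bp" for g
        using key[OF that(1)] that(2) 2 by blast
      then have "rst Bp (act CI c f) = \<zero>\<^bsub>CI\<^esub>" unfolding rst_def CI_ops by (auto simp: fun_eq_iff)
      then show ?thesis using nm_zero submodule_zero[OF spW] by simp
    next
      case 3
      then obtain h c' where h: "h \<in> H" "c' \<in> C" "c = h ** c'" using C(3)[OF c] by blast
      have c'b: "c' \<in> borel_set" using h C by blast
      \<comment> \<open>B^+ is stable under left multiplication by H, so truncation commutes with
        the action of h, and the truncated translate by c is the one by c' moved by h.\<close>
      have "ginv (g ** h) \<in> Bp \<longleftrightarrow> ginv g \<in> Bp" if "g \<in> borel_set" for g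
        using Bp_H_cancel[OF H_ginv[OF h(1)] borel_ginv[OF that]] that h(1) by (simp add: ginv_prod borel_GL2 H_b)
      then have "rst Bp (act CI c f) = act CI h (rst Bp (act CI c' f))"
        unfolding rst_def CI_ops h(3) using borel_mult H_b[OF h(1)] by (auto simp: fun_eq_iff matrix_mul_assoc)
      then have "nm (rst Bp (act CI c f)) = act V h (nm (rst Bp (act CI c' f)))"
        using nm_act[OF H_b[OF h(1)]] rst_CI(1)[OF fc[OF c'b] right_H_Bp(1)] by simp
      then show ?thesis using sp_inc[OF h(1), of "nm (rst Bp (act CI c' f))" W] h(2) unfolding W_def by simp
    qed
  qed
  then show ?thesis using W by blast
qed

text \<open>The kernel elements whose truncation has its image in the span of W form a submodule. It
  contains all translates of the generators of the kernel, hence the whole kernel.\<close>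

lemma \<Delta>_finite_type: "\<exists>W. finite W \<and> W \<subseteq> \<Delta> \<and> \<Delta> = sp H W"
proof -
  let ?K = "ker_rep CI V nm"
  have tf: "smooth_tf R (GL2_on borel_set) T (CI \<downharpoonright> ?K)"
    using presentation unfolding finite_presentation_def by blast
  then interpret K: smooth_rep R "GL2_on borel_set" T "CI \<downharpoonright> ?K" unfolding smooth_tf_def by blast
  have K_iff: "f \<in> ?K \<longleftrightarrow> f \<in> carrier CI \<and> nm f = \<zero>" for f unfolding ker_rep_def by simp
  obtain S where S: "finite S" "S \<subseteq> ?K" "act_span R (CI \<downharpoonright> ?K) borel_set S = ?K"
    using tf unfolding smooth_tf_def finite_type_def GL2_on_simps by auto
  have cK: "act CI c f \<in> ?K" if "c \<in> borel_set" "f \<in> ?K" for c f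
    using K.act_closed[of c f] that by (simp add: GL2_on_simps)
  have "\<forall>f\<in>S. \<exists>W. finite W \<and> W \<subseteq> \<Delta> \<and> (\<forall>c\<in>borel_set. nm (rst Bp (act CI c f)) \<in> sp H W)"
  proof
    fix f assume "f \<in> S"
    then have f: "f \<in> ?K" using S(2) by blast
    show "\<exists>W. finite W \<and> W \<subseteq> \<Delta> \<and> (\<forall>c\<in>borel_set. nm (rst Bp (act CI c f)) \<in> sp H W)"
      by (rule translate_rst) (use f cK[OF _ f] in \<open>auto simp: ker_rep_def\<close>)
  qed
  then obtain w where w: "\<And>f. f \<in> S \<Longrightarrow> finite (w f) \<and> w f \<subseteq> \<Delta> \<and> (\<forall>c\<in>borel_set. nm (rst Bp (act CI c f)) \<in> sp H (w f))" by metis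
  define W where "W = (\<Union>f\<in>S. w f)"
  have W: "finite W" "W \<subseteq> \<Delta>" unfolding W_def using S(1) w by auto
  have Wc: "W \<subseteq> carrier V" using W(2) \<Delta>_sub submodule_subset by blast
  have spW: "submodule (sp H W) R V" using sp_submodule[OF H_sub Wc] .
  have "submodule {f \<in> ?K. nm (rst Bp f) \<in> sp H W} R (CI \<downharpoonright> ?K)"
  proof (rule K.submoduleI')
    have "\<zero>\<^bsub>CI\<^esub> \<in> ?K" using zero_CI nm_zero K_iff by blast
    then show "\<zero>\<^bsub>CI \<downharpoonright> ?K\<^esub> \<in> {f \<in> ?K. nm (rst Bp f) \<in> sp H W}" using rst_zero nm_zero submodule_zero[OF spW] by simp
  next
    fix a b assume ab: "a \<in> {f \<in> ?K. nm (rst Bp f) \<in> sp H W}" "b \<in> {f \<in> ?K. nm (rst Bp f) \<in> sp H W}"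
    then have c: "a \<in> carrier CI" "b \<in> carrier CI" "nm a = \<zero>" "nm b = \<zero>" unfolding K_iff by auto
    have "a \<oplus>\<^bsub>CI\<^esub> b \<in> ?K" unfolding K_iff using CI_add[OF c(1,2)] nm_add[OF c(1,2)] c(3,4) by simp
    moreover have "nm (rst Bp (a \<oplus>\<^bsub>CI\<^esub> b)) \<in> sp H W"
      unfolding rst_add using nm_add rst_CI(1)[OF _ right_H_Bp(1)] c ab submoduleE(5)[OF spW] by simp
    ultimately show "a \<oplus>\<^bsub>CI \<downharpoonright> ?K\<^esub> b \<in> {f \<in> ?K. nm (rst Bp f) \<in> sp H W}" by simp
  next
    fix r a assume r: "r \<in> carrier R" and a: "a \<in> {f \<in> ?K. nm (rst Bp f) \<in> sp H W}"
    then have c: "a \<in> carrier CI" "nm a = \<zero>" unfolding K_iff by auto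
    have "r \<odot>\<^bsub>CI\<^esub> a \<in> ?K" unfolding K_iff using CI_smult[OF r c(1)] nm_smult[OF r c(1)] c(2) r by simp
    moreover have "nm (rst Bp (r \<odot>\<^bsub>CI\<^esub> a)) \<in> sp H W"
      unfolding rst_smult[OF r] using nm_smult[OF r] rst_CI(1)[OF c(1) right_H_Bp(1)] a submoduleE(4)[OF spW r] by simp
    ultimately show "r \<odot>\<^bsub>CI \<downharpoonright> ?K\<^esub> a \<in> {f \<in> ?K. nm (rst Bp f) \<in> sp H W}" by simp
  qed auto
  moreover have "{act (CI \<downharpoonright> ?K) x w | x w. x \<in> borel_set \<and> w \<in> S} \<subseteq> {f \<in> ?K. nm (rst Bp f) \<in> sp H W}"
  proof safe
    fix c :: "'a^2^2" and f assume c: "c \<in> borel_set" and f: "f \<in> S"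
    show "act (CI \<downharpoonright> ?K) c f \<in> ?K" using cK[OF c] f S(2) by auto
    have "nm (rst Bp (act CI c f)) \<in> sp H (w f)" using w[OF f] c by blast
    moreover have "sp H (w f) \<subseteq> sp H W" unfolding W_def using f by (intro sp_mono) auto
    ultimately show "nm (rst Bp (act (CI \<downharpoonright> ?K) c f)) \<in> sp H W" by auto
  qed
  ultimately have "?K \<subseteq> {f \<in> ?K. nm (rst Bp f) \<in> sp H W}"
    using S(3) unfolding act_span_def by (metis (no_types, lifting) hull_minimal)
  then have "\<Delta> \<subseteq> sp H W" using \<Delta>_from_kernel K_iff by blast
  moreover have "sp H W \<subseteq> \<Delta>" using sp_minimal[OF \<Delta>_sub] \<Delta>_H W(2) by blast
  ultimately show ?thesis using W by blast
qed

end

subsection \<open>The etale property\<close>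

context presented_rep
begin

abbreviation D where "D \<equiv> D_rep R A \<pi> V V0"
abbreviation E where "E \<equiv> etale_target A \<pi> D"
abbreviation em where "em \<equiv> etale_map A \<pi> D"
abbreviation Binv where "Binv \<equiv> Bplus_inv A \<pi>"

text \<open>The class of v in D, defined on all of V and not only on V^+, so that an element of
  (B^+)^-1 may leave V^+ before the class is taken.\<close>

definition \<kappa> :: "'c \<Rightarrow> 'c set" where "\<kappa> v = (Vm +> v) \<inter> Vp"

lemma Binv_eq: "Binv = ginv ` Bp" unfolding Bplus_inv_def ..

lemma Binv_borel: "h \<in> Binv \<Longrightarrow> h \<in> borel_set" unfolding Binv_eq using borel_ginv Bp_borel by blast

lemma H_Binv: "h \<in> H \<Longrightarrow> h \<in> Binv"
  unfolding Binv_eq using H_Bp[OF H_ginv] ginv_ginv[OF borel_GL2[OF H_borel]] by (metis imageI)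

lemma ut_Binv: "x \<in> \<tau>s \<Longrightarrow> ginv (ut x) \<in> Binv"
  unfolding Binv_eq using ut_Bp[OF \<tau>s_in] by blast

lemma Vm_Binv: "\<lbrakk>h \<in> Binv; v \<in> Vm\<rbrakk> \<Longrightarrow> act V h v \<in> Vm"
  unfolding Binv_eq using Vm_act by blast

lemma \<kappa>_in_iff: "v \<in> carrier V \<Longrightarrow> x \<in> \<kappa> v \<longleftrightarrow> x \<in> Vp \<and> x \<ominus> v \<in> Vm"
  unfolding \<kappa>_def using coset_in_iff[OF Vm_sub, of v x] Vp_carrier by auto

text \<open>Intersecting with V^+ loses nothing, because every coset of V^- meets V^+.\<close>

lemma \<kappa>_eq_iff: assumes v: "v \<in> carrier V" and w: "w \<in> carrier V" shows "\<kappa> v = \<kappa> w \<longleftrightarrow> v \<ominus> w \<in> Vm"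
proof
  assume eq: "\<kappa> v = \<kappa> w"
  obtain a where a: "a \<in> Vp" "v \<ominus> a \<in> Vm" using Vp_Vm_diff[OF v] by blast
  note ac = Vp_carrier[OF a(1)]
  have "a \<in> \<kappa> v" using \<kappa>_in_iff[OF v] a diff_swap_in[OF Vm_sub a(2) v ac] by blast
  then have "a \<ominus> w \<in> Vm" using \<kappa>_in_iff[OF w] eq by blast
  then show "v \<ominus> w \<in> Vm" using submoduleE(5)[OF Vm_sub a(2)] diff_trans[OF v ac w] by metis
next
  assume "v \<ominus> w \<in> Vm"
  then show "\<kappa> v = \<kappa> w" unfolding \<kappa>_def using coset_eq_iff[OF Vm_sub v w] by simp
qed

lemma \<kappa>_Vp: "v \<in> carrier V \<Longrightarrow> \<exists>a\<in>Vp. \<kappa> v = \<kappa> a"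
  using Vp_Vm_diff[of v] \<kappa>_eq_iff Vp_carrier by blast

lemma \<kappa>_coset: assumes a: "a \<in> Vp" shows "\<Delta> +> a = \<kappa> a"
proof -
  note ac = Vp_carrier[OF a]
  have "x \<in> \<Delta> +> a \<longleftrightarrow> x \<in> \<kappa> a" for x
  proof (cases "x \<in> carrier V")
    case True
    have "x \<in> Vp" if "x \<ominus> a \<in> Vp" using submodule_diffD[OF Vp_sub that a True] .
    then show ?thesis unfolding \<kappa>_in_iff[OF ac] coset_in_iff[OF \<Delta>_sub ac True]
      using submodule_minus[OF Vp_sub _ a] by (auto simp: \<Delta>_def)
  next
    case False
    then show ?thesis using coset_carrier[OF \<Delta>_sub ac] Vp_carrier \<kappa>_in_iff[OF ac] by blast
  qed
  then show ?thesis by blast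
qed

lemma D_eq: "D = (quot_rep (V \<downharpoonright> Vp) \<Delta>)\<lparr>act := (\<lambda>h X. (Vm <+>\<^bsub>V\<^esub> act V h ` X) \<inter> Vp)\<rparr>"
  unfolding D_rep_def Delta_def Vplus_def Vminus_def Vp_def Vm_def \<Delta>_def ..

lemma D_carrier: "carrier D = \<kappa> ` carrier V" and D_carrier': "carrier D = \<kappa> ` Vp"
  and D_zero: "\<zero>\<^bsub>D\<^esub> = \<kappa> \<zero>"
  and D_add: "\<lbrakk>x \<in> carrier V; y \<in> carrier V\<rbrakk> \<Longrightarrow> \<kappa> x \<oplus>\<^bsub>D\<^esub> \<kappa> y = \<kappa> (x \<oplus> y)"
  and D_smult: "\<lbrakk>r \<in> carrier R; x \<in> carrier V\<rbrakk> \<Longrightarrow> r \<odot>\<^bsub>D\<^esub> \<kappa> x = \<kappa> (r \<odot> x)"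
proof -
  have sub: "\<Delta> \<subseteq> Vp" unfolding \<Delta>_def by blast
  let ?D = "quot_rep (V \<downharpoonright> Vp) \<Delta>"
  note quot = quotient_ops[OF \<Delta>_sub sub \<Delta>_H Vp_sub Vp_H]
  have q1: "carrier ?D = (\<lambda>y. \<Delta> +> y) ` Vp" by (rule quot(1))
  have q2: "\<zero>\<^bsub>?D\<^esub> = \<Delta> +> \<zero>" by (rule quot(2))
  have q3: "(\<Delta> +> a) \<oplus>\<^bsub>?D\<^esub> (\<Delta> +> b) = \<Delta> +> (a \<oplus> b)" if "a \<in> Vp" "b \<in> Vp" for a b
    by (rule quotient_ops(3)[OF \<Delta>_sub sub \<Delta>_H Vp_sub Vp_H that])
  have q4: "r \<odot>\<^bsub>?D\<^esub> (\<Delta> +> a) = \<Delta> +> (r \<odot> a)" if "r \<in> carrier R" "a \<in> Vp" for r a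
    by (rule quotient_ops(4)[OF \<Delta>_sub sub \<Delta>_H Vp_sub Vp_H that])
  have "carrier D = (\<lambda>y. \<Delta> +> y) ` Vp" using q1 unfolding D_eq by simp
  then show c': "carrier D = \<kappa> ` Vp" using \<kappa>_coset by (metis (no_types, lifting) image_cong)
  show "carrier D = \<kappa> ` carrier V" unfolding c' using \<kappa>_Vp Vp_carrier by blast
  show "\<zero>\<^bsub>D\<^esub> = \<kappa> \<zero>" using q2 \<kappa>_coset[OF submodule_zero[OF Vp_sub]] unfolding D_eq by simp
  show "\<kappa> x \<oplus>\<^bsub>D\<^esub> \<kappa> y = \<kappa> (x \<oplus> y)" if xy: "x \<in> carrier V" "y \<in> carrier V"
  proof -
    obtain a b where ab: "a \<in> Vp" "\<kappa> x = \<kappa> a" "b \<in> Vp" "\<kappa> y = \<kappa> b"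
      using \<kappa>_Vp[OF xy(1)] \<kappa>_Vp[OF xy(2)] by metis
    note c = Vp_carrier[OF ab(1)] Vp_carrier[OF ab(3)]
    have ab': "a \<oplus> b \<in> Vp" using submoduleE(5)[OF Vp_sub] ab by blast
    have "\<kappa> x \<oplus>\<^bsub>D\<^esub> \<kappa> y = \<kappa> (a \<oplus> b)"
      using q3[OF ab(1,3)] unfolding D_eq ab(2,4) by (simp add: \<kappa>_coset ab ab')
    moreover have "(x \<oplus> y) \<ominus> (a \<oplus> b) \<in> Vm"
      unfolding diff_add[OF xy(1) c(1) xy(2) c(2)]
      using submoduleE(5)[OF Vm_sub] \<kappa>_eq_iff[OF xy(1) c(1)] \<kappa>_eq_iff[OF xy(2) c(2)] ab(2,4) by blast
    ultimately show ?thesis using \<kappa>_eq_iff[of "x \<oplus> y" "a \<oplus> b"] xy c by simp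
  qed
  show "r \<odot>\<^bsub>D\<^esub> \<kappa> x = \<kappa> (r \<odot> x)" if rx: "r \<in> carrier R" "x \<in> carrier V"
  proof -
    obtain a where a: "a \<in> Vp" "\<kappa> x = \<kappa> a" using \<kappa>_Vp[OF rx(2)] by metis
    note c = Vp_carrier[OF a(1)]
    have ra: "r \<odot> a \<in> Vp" using submoduleE(4)[OF Vp_sub] a rx by blast
    have "r \<odot>\<^bsub>D\<^esub> \<kappa> x = \<kappa> (r \<odot> a)"
      using q4[OF rx(1) a(1)] unfolding D_eq a(2) by (simp add: \<kappa>_coset a ra)
    moreover have "x \<ominus> a \<in> Vm" using \<kappa>_eq_iff rx c a(2) by blast
    then have "(r \<odot> x) \<ominus> (r \<odot> a) \<in> Vm"
      using submoduleE(4)[OF Vm_sub rx(1)] smult_diff[OF rx(1,2) c] by metis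
    ultimately show ?thesis using \<kappa>_eq_iff[of "r \<odot> x" "r \<odot> a"] rx c by simp
  qed
qed

text \<open>Only the stability of V^- under (B^+)^-1 enters: it lets h act on cosets of V^- even
  where h leaves V^+.\<close>

lemma D_act: assumes h: "h \<in> Binv" and y: "y \<in> carrier V" shows "act D h (\<kappa> y) = \<kappa> (act V h y)"
proof -
  have hb: "h \<in> borel_set" using Binv_borel h .
  have mem: "z \<in> carrier V" "z \<ominus> y \<in> Vm" if "z \<in> \<kappa> y" for z using that \<kappa>_in_iff[OF y] Vp_carrier by auto
  obtain a where "a \<in> Vp" "\<kappa> y = \<kappa> a" using \<kappa>_Vp[OF y] by blast
  then have ne: "\<kappa> y \<noteq> {}" using \<kappa>_in_iff[of a a] Vp_carrier minus_self[of a] submodule_zero[OF Vm_sub] by auto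
  have "Vm <+>\<^bsub>V\<^esub> act V h ` \<kappa> y = Vm +> act V h y"
  proof (rule set_plus_image_coset[OF Vm_sub act_in[OF hb y]])
    show "act V h ` \<kappa> y \<subseteq> carrier V" using mem act_in[OF hb] by blast
    fix z assume "z \<in> act V h ` \<kappa> y"
    then obtain z' where z': "z' \<in> \<kappa> y" "z = act V h z'" by blast
    then show "z \<ominus> act V h y \<in> Vm" using act_diff_in[OF hb mem(1)[OF z'(1)] y mem(2)[OF z'(1)] Vm_Binv[OF h]] by simp
  qed (use ne in blast)
  then show ?thesis unfolding D_eq \<kappa>_def[of "act V h y"] by simp
qed

text \<open>D is presented as the image of the whole of V, which is stable under (B^+)^-1, whereas
  V^+ need not be.\<close>

lemma D_smooth: "smooth_rep R (GL2_on Binv) T D"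
proof (rule smooth_rep_image[of Binv "carrier V" _ \<kappa>, OF _ _ _ carrier_is_submodule _ D_carrier D_zero D_add D_smult D_act])
  show "Binv \<subseteq> borel_set" using Binv_borel by blast
  show "mat 1 \<in> Binv" using H_Binv H_one by blast
  fix g h assume "g \<in> Binv" "h \<in> Binv"
  then obtain a b where ab: "a \<in> Bp" "b \<in> Bp" "g = ginv a" "h = ginv b" unfolding Binv_eq by blast
  then have "g ** h = ginv (b ** a)" using ginv_prod borel_GL2 Bp_borel by metis
  then show "g ** h \<in> Binv" unfolding Binv_eq using Bp_mult ab by blast
qed (use act_in Binv_borel in auto)

lemma em_apply: assumes v: "v \<in> carrier V"
  shows "em (\<kappa> v) = (\<lambda>u\<in>Uq A \<pi>. \<kappa> (act V (ginv (u ** tmat \<pi>)) v))"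
proof -
  have "act D (ginv (u ** tmat \<pi>)) (\<kappa> v) = \<kappa> (act V (ginv (u ** tmat \<pi>)) v)" if "u \<in> Uq A \<pi>" for u
  proof -
    obtain x where "x \<in> \<tau>s" "u = mat2 1 x 0 1" using \<open>u \<in> Uq A \<pi>\<close> unfolding Uq_iff by blast
    then show ?thesis using D_act[OF ut_Binv v] by (simp add: u_tmat)
  qed
  then show ?thesis unfolding etale_map_def by (auto simp: fun_eq_iff)
qed

lemma E_ops: "carrier E = Uq A \<pi> \<rightarrow>\<^sub>E carrier D" "\<zero>\<^bsub>E\<^esub> = (\<lambda>u\<in>Uq A \<pi>. \<zero>\<^bsub>D\<^esub>)"
  "x \<oplus>\<^bsub>E\<^esub> y = (\<lambda>u\<in>Uq A \<pi>. x u \<oplus>\<^bsub>D\<^esub> y u)" "r \<odot>\<^bsub>E\<^esub> x = (\<lambda>u\<in>Uq A \<pi>. r \<odot>\<^bsub>D\<^esub> x u)"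
  "act E b x = (\<lambda>u\<in>Uq A \<pi>. let u' = etale_index A \<pi> b u in
       act D (inv\<^bsub>GL2\<^esub> (u \<otimes>\<^bsub>GL2\<^esub> tmat \<pi>) \<otimes>\<^bsub>GL2\<^esub> b \<otimes>\<^bsub>GL2\<^esub> u' \<otimes>\<^bsub>GL2\<^esub> tmat \<pi>) (x u'))"
  unfolding etale_target_def by simp_all

lemma u_borel: "u \<in> Uq A \<pi> \<Longrightarrow> u ** tmat \<pi> \<in> borel_set" unfolding Uq_iff using ut_borel u_tmat by auto

lemma E_add: assumes v: "v \<in> carrier V" and w: "w \<in> carrier V"
  shows "em (\<kappa> v) \<oplus>\<^bsub>E\<^esub> em (\<kappa> w) = em (\<kappa> (v \<oplus> w))"
proof -
  have "em (\<kappa> v) u \<oplus>\<^bsub>D\<^esub> em (\<kappa> w) u = \<kappa> (act V (ginv (u ** tmat \<pi>)) (v \<oplus> w))" if u: "u \<in> Uq A \<pi>" for u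
    using em_apply[OF v] em_apply[OF w] u act_plus[OF borel_ginv[OF u_borel[OF u]] v w]
      D_add[OF act_in[OF borel_ginv[OF u_borel[OF u]] v] act_in[OF borel_ginv[OF u_borel[OF u]] w]] by simp
  then show ?thesis unfolding E_ops em_apply[OF M.add.m_closed[OF v w]] by (rule restrict_ext)
qed

lemma E_smult: assumes r: "r \<in> carrier R" and v: "v \<in> carrier V"
  shows "r \<odot>\<^bsub>E\<^esub> em (\<kappa> v) = em (\<kappa> (r \<odot> v))"
proof -
  have "r \<odot>\<^bsub>D\<^esub> em (\<kappa> v) u = \<kappa> (act V (ginv (u ** tmat \<pi>)) (r \<odot> v))" if u: "u \<in> Uq A \<pi>" for u
    using em_apply[OF v] u act_scalar[OF borel_ginv[OF u_borel[OF u]] r v]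
      D_smult[OF r act_in[OF borel_ginv[OF u_borel[OF u]] v]] by simp
  then show ?thesis unfolding E_ops em_apply[OF smult_closed[OF r v]] by (rule restrict_ext)
qed

lemma ut_inverse_act:
  assumes h: "h \<in> H" and v: "v \<in> carrier V" and c: "ginv (ut x) ** (h ** ut y) \<in> H"
  shows "act V (ginv (ut x)) (act V h v) = act V (ginv (ut x) ** (h ** ut y)) (act V (ginv (ut y)) v)"
proof -
  have "ginv (ut x) ** (h ** ut y) ** ginv (ut y) = ginv (ut x) ** h"
    using ginv_cancel(3)[OF borel_GL2[OF ut_borel], of "ginv (ut x) ** h" y] by (simp add: matrix_mul_assoc)
  then show ?thesis
    using act_comp[OF H_borel[OF c] borel_ginv[OF ut_borel] v, of y] act_comp[OF borel_ginv[OF ut_borel] H_borel[OF h] v, of x] by simp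
qed

text \<open>If y is the index that belongs to x, then (ut x)^-1 h = c (ut y)^-1 with c in H, and c
  is the element that occurs in the action on the target.\<close>

lemma E_act: assumes h: "h \<in> H" and v: "v \<in> carrier V"
  shows "act E h (em (\<kappa> v)) = em (\<kappa> (act V h v))"
proof -
  have hv: "act V h v \<in> carrier V" using act_in[OF H_borel[OF h] v] .
  have "act E h (em (\<kappa> v)) u = em (\<kappa> (act V h v)) u" if u: "u \<in> Uq A \<pi>" for u
  proof -
    obtain x where x: "x \<in> \<tau>s" "u = mat2 1 x 0 1" using u unfolding Uq_iff by blast
    obtain y where y: "y \<in> \<tau>s" "etale_index A \<pi> h u = mat2 1 y 0 1" "ginv (ut x) ** (h ** ut y) \<in> H"
      using etale_index_eq[OF h x(1)] unfolding x(2) by blast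
    let ?c = "ginv (ut x) ** (h ** ut y)"
    have yU: "mat2 1 y 0 1 \<in> Uq A \<pi>" unfolding Uq_iff using y(1) by blast
    have "ginv (u ** tmat \<pi>) ** h ** mat2 1 y 0 1 ** tmat \<pi> = ?c"
      unfolding x(2) u_tmat by (simp add: matrix_mul_assoc[symmetric] u_tmat)
    then have "act E h (em (\<kappa> v)) u = act D ?c (em (\<kappa> v) (mat2 1 y 0 1))"
      unfolding E_ops using u y(2) by (simp add: Let_def)
    also have "em (\<kappa> v) (mat2 1 y 0 1) = \<kappa> (act V (ginv (ut y)) v)" using em_apply[OF v] yU by (simp add: u_tmat)
    also have "act D ?c \<dots> = \<kappa> (act V ?c (act V (ginv (ut y)) v))"
      by (rule D_act[OF H_Binv[OF y(3)] act_in[OF borel_ginv[OF ut_borel] v]])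
    also have "\<dots> = em (\<kappa> (act V h v)) u"
      unfolding ut_inverse_act[OF h v y(3), symmetric] using em_apply[OF hv] u x(2) by (simp add: u_tmat)
    finally show ?thesis .
  qed
  then show ?thesis using em_apply[OF hv] unfolding E_ops by (auto simp: fun_eq_iff)
qed

lemma em_closed: assumes v: "v \<in> carrier V" shows "em (\<kappa> v) \<in> carrier E"
  unfolding E_ops em_apply[OF v] D_carrier using act_in[OF borel_ginv[OF u_borel] v] by auto

lemma em_hom: "em \<in> rep_hom R (GL2_on H) D E"
  unfolding rep_hom_def D_carrier GL2_on_simps
  by (auto simp: em_closed D_add D_smult D_act H_Binv E_add E_smult E_act)

lemma em_surj: "em ` carrier D = carrier E"
proof (intro equalityI subsetI)
  fix f assume "f \<in> carrier E"
  then have f: "f \<in> Uq A \<pi> \<rightarrow>\<^sub>E \<kappa> ` Vp" unfolding E_ops D_carrier' .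
  have "\<forall>x\<in>\<tau>s. \<exists>e\<in>Vp. f (mat2 1 x 0 1) = \<kappa> e" using f Uq_iff by (auto simp: PiE_iff image_iff)
  then obtain e where e: "\<And>x. x \<in> \<tau>s \<Longrightarrow> e x \<in> Vp" "\<And>x. x \<in> \<tau>s \<Longrightarrow> f (mat2 1 x 0 1) = \<kappa> (e x)" by metis
  \<comment> \<open>The vector with the prescribed coordinates; the summand 0 stands for v0, so that
    \<open>ut_projection\<close> applies literally.\<close>
  define v where "v = \<zero> \<oplus> (\<Oplus>x\<in>\<tau>s. act V (ut x) (e x))"
  have v: "v \<in> carrier V" unfolding v_def using e(1) Vp_carrier act_in[OF ut_borel] by (intro M.add.m_closed M.finsum_closed) auto
  have "em (\<kappa> v) u = f u" if u: "u \<in> Uq A \<pi>" for u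
  proof -
    obtain y where y: "y \<in> \<tau>s" "u = mat2 1 y 0 1" using u unfolding Uq_iff by blast
    have "act V (ginv (ut y)) v \<ominus> e y \<in> Vm"
      unfolding v_def by (rule ut_projection[OF submodule_zero[OF V0_sub] e(1) y(1)])
    then have "\<kappa> (act V (ginv (ut y)) v) = \<kappa> (e y)"
      using \<kappa>_eq_iff[OF act_in[OF borel_ginv[OF ut_borel] v] Vp_carrier[OF e(1)[OF y(1)]]] by blast
    then show ?thesis using em_apply[OF v] u y e(2) by (simp add: u_tmat)
  qed
  then have "em (\<kappa> v) = f" using em_apply[OF v] f by (auto simp: fun_eq_iff PiE_iff extensional_def)
  then show "f \<in> em ` carrier D" unfolding D_carrier using v by blast
qed (auto simp: D_carrier em_closed)

text \<open>The quotient has a single element. It is exhibited as the image of the zero submodule of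
  V under a constant map, so that the criterion for subquotients of V applies.\<close>

lemma em_cokernel: "smooth_tf R (GL2_on H) T (quot_rep E (em ` carrier D))"
proof -
  have E_em: "carrier E = (\<lambda>v. em (\<kappa> v)) ` carrier V" using em_surj D_carrier by auto
  have absorb: "carrier E <+>\<^bsub>E\<^esub> X = carrier E" if X: "X \<subseteq> carrier E" "X \<noteq> {}" for X
  proof (intro equalityI subsetI)
    fix z assume "z \<in> carrier E <+>\<^bsub>E\<^esub> X"
    then obtain a b where "a \<in> carrier E" "b \<in> carrier E" "z = a \<oplus>\<^bsub>E\<^esub> b" unfolding set_add_def' using X by blast
    then show "z \<in> carrier E" unfolding E_em using E_add by auto
  next
    fix z assume "z \<in> carrier E"
    obtain x where x: "x \<in> X" using X by blast
    obtain v w where vw: "v \<in> carrier V" "w \<in> carrier V" "z = em (\<kappa> v)" "x = em (\<kappa> w)"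
      using \<open>z \<in> carrier E\<close> x X unfolding E_em by blast
    have "z = em (\<kappa> (v \<ominus> w)) \<oplus>\<^bsub>E\<^esub> x" using E_add[of "v \<ominus> w" w] vw minus_add_cancel by simp
    moreover have "em (\<kappa> (v \<ominus> w)) \<in> carrier E" using em_closed vw by simp
    ultimately show "z \<in> carrier E <+>\<^bsub>E\<^esub> X" unfolding set_add_def' using x by blast
  qed
  have ne: "em (\<kappa> \<zero>) \<in> carrier E" using em_closed by simp
  let ?Q = "quot_rep E (carrier E)"
  have coset: "carrier E +>\<^bsub>E\<^esub> e = carrier E" if "e \<in> carrier E" for e
    using absorb[of "{e}"] that unfolding set_add_def' a_r_coset_def' by simp
  have sub: "module.smult E r ` carrier E \<subseteq> carrier E" "act E h ` carrier E \<subseteq> carrier E" if "r \<in> carrier R" "h \<in> H" for r h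
    unfolding E_em using E_smult[OF that(1)] E_act[OF that(2)] that H_borel act_in by auto
  have "smooth_tf R (GL2_on H) T ?Q"
  proof (rule smooth_tf_image[OF H_sub H_one H_mult submodule_trivial, where \<kappa> = "\<lambda>_. carrier E" and W = "{}"])
    show "carrier ?Q = (\<lambda>_. carrier E) ` {\<zero>}"
      unfolding quot_rep_def A_RCOSETS_def' using coset ne by auto
    fix r assume "r \<in> carrier R"
    then show "r \<odot>\<^bsub>?Q\<^esub> carrier E = carrier E"
      unfolding quot_rep_def using absorb[OF sub(1)[OF _ H_one]] ne by auto
  next
    fix h assume "h \<in> H"
    then show "act ?Q h (carrier E) = carrier E"
      unfolding quot_rep_def using absorb[OF sub(2)[OF R.zero_closed]] ne by auto
  next
    fix y show "\<exists>y'\<in>sp H {}. carrier E = carrier E"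
      using submodule_zero[OF sp_submodule[OF H_sub]] by blast
  qed (use act_zero H_borel absorb[of "carrier E"] ne in \<open>auto simp: quot_rep_def\<close>)
  then show ?thesis unfolding em_surj .
qed

lemma em_kernel: "smooth_tf R (GL2_on H) T (D \<downharpoonright> ker_rep D E em)"
proof -
  \<comment> \<open>The preimage of the kernel in V: stability under H and generation are checked on
    vectors and carried to D by \<open>\<kappa>\<close>.\<close>
  define Y where "Y = {v \<in> carrier V. \<forall>x\<in>\<tau>s. act V (ginv (ut x)) v \<in> Vm}"
  have gb: "ginv (ut x) \<in> borel_set" for x using borel_ginv[OF ut_borel] .
  have "Y = \<Inter>(insert (carrier V) ((\<lambda>x. {v \<in> carrier V. act V (ginv (ut x)) v \<in> Vm}) ` \<tau>s))" unfolding Y_def by auto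
  then have Ysub: "submodule Y R V"
    using submodule_Inter[of "insert (carrier V) ((\<lambda>x. {v \<in> carrier V. act V (ginv (ut x)) v \<in> Vm}) ` \<tau>s)"]
      carrier_is_submodule submodule_act_vimage[OF gb Vm_sub] by auto
  have YH: "act V h v \<in> Y" if h: "h \<in> H" and "v \<in> Y" for h v
  proof -
    have v: "v \<in> carrier V" "\<And>x. x \<in> \<tau>s \<Longrightarrow> act V (ginv (ut x)) v \<in> Vm" using \<open>v \<in> Y\<close> unfolding Y_def by auto
    have "act V (ginv (ut x)) (act V h v) \<in> Vm" if x: "x \<in> \<tau>s" for x
    proof -
      obtain y where y: "y \<in> \<tau>s" "ginv (ut x) ** (h ** ut y) \<in> H" using etale_index_eq[OF h x] by blast
      show ?thesis unfolding ut_inverse_act[OF h v(1) y(2)] using Vm_H[OF y(2) v(2)[OF y(1)]] .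
    qed
    then show ?thesis unfolding Y_def using act_in[OF H_borel[OF h] v(1)] by simp
  qed
  have ker: "ker_rep D E em = \<kappa> ` Y"
  proof -
    have "em (\<kappa> v) = \<zero>\<^bsub>E\<^esub> \<longleftrightarrow> v \<in> Y" if v: "v \<in> carrier V" for v
    proof -
      have "em (\<kappa> v) = \<zero>\<^bsub>E\<^esub> \<longleftrightarrow> (\<forall>u\<in>Uq A \<pi>. \<kappa> (act V (ginv (u ** tmat \<pi>)) v) = \<kappa> \<zero>)"
        unfolding em_apply[OF v] E_ops(2) D_zero by (auto simp: fun_eq_iff restrict_def)
      also have "\<dots> \<longleftrightarrow> (\<forall>x\<in>\<tau>s. \<kappa> (act V (ginv (ut x)) v) = \<kappa> \<zero>)"
        unfolding Ball_def Uq_iff by (metis u_tmat)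
      also have "\<dots> \<longleftrightarrow> v \<in> Y"
        unfolding Y_def using \<kappa>_eq_iff[OF act_in[OF gb v] M.zero_closed] minus_minus_zero[OF act_in[OF gb v]] v by simp
      finally show ?thesis .
    qed
    then show ?thesis unfolding ker_rep_def D_carrier using Ysub submodule_subset by auto
  qed
  obtain W where W: "finite W" "W \<subseteq> \<Delta>" "\<Delta> = sp H W" using \<Delta>_finite_type by blast
  define W' where "W' = S0 \<union> (\<lambda>(x, s). act V (ut x) s) ` (\<tau>s \<times> W)"
  have uW: "act V (ut x) s \<in> Y" if x: "x \<in> \<tau>s" and s: "s \<in> \<Delta>" for x s
  proof -
    have s': "s \<in> Vp" "s \<in> Vm" "s \<in> carrier V" using s Vp_carrier unfolding \<Delta>_def by auto
    have "act V (ginv (ut y)) (act V (ut x) s) \<in> Vm" if y: "y \<in> \<tau>s" for y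
      using ut_cross_Vm[OF x y _ s'(1)] act_cancel(1)[OF ut_borel s'(3)] s'(2) by (cases "x = y") auto
    then show ?thesis unfolding Y_def using act_in[OF ut_borel s'(3)] by blast
  qed
  have W'Y: "W' \<subseteq> Y" "finite W'"
  proof -
    have "S0 \<subseteq> Y" unfolding Y_def using S0(2) V0_carrier ut_inverse_V0 by blast
    then show "W' \<subseteq> Y" "finite W'" unfolding W'_def using uW W(1,2) S0(1) \<tau>s_finite by auto
  qed
  have W'c: "W' \<subseteq> carrier V" using W'Y Ysub submodule_subset by blast
  have spW': "submodule (sp H W') R V" using sp_submodule[OF H_sub W'c] .
  have ut\<Delta>: "act V (ut x) d \<in> sp H W'" if x: "x \<in> \<tau>s" and d: "d \<in> \<Delta>" for x d
  proof -
    have "sp H W \<subseteq> {v \<in> carrier V. act V (ut x) v \<in> sp H W'}"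
    proof (rule sp_minimal[OF submodule_act_vimage[OF ut_borel spW']])
      fix h s assume h: "h \<in> H" and s: "s \<in> W"
      have sc: "s \<in> carrier V" using s W(2) \<Delta>_sub submodule_subset by blast
      obtain h' where h': "h' \<in> H" "ut x ** h = h' ** ut x" using ut_H_left[OF h \<tau>s_in[OF x]] by blast
      have "act V (ut x) (act V h s) = act V h' (act V (ut x) s)"
        using h'(2) act_comp[OF ut_borel H_borel[OF h] sc] act_comp[OF H_borel[OF h'(1)] ut_borel sc] by metis
      moreover have "act V (ut x) s \<in> W'" unfolding W'_def using x s by force
      ultimately show "act V h s \<in> {v \<in> carrier V. act V (ut x) v \<in> sp H W'}"
        using sp_inc[OF h'(1)] act_in[OF H_borel[OF h] sc] by simp
    qed
    then show ?thesis using d W(3) by blast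
  qed
  have gen: "\<exists>y'\<in>sp H W'. \<kappa> v = \<kappa> y'" if "v \<in> Y" for v
  proof -
    have v: "v \<in> carrier V" "\<And>x. x \<in> \<tau>s \<Longrightarrow> act V (ginv (ut x)) v \<in> Vm" using \<open>v \<in> Y\<close> unfolding Y_def by auto
    obtain a where a: "a \<in> Vp" "v \<ominus> a \<in> Vm" using Vp_Vm_diff[OF v(1)] by blast
    have ac: "a \<in> carrier V" using Vp_carrier a by blast
    obtain n where "a \<in> Vl n" using Vp_level[OF a(1)] by blast
    \<comment> \<open>The next stage of the filtration is used because only successor stages
      decompose.\<close>
    then have "a \<in> Vl (Suc n)" using Vl_mono by blast
    then obtain v0 e where e: "v0 \<in> V0" "\<forall>x\<in>\<tau>s. e x \<in> Vl n" "a = v0 \<oplus> (\<Oplus>x\<in>\<tau>s. act V (ut x) (e x))"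
      using Vl_decomp by blast
    have eVp: "e x \<in> Vp" if "x \<in> \<tau>s" for x using e(2) Vl_Vp that by blast
    \<comment> \<open>Modulo V^- the coordinate \<open>e y\<close> agrees with (ut y)^-1 a, hence
      with (ut y)^-1 v, which lies in V^- because v represents an element of the kernel.\<close>
    have e\<Delta>: "e y \<in> \<Delta>" if y: "y \<in> \<tau>s" for y
    proof -
      let ?g = "ginv (ut y)"
      have ey: "e y \<in> carrier V" using eVp[OF y] Vp_carrier by blast
      have 1: "act V ?g a \<ominus> e y \<in> Vm" unfolding e(3) by (rule ut_projection[OF e(1) eVp y])
      have 2: "act V ?g v \<ominus> act V ?g a \<in> Vm" by (rule act_diff_in[OF gb v(1) ac a(2) ut_inverse_Vm[OF y]])
      have c: "act V ?g v \<in> carrier V" "act V ?g a \<in> carrier V" using act_in[OF gb] v(1) ac by auto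
      have "act V ?g v \<ominus> e y \<in> Vm" using submoduleE(5)[OF Vm_sub 2 1] diff_trans[OF c ey] by simp
      then have "e y \<ominus> act V ?g v \<in> Vm" using diff_swap_in[OF Vm_sub _ c(1) ey] by blast
      then have "e y \<in> Vm" using submodule_diffD[OF Vm_sub _ v(2)[OF y] ey] by blast
      then show ?thesis unfolding \<Delta>_def using eVp[OF y] by blast
    qed
    have "V0 \<subseteq> sp H W'" unfolding S0(3) by (rule sp_mono) (auto simp: W'_def)
    then have "v0 \<in> sp H W'" using e(1) by blast
    moreover have "(\<Oplus>x\<in>\<tau>s. act V (ut x) (e x)) \<in> sp H W'"
      by (rule finsum_in[OF spW' \<tau>s_finite]) (rule ut\<Delta>[OF _ e\<Delta>])
    ultimately have "a \<in> sp H W'" unfolding e(3) using submoduleE(5)[OF spW'] by blast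
    then show ?thesis using \<kappa>_eq_iff[OF v(1) ac] a(2) by blast
  qed
  note Yc = subsetD[OF submodule_subset[OF Ysub]]
  show ?thesis unfolding ker
    by (rule smooth_tf_image[OF H_sub H_one H_mult Ysub YH, where \<kappa> = \<kappa> and W = W'])
      (use W'Y gen Yc in \<open>auto simp: D_zero D_add D_smult D_act H_Binv\<close>)
qed

lemma etale: "etale_mod_tf R A \<pi> D"
  unfolding etale_mod_tf_def using D_smooth em_hom em_kernel em_cokernel by blast

end

subsection \<open>Exactness\<close>

lemma hom_zero:
  assumes "Module.module R M" "Module.module R N" and f: "f \<in> carrier M \<rightarrow> carrier N"
    "\<And>r x. \<lbrakk>r \<in> carrier R; x \<in> carrier M\<rbrakk> \<Longrightarrow> f (r \<odot>\<^bsub>M\<^esub> x) = r \<odot>\<^bsub>N\<^esub> f x"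
  shows "f \<zero>\<^bsub>M\<^esub> = \<zero>\<^bsub>N\<^esub>"
proof -
  interpret M: Module.module R M by fact
  interpret N: Module.module R N by fact
  have "f \<zero>\<^bsub>M\<^esub> \<in> carrier N" using f(1) M.M.zero_closed by blast
  then show ?thesis using f(2)[of "\<zero>\<^bsub>R\<^esub>" "\<zero>\<^bsub>M\<^esub>"] by simp
qed

lemma submodule_vimage_hom:
  assumes M: "Module.module R M" and N: "Module.module R N" and f: "f \<in> carrier M \<rightarrow> carrier N"
    "\<And>x y. \<lbrakk>x \<in> carrier M; y \<in> carrier M\<rbrakk> \<Longrightarrow> f (x \<oplus>\<^bsub>M\<^esub> y) = f x \<oplus>\<^bsub>N\<^esub> f y"
    "\<And>r x. \<lbrakk>r \<in> carrier R; x \<in> carrier M\<rbrakk> \<Longrightarrow> f (r \<odot>\<^bsub>M\<^esub> x) = r \<odot>\<^bsub>N\<^esub> f x"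
    and L: "submodule L R N" and K: "submodule K R M"
  shows "submodule {x \<in> K. f x \<in> L} R M"
proof -
  interpret M: Module.module R M by (rule M)
  interpret N: Module.module R N by (rule N)
  note Kc = subsetD[OF M.submodule_subset[OF K]]
  show ?thesis
  proof (rule M.submoduleI')
    show "\<zero>\<^bsub>M\<^esub> \<in> {x \<in> K. f x \<in> L}"
      using hom_zero[OF M N f(1,3)] N.submodule_zero[OF L] M.submodule_zero[OF K] by simp
  qed (use Kc f(2,3) M.submoduleE(4,5)[OF K] N.submoduleE(4,5)[OF L] in auto)
qed

lemma submodule_image_hom:
  assumes M: "Module.module R M" and N: "Module.module R N" and f: "f \<in> carrier M \<rightarrow> carrier N"
    "\<And>x y. \<lbrakk>x \<in> carrier M; y \<in> carrier M\<rbrakk> \<Longrightarrow> f (x \<oplus>\<^bsub>M\<^esub> y) = f x \<oplus>\<^bsub>N\<^esub> f y"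
    "\<And>r x. \<lbrakk>r \<in> carrier R; x \<in> carrier M\<rbrakk> \<Longrightarrow> f (r \<odot>\<^bsub>M\<^esub> x) = r \<odot>\<^bsub>N\<^esub> f x"
    and K: "submodule K R M"
  shows "submodule (f ` K) R N"
proof -
  interpret M: Module.module R M by (rule M)
  interpret N: Module.module R N by (rule N)
  note Kc = subsetD[OF M.submodule_subset[OF K]]
  show ?thesis
  proof (rule N.submoduleI')
    show "f ` K \<subseteq> carrier N" using Kc f(1) by blast
    show "\<zero>\<^bsub>N\<^esub> \<in> f ` K" using hom_zero[OF M N f(1,3)] M.submodule_zero[OF K] by (metis imageI)
  next
    fix a b assume "a \<in> f ` K" "b \<in> f ` K"
    then obtain x y where xy: "x \<in> K" "y \<in> K" "a = f x" "b = f y" by blast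
    then have "a \<oplus>\<^bsub>N\<^esub> b = f (x \<oplus>\<^bsub>M\<^esub> y)" using f(2) Kc by simp
    then show "a \<oplus>\<^bsub>N\<^esub> b \<in> f ` K" using M.submoduleE(5)[OF K] xy by blast
  next
    fix r a assume r: "r \<in> carrier R" and "a \<in> f ` K"
    then obtain x where x: "x \<in> K" "a = f x" by blast
    then have "r \<odot>\<^bsub>N\<^esub> a = f (r \<odot>\<^bsub>M\<^esub> x)" using f(3)[OF r] Kc by simp
    then show "r \<odot>\<^bsub>N\<^esub> a \<in> f ` K" using M.submoduleE(4)[OF K r] x by blast
  qed
qed

text \<open>The outer homology vanishes: \<open>\<alpha>\<close> is injective, and
  \<open>\<beta>\<close> maps V^+ onto its counterpart because it maps V0 onto \<open>V0''\<close>.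
  The middle homology is generated by the kernel of \<open>\<beta>\<close> on Delta, which is of
  finite type as a subrepresentation of Delta.\<close>

lemma (in presented_rep) exact_Vplus:
  fixes V' :: "('b, 'u, 'a^2^2) rep" and V'' :: "('b, 'w, 'a^2^2) rep"
  assumes "gen_rep A \<pi> R V' V0' S'" and "gen_rep A \<pi> R V'' V0'' S''"
    and ex: "short_exact R (GL2_on borel_set) V' \<alpha> V \<beta> V''"
    and ex0: "short_exact R (GL2_on H) (V' \<downharpoonright> V0') \<alpha> (V \<downharpoonright> V0) \<beta> (V'' \<downharpoonright> V0'')"
  shows "short_exact_mod_tf R (GL2_on H) T (V' \<downharpoonright> act_span R V' Bp V0') \<alpha> (V \<downharpoonright> Vp) \<beta> (V'' \<downharpoonright> act_span R V'' Bp V0'')"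
proof -
  interpret X: gen_rep A \<pi> R V' V0' S' by fact
  interpret Z: gen_rep A \<pi> R V'' V0'' S'' by fact
  have \<alpha>: "\<alpha> \<in> carrier V' \<rightarrow> carrier V"
    "\<And>x y. \<lbrakk>x \<in> carrier V'; y \<in> carrier V'\<rbrakk> \<Longrightarrow> \<alpha> (x \<oplus>\<^bsub>V'\<^esub> y) = \<alpha> x \<oplus> \<alpha> y"
    "\<And>r x. \<lbrakk>r \<in> carrier R; x \<in> carrier V'\<rbrakk> \<Longrightarrow> \<alpha> (r \<odot>\<^bsub>V'\<^esub> x) = r \<odot> \<alpha> x"
    "\<And>h x. \<lbrakk>h \<in> borel_set; x \<in> carrier V'\<rbrakk> \<Longrightarrow> \<alpha> (act V' h x) = act V h (\<alpha> x)"
    and \<beta>: "\<beta> \<in> carrier V \<rightarrow> carrier V''"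
    "\<And>x y. \<lbrakk>x \<in> carrier V; y \<in> carrier V\<rbrakk> \<Longrightarrow> \<beta> (x \<oplus> y) = \<beta> x \<oplus>\<^bsub>V''\<^esub> \<beta> y"
    "\<And>r x. \<lbrakk>r \<in> carrier R; x \<in> carrier V\<rbrakk> \<Longrightarrow> \<beta> (r \<odot> x) = r \<odot>\<^bsub>V''\<^esub> \<beta> x"
    "\<And>h x. \<lbrakk>h \<in> borel_set; x \<in> carrier V\<rbrakk> \<Longrightarrow> \<beta> (act V h x) = act V'' h (\<beta> x)"
    using ex unfolding short_exact_def rep_hom_def GL2_on_simps by auto
  have inj: "inj_on \<alpha> (carrier V')" and exact: "\<alpha> ` carrier V' = {x \<in> carrier V. \<beta> x = \<zero>\<^bsub>V''\<^esub>}"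
    using ex unfolding short_exact_def ker_rep_def by auto
  have V0: "\<alpha> ` V0' \<subseteq> V0" "\<beta> ` V0 = V0''" using ex0 unfolding short_exact_def ker_rep_def by auto
  note \<alpha>c = funcset_mem[OF \<alpha>(1)] and \<beta>c = funcset_mem[OF \<beta>(1)]
  have \<alpha>_sp: "\<alpha> x \<in> sp P V0" if P: "P \<subseteq> borel_set" and x: "x \<in> act_span R V' P V0'" for P x
  proof -
    have "act_span R V' P V0' \<subseteq> {x \<in> carrier V'. \<alpha> x \<in> sp P V0}"
    proof (rule X.sp_minimal)
      show "submodule {x \<in> carrier V'. \<alpha> x \<in> sp P V0} R V'"
        by (rule submodule_vimage_hom[OF X.module_axioms module_axioms \<alpha>(1-3) sp_submodule[OF P V0_carrier] X.carrier_is_submodule])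
      fix b w assume b: "b \<in> P" and w: "w \<in> V0'"
      have wc: "w \<in> carrier V'" "\<alpha> w \<in> V0" using w X.V0_carrier V0 by auto
      show "act V' b w \<in> {x \<in> carrier V'. \<alpha> x \<in> sp P V0}"
        using \<alpha>(4)[OF _ wc(1)] sp_inc[OF b wc(2)] X.act_in[OF _ wc(1)] b P by auto
    qed
    then show ?thesis using x by blast
  qed
  have \<alpha>Vp: "\<alpha> x \<in> Vp" if "x \<in> X.Vp" for x using \<alpha>_sp[OF Bp_sub] that unfolding Vp_def X.Vp_def .
  have \<alpha>Vm: "\<alpha> x \<in> Vm" if "x \<in> X.Vm" for x using \<alpha>_sp[of "borel_set - Bp"] that unfolding Vm_def X.Vm_def by blast
  have \<beta>Vp: "\<beta> ` Vp = Z.Vp"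
  proof
    have "Vp \<subseteq> {x \<in> carrier V. \<beta> x \<in> Z.Vp}" unfolding Vp_def
    proof (rule sp_minimal[OF submodule_vimage_hom[OF module_axioms Z.module_axioms \<beta>(1-3) Z.Vp_sub carrier_is_submodule]])
      fix b w assume b: "b \<in> Bp" and w: "w \<in> V0"
      have wc: "w \<in> carrier V" "\<beta> w \<in> Z.Vp" using w V0_carrier V0 Z.V0_Vp by auto
      show "act V b w \<in> {x \<in> carrier V. \<beta> x \<in> Z.Vp}"
        using \<beta>(4)[OF Bp_borel[OF b] wc(1)] Z.Vp_act[OF b wc(2)] act_in[OF Bp_borel[OF b] wc(1)] by simp
    qed
    then show "\<beta> ` Vp \<subseteq> Z.Vp" by blast
    show "Z.Vp \<subseteq> \<beta> ` Vp" unfolding Z.Vp_def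
    proof (rule Z.sp_minimal[OF submodule_image_hom[OF module_axioms Z.module_axioms \<beta>(1-3) Vp_sub]])
      fix b w assume b: "b \<in> Bp" and "w \<in> V0''"
      then obtain v where v: "v \<in> V0" "w = \<beta> v" using V0 by blast
      then have "act V'' b w = \<beta> (act V b v)" using \<beta>(4)[OF Bp_borel[OF b]] V0_carrier by auto
      then show "act V'' b w \<in> \<beta> ` Vp" using Vp_act[OF b] V0_Vp v(1) by blast
    qed
  qed
  let ?Y = "{x \<in> Vp. \<beta> x = \<zero>\<^bsub>V''\<^esub>}"
  have \<beta>ker: "submodule {x \<in> K. \<beta> x = \<zero>\<^bsub>V''\<^esub>} R V" if "submodule K R V" for K
    using submodule_vimage_hom[OF module_axioms Z.module_axioms \<beta>(1-3) Z.submodule_trivial that] by simp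
  have \<beta>H: "\<beta> (act V h x) = \<zero>\<^bsub>V''\<^esub>" if "h \<in> H" "x \<in> carrier V" "\<beta> x = \<zero>\<^bsub>V''\<^esub>" for h x
    using \<beta>(4) Z.act_zero H_borel that by simp
  have NY: "\<alpha> ` X.Vp \<subseteq> ?Y" using \<alpha>Vp exact X.Vp_carrier by blast
  have middle: "smooth_tf R (GL2_on H) T (quot_rep (V \<downharpoonright> ?Y) (\<alpha> ` X.Vp))"
  proof -
    obtain W0 where W0: "finite W0" "W0 \<subseteq> \<Delta>" "\<Delta> = sp H W0" using \<Delta>_finite_type by blast
    have W0c: "W0 \<subseteq> carrier V" using W0(2) \<Delta>_sub submodule_subset by blast
    let ?N = "{x \<in> \<Delta>. \<beta> x = \<zero>\<^bsub>V''\<^esub>}"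
    have NH: "act V h y \<in> ?N" if "h \<in> H" "y \<in> ?N" for h y
      using that \<Delta>_H \<beta>H submodule_subset[OF \<Delta>_sub] by auto
    have sub: "?N \<subseteq> sp H W0" using W0(3) by blast
    obtain W where W: "finite W" "W \<subseteq> ?N" "?N = sp H W"
      by (rule sub_finite_type[OF W0(1) W0c \<beta>ker[OF \<Delta>_sub] sub NH])
    show ?thesis
    proof (rule smooth_tf_quot[OF _ NY _ \<beta>ker[OF Vp_sub] _ W(1)])
      show "submodule (\<alpha> ` X.Vp) R V" by (rule submodule_image_hom[OF X.module_axioms module_axioms \<alpha>(1-3) X.Vp_sub])
      fix h y assume "h \<in> H" "y \<in> \<alpha> ` X.Vp"
      then show "act V h y \<in> \<alpha> ` X.Vp" using \<alpha>(4)[OF H_borel X.Vp_carrier, symmetric] X.Vp_H by auto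
    next
      fix h y assume "h \<in> H" "y \<in> ?Y"
      then show "act V h y \<in> ?Y" using Vp_H \<beta>H Vp_carrier by auto
    next
      show "W \<subseteq> ?Y" using W(2) unfolding \<Delta>_def by blast
      fix y assume y: "y \<in> ?Y"
      then obtain z where z: "z \<in> carrier V'" "y = \<alpha> z" using exact Vp_carrier by blast
      obtain a b where ab: "a \<in> X.Vp" "b \<in> X.Vm" "z = a \<oplus>\<^bsub>V'\<^esub> b" using X.Vp_Vm_sum[OF z(1)] by blast
      note c = X.Vp_carrier[OF ab(1)] X.Vm_carrier[OF ab(2)]
      have y': "y = \<alpha> a \<oplus> \<alpha> b" using z(2) ab(3) \<alpha>(2) c by simp
      have d: "y \<ominus> \<alpha> b = \<alpha> a" "y \<ominus> \<alpha> a = \<alpha> b"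
        unfolding y' using add_minus_cancel[of "\<alpha> a" "\<alpha> b"] add_minus_cancel[of "\<alpha> b" "\<alpha> a"] \<alpha>c c by (simp_all add: M.a_comm)
      have "\<alpha> b \<in> Vp" using submodule_minus[OF Vp_sub, of y "\<alpha> a"] d(2) y \<alpha>Vp[OF ab(1)] by auto
      then have "\<alpha> b \<in> ?N" using \<alpha>Vm[OF ab(2)] exact c(2) unfolding \<Delta>_def by auto
      then show "\<exists>y'\<in>sp H W. y \<ominus> y' \<in> \<alpha> ` X.Vp" using W(3) d(1) ab(1) by auto
    qed
  qed
  have left: "smooth_tf R (GL2_on H) T (V' \<downharpoonright> {x \<in> X.Vp. \<alpha> x = \<zero>})"
  proof -
    have "\<alpha> \<zero>\<^bsub>V'\<^esub> = \<zero>" by (rule hom_zero[OF X.module_axioms module_axioms \<alpha>(1,3)])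
    then have "{x \<in> X.Vp. \<alpha> x = \<zero>} = {\<zero>\<^bsub>V'\<^esub>}"
      using inj_onD[OF inj] X.Vp_carrier X.submodule_zero[OF X.Vp_sub] by (auto simp: set_eq_iff)
    then show ?thesis using X.zero_sub_tf by simp
  qed
  have right: "smooth_tf R (GL2_on H) T (quot_rep (V'' \<downharpoonright> Z.Vp) Z.Vp)"
  proof (rule Z.smooth_tf_quot[OF Z.Vp_sub _ _ Z.Vp_sub, of "{}"])
    fix y assume y: "y \<in> Z.Vp"
    have "y \<ominus>\<^bsub>V''\<^esub> \<zero>\<^bsub>V''\<^esub> \<in> Z.Vp" using y Z.minus_minus_zero[OF Z.Vp_carrier[OF y]] by simp
    then show "\<exists>y'\<in>act_span R V'' H {}. y \<ominus>\<^bsub>V''\<^esub> y' \<in> Z.Vp"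
      using Z.submodule_zero[OF Z.sp_submodule[OF H_sub]] by blast
  qed (use Z.Vp_H in auto)
  have reps: "smooth_rep R (GL2_on H) T (V' \<downharpoonright> X.Vp)" "smooth_rep R (GL2_on H) T (V \<downharpoonright> Vp)" "smooth_rep R (GL2_on H) T (V'' \<downharpoonright> Z.Vp)"
    by (rule X.smooth_rep_sub smooth_rep_sub Z.smooth_rep_sub; use H_sub H_one H_mult X.Vp_sub X.Vp_H Vp_sub Vp_H Z.Vp_sub Z.Vp_H in blast)+
  have homs: "\<alpha> \<in> rep_hom R (GL2_on H) (V' \<downharpoonright> X.Vp) (V \<downharpoonright> Vp)" "\<beta> \<in> rep_hom R (GL2_on H) (V \<downharpoonright> Vp) (V'' \<downharpoonright> Z.Vp)"
    unfolding rep_hom_def GL2_on_simps using \<alpha> \<beta> \<alpha>Vp \<beta>Vp X.Vp_carrier Vp_carrier H_borel by auto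
  show ?thesis unfolding short_exact_mod_tf_def ker_rep_def X.Vp_def[symmetric] Z.Vp_def[symmetric]
    using reps homs NY left middle right \<beta>Vp by simp
qed

subsection \<open>Vectors fixed by the unipotent group\<close>

context cdvr
begin

definition uu :: "'a \<Rightarrow> 'a^2^2" where "uu y = mat2 1 y 0 1"

lemma uu_borel: "uu y \<in> borel_set" unfolding uu_def borel_iff by simp

lemma uu_H: "y \<in> A \<Longrightarrow> uu y \<in> H"
  unfolding H_iff using uu_borel[of y] unit_one by (simp add: uu_def slope_def shift_def)

lemma uu_K: "y \<in> pw l \<Longrightarrow> uu y \<in> K l" unfolding K_iff uu_def by (simp add: pw_zero)

lemma uu_ut: "uu (\<pi> * y) ** ut x = ut x ** uu y" "uu x ** ut 0 = ut x"
  unfolding uu_def ut_def matrix_eq_iff_entries by (simp_all add: mult_nth add.commute)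

lemma uu_ginv: "ginv (uu y) = uu (- y)"
  by (rule ginv_unique) (use uu_borel borel_GL2 in \<open>auto simp: uu_def matrix_eq_iff_entries mult_nth\<close>)

lemma ginv_ut: "ginv (ut x) = ginv (ut 0) ** uu (- x)"
  using ginv_prod[OF borel_GL2[OF uu_borel] borel_GL2[OF ut_borel], of x 0] unfolding uu_ut(2) uu_ginv .

lemma uu_ginv_ut: "uu y ** ginv (ut 0) = ginv (ut 0) ** uu (\<pi> * y)"
proof -
  have "ginv (ut 0) ** (uu (\<pi> * y) ** ut 0) ** ginv (ut 0) = uu y ** ginv (ut 0)"
    unfolding uu_ut(1) using ginv_cancel(1)[OF borel_GL2[OF ut_borel]] by simp
  then show ?thesis using ginv_cancel(3)[OF borel_GL2[OF ut_borel], of "ginv (ut 0) ** uu (\<pi> * y)" 0] by (simp add: matrix_mul_assoc)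
qed

lemma uu_H_commute: assumes "h \<in> H" shows "uu y ** h = h ** uu (y / slope h)"
  using assms unfolding H_iff borel_iff uu_def matrix_eq_iff_entries by (simp add: mult_nth slope_def)

text \<open>Apart from G M = 1 only integrality matters: G (k - 1) M is divisible by pi^l together
  with k - 1.\<close>

lemma K_conj:
  fixes G M :: "'a^2^2"
  assumes k: "k \<in> K l" and GM: "G ** M = mat 1" and A: "\<And>i j. G $ i $ j \<in> A" "\<And>i j. M $ i $ j \<in> A"
  shows "G ** k ** M \<in> K l"
  unfolding K_def near_def mem_Collect_eq
proof (intro allI)
  fix i j
  have d: "k $ a $ b - (mat 1 :: 'a^2^2) $ a $ b \<in> pw l" for a b using k unfolding K_def near_def by blast
  let ?I = "mat 1 :: 'a^2^2"
  have "?I $ i $ j = (G ** ?I ** M) $ i $ j" using GM by simp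
  then have "(G ** k ** M) $ i $ j - ?I $ i $ j =
      (G $ i $ 1 * (k $ 1 $ 1 - ?I $ 1 $ 1) + G $ i $ 2 * (k $ 2 $ 1 - ?I $ 2 $ 1)) * M $ 1 $ j
    + (G $ i $ 1 * (k $ 1 $ 2 - ?I $ 1 $ 2) + G $ i $ 2 * (k $ 2 $ 2 - ?I $ 2 $ 2)) * M $ 2 $ j"
    unfolding mult_nth by (simp add: algebra_simps)
  also have "\<dots> \<in> pw l" by (intro pw_add pw_mult_A d A)
  finally show "(G ** k ** M) $ i $ j - (mat 1 :: 'a^2^2) $ i $ j \<in> pw l" .
qed

text \<open>Up to a scalar, which cancels in the conjugation, h is integral with integral
  inverse.\<close>

lemma K_conj_H: assumes h: "h \<in> H" and k: "k \<in> K l" shows "ginv h ** k ** h \<in> K l"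
proof -
  let ?z = "mat2 (h $ 2 $ 2) 0 0 (h $ 2 $ 2)" and ?h = "mat2 (slope h) (shift h) 0 1"
  have hb: "h \<in> borel_set" "unit (slope h)" "shift h \<in> A" using h unfolding H_iff by auto
  have e: "h $ 2 $ 1 = 0" "h $ 1 $ 1 \<noteq> 0" "h $ 2 $ 2 \<noteq> 0" using hb(1) unfolding borel_iff by auto
  have zb: "?z \<in> borel_set" "?h \<in> borel_set" using e hb(2) unfolding borel_iff unit_def by auto
  have hz: "h = ?z ** ?h" unfolding matrix_eq_iff_entries using e by (simp add: mult_nth slope_def shift_def)
  have HA: "?h \<in> H_A" unfolding H_A_def H_iff using zb(2) hb unit_one by (simp add: slope_def[of ?h] shift_def[of ?h])
  have comm: "k ** ?z = ?z ** k" unfolding matrix_eq_iff_entries by (simp add: mult_nth mult.commute)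
  have "ginv h ** k ** h = ginv ?h ** ginv ?z ** k ** (?z ** ?h)"
    using hz ginv_prod[OF borel_GL2[OF zb(1)] borel_GL2[OF zb(2)]] by metis
  also have "\<dots> = ginv ?h ** (ginv ?z ** (k ** ?z)) ** ?h" by (simp add: matrix_mul_assoc)
  also have "\<dots> = ginv ?h ** k ** ?h" unfolding comm using ginv_cancel(1)[OF borel_GL2[OF zb(1)]] by simp
  finally show ?thesis
    using K_conj[OF k ginv_mult(1)[OF borel_GL2[OF zb(2)]] H_A_ginv[OF HA] H_A_entries[OF HA]] by simp
qed

lemma ginv_ut_0: "ginv (ut 0) = mat2 (1 / \<pi>) 0 0 1"
  by (rule ginv_unique) (use borel_GL2[OF ut_borel] pi_nonzero in \<open>auto simp: ut_def carrier_GL2 det_2 matrix_eq_iff_entries mult_nth\<close>)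

lemma ut_conj: "ginv (ut x) ** k ** ut x = ginv (ut 0) ** (ginv (uu x) ** k ** uu x) ** ut 0"
  unfolding ginv_ut[of x] uu_ginv by (simp add: uu_ut(2)[symmetric, of x] matrix_mul_assoc del: uu_ut(2))

text \<open>After the integral unipotent factor is removed, conjugation by t^-1 divides the upper
  right entry by pi; this costs one level.\<close>

lemma K_conj_ut: assumes k: "k \<in> K (Suc l)" and x: "x \<in> A" shows "ginv (ut x) ** k ** ut x \<in> K l"
proof -
  let ?k = "ginv (uu x) ** k ** uu x"
  have k': "?k $ 1 $ 1 - 1 \<in> pw (Suc l)" "?k $ 1 $ 2 \<in> pw (Suc l)" "?k $ 2 $ 1 \<in> pw (Suc l)" "?k $ 2 $ 2 - 1 \<in> pw (Suc l)"
    using K_conj_H[OF uu_H[OF x] k] unfolding K_iff by auto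
  have "?k $ 1 $ 2 / \<pi> \<in> pw l" using k'(2) unfolding pw_iff by (simp add: mult.commute)
  moreover have "?k $ 2 $ 1 * \<pi> \<in> pw l" using pw_mult_A(1)[OF pw_antimono[OF _ k'(3)] pi_in, of l] by simp
  ultimately show ?thesis
    unfolding ut_conj K_iff ginv_ut_0 using pw_antimono[OF _ k'(1), of l] pw_antimono[OF _ k'(4), of l] pi_nonzero
    by (simp add: mult_nth[of "_ ** ?k"] mult_nth[of "mat2 _ _ _ _"] mult_nth[of _ "ut 0"] ut_def)
qed

text \<open>Conjugation by \<open>t\<close> enlarges only the upper right entry, which splits off as a unipotent factor.\<close>

lemma K_conj_ut_split:
  assumes k: "k \<in> K (Suc l)" and x: "x \<in> A"
  shows "\<exists>y\<in>pw l. \<exists>k'\<in>K (Suc l). ginv (ut x) ** k ** ut x = uu y ** k'"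
proof -
  let ?k = "ginv (uu x) ** k ** uu x"
  let ?M = "ginv (ut x) ** k ** ut x"
  have kK: "?k \<in> K (Suc l)" by (rule K_conj_H[OF uu_H[OF x] k])
  then have k': "?k $ 1 $ 1 - 1 \<in> pw (Suc l)" "?k $ 1 $ 2 \<in> pw (Suc l)" "?k $ 2 $ 1 \<in> pw (Suc l)" "?k $ 2 $ 2 - 1 \<in> pw (Suc l)"
    unfolding K_iff by auto
  have M: "?M $ 1 $ 1 = ?k $ 1 $ 1" "?M $ 1 $ 2 = ?k $ 1 $ 2 / \<pi>" "?M $ 2 $ 1 = ?k $ 2 $ 1 * \<pi>" "?M $ 2 $ 2 = ?k $ 2 $ 2"
    unfolding ut_conj ginv_ut_0 using pi_nonzero
    by (simp_all add: mult_nth[of "_ ** ?k"] mult_nth[of "mat2 _ _ _ _"] mult_nth[of _ "ut 0"] ut_def)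
  have d: "unit (?k $ 2 $ 2)"
    using unit_add_pw[OF unit_one pw_antimono[OF _ k'(4), of 1]] by simp
  define y where "y = ?k $ 1 $ 2 / \<pi> * inverse (?k $ 2 $ 2)"
  have "?k $ 1 $ 2 / \<pi> \<in> pw l" using k'(2) unfolding pw_iff by (simp add: mult.commute)
  then have y: "y \<in> pw l" unfolding y_def using d unfolding unit_def by (intro pw_mult_A) auto
  let ?k' = "uu (- y) ** ?M"
  have yd: "y * ?k $ 2 $ 2 = ?k $ 1 $ 2 / \<pi>" unfolding y_def using d unfolding unit_def by simp
  have "?k' $ 1 $ 1 = ?k $ 1 $ 1 - y * (?k $ 2 $ 1 * \<pi>)" "?k' $ 1 $ 2 = 0" "?k' $ 2 $ 1 = ?k $ 2 $ 1 * \<pi>" "?k' $ 2 $ 2 = ?k $ 2 $ 2"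
    unfolding mult_nth[of "uu _"] M using yd by (simp_all add: uu_def)
  moreover have c: "?k $ 2 $ 1 * \<pi> \<in> pw (Suc l)" by (rule pw_mult_A(1)[OF k'(3) pi_in])
  moreover have "?k $ 1 $ 1 - y * (?k $ 2 $ 1 * \<pi>) - 1 \<in> pw (Suc l)"
    using pw_diff[OF k'(1) pw_mult_A(2)[OF c pw_in[OF y]]] by (simp add: algebra_simps)
  ultimately have "?k' \<in> K (Suc l)" unfolding K_iff using k'(4) by (simp add: pw_zero)
  moreover have "?M = uu y ** ?k'" using ginv_cancel(2)[OF borel_GL2[OF uu_borel], of y ?M] unfolding uu_ginv by simp
  ultimately show ?thesis using y by blast
qed

end

text \<open>The action of G is a separate map \<open>\<rho>\<close>, because nothing is assumed
  about \<open>act V\<close> outside the Borel subgroup.\<close>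

locale admissible_rep = presented_rep +
  fixes \<rho> :: "'a^2^2 \<Rightarrow> 'c \<Rightarrow> 'c"
  assumes \<rho>_borel: "\<lbrakk>b \<in> borel_set; v \<in> carrier V\<rbrakk> \<Longrightarrow> \<rho> b v = act V b v"
    and admissible: "admissible R GL2 T (V\<lparr>act := \<rho>\<rparr>)"
begin

lemma G_rep: "smooth_rep R GL2 T (V\<lparr>act := \<rho>\<rparr>)" using admissible unfolding admissible_def by blast

lemma \<rho>_in: "\<lbrakk>g \<in> carrier GL2; v \<in> carrier V\<rbrakk> \<Longrightarrow> \<rho> g v \<in> carrier V"
  and \<rho>_add: "\<lbrakk>g \<in> carrier GL2; v \<in> carrier V; w \<in> carrier V\<rbrakk> \<Longrightarrow> \<rho> g (v \<oplus> w) = \<rho> g v \<oplus> \<rho> g w"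
  and \<rho>_smult: "\<lbrakk>g \<in> carrier GL2; r \<in> carrier R; v \<in> carrier V\<rbrakk> \<Longrightarrow> \<rho> g (r \<odot> v) = r \<odot> \<rho> g v"
  and \<rho>_mult: "\<lbrakk>g \<in> carrier GL2; h \<in> carrier GL2; v \<in> carrier V\<rbrakk> \<Longrightarrow> \<rho> (g ** h) v = \<rho> g (\<rho> h v)"
  using smooth_rep.act_closed[OF G_rep] smooth_rep.act_add[OF G_rep] smooth_rep.act_smult[OF G_rep] smooth_rep.act_mult[OF G_rep]
  by simp_all

lemma submodule_act_update: "submodule N R (V\<lparr>act := \<rho>\<rparr>) \<longleftrightarrow> submodule N R V"
  unfolding submodule_def submodule_axioms_def by simp

section \<open>Vectors fixed by a congruence subgroup\<close>

definition Fix :: "nat \<Rightarrow> 'c set" where "Fix j = {v \<in> carrier V. \<forall>k\<in>K j. \<rho> k v = v}"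

lemma Fix_carrier: "v \<in> Fix j \<Longrightarrow> v \<in> carrier V" unfolding Fix_def by blast

lemma Fix_mono: "\<lbrakk>i \<le> j; v \<in> Fix i\<rbrakk> \<Longrightarrow> v \<in> Fix j"
  unfolding Fix_def using K_antimono[of i j] by blast

lemma \<rho>_zero: "g \<in> carrier GL2 \<Longrightarrow> \<rho> g \<zero> = \<zero>"
  using \<rho>_smult[of g "\<zero>\<^bsub>R\<^esub>" "\<zero>"] \<rho>_in[of g "\<zero>"] by simp

lemma Fix_sub: "j \<ge> 1 \<Longrightarrow> submodule (Fix j) R V"
  by (rule submoduleI') (auto simp: Fix_def \<rho>_zero \<rho>_add \<rho>_smult K_GL2)

lemma Fix_fg: assumes j: "j \<ge> 1" shows "fg R V (Fix j)"
proof -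
  have "fixed_vectors (V\<lparr>act := \<rho>\<rparr>) (K j) = Fix j" unfolding fixed_vectors_def Fix_def by simp
  then show ?thesis
    using admissible subgroup_K[OF j] compact_K[OF j] open_K[OF j]
    unfolding admissible_def fg_def submodule_act_update by metis
qed

lemma Fix_exists: assumes v: "v \<in> carrier V" shows "\<exists>j\<ge>1. v \<in> Fix j"
proof -
  interpret G: smooth_rep R GL2 T "V\<lparr>act := \<rho>\<rparr>" by (rule G_rep)
  have o: "openin (subtopology T (carrier GL2)) {h \<in> carrier GL2. \<rho> h v = v}" using G.smooth[of v] v by simp
  have "mat 1 \<in> {h \<in> carrier GL2. \<rho> h v = v}" using G.act_one[of v] v borel_GL2[OF borel_one] by simp
  then obtain k where k: "\<And>N. \<lbrakk>N \<in> carrier GL2; near k (mat 1) N\<rbrakk> \<Longrightarrow> \<rho> N v = v"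
    using o unfolding openin_sub_iff by blast
  have "v \<in> Fix (max 1 k)"
  proof -
    have "\<rho> N v = v" if N: "N \<in> K (max 1 k)" for N
    proof (rule k)
      show "N \<in> carrier GL2" by (rule K_GL2[OF N]) simp
      show "near k (mat 1) N" using K_antimono[of k "max 1 k"] N unfolding K_def by auto
    qed
    then show ?thesis unfolding Fix_def using v by blast
  qed
  then show ?thesis by (meson max.cobounded1)
qed

lemma Fix_exists_finite: "\<lbrakk>finite W; W \<subseteq> carrier V\<rbrakk> \<Longrightarrow> \<exists>j\<ge>1. W \<subseteq> Fix j"
proof (induction W rule: finite_induct)
  case empty
  show ?case by auto
next
  case (insert w W)
  then obtain j where j: "j \<ge> 1" "W \<subseteq> Fix j" by auto
  obtain i where i: "i \<ge> 1" "w \<in> Fix i" using Fix_exists insert.prems by blast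
  then have "insert w W \<subseteq> Fix (max i j)" using j Fix_mono[of i "max i j"] Fix_mono[of j "max i j"] by auto
  then show ?case using i(1) by (intro exI[of _ "max i j"]) auto
qed

lemma \<rho>_conj:
  assumes g: "g \<in> borel_set" and k: "k \<in> carrier GL2" and v: "v \<in> carrier V"
    and fixed: "\<rho> (ginv g ** k ** g) v = v"
  shows "\<rho> k (act V g v) = act V g v"
proof -
  have gG: "g \<in> carrier GL2" using borel_GL2 g .
  have "k ** g = g ** (ginv g ** k ** g)" using ginv_cancel(2)[OF gG] by (simp flip: matrix_mul_assoc)
  moreover have "ginv g ** k ** g \<in> carrier GL2" by (intro GL2_mult_closed ginv_closed gG k)
  ultimately have "\<rho> k (\<rho> g v) = \<rho> g (\<rho> (ginv g ** k ** g) v)"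
    using \<rho>_mult[OF k gG v] \<rho>_mult[OF gG _ v, of "ginv g ** k ** g"] by simp
  then show ?thesis using \<rho>_borel[OF g v] fixed by simp
qed

lemma Fix_H: assumes j: "j \<ge> 1" and h: "h \<in> H" and v: "v \<in> Fix j" shows "act V h v \<in> Fix j"
proof -
  note vc = Fix_carrier[OF v]
  have "\<rho> k (act V h v) = act V h v" if k: "k \<in> K j" for k
    by (rule \<rho>_conj[OF H_borel[OF h] K_GL2[OF k j] vc]) (use v K_conj_H[OF h k] Fix_def in blast)
  then show ?thesis unfolding Fix_def using act_in[OF H_borel[OF h] vc] by blast
qed

lemma Fix_ut: assumes x: "x \<in> A" and v: "v \<in> Fix j" shows "act V (ut x) v \<in> Fix (Suc j)"
proof -
  note vc = Fix_carrier[OF v]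
  have "\<rho> k (act V (ut x) v) = act V (ut x) v" if k: "k \<in> K (Suc j)" for k
    by (rule \<rho>_conj[OF ut_borel K_GL2[OF k] vc]) (use v K_conj_ut[OF k x] Fix_def in auto)
  then show ?thesis unfolding Fix_def using act_in[OF ut_borel vc] by blast
qed

text \<open>In contrast to \<open>Fix_ut\<close> the level does not rise: conjugation by
  \<open>ut x\<close> produces only a unipotent factor of lower level, and v is assumed to be fixed
  by it.\<close>

lemma Fix_ut_unipotent:
  assumes x: "x \<in> A" and v: "v \<in> Fix (Suc l)" and u: "\<And>y. y \<in> pw l \<Longrightarrow> act V (uu y) v = v"
  shows "act V (ut x) v \<in> Fix (Suc l)"
proof -
  note vc = Fix_carrier[OF v]
  have "\<rho> k (act V (ut x) v) = act V (ut x) v" if k: "k \<in> K (Suc l)" for k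
  proof (rule \<rho>_conj[OF ut_borel K_GL2[OF k] vc])
    obtain y k' where yk: "y \<in> pw l" "k' \<in> K (Suc l)" "ginv (ut x) ** k ** ut x = uu y ** k'"
      using K_conj_ut_split[OF k x] by blast
    have "\<rho> k' v = v" using v yk(2) unfolding Fix_def by blast
    then show "\<rho> (ginv (ut x) ** k ** ut x) v = v"
      unfolding yk(3) using \<rho>_mult[OF borel_GL2[OF uu_borel] K_GL2[OF yk(2)] vc] \<rho>_borel[OF uu_borel vc] u[OF yk(1)] by simp
  qed simp
  then show ?thesis unfolding Fix_def using act_in[OF ut_borel vc] by blast
qed

text \<open>On vectors fixed by U0 this is the Hecke operator of the double coset U0 t U0.\<close>

definition F :: "'c \<Rightarrow> 'c" where "F v = (\<Oplus>x\<in>\<tau>s. act V (ut x) v)"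

lemma F_in: "v \<in> carrier V \<Longrightarrow> F v \<in> carrier V"
  unfolding F_def using act_in[OF ut_borel] by (intro M.finsum_closed) auto

lemma F_add: assumes "v \<in> carrier V" "w \<in> carrier V" shows "F (v \<oplus> w) = F v \<oplus> F w"
proof -
  have "(\<Oplus>x\<in>\<tau>s. act V (ut x) (v \<oplus> w)) = (\<Oplus>x\<in>\<tau>s. act V (ut x) v \<oplus> act V (ut x) w)"
    using act_plus[OF ut_borel assms] by simp
  also have "\<dots> = F v \<oplus> F w" unfolding F_def using act_in[OF ut_borel] assms by (intro M.finsum_addf) auto
  finally show ?thesis unfolding F_def .
qed

lemma F_smult: assumes "r \<in> carrier R" "v \<in> carrier V" shows "F (r \<odot> v) = r \<odot> F v"
proof -
  have "(\<Oplus>x\<in>\<tau>s. act V (ut x) (r \<odot> v)) = (\<Oplus>x\<in>\<tau>s. r \<odot> act V (ut x) v)"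
    using act_scalar[OF ut_borel assms] by simp
  also have "\<dots> = r \<odot> F v" unfolding F_def using act_in[OF ut_borel] assms \<tau>s_finite by (intro finsum_smult_ldistr[symmetric]) auto
  finally show ?thesis unfolding F_def .
qed

lemma F_pow_in: "v \<in> carrier V \<Longrightarrow> (F ^^ k) v \<in> carrier V" by (induction k) (auto simp: F_in)

lemma F_pow_add: "\<lbrakk>v \<in> carrier V; w \<in> carrier V\<rbrakk> \<Longrightarrow> (F ^^ k) (v \<oplus> w) = (F ^^ k) v \<oplus> (F ^^ k) w"
  by (induction k) (auto simp: F_add F_pow_in)

lemma F_pow_smult: "\<lbrakk>r \<in> carrier R; v \<in> carrier V\<rbrakk> \<Longrightarrow> (F ^^ k) (r \<odot> v) = r \<odot> (F ^^ k) v"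
  by (induction k) (auto simp: F_smult F_pow_in)

lemma F_pow_minus: assumes "v \<in> carrier V" "w \<in> carrier V" shows "(F ^^ k) (v \<ominus> w) = (F ^^ k) v \<ominus> (F ^^ k) w"
proof -
  have "(F ^^ k) (v \<ominus> w) \<oplus> (F ^^ k) w = (F ^^ k) v"
    using F_pow_add[of "v \<ominus> w" w k] minus_add_cancel assms by simp
  then show ?thesis using add_minus_cancel[of "(F ^^ k) (v \<ominus> w)" "(F ^^ k) w"] F_pow_in assms by simp
qed

lemma F_Fix: assumes "v \<in> Fix j" shows "F v \<in> Fix (Suc j)"
  unfolding F_def using Fix_ut[OF \<tau>s_in assms] by (intro finsum_in[OF Fix_sub \<tau>s_finite]) auto

lemma F_pow_Fix: "v \<in> Fix j \<Longrightarrow> (F ^^ k) v \<in> Fix (j + k)"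
  by (induction k) (auto simp: F_Fix)

lemma uu_F: assumes v: "v \<in> carrier V" shows "act V (uu (\<pi> * y)) (F v) = F (act V (uu y) v)"
proof -
  have "act V (uu (\<pi> * y)) (F v) = (\<Oplus>x\<in>\<tau>s. act V (uu (\<pi> * y)) (act V (ut x) v))"
    unfolding F_def by (rule act_finsum[OF \<tau>s_finite uu_borel act_in[OF ut_borel v]])
  also have "\<dots> = F (act V (uu y) v)"
    unfolding F_def using act_comp[OF uu_borel ut_borel v] act_comp[OF ut_borel uu_borel v] uu_ut(1) by metis
  finally show ?thesis .
qed

lemma uu_F_pow: "v \<in> carrier V \<Longrightarrow> act V (uu (\<pi> ^ k * y)) ((F ^^ k) v) = (F ^^ k) (act V (uu y) v)"
proof (induction k)
  case 0
  then show ?case by simp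
next
  case (Suc k)
  have "act V (uu (\<pi> * (\<pi> ^ k * y))) (F ((F ^^ k) v)) = F (act V (uu (\<pi> ^ k * y)) ((F ^^ k) v))"
    by (rule uu_F[OF F_pow_in[OF Suc.prems]])
  then show ?case using Suc by (simp add: mult.assoc)
qed

section \<open>Vectors fixed by U0 modulo Delta\<close>

definition unip :: "'c \<Rightarrow> bool" where
  "unip d \<longleftrightarrow> (\<forall>y\<in>A. act V (uu y) d \<ominus> d \<in> \<Delta>)"

text \<open>A vector of \<open>\<langle>B\<^sup>+ V0\<rangle>\<close> fixed by \<open>U0\<close> modulo \<open>\<Delta>\<close> has, modulo \<open>\<Delta>\<close>, the same coordinates along
  all \<open>u t\<close>; so up to a bounded term it is of the form \<open>F d'\<close>, and \<open>d'\<close> inherits the property.\<close>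

lemma unip_step:
  assumes d: "d \<in> Vl (Suc n)" and u: "unip d"
  shows "\<exists>d'\<in>Vl n. unip d' \<and> (\<exists>v0\<in>V0. \<exists>\<delta>. (\<forall>x\<in>\<tau>s. \<delta> x \<in> \<Delta>) \<and>
    d = (v0 \<oplus> (\<Oplus>x\<in>\<tau>s. act V (ut x) (\<delta> x))) \<oplus> F d')"
proof -
  obtain v0 e where e: "v0 \<in> V0" "\<forall>x\<in>\<tau>s. e x \<in> Vl n" "d = v0 \<oplus> (\<Oplus>x\<in>\<tau>s. act V (ut x) (e x))"
    using Vl_decomp[OF d] by blast
  have dc: "d \<in> carrier V" using d Vl_sub submodule_subset by blast
  have v0c: "v0 \<in> carrier V" using e(1) V0_carrier by blast
  have eVp: "e x \<in> Vp" and ec: "e x \<in> carrier V" if "x \<in> \<tau>s" for x using e(2) Vl_Vp Vp_carrier that by blast+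
  have trans: "a \<ominus> c \<in> Vm" if "a \<ominus> b \<in> Vm" "b \<ominus> c \<in> Vm" "a \<in> carrier V" "b \<in> carrier V" "c \<in> carrier V" for a b c
    using submoduleE(5)[OF Vm_sub that(1,2)] diff_trans[OF that(3-5)] by simp
  have sym: "b \<ominus> a \<in> Vm" if "a \<ominus> b \<in> Vm" "a \<in> carrier V" "b \<in> carrier V" for a b
    using diff_swap_in[OF Vm_sub that] .
  have tb: "ginv (ut x) \<in> borel_set" for x using borel_ginv[OF ut_borel] .
  have ud: "act V (uu y) d \<ominus> d \<in> Vm" if "y \<in> A" for y using u that unfolding unip_def \<Delta>_def by blast
  define g where "g = act V (ginv (ut 0)) d"
  have gc: "g \<in> carrier V" unfolding g_def using act_in[OF tb dc] .
  have proj: "act V (ginv (ut x)) d \<ominus> e x \<in> Vm" if "x \<in> \<tau>s" for x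
    unfolding e(3) by (rule ut_projection[OF e(1) eVp that])
  have t_inv: "act V (ginv (ut 0)) (act V (uu y) d) \<ominus> g \<in> Vm" if "y \<in> A" for y
    unfolding g_def by (rule act_diff_in[OF tb act_in[OF uu_borel dc] dc ud[OF that] ut_inverse_Vm[OF \<tau>s_zero]])
  \<comment> \<open>The inverse of \<open>ut x\<close> is t^-1 times the unipotent element with
    entry - x, and that element fixes d modulo V^-. So all coordinates agree with g modulo
    V^-.\<close>
  have eg: "e x \<ominus> g \<in> Vm" if x: "x \<in> \<tau>s" for x
  proof (rule trans[OF sym[OF proj[OF x] act_in[OF tb dc] ec[OF x]] _ ec[OF x] act_in[OF tb dc] gc])
    show "act V (ginv (ut x)) d \<ominus> g \<in> Vm"
      using t_inv[OF uminus_in[OF \<tau>s_in[OF x]]] act_comp[OF tb uu_borel dc] unfolding ginv_ut[of x] by simp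
  qed
  \<comment> \<open>The coordinate at 0, where \<open>ut 0\<close> is t itself; it represents g
    inside V^+.\<close>
  define d' where "d' = e 0"
  have d': "d' \<in> Vl n" "d' \<in> Vp" "d' \<in> carrier V" "d' \<ominus> g \<in> Vm" unfolding d'_def using e(2) eVp ec eg \<tau>s_zero by auto
  define \<delta> where "\<delta> x = e x \<ominus> d'" for x
  have \<delta>: "\<delta> x \<in> \<Delta>" if x: "x \<in> \<tau>s" for x
    unfolding \<Delta>_def \<delta>_def using submodule_minus[OF Vp_sub eVp[OF x] d'(2)]
      trans[OF eg[OF x] sym[OF d'(4,3) gc] ec[OF x] gc d'(3)] by blast
  have "act V (uu y) d' \<ominus> d' \<in> \<Delta>" if y: "y \<in> A" for y
  proof -
    have c: "act V (uu y) d' \<in> carrier V" "act V (uu y) g \<in> carrier V" using act_in[OF uu_borel] d' gc by auto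
    have 1: "act V (uu y) d' \<ominus> act V (uu y) g \<in> Vm"
      by (rule act_diff_in[OF uu_borel d'(3) gc d'(4) Vm_H[OF uu_H[OF y]]])
    \<comment> \<open>Moving t^-1 to the left turns the entry y into pi y, which is again
      integral.\<close>
    have "act V (uu y) g = act V (ginv (ut 0)) (act V (uu (\<pi> * y)) d)"
      unfolding g_def using act_comp[OF uu_borel tb dc, of y 0] act_comp[OF tb uu_borel dc, of 0 "\<pi> * y"] uu_ginv_ut by simp
    then have 2: "act V (uu y) g \<ominus> g \<in> Vm" using t_inv[OF mult_in[OF pi_in y]] by simp
    have "act V (uu y) d' \<ominus> d' \<in> Vm"
      using trans[OF trans[OF 1 2 c gc] sym[OF d'(4,3) gc] c(1) gc d'(3)] .
    moreover have "act V (uu y) d' \<ominus> d' \<in> Vp"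
      using submodule_minus[OF Vp_sub Vp_H[OF uu_H[OF y] d'(2)] d'(2)] .
    ultimately show ?thesis unfolding \<Delta>_def by blast
  qed
  then have "unip d'" unfolding unip_def by blast
  moreover have "d = (v0 \<oplus> (\<Oplus>x\<in>\<tau>s. act V (ut x) (\<delta> x))) \<oplus> F d'"
  proof -
    have \<delta>c: "\<delta> x \<in> carrier V" if "x \<in> \<tau>s" for x unfolding \<delta>_def using ec[OF that] d'(3) by simp
    have a: "act V (ut x) (\<delta> x) \<in> carrier V" "act V (ut x) d' \<in> carrier V" if "x \<in> \<tau>s" for x
      using act_in[OF ut_borel] \<delta>c[OF that] d'(3) by auto
    have "act V (ut x) (e x) = act V (ut x) (\<delta> x) \<oplus> act V (ut x) d'" if "x \<in> \<tau>s" for x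
      using act_plus[OF ut_borel \<delta>c[OF that] d'(3)] minus_add_cancel[OF ec[OF that] d'(3)] unfolding \<delta>_def by simp
    then have "(\<Oplus>x\<in>\<tau>s. act V (ut x) (e x)) = (\<Oplus>x\<in>\<tau>s. act V (ut x) (\<delta> x) \<oplus> act V (ut x) d')"
      using a by (intro M.finsum_cong') auto
    also have "\<dots> = (\<Oplus>x\<in>\<tau>s. act V (ut x) (\<delta> x)) \<oplus> F d'"
      unfolding F_def using a by (intro M.finsum_addf) auto
    finally show ?thesis unfolding e(3) using v0c a F_in[OF d'(3)] by (simp add: M.a_assoc M.finsum_closed Pi_iff)
  qed
  ultimately show ?thesis using d'(1) e(1) \<delta> by blast
qed

lemma fixed_in_Fix: "\<exists>l\<ge>1. \<forall>v\<in>Vp. (\<forall>y\<in>A. act V (uu y) v = v) \<longrightarrow> v \<in> Fix l"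
proof -
  obtain W where W: "finite W" "W \<subseteq> \<Delta>" "\<Delta> = sp H W" using \<Delta>_finite_type by blast
  have "finite (S0 \<union> W)" "S0 \<union> W \<subseteq> carrier V" using S0(1,2) W(1,2) V0_carrier submodule_subset[OF \<Delta>_sub] by auto
  then obtain m where m: "m \<ge> 1" "S0 \<union> W \<subseteq> Fix m" using Fix_exists_finite by blast
  have spFix: "sp H X \<subseteq> Fix m" if "X \<subseteq> Fix m" for X
    by (rule sp_minimal[OF Fix_sub[OF m(1)]]) (use Fix_H[OF m(1)] that in blast)
  have V0m: "V0 \<subseteq> Fix m" unfolding S0(3) by (rule spFix) (use m(2) in blast)
  have \<Delta>m: "\<Delta> \<subseteq> Fix m" unfolding W(3) by (rule spFix) (use m(2) in blast)
  \<comment> \<open>Since all of Delta has level m, it is finitely generated over o itself and not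
    only over H; this lets the kernels of the powers of F on Delta stabilise.\<close>
  have \<Delta>fg: "fg R V \<Delta>" by (rule fg_submodule[OF noetherian Fix_fg[OF m(1)] Fix_sub[OF m(1)] \<Delta>_sub \<Delta>m])
  have \<Delta>c: "\<delta> \<in> carrier V" if "\<delta> \<in> \<Delta>" for \<delta> using that submodule_subset[OF \<Delta>_sub] by blast
  let ?N = "\<lambda>k. {\<delta> \<in> \<Delta>. (F ^^ k) \<delta> = \<zero>}"
  have F0: "F \<zero> = \<zero>" unfolding F_def using act_zero[OF ut_borel] by simp
  have Fk0: "(F ^^ k) \<zero> = \<zero>" for k by (induction k) (auto simp: F0)
  have Nsub: "submodule (?N k) R V" for k
    by (rule submoduleI')
      (use \<Delta>c submodule_zero[OF \<Delta>_sub] submoduleE(4,5)[OF \<Delta>_sub] Fk0 in \<open>auto simp: F_pow_add F_pow_smult\<close>)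
  have "\<exists>e. \<forall>k. ?N k \<subseteq> ?N e"
    by (rule fg_chain_stable[OF noetherian \<Delta>fg \<Delta>_sub Nsub]) (auto simp: F0)
  then obtain e where e: "\<And>k. ?N k \<subseteq> ?N e" by blast
  \<comment> \<open>The level m belongs to V0 and Delta, one more is lost when \<open>ut x\<close>
    is applied to Delta, and e more when F^e is applied. The result will have level l + 1, one above
    the level of the unipotent elements that fix F^e d.\<close>
  define l where "l = m + 1 + e"
  \<comment> \<open>The property that survives unwinding. For a vector fixed by U0 the defects
    vanish and k = 0 works; each step d = q + F d' raises k by one. This growth is harmless, as a
    defect lies in Delta and is killed by F^e if by any power of F.\<close>
  define good where "good d \<longleftrightarrow> unip d \<and> (\<exists>k. \<forall>y\<in>pw (m + 1). (F ^^ k) (act V (uu y) d \<ominus> d) = \<zero>)" for d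
  have descend: "\<exists>d'\<in>Vl n. good d' \<and> (\<exists>q\<in>Fix (m + 1). d = q \<oplus> F d')" if d: "d \<in> Vl (Suc n)" and gd: "good d" for d n
  proof -
    obtain k where k: "\<And>y. y \<in> pw (m + 1) \<Longrightarrow> (F ^^ k) (act V (uu y) d \<ominus> d) = \<zero>" using gd unfolding good_def by blast
    obtain d' v0 \<delta> where d': "d' \<in> Vl n" "unip d'" "v0 \<in> V0" "\<forall>x\<in>\<tau>s. \<delta> x \<in> \<Delta>"
      "d = (v0 \<oplus> (\<Oplus>x\<in>\<tau>s. act V (ut x) (\<delta> x))) \<oplus> F d'"
      using unip_step[OF d] gd unfolding good_def by blast
    define q where "q = v0 \<oplus> (\<Oplus>x\<in>\<tau>s. act V (ut x) (\<delta> x))"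
    have sub: "submodule (Fix (m + 1)) R V" by (rule Fix_sub) simp
    have "v0 \<in> Fix (m + 1)" using Fix_mono[of m "m + 1"] V0m d'(3) by auto
    moreover have "(\<Oplus>x\<in>\<tau>s. act V (ut x) (\<delta> x)) \<in> Fix (m + 1)"
      using Fix_ut[OF \<tau>s_in] d'(4) \<Delta>m by (intro finsum_in[OF sub \<tau>s_finite]) auto
    ultimately have q: "q \<in> Fix (m + 1)" unfolding q_def using submoduleE(5)[OF sub] by blast
    note qc = Fix_carrier[OF q]
    have d'c: "d' \<in> carrier V" using d'(1) Vl_sub submodule_subset by blast
    have dq: "d = q \<oplus> F d'" unfolding q_def by (rule d'(5))
    \<comment> \<open>As pi y still has level m + 1, its unipotent element fixes q. Hence the defect
      of d at pi y is F applied to the defect of d' at y.\<close>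
    have "(F ^^ Suc k) (act V (uu y) d' \<ominus> d') = \<zero>" if y: "y \<in> pw (m + 1)" for y
    proof -
      have \<pi>y: "\<pi> * y \<in> pw (m + 1)" by (rule pw_mult_A(2)[OF y pi_in])
      have uc: "act V (uu y) d' \<in> carrier V" using act_in[OF uu_borel d'c] .
      have uq: "act V (uu (\<pi> * y)) q = q" using q uu_K[OF \<pi>y] \<rho>_borel[OF uu_borel qc] unfolding Fix_def by auto
      have "act V (uu (\<pi> * y)) d \<ominus> d = (q \<oplus> act V (uu (\<pi> * y)) (F d')) \<ominus> (q \<oplus> F d')"
        unfolding dq using act_plus[OF uu_borel qc F_in[OF d'c]] uq by simp
      also have "\<dots> = F (act V (uu y) d') \<ominus> F d'"
        using diff_add[OF qc qc F_in[OF uc] F_in[OF d'c]] minus_self[OF qc] F_in[OF uc] F_in[OF d'c] uu_F[OF d'c] by simp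
      also have "\<dots> = F (act V (uu y) d' \<ominus> d')" using F_pow_minus[OF uc d'c, of 1] by simp
      finally show ?thesis using k[OF \<pi>y] by (simp add: funpow_Suc_right del: funpow.simps)
    qed
    then have "good d'" unfolding good_def using d'(2) by blast
    then show ?thesis using d'(1) q dq by blast
  qed
  have Vlc: "d \<in> carrier V" if "d \<in> Vl n" for d n using that Vl_sub submodule_subset by blast
  have low: "(F ^^ i) q \<in> Fix (Suc l)" if "q \<in> Fix (m + 1)" "i \<le> e" for i q
    by (rule Fix_mono[OF _ F_pow_Fix[OF that(1)]]) (use that(2) l_def in simp)
  have lsub: "submodule (Fix (Suc l)) R V" by (rule Fix_sub) simp
  have F_e: "(F ^^ e) d \<in> Fix (Suc l)" if "d \<in> Vl n" "good d" for d n
    using that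
  proof (induction n arbitrary: d)
    case 0
    then have "d \<in> Fix (m + 1)" using Fix_mono[of m "m + 1"] Vl_0 V0m by auto
    then show ?case using low by blast
  next
    case (Suc n)
    obtain d' q where d': "d' \<in> Vl n" "good d'" "q \<in> Fix (m + 1)" "d = q \<oplus> F d'" using descend[OF Suc.prems] by blast
    note d'c = Vlc[OF d'(1)]
    have IH: "(F ^^ e) d' \<in> Fix (Suc l)" using Suc.IH d' by blast
    have "act V (uu y) ((F ^^ e) d') = (F ^^ e) d'" if y: "y \<in> pw l" for y
    proof -
      \<comment> \<open>The entry y of level l is pi^e times an entry y0 of level m + 1. Moving the
        unipotent element past F^e turns y into y0, and F^e kills the defect of d' at y0.\<close>
      obtain b where b: "b \<in> A" "y = \<pi> ^ l * b" using y unfolding pw_def by blast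
      define y0 where "y0 = \<pi> ^ (m + 1) * b"
      have "y0 \<in> pw (m + 1)" unfolding y0_def by (rule pwI[OF b(1)])
      moreover have "y = \<pi> ^ e * y0" unfolding y0_def b(2) l_def by (simp add: power_add mult_ac)
      ultimately have y0: "y0 \<in> pw (m + 1)" "y0 \<in> A" "y = \<pi> ^ e * y0" using pw_in by auto
      have uc: "act V (uu y0) d' \<in> carrier V" using act_in[OF uu_borel d'c] .
      have "act V (uu y0) d' \<ominus> d' \<in> \<Delta>" using d'(2) y0(2) unfolding good_def unip_def by blast
      moreover obtain k where "(F ^^ k) (act V (uu y0) d' \<ominus> d') = \<zero>" using d'(2) y0(1) unfolding good_def by blast
      ultimately have "(F ^^ e) (act V (uu y0) d' \<ominus> d') = \<zero>" using e[of k] by blast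
      then have "(F ^^ e) (act V (uu y0) d') = (F ^^ e) d'"
        using F_pow_minus[OF uc d'c] minus_eq_zeroD F_pow_in uc d'c by metis
      then show ?thesis unfolding y0(3) using uu_F_pow[OF d'c] by simp
    qed
    then have "F ((F ^^ e) d') \<in> Fix (Suc l)"
      unfolding F_def[of "(F ^^ e) d'"] using Fix_ut_unipotent[OF \<tau>s_in IH] by (intro finsum_in[OF lsub \<tau>s_finite]) blast
    moreover have "(F ^^ e) d = (F ^^ e) q \<oplus> F ((F ^^ e) d')"
      unfolding d'(4) using F_pow_add[OF Fix_carrier[OF d'(3)] F_in[OF d'c], of e] by (simp add: funpow_swap1)
    ultimately show ?case using submoduleE(5)[OF lsub low[OF d'(3) order_refl]] by simp
  qed
  \<comment> \<open>Lowers the exponent from e to 0: F^i d is F^i q plus F^(i + 1) d', and the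
    induction hypothesis holds for all good vectors, in particular for d'.\<close>
  have F_i: "(F ^^ i) d \<in> Fix (Suc l)" if "i \<le> e" "d \<in> Vl n" "good d" for i d n
    using that
  proof (induction i arbitrary: d n rule: inc_induct)
    case base
    then show ?case using F_e by blast
  next
    case (step i)
    \<comment> \<open>Regarded at depth n + 1, the vector d unwinds to a vector d' of depth n even
      if n = 0.\<close>
    have "d \<in> Vl (Suc n)" using step.prems(1) Vl_mono by blast
    then obtain d' q where d': "d' \<in> Vl n" "good d'" "q \<in> Fix (m + 1)" "d = q \<oplus> F d'" using descend step.prems(2) by blast
    have "(F ^^ i) d = (F ^^ i) q \<oplus> (F ^^ Suc i) d'"
      unfolding d'(4) using F_pow_add[OF Fix_carrier[OF d'(3)] F_in[OF Vlc[OF d'(1)]], of i] by (simp add: funpow_swap1)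
    then show ?case using submoduleE(5)[OF lsub low[OF d'(3)] step.IH[OF d'(1,2)]] step.hyps by simp
  qed
  have "v \<in> Fix (Suc l)" if v: "v \<in> Vp" "\<forall>y\<in>A. act V (uu y) v = v" for v
  proof -
    have "act V (uu y) v \<ominus> v = \<zero>" if "y \<in> A" for y using v that minus_self[OF Vp_carrier[OF v(1)]] by simp
    then have "unip v" "\<forall>y\<in>pw (m + 1). (F ^^ 0) (act V (uu y) v \<ominus> v) = \<zero>"
      unfolding unip_def using submodule_zero[OF \<Delta>_sub] pw_in by auto
    then have "good v" unfolding good_def by blast
    moreover obtain n where "v \<in> Vl n" using Vp_level[OF v(1)] by blast
    ultimately show ?thesis using F_i[of 0 v n] by simp
  qed
  then show ?thesis by (intro exI[of _ "Suc l"]) simp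
qed

text \<open>All vectors in question have a common level, so by admissibility they form a finitely
  generated o-module; its generators also generate it over H.\<close>

lemma fixed_finite_type: "smooth_tf R (GL2_on H) T (V \<downharpoonright> fixed_vectors (V \<downharpoonright> Vp) (U0 A))"
proof -
  let ?M = "fixed_vectors (V \<downharpoonright> Vp) (U0 A)"
  have M: "v \<in> ?M \<longleftrightarrow> v \<in> Vp \<and> (\<forall>y\<in>A. act V (uu y) v = v)" for v
    unfolding fixed_vectors_def U0_def uu_def by auto
  have Msub: "submodule ?M R V"
    by (rule submoduleI')
      (use Vp_carrier submodule_zero[OF Vp_sub] submoduleE(4,5)[OF Vp_sub] act_zero[OF uu_borel] act_plus[OF uu_borel] act_scalar[OF uu_borel] in \<open>auto simp: M\<close>)
  have MH: "act V h v \<in> ?M" if h: "h \<in> H" and v: "v \<in> ?M" for h v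
  proof -
    have v': "v \<in> Vp" "v \<in> carrier V" "\<And>y. y \<in> A \<Longrightarrow> act V (uu y) v = v" using v M Vp_carrier by auto
    \<comment> \<open>H normalises U0: the entry y is divided by the slope of h, which is a
      unit.\<close>
    have "act V (uu y) (act V h v) = act V h v" if y: "y \<in> A" for y
    proof -
      have "y / slope h \<in> A" using unit_divide_in[OF y] h unfolding H_iff by blast
      then have "act V h (act V (uu (y / slope h)) v) = act V h v" using v'(3) by simp
      then show ?thesis
        using act_comp[OF uu_borel H_borel[OF h] v'(2), of y] act_comp[OF H_borel[OF h] uu_borel v'(2), of "y / slope h"] uu_H_commute[OF h, of y] by simp
    qed
    then show ?thesis unfolding M using Vp_H[OF h v'(1)] by blast
  qed
  obtain l where l1: "l \<ge> 1" "\<forall>v\<in>Vp. (\<forall>y\<in>A. act V (uu y) v = v) \<longrightarrow> v \<in> Fix l" using fixed_in_Fix by blast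
  then have l: "l \<ge> 1" "?M \<subseteq> Fix l" using M by auto
  have "fg R V ?M" by (rule fg_submodule[OF noetherian Fix_fg[OF l(1)] Fix_sub[OF l(1)] Msub l(2)])
  then obtain S where S: "finite S" "S \<subseteq> ?M" "mspan R V S = ?M" unfolding fg_def by blast
  have Sc: "S \<subseteq> carrier V" using S(2) Msub submodule_subset by blast
  have "?M \<subseteq> sp H S"
    unfolding S(3)[symmetric] by (rule mspan_minimal[OF sp_submodule[OF H_sub Sc] sp_id_subset[OF H_one Sc]])
  then show ?thesis using smooth_tf_sub[OF Msub MH S(1,2)] by blast
qed

end

section \<open>The theorem\<close>

lemma (in borel_rep) presented_rep_exists:
  assumes pres: "presenting_subrep R (GL2_on borel_set) T H V V0"
  shows "\<exists>S0. presented_rep A \<pi> R V V0 S0"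
proof -
  have on: "(GL2_on borel_set)\<lparr>carrier := H\<rparr> = GL2_on H" by simp
  have sub: "submodule V0 R V" and stable: "\<And>h v. \<lbrakk>h \<in> H; v \<in> V0\<rbrakk> \<Longrightarrow> act V h v \<in> V0"
    using pres unfolding presenting_subrep_def subrep_def by simp_all
  have ft: "finite_type R (GL2_on H) (V \<downharpoonright> V0)"
    using pres unfolding presenting_subrep_def on by blast
  obtain S0 where S0: "finite S0" "S0 \<subseteq> V0" "V0 = sp H S0" by (rule finite_type_subD[OF sub stable ft])
  have gen: "sp borel_set V0 = carrier V" and fin: "finite_presentation R (GL2_on borel_set) T H (V \<downharpoonright> V0) (natural_map (GL2_on borel_set) H V) V"
    using pres unfolding presenting_subrep_def GL2_on_simps by blast+
  have "presented_rep A \<pi> R V V0 S0"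
    by (rule presented_rep.intro[OF gen_rep.intro[OF borel_rep_axioms
      gen_rep_axioms.intro[OF sub stable S0 gen]] presented_rep_axioms.intro[OF fin]])
  then show ?thesis ..
qed

lemma base_field_cdvr:
  assumes "Factorial_Ring.prime p"
    and "padic_field_integers p A \<or> laurent_field_integers TYPE('k::{field,finite}) A \<and> (\<exists>n>0. CARD('k) = p ^ n)"
    and "uniformizer A \<pi>"
  shows "cdvr A \<pi>"
  using assms(2)
proof
  assume "padic_field_integers p A"
  then obtain A0 N where "padic_extension A0 p N" "A = integral_closure A0"
    using padic_field_integers_extension assms(1) by blast
  then show ?thesis using padic_extension.cdvr assms(3) by blast
next
  assume "laurent_field_integers TYPE('k) A \<and> (\<exists>n>0. CARD('k) = p ^ n)"
  then show ?thesis using laurent_cdvr assms(3) by blast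
qed

lemma (in cdvr) borel_rep_of_finitely_presented:
  assumes "noetherian_ring R" and V: "finitely_presented R (GL2_on borel_set) (matrix_topology A) (B0Z A) V"
  shows "borel_rep A \<pi> R V"
proof (rule borel_rep.intro[OF cdvr_axioms _ borel_rep_axioms.intro])
  show "smooth_rep R (GL2_on borel_set) (matrix_topology A) V" using V unfolding finitely_presented_def by (rule conjunct1)
qed fact

theorem mainTheorem2:
  fixes p :: nat
    and OF :: "'f::field set" and \<pi> :: 'f
    and OE :: "'e::field set"
    and R :: "'e ring" and T :: "('f^2^2) topology"
    and V :: "('e, 'v, 'f^2^2) rep" and V0 :: "'v set"
  assumes p: "Factorial_Ring.prime p"
    and F: "padic_field_integers p OF \<or>
      laurent_field_integers TYPE('k::{field,finite}) OF \<and> (\<exists>n>0. CARD('k) = p ^ n)"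
    and \<pi>: "uniformizer OF \<pi>"
    and E: "padic_field_integers p OE"
    and R: "R = subset_ring OE"
    and T: "T = matrix_topology OF"
    and V: "finitely_presented R (GL2_on borel_set) T (B0Z OF) V"
    and V0: "presenting_subrep R (GL2_on borel_set) T (B0Z OF) V V0"
  shows
    "(\<forall>V1. presenting_subrep R (GL2_on borel_set) T (B0Z OF) V V1
      \<longrightarrow> iso_mod_tf R (GL2_on (B0Z OF)) T
            (V \<downharpoonright> Vplus R OF \<pi> V V0) (V \<downharpoonright> Vplus R OF \<pi> V V1))
    \<and> smooth_tf R (GL2_on (B0Z OF)) T
      (V \<downharpoonright> Delta R OF \<pi> V V0)
    \<and> etale_mod_tf R OF \<pi> (D_rep R OF \<pi> V V0)
    \<and> (\<forall>(V' :: ('e, 'u, 'f^2^2) rep) (V'' :: ('e, 'w, 'f^2^2) rep) \<alpha> \<beta> V0' V0''.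
      finitely_presented R (GL2_on borel_set) T (B0Z OF) V' \<and>
      finitely_presented R (GL2_on borel_set) T (B0Z OF) V'' \<and>
      short_exact R (GL2_on borel_set) V' \<alpha> V \<beta> V'' \<and>
      presenting_subrep R (GL2_on borel_set) T (B0Z OF) V' V0' \<and>
      presenting_subrep R (GL2_on borel_set) T (B0Z OF) V'' V0'' \<and>
      short_exact R (GL2_on (B0Z OF)) (V' \<downharpoonright> V0') \<alpha> (V \<downharpoonright> V0) \<beta> (V'' \<downharpoonright> V0'')
      \<longrightarrow> short_exact_mod_tf R (GL2_on (B0Z OF)) T
            (V' \<downharpoonright> Vplus R OF \<pi> V' V0') \<alpha>
            (V \<downharpoonright> Vplus R OF \<pi> V V0) \<beta>
            (V'' \<downharpoonright> Vplus R OF \<pi> V'' V0''))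
    \<and> ((\<exists>\<rho>. (\<forall>b\<in>borel_set. \<forall>v\<in>carrier V. \<rho> b v = act V b v) \<and>
        admissible R GL2 T (V\<lparr>act := \<rho>\<rparr>))
      \<longrightarrow> smooth_tf R (GL2_on (B0Z OF)) T
            (V \<downharpoonright> fixed_vectors (V \<downharpoonright> Vplus R OF \<pi> V V0) (U0 OF)))"
proof -
  interpret cdvr OF \<pi> by (rule base_field_cdvr[OF p F \<pi>])
  have noeth: "noetherian_ring R" unfolding R by (rule noetherian_padic_integers(1)[OF p E])
  note rep = borel_rep_of_finitely_presented[OF noeth, folded T]
  interpret V: borel_rep OF \<pi> R V by (rule rep[OF V])
  obtain S0 where "presented_rep OF \<pi> R V V0 S0" using V.presented_rep_exists V0 unfolding T by blast
  then interpret V: presented_rep OF \<pi> R V V0 S0 .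
  have Vp: "Vplus R OF \<pi> V V0 = V.Vp" unfolding Vplus_def V.Vp_def ..
  have \<Delta>: "Delta R OF \<pi> V V0 = V.\<Delta>" unfolding Delta_def Vplus_def Vminus_def V.\<Delta>_def V.Vp_def V.Vm_def ..
  have a: "iso_mod_tf R (GL2_on (B0Z OF)) T (V \<downharpoonright> Vplus R OF \<pi> V V0) (V \<downharpoonright> Vplus R OF \<pi> V V1)"
    if V1: "presenting_subrep R (GL2_on borel_set) T (B0Z OF) V V1" for V1
  proof -
    obtain S1 where "presented_rep OF \<pi> R V V1 S1" using V.presented_rep_exists V1 unfolding T by blast
    then have "gen_rep OF \<pi> R V V1 S1" unfolding presented_rep_def by blast
    then show ?thesis unfolding Vp unfolding Vplus_def T by (rule V.Vplus_independent)
  qed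
  have b: "smooth_tf R (GL2_on (B0Z OF)) T (V \<downharpoonright> Delta R OF \<pi> V V0)"
  proof -
    obtain W where W: "finite W" "W \<subseteq> V.\<Delta>" "V.\<Delta> = V.sp (B0Z OF) W" using V.\<Delta>_finite_type by blast
    show ?thesis unfolding \<Delta> T by (rule V.smooth_tf_sub[OF V.\<Delta>_sub V.\<Delta>_H W(1,2)]) (use W(3) in auto)
  qed
  have d: "short_exact_mod_tf R (GL2_on (B0Z OF)) T (V' \<downharpoonright> Vplus R OF \<pi> V' V0') \<alpha>
      (V \<downharpoonright> Vplus R OF \<pi> V V0) \<beta> (V'' \<downharpoonright> Vplus R OF \<pi> V'' V0'')"
    if V': "finitely_presented R (GL2_on borel_set) T (B0Z OF) V'"
      and V'': "finitely_presented R (GL2_on borel_set) T (B0Z OF) V''"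
      and ex: "short_exact R (GL2_on borel_set) V' \<alpha> V \<beta> V''"
      and V0': "presenting_subrep R (GL2_on borel_set) T (B0Z OF) V' V0'"
      and V0'': "presenting_subrep R (GL2_on borel_set) T (B0Z OF) V'' V0''"
      and ex0: "short_exact R (GL2_on (B0Z OF)) (V' \<downharpoonright> V0') \<alpha> (V \<downharpoonright> V0) \<beta> (V'' \<downharpoonright> V0'')"
    for V' :: "('e, 'u, 'f^2^2) rep" and V'' :: "('e, 'w, 'f^2^2) rep" and \<alpha> \<beta> V0' V0''
  proof -
    interpret X: borel_rep OF \<pi> R V' by (rule rep[OF V'])
    interpret Z: borel_rep OF \<pi> R V'' by (rule rep[OF V''])
    obtain S' where "presented_rep OF \<pi> R V' V0' S'" using X.presented_rep_exists V0' unfolding T by blast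
    then have 1: "gen_rep OF \<pi> R V' V0' S'" unfolding presented_rep_def by blast
    obtain S'' where "presented_rep OF \<pi> R V'' V0'' S''" using Z.presented_rep_exists V0'' unfolding T by blast
    then have 2: "gen_rep OF \<pi> R V'' V0'' S''" unfolding presented_rep_def by blast
    show ?thesis unfolding Vp unfolding Vplus_def T by (rule V.exact_Vplus[OF 1 2 ex ex0])
  qed
  have e: "smooth_tf R (GL2_on (B0Z OF)) T (V \<downharpoonright> fixed_vectors (V \<downharpoonright> Vplus R OF \<pi> V V0) (U0 OF))"
    if "\<forall>b\<in>borel_set. \<forall>v\<in>carrier V. \<rho> b v = act V b v" "admissible R GL2 T (V\<lparr>act := \<rho>\<rparr>)" for \<rho>
  proof -
    interpret admissible_rep OF \<pi> R V V0 S0 \<rho>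
      by (rule admissible_rep.intro[OF V.presented_rep_axioms admissible_rep_axioms.intro]) (use that T in auto)
    show ?thesis unfolding Vp T by (rule fixed_finite_type)
  qed
  show ?thesis
  proof (intro conjI allI impI)
    fix V1 assume "presenting_subrep R (GL2_on borel_set) T (B0Z OF) V V1"
    then show "iso_mod_tf R (GL2_on (B0Z OF)) T (V \<downharpoonright> Vplus R OF \<pi> V V0) (V \<downharpoonright> Vplus R OF \<pi> V V1)" by (rule a)
  next
    show "smooth_tf R (GL2_on (B0Z OF)) T (V \<downharpoonright> Delta R OF \<pi> V V0)" by (rule b)
  next
    show "etale_mod_tf R OF \<pi> (D_rep R OF \<pi> V V0)" by (rule V.etale)
  next
    fix V' :: "('e, 'u, 'f^2^2) rep" and V'' :: "('e, 'w, 'f^2^2) rep" and \<alpha> \<beta> V0' V0''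
    assume "finitely_presented R (GL2_on borel_set) T (B0Z OF) V' \<and>
      finitely_presented R (GL2_on borel_set) T (B0Z OF) V'' \<and>
      short_exact R (GL2_on borel_set) V' \<alpha> V \<beta> V'' \<and>
      presenting_subrep R (GL2_on borel_set) T (B0Z OF) V' V0' \<and>
      presenting_subrep R (GL2_on borel_set) T (B0Z OF) V'' V0'' \<and>
      short_exact R (GL2_on (B0Z OF)) (V' \<downharpoonright> V0') \<alpha> (V \<downharpoonright> V0) \<beta> (V'' \<downharpoonright> V0'')"
    then show "short_exact_mod_tf R (GL2_on (B0Z OF)) T (V' \<downharpoonright> Vplus R OF \<pi> V' V0') \<alpha>
      (V \<downharpoonright> Vplus R OF \<pi> V V0) \<beta> (V'' \<downharpoonright> Vplus R OF \<pi> V'' V0'')"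
      by (elim conjE) (rule d)
  next
    assume "\<exists>\<rho>. (\<forall>b\<in>borel_set. \<forall>v\<in>carrier V. \<rho> b v = act V b v) \<and> admissible R GL2 T (V\<lparr>act := \<rho>\<rparr>)"
    then obtain \<rho> where "\<forall>b\<in>borel_set. \<forall>v\<in>carrier V. \<rho> b v = act V b v" "admissible R GL2 T (V\<lparr>act := \<rho>\<rparr>)"
      by (elim exE conjE)
    then show "smooth_tf R (GL2_on (B0Z OF)) T (V \<downharpoonright> fixed_vectors (V \<downharpoonright> Vplus R OF \<pi> V V0) (U0 OF))" by (rule e)
  qed
qed

end
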